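(* Let $\Lambda\in P^+$. Fix $p\in\mathbb{N}$, $\mathbf{b}=(b_1,\dots,b_p)\in\mathbb{N}^p$ with $\sum_ib_i=n$, and pairwise distinct $\nu^1,\dots,\nu^p\in I$. Let $\widetilde\nu=(\nu^1,\dots,\nu^1,\dots,\nu^p,\dots,\nu^p)\in I^n$ ($b_i$ copies of $\nu^i$) and $\beta=\sum_ib_i\alpha_{\nu^i}\in Q_n^+$, so $\widetilde\nu\in I^\beta$. Then the set $$\Bigl\{e(\widetilde\nu)\prod_{k=1}^nx_k^{r_k}\tau_w\ \Bigm|\ w\in\mathfrak{S}_{\mathbf{b}},\ 0\le r_k<N^\Lambda(\widetilde\nu,k)\text{ for all }1\le k\le n\Bigr\}$$ is a $\mathbf{k}$-basis of $e(\widetilde\nu)R^\Lambda(\beta)e(\widetilde\nu)$.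
   Context: Fix a field $\mathbf{k}$ of characteristic $\neq 2$. A Cartan superdatum consists of an index set $I$; a symmetrizable generalized Cartan matrix $A=(a_{ij})_{i,j\in I}$ ($a_{ii}=2$, $a_{ij}\le 0$ for $i\ne j$, $a_{ij}=0\iff a_{ji}=0$, positive integers $d_i$ with $d_ia_{ij}=d_ja_{ji}$); a free abelian group $P$; $\mathbb{Z}$-linearly independent $\alpha_i\in P$; $h_i\in\mathrm{Hom}_{\mathbb{Z}}(P,\mathbb{Z})$ with $\langle h_i,\alpha_j\rangle=a_{ij}$; and $I=I_{\mathrm{even}}\sqcup I_{\mathrm{odd}}$ with $a_{ij}\in2\mathbb{Z}$ whenever $i\in I_{\mathrm{odd}}$. A symmetric bilinear form $(\cdot|\cdot)$ on $P$ satisfies $(\alpha_i|\lambda)=d_i\langle h_i,\lambda\rangle$. Parity $\mathrm{p}(i)=1$ if $i\in I_{\mathrm{odd}}$, $0$ otherwise. $Q^+=\bigoplus_i\mathbb{Z}_{\ge0}\alpha_i$, $Q_n^+=\{\sum k_i\alpha_i\in Q^+:\sum k_i=n\}$, $P^+=\{\Lambda:\langle h_i,\Lambda\rangle\ge0\ \forall i\}$, $I^\beta=\{\nu\in I^n:\sum_s\alpha_{\nu_s}=\beta\}$. For $\nu\in I^n$, $\mathcal{P}_\nu=\mathbf{k}\langle\mathrm{x}_1,\dots,\mathrm{x}_n\rangle/(\mathrm{x}_a\mathrm{x}_b-(-1)^{\mathrm{p}(\nu_a)\mathrm{p}(\nu_b)}\mathrm{x}_b\mathrm{x}_a)$. Fix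 $Q_{ij}(\mathrm{x}_1,\mathrm{x}_2)=\sum_{r,s}t_{i,j;(r,s)}\mathrm{x}_1^r\mathrm{x}_2^s\in\mathcal{P}_{(i,j)}$ with: $t_{i,j;(r,s)}\ne0$ only if $-2(\alpha_i|\alpha_j)-r(\alpha_i|\alpha_i)-s(\alpha_j|\alpha_j)=0$; $t_{i,j;(r,s)}=t_{j,i;(s,r)}$; $t_{i,j;(-a_{ij},0)}\in\mathbf{k}^\times$; $t_{i,j;(r,s)}=0$ if $i=j$ or ($i\in I_{\mathrm{odd}}$ and $r$ odd). $R(\beta)$ is the $\mathbf{k}$-algebra with generators $e(\nu)$ ($\nu\in I^\beta$), $x_1,\dots,x_n$, $\tau_1,\dots,\tau_{n-1}$ and relations: $e(\mu)e(\nu)=\delta_{\mu\nu}e(\nu)$, $\sum_\nu e(\nu)=1$; $x_px_qe(\nu)=(-1)^{\mathrm{p}(\nu_p)\mathrm{p}(\nu_q)}x_qx_pe(\nu)$ ($p\ne q$); $x_pe(\nu)=e(\nu)x_p$; $\tau_ae(\nu)=e(s_a\nu)\tau_a$; $\tau_ax_pe(\nu)=(-1)^{\mathrm{p}(\nu_p)\mathrm{p}(\nu_a)\mathrm{p}(\nu_{a+1})}x_p\tau_ae(\nu)$ ($p\ne a,a+1$); $(\tau_ax_{a+1}-(-1)^{\mathrm{p}(\nu_a)\mathrm{p}(\nu_{a+1})}x_a\tau_a)e(\nu)=(x_{a+1}\tau_a-(-1)^{\mathrm{p}(\nu_a)\mathrm{p}(\nu_{a+1})}\tau_ax_a)e(\nu)=\delta_{\nu_a,\nu_{a+1}}e(\nu)$;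 $\tau_a^2e(\nu)=Q_{\nu_a,\nu_{a+1}}(x_a,x_{a+1})e(\nu)$; $\tau_a\tau_be(\nu)=(-1)^{\mathrm{p}(\nu_a)\mathrm{p}(\nu_{a+1})\mathrm{p}(\nu_b)\mathrm{p}(\nu_{b+1})}\tau_b\tau_ae(\nu)$ ($|a-b|>1$); $(\tau_{a+1}\tau_a\tau_{a+1}-\tau_a\tau_{a+1}\tau_a)e(\nu)$ equals $\frac{Q_{\nu_a,\nu_{a+1}}(x_{a+2},x_{a+1})-Q_{\nu_a,\nu_{a+1}}(x_a,x_{a+1})}{x_{a+2}-x_a}e(\nu)$ if $\nu_a=\nu_{a+2}\in I_{\mathrm{even}}$, $(-1)^{\mathrm{p}(\nu_{a+1})}(x_{a+2}-x_a)\frac{Q_{\nu_a,\nu_{a+1}}(x_{a+2},x_{a+1})-Q_{\nu_a,\nu_{a+1}}(x_a,x_{a+1})}{x_{a+2}^2-x_a^2}e(\nu)$ if $\nu_a=\nu_{a+2}\in I_{\mathrm{odd}}$, $0$ otherwise; $s_a=(a,a+1)$, and $\mathfrak{S}_n$ acts on $I^n$ by $(w\nu)_j=\nu_{w^{-1}(j)}$. For $\Lambda\in P^+$, $R^\Lambda(\beta)=R(\beta)/\langle\sum_{\nu}x_1^{\langle h_{\nu_1},\Lambda\rangle}e(\nu)\rangle$. For each $w\in\mathfrak{S}_n$ a reduced expression $w=s_{i_1}\cdots s_{i_l}$ is fixed and $\tau_w=\tau_{i_1}\cdots\tau_{i_l}$. Notation: $c_0=0$, $c_t=b_1+\dots+b_t$;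 $\mathfrak{S}_{\mathbf{b}}=\mathfrak{S}_{\{1,\dots,c_1\}}\times\mathfrak{S}_{\{c_1+1,\dots,c_2\}}\times\dots\times\mathfrak{S}_{\{c_{p-1}+1,\dots,n\}}$; $N_i^\Lambda(\widetilde\nu)=\langle h_{\nu^i},\Lambda-\sum_{j=1}^{c_{i-1}}\alpha_{\widetilde\nu_j}\rangle$; and for $c_{i-1}<k\le c_i$, $N^\Lambda(\widetilde\nu,k)=N^\Lambda_i(\widetilde\nu)-(k-c_{i-1}-1)$. *)

theory Defs
  imports Complex_Main "HOL-Library.Poly_Mapping" "HOL-Combinatorics.Permutations"
begin

text \<open>The weight lattice P is modelled as the free abelian group 'b =>0 int
  (every free abelian group is of this form up to isomorphism).\<close>

definition zscale :: "int \<Rightarrow> ('b \<Rightarrow>\<^sub>0 int) \<Rightarrow> ('b \<Rightarrow>\<^sub>0 int)" where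
  "zscale c v = Poly_Mapping.map (\<lambda>x. c * x) v"

definition cartan_superdatum ::
  "'i set \<Rightarrow> 'i set \<Rightarrow> ('i \<Rightarrow> 'i \<Rightarrow> int) \<Rightarrow> ('i \<Rightarrow> nat) \<Rightarrow> ('i \<Rightarrow> ('b \<Rightarrow>\<^sub>0 int))
   \<Rightarrow> ('i \<Rightarrow> ('b \<Rightarrow>\<^sub>0 int) \<Rightarrow> int) \<Rightarrow> (('b \<Rightarrow>\<^sub>0 int) \<Rightarrow> ('b \<Rightarrow>\<^sub>0 int) \<Rightarrow> rat) \<Rightarrow> bool" where
  "cartan_superdatum I Iodd A d alpha h form \<longleftrightarrow>
     (\<forall>i\<in>I. A i i = 2) \<and>
     (\<forall>i\<in>I. \<forall>j\<in>I. i \<noteq> j \<longrightarrow> A i j \<le> 0) \<and>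
     (\<forall>i\<in>I. \<forall>j\<in>I. A i j = 0 \<longleftrightarrow> A j i = 0) \<and>
     (\<forall>i\<in>I. d i > 0) \<and>
     (\<forall>i\<in>I. \<forall>j\<in>I. int (d i) * A i j = int (d j) * A j i) \<and>
     (\<forall>F c. finite F \<and> F \<subseteq> I \<and> (\<Sum>i\<in>F. zscale (c i) (alpha i)) = 0 \<longrightarrow> (\<forall>i\<in>F. c i = 0)) \<and>
     (\<forall>i\<in>I. \<forall>x y. h i (x + y) = h i x + h i y) \<and>
     (\<forall>i\<in>I. \<forall>j\<in>I. h i (alpha j) = A i j) \<and>
     Iodd \<subseteq> I \<and> (\<forall>i\<in>Iodd. \<forall>j\<in>I. even (A i j)) \<and>
     (\<forall>x y. form x y = form y x) \<and>
     (\<forall>x y z. form (x + y) z = form x z + form y z) \<and>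
     (\<forall>i\<in>I. \<forall>l. form (alpha i) l = of_nat (d i) * of_int (h i l))"

text \<open>Coefficients t i j r s = t_{i,j;(r,s)} of the polynomials Q_{ij}.\<close>
definition Q_data ::
  "'i set \<Rightarrow> 'i set \<Rightarrow> ('i \<Rightarrow> 'i \<Rightarrow> int) \<Rightarrow> ('i \<Rightarrow> ('b \<Rightarrow>\<^sub>0 int))
   \<Rightarrow> (('b \<Rightarrow>\<^sub>0 int) \<Rightarrow> ('b \<Rightarrow>\<^sub>0 int) \<Rightarrow> rat) \<Rightarrow> ('i \<Rightarrow> 'i \<Rightarrow> nat \<Rightarrow> nat \<Rightarrow> 'k::field) \<Rightarrow> bool" where
  "Q_data I Iodd A alpha form t \<longleftrightarrow>
     (\<forall>i\<in>I. \<forall>j\<in>I. \<forall>r s.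
        (t i j r s \<noteq> 0 \<longrightarrow>
           - 2 * form (alpha i) (alpha j) - of_nat r * form (alpha i) (alpha i)
             - of_nat s * form (alpha j) (alpha j) = 0) \<and>
        t i j r s = t j i s r \<and>
        (i = j \<longrightarrow> t i j r s = 0) \<and>
        (i \<in> Iodd \<and> odd r \<longrightarrow> t i j r s = 0)) \<and>
     (\<forall>i\<in>I. \<forall>j\<in>I. i \<noteq> j \<longrightarrow> t i j (nat (- A i j)) 0 \<noteq> 0)"

section \<open>Free algebra on words, as finitely supported coefficient functions\<close>

datatype 'i gen = E "'i list" | X nat | T nat

type_synonym ('i, 'k) fa = "'i gen list \<Rightarrow> 'k"

definition fa_word :: "'g list \<Rightarrow> ('g list \<Rightarrow> 'k::field)" where
  "fa_word u = (\<lambda>w. if w = u then 1 else 0)"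

definition fa_one :: "('i, 'k::field) fa" where "fa_one = fa_word []"

definition fa_zero :: "('i, 'k::field) fa" where "fa_zero = (\<lambda>w. 0)"

definition fa_mult :: "('g list \<Rightarrow> 'k::field) \<Rightarrow> ('g list \<Rightarrow> 'k) \<Rightarrow> ('g list \<Rightarrow> 'k)" where
  "fa_mult f g = (\<lambda>w. \<Sum>k\<le>length w. f (take k w) * g (drop k w))"

definition fa_add :: "('i, 'k::field) fa \<Rightarrow> ('i, 'k) fa \<Rightarrow> ('i, 'k) fa" where
  "fa_add f g = (\<lambda>w. f w + g w)"

definition fa_diff :: "('i, 'k::field) fa \<Rightarrow> ('i, 'k) fa \<Rightarrow> ('i, 'k) fa" where
  "fa_diff f g = (\<lambda>w. f w - g w)"

definition fa_smul :: "'k::field \<Rightarrow> ('i, 'k) fa \<Rightarrow> ('i, 'k) fa" where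
  "fa_smul c f = (\<lambda>w. c * f w)"

definition fa_sum :: "'a set \<Rightarrow> ('a \<Rightarrow> ('i, 'k::field) fa) \<Rightarrow> ('i, 'k) fa" where
  "fa_sum S f = (\<lambda>w. \<Sum>a\<in>S. f a w)"

definition fa_pow :: "('i, 'k::field) fa \<Rightarrow> nat \<Rightarrow> ('i, 'k) fa" where
  "fa_pow f m = ((fa_mult f) ^^ m) fa_one"

definition fa_prod :: "('i, 'k::field) fa list \<Rightarrow> ('i, 'k) fa" where
  "fa_prod fs = foldr fa_mult fs fa_one"

definition gE :: "'i list \<Rightarrow> ('i, 'k::field) fa" where "gE \<nu> = fa_word [E \<nu>]"
definition gX :: "nat \<Rightarrow> ('i, 'k::field) fa" where "gX p = fa_word [X p]"
definition gT :: "nat \<Rightarrow> ('i, 'k::field) fa" where "gT a = fa_word [T a]"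

definition Ibeta :: "'i set \<Rightarrow> ('i \<Rightarrow> 'p::comm_monoid_add) \<Rightarrow> nat \<Rightarrow> 'p \<Rightarrow> 'i list set" where
  "Ibeta I alpha n \<beta> = {\<nu>. length \<nu> = n \<and> set \<nu> \<subseteq> I \<and> sum_list (map alpha \<nu>) = \<beta>}"

definition ent :: "'i list \<Rightarrow> nat \<Rightarrow> 'i" where "ent \<nu> p = \<nu> ! (p - 1)"

text \<open>s_a nu, for 1 <= a < n.\<close>
definition swap_at :: "nat \<Rightarrow> 'i list \<Rightarrow> 'i list" where
  "swap_at a \<nu> = \<nu>[a - 1 := \<nu> ! a, a := \<nu> ! (a - 1)]"

definition sgn_par :: "'i set \<Rightarrow> 'i list \<Rightarrow> 'k::field" where
  "sgn_par Iodd is = (if (\<forall>i\<in>set is. i \<in> Iodd) then - 1 else 1)"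

definition Qsupp :: "('i \<Rightarrow> 'i \<Rightarrow> nat \<Rightarrow> nat \<Rightarrow> 'k::field) \<Rightarrow> 'i \<Rightarrow> 'i \<Rightarrow> (nat \<times> nat) set" where
  "Qsupp t i j = {(r, s). t i j r s \<noteq> 0}"

definition Qx :: "('i \<Rightarrow> 'i \<Rightarrow> nat \<Rightarrow> nat \<Rightarrow> 'k::field) \<Rightarrow> 'i \<Rightarrow> 'i \<Rightarrow> nat \<Rightarrow> nat \<Rightarrow> ('i, 'k) fa" where
  "Qx t i j p q = fa_sum (Qsupp t i j)
     (\<lambda>(r, s). fa_smul (t i j r s) (fa_mult (fa_pow (gX p) r) (fa_pow (gX q) s)))"

text \<open>Right-hand side of the braid relation (divided differences computed explicitly:
  for i even, (u^r - w^r)/(u - w) = sum_{k<r} u^k w^(r-1-k); for i odd, t vanishes at odd r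
  and (u^(2m) - w^(2m))/(u^2 - w^2) = sum_{k<m} u^(2k) w^(2(m-1-k)), the squares being central).\<close>
definition braid_rhs :: "'i set \<Rightarrow> ('i \<Rightarrow> 'i \<Rightarrow> nat \<Rightarrow> nat \<Rightarrow> 'k::field) \<Rightarrow> 'i list \<Rightarrow> nat \<Rightarrow> ('i, 'k) fa" where
  "braid_rhs Iodd t \<nu> a =
    (let i = ent \<nu> a; j = ent \<nu> (a + 1) in
     if ent \<nu> a = ent \<nu> (a + 2) \<and> i \<notin> Iodd then
       fa_sum (Qsupp t i j) (\<lambda>(r, s). fa_smul (t i j r s)
         (fa_sum {..<r} (\<lambda>k. fa_prod [fa_pow (gX (a + 2)) k, fa_pow (gX a) (r - 1 - k),
                                        fa_pow (gX (a + 1)) s])))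
     else if ent \<nu> a = ent \<nu> (a + 2) \<and> i \<in> Iodd then
       fa_smul (sgn_par Iodd [j])
         (fa_mult (fa_diff (gX (a + 2)) (gX a))
           (fa_sum (Qsupp t i j) (\<lambda>(r, s). fa_smul (t i j r s)
             (fa_sum {..<r div 2} (\<lambda>k. fa_prod [fa_pow (gX (a + 2)) (2 * k),
                 fa_pow (gX a) (2 * (r div 2 - 1 - k)), fa_pow (gX (a + 1)) s])))))
     else fa_zero)"

definition KLR_gens :: "'i set \<Rightarrow> ('i \<Rightarrow> 'p::comm_monoid_add) \<Rightarrow> nat \<Rightarrow> 'p \<Rightarrow> 'i gen set" where
  "KLR_gens I alpha n \<beta> =
     {E \<nu> | \<nu>. \<nu> \<in> Ibeta I alpha n \<beta>} \<union> {X p | p. 1 \<le> p \<and> p \<le> n} \<union> {T a | a. 1 \<le> a \<and> a < n}"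

definition KLR_rels :: "'i set \<Rightarrow> 'i set \<Rightarrow> ('i \<Rightarrow> 'p::comm_monoid_add) \<Rightarrow>
    ('i \<Rightarrow> 'i \<Rightarrow> nat \<Rightarrow> nat \<Rightarrow> 'k::field) \<Rightarrow> nat \<Rightarrow> 'p \<Rightarrow> ('i, 'k) fa set" where
  "KLR_rels I Iodd alpha t n \<beta> = (let IB = Ibeta I alpha n \<beta> in
     {fa_diff (fa_mult (gE \<mu>) (gE \<nu>)) (if \<mu> = \<nu> then gE \<nu> else fa_zero) | \<mu> \<nu>. \<mu> \<in> IB \<and> \<nu> \<in> IB}
   \<union> {fa_diff (fa_sum IB gE) fa_one}
   \<union> {fa_diff (fa_prod [gX p, gX q, gE \<nu>])
              (fa_smul (sgn_par Iodd [ent \<nu> p, ent \<nu> q]) (fa_prod [gX q, gX p, gE \<nu>]))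
       | p q \<nu>. \<nu> \<in> IB \<and> 1 \<le> p \<and> p \<le> n \<and> 1 \<le> q \<and> q \<le> n \<and> p \<noteq> q}
   \<union> {fa_diff (fa_mult (gX p) (gE \<nu>)) (fa_mult (gE \<nu>) (gX p)) | p \<nu>. \<nu> \<in> IB \<and> 1 \<le> p \<and> p \<le> n}
   \<union> {fa_diff (fa_mult (gT a) (gE \<nu>)) (fa_mult (gE (swap_at a \<nu>)) (gT a))
       | a \<nu>. \<nu> \<in> IB \<and> 1 \<le> a \<and> a < n}
   \<union> {fa_diff (fa_prod [gT a, gX p, gE \<nu>])
              (fa_smul (sgn_par Iodd [ent \<nu> p, ent \<nu> a, ent \<nu> (a + 1)]) (fa_prod [gX p, gT a, gE \<nu>]))
       | a p \<nu>. \<nu> \<in> IB \<and> 1 \<le> a \<and> a < n \<and> 1 \<le> p \<and> p \<le> n \<and> p \<noteq> a \<and> p \<noteq> a + 1}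
   \<union> {fa_diff (fa_mult (fa_diff (fa_mult (gT a) (gX (a + 1)))
                         (fa_smul (sgn_par Iodd [ent \<nu> a, ent \<nu> (a + 1)]) (fa_mult (gX a) (gT a))))
                (gE \<nu>))
              (if ent \<nu> a = ent \<nu> (a + 1) then gE \<nu> else fa_zero)
       | a \<nu>. \<nu> \<in> IB \<and> 1 \<le> a \<and> a < n}
   \<union> {fa_diff (fa_mult (fa_diff (fa_mult (gX (a + 1)) (gT a))
                         (fa_smul (sgn_par Iodd [ent \<nu> a, ent \<nu> (a + 1)]) (fa_mult (gT a) (gX a))))
                (gE \<nu>))
              (if ent \<nu> a = ent \<nu> (a + 1) then gE \<nu> else fa_zero)
       | a \<nu>. \<nu> \<in> IB \<and> 1 \<le> a \<and> a < n}
   \<union> {fa_diff (fa_prod [gT a, gT a, gE \<nu>])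
              (fa_mult (Qx t (ent \<nu> a) (ent \<nu> (a + 1)) a (a + 1)) (gE \<nu>))
       | a \<nu>. \<nu> \<in> IB \<and> 1 \<le> a \<and> a < n}
   \<union> {fa_diff (fa_prod [gT a, gT c, gE \<nu>])
              (fa_smul (sgn_par Iodd [ent \<nu> a, ent \<nu> (a + 1), ent \<nu> c, ent \<nu> (c + 1)])
                 (fa_prod [gT c, gT a, gE \<nu>]))
       | a c \<nu>. \<nu> \<in> IB \<and> 1 \<le> a \<and> a < n \<and> 1 \<le> c \<and> c < n \<and> (a > c + 1 \<or> c > a + 1)}
   \<union> {fa_diff (fa_diff (fa_prod [gT (a + 1), gT a, gT (a + 1), gE \<nu>])
                       (fa_prod [gT a, gT (a + 1), gT a, gE \<nu>]))
              (fa_mult (braid_rhs Iodd t \<nu> a) (gE \<nu>))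
       | a \<nu>. \<nu> \<in> IB \<and> 1 \<le> a \<and> a + 1 < n})"

definition cyc_rels :: "'i set \<Rightarrow> ('i \<Rightarrow> 'p::comm_monoid_add) \<Rightarrow> ('i \<Rightarrow> 'p \<Rightarrow> int) \<Rightarrow> 'p \<Rightarrow> nat \<Rightarrow> 'p
    \<Rightarrow> ('i, 'k::field) fa set" where
  "cyc_rels I alpha h Lam n \<beta> =
     (if n = 0 then {} else
      {fa_sum (Ibeta I alpha n \<beta>) (\<lambda>\<nu>. fa_mult (fa_pow (gX 1) (nat (h (ent \<nu> 1) Lam))) (gE \<nu>))})"

inductive_set gen_ideal :: "'g set \<Rightarrow> ('g list \<Rightarrow> 'k::field) set \<Rightarrow> ('g list \<Rightarrow> 'k) set"
  for V G where
  zero: "(\<lambda>w. 0) \<in> gen_ideal V G"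
| gen: "g \<in> G \<Longrightarrow> set u \<subseteq> V \<Longrightarrow> set v \<subseteq> V \<Longrightarrow>
          fa_mult (fa_mult (fa_word u) g) (fa_word v) \<in> gen_ideal V G"
| add: "f \<in> gen_ideal V G \<Longrightarrow> g \<in> gen_ideal V G \<Longrightarrow> (\<lambda>w. f w + g w) \<in> gen_ideal V G"
| smul: "f \<in> gen_ideal V G \<Longrightarrow> (\<lambda>w. c * f w) \<in> gen_ideal V G"

text \<open>Kernel of the map from the free algebra onto R^Lambda(beta).\<close>
definition cyc_ideal :: "'i set \<Rightarrow> 'i set \<Rightarrow> ('i \<Rightarrow> 'p::comm_monoid_add) \<Rightarrow> ('i \<Rightarrow> 'p \<Rightarrow> int) \<Rightarrow>
    ('i \<Rightarrow> 'i \<Rightarrow> nat \<Rightarrow> nat \<Rightarrow> 'k::field) \<Rightarrow> 'p \<Rightarrow> nat \<Rightarrow> 'p \<Rightarrow> ('i, 'k) fa set" where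
  "cyc_ideal I Iodd alpha h t Lam n \<beta> =
     gen_ideal (KLR_gens I alpha n \<beta>) (KLR_rels I Iodd alpha t n \<beta> \<union> cyc_rels I alpha h Lam n \<beta>)"

definition fa_elem :: "'g set \<Rightarrow> ('g list \<Rightarrow> 'k::zero) \<Rightarrow> bool" where
  "fa_elem V f \<longleftrightarrow> finite {w. f w \<noteq> 0} \<and> (\<forall>w. f w \<noteq> 0 \<longrightarrow> set w \<subseteq> V)"

definition sfun :: "nat \<Rightarrow> nat \<Rightarrow> nat" where
  "sfun a = (\<lambda>k. if k = a then a + 1 else if k = a + 1 then a else k)"

definition word_perm :: "nat list \<Rightarrow> nat \<Rightarrow> nat" where
  "word_perm l = foldr (\<lambda>a f. sfun a \<circ> f) l id"

definition reduced_expr :: "nat \<Rightarrow> nat list \<Rightarrow> (nat \<Rightarrow> nat) \<Rightarrow> bool" where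
  "reduced_expr n l w \<longleftrightarrow> set l \<subseteq> {1..<n} \<and> word_perm l = w \<and>
     (\<forall>l'. set l' \<subseteq> {1..<n} \<and> word_perm l' = w \<longrightarrow> length l \<le> length l')"

definition tau_w :: "((nat \<Rightarrow> nat) \<Rightarrow> nat list) \<Rightarrow> (nat \<Rightarrow> nat) \<Rightarrow> ('i, 'k::field) fa" where
  "tau_w red w = fa_prod (map gT (red w))"

definition blkc :: "nat list \<Rightarrow> nat \<Rightarrow> nat" where "blkc b t = sum_list (take t b)"

definition nutilde :: "nat list \<Rightarrow> 'i list \<Rightarrow> 'i list" where
  "nutilde b nus = concat (map (\<lambda>t. replicate (b ! t) (nus ! t)) [0..<length nus])"

text \<open>N^Lambda_{t+1}(nutilde), for 0-based block index t.\<close>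
definition NLam :: "('i \<Rightarrow> 'p::ab_group_add) \<Rightarrow> ('i \<Rightarrow> 'p \<Rightarrow> int) \<Rightarrow> 'p \<Rightarrow> nat list \<Rightarrow> 'i list \<Rightarrow> nat \<Rightarrow> int" where
  "NLam alpha h Lam b nus t =
     h (nus ! t) (Lam - sum_list (map alpha (take (blkc b t) (nutilde b nus))))"

text \<open>N^Lambda(nutilde, k) for c_t < k <= c_{t+1}.\<close>
definition NLamk :: "('i \<Rightarrow> 'p::ab_group_add) \<Rightarrow> ('i \<Rightarrow> 'p \<Rightarrow> int) \<Rightarrow> 'p \<Rightarrow> nat list \<Rightarrow> 'i list \<Rightarrow> nat \<Rightarrow> nat \<Rightarrow> int" where
  "NLamk alpha h Lam b nus t k = NLam alpha h Lam b nus t - int (k - blkc b t - 1)"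

definition young :: "nat list \<Rightarrow> (nat \<Rightarrow> nat) set" where
  "young b = {w. w permutes {1..sum_list b} \<and>
     (\<forall>t<length b. w ` {blkc b t + 1..blkc b (t + 1)} = {blkc b t + 1..blkc b (t + 1)})}"

definition basis_idx :: "('i \<Rightarrow> 'p::ab_group_add) \<Rightarrow> ('i \<Rightarrow> 'p \<Rightarrow> int) \<Rightarrow> 'p \<Rightarrow> nat list \<Rightarrow> 'i list
    \<Rightarrow> ((nat \<Rightarrow> nat) \<times> nat list) set" where
  "basis_idx alpha h Lam b nus = {(w, r). w \<in> young b \<and> length r = sum_list b \<and>
     (\<forall>t<length b. \<forall>k. blkc b t < k \<and> k \<le> blkc b (t + 1) \<longrightarrow>
         int (r ! (k - 1)) < NLamk alpha h Lam b nus t k)}"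

definition basis_elem :: "((nat \<Rightarrow> nat) \<Rightarrow> nat list) \<Rightarrow> 'i list \<Rightarrow> (nat \<Rightarrow> nat) \<times> nat list \<Rightarrow> ('i, 'k::field) fa" where
  "basis_elem red \<nu> wr = (case wr of (w, r) \<Rightarrow>
     fa_prod ([gE \<nu>] @ map (\<lambda>k. fa_pow (gX k) (r ! (k - 1))) [1..<length r + 1] @ [tau_w red w]))"

text \<open>The images of the family B (indexed by S) in A/J form a basis of e (A/J) e,
  where A is the free algebra on V.\<close>
definition is_basis_corner :: "'g set \<Rightarrow> ('g list \<Rightarrow> 'k::field) set \<Rightarrow> ('g list \<Rightarrow> 'k)
    \<Rightarrow> 'a set \<Rightarrow> ('a \<Rightarrow> ('g list \<Rightarrow> 'k)) \<Rightarrow> bool" where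
  "is_basis_corner V J e S B \<longleftrightarrow>
     (\<forall>i\<in>S. (\<lambda>w. B i w - fa_mult (fa_mult e (B i)) e w) \<in> J) \<and>
     (\<forall>c. (\<lambda>w. \<Sum>i\<in>S. c i * B i w) \<in> J \<longrightarrow> (\<forall>i\<in>S. c i = 0)) \<and>
     (\<forall>f. fa_elem V f \<longrightarrow>
        (\<exists>c. (\<lambda>w. fa_mult (fa_mult e f) e w - (\<Sum>i\<in>S. c i * B i w)) \<in> J))"

end

theory Submission
  imports Defs "HOL-Library.Function_Algebras" "HOL-Library.Product_Lexorder" "HOL-Library.Multiset"
begin

text \<open>
  Spanning: modulo the cyclotomic ideal a power of \<open>x\<^sub>1\<close> vanishes on each idempotent. Multiplying a
  relation that lowers the degree in \<open>x\<^sub>j\<close> by \<open>\<tau>\<^sub>j\<close> on both sides turns it into one for \<open>x\<close> at the next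
  position, whose degree grows by that of \<open>\<tau>\<^sub>j\<^sup>2\<close> at a crossing of two blocks and drops by one inside
  a block; on the block word the resulting exponents are the \<open>N(k)\<close>. Words of \<open>\<tau>\<close>'s between equal
  idempotents reduce to the Young subgroup.

  Independence: the algebra acts on superpolynomials, crossings of equal colours acting by divided
  differences and the others by \<open>1\<close> or \<open>Q\<close>. The cyclotomic relation acts by zero modulo the left
  ideal \<open>K\<close> generated by iterated divided differences of \<open>x\<^sub>f\<^sup>\<Lambda> \<Prod>Q(x\<^sub>f, x\<^sub>q)\<close>, \<open>f\<close> the first position
  of a block. The generators are monic of degree \<open>N(k)\<close> in the \<open>k\<close>-th variable, so monomials with
  smaller exponents are independent modulo \<open>K\<close>; and distinct elements of the Young subgroup are
  separated by completing one of minimal length to the longest element.\<close>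

text \<open>Every Q contains an odd variable only in even powers, so it is central among the
  superpolynomials; signs come only from the cyclotomic power and from the divided differences. An
  odd power of an odd variable is not central, so \<open>K\<close> is only a left ideal: dividing by
  a generator is a matter of right multiplication, and the ideal of the earlier generators has to be
  shown stable under right multiplication by the next one. It is, because a divided difference kills
  every generator except the one that it turns into its successor. The relations involve all
  idempotents, not only that of the block word. A single polynomial ring serves all words, its
  variables being named after the positions in the block word. At a word in which some labels are
  inverted, the subspace factored out consists of the polynomials that fall into \<open>K\<close>
  after multiplication by the Q of all inverted pairs; at the block word this is \<open>K\<close>
  itself, and independence is tested there alone. If some bound \<open>N k\<close> is 0, the index
  set is empty, so this argument may assume positive bounds.\<close>

declare One_nat_def [simp del]

subsection \<open>Inversions and reduced words\<close>

definition invs :: "nat \<Rightarrow> (nat \<Rightarrow> nat) \<Rightarrow> (nat \<times> nat) set" where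
  "invs n w = {(i, j). 1 \<le> i \<and> i < j \<and> j \<le> n \<and> w j < w i}"

definition inv_num :: "nat \<Rightarrow> (nat \<Rightarrow> nat) \<Rightarrow> nat" where
  "inv_num n w = card (invs n w)"

lemma finite_invs [simp]: "finite (invs n w)"
  by (rule finite_subset[of _ "{1..n} \<times> {1..n}"]) (auto simp: invs_def)

lemma sfun_eq_transpose: "sfun a = Transposition.transpose a (Suc a)"
  by (auto simp: sfun_def fun_eq_iff transpose_def)

lemma sfun_permutes: "1 \<le> a \<Longrightarrow> a < n \<Longrightarrow> sfun a permutes {1..n}"
  by (simp add: sfun_eq_transpose permutes_swap_id)

lemma sfun_sfun [simp]: "sfun a (sfun a k) = k"
  by (auto simp: sfun_def)

lemma sfun_apply: "sfun a k = (if k = a then Suc a else if k = Suc a then a else k)"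
  by (simp add: sfun_def)

lemma sfun_comp_sfun [simp]: "sfun a \<circ> sfun a = id"
  by (auto simp: fun_eq_iff)

lemma sfun_comp_sfun_comp [simp]: "sfun a \<circ> (sfun a \<circ> w) = w"
  by (simp add: comp_assoc[symmetric])

lemma inv_sfun [simp]: "inv (sfun a) = sfun a"
  by (rule inv_equality) auto

lemma sfun_le_iff: "1 \<le> a \<Longrightarrow> a < n \<Longrightarrow> sfun a k \<in> {1..n} \<longleftrightarrow> k \<in> {1..n}"
  by (auto simp: sfun_def)

lemma word_perm_Nil [simp]: "word_perm [] = id"
  by (simp add: word_perm_def)

lemma word_perm_Cons [simp]: "word_perm (a # l) = sfun a \<circ> word_perm l"
  by (simp add: word_perm_def)

lemma word_perm_append: "word_perm (l @ l') = word_perm l \<circ> word_perm l'"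
  by (induction l) (auto simp: comp_assoc)

lemma word_perm_permutes: "set l \<subseteq> {1..<n} \<Longrightarrow> word_perm l permutes {1..n}"
  by (induction l) (auto simp: permutes_id intro!: permutes_compose sfun_permutes)

text \<open>Strict increase gives \<open>i \<le> f i\<close> counting up from 1 and
  \<open>f i \<le> i\<close> counting down from \<open>n\<close>.\<close>

lemma strict_inc_id:
  fixes f :: "nat \<Rightarrow> nat"
  assumes "\<And>i. i \<in> {1..n} \<Longrightarrow> f i \<in> {1..n}" "\<And>i. 1 \<le> i \<Longrightarrow> i < n \<Longrightarrow> f i < f (Suc i)"
    and "i \<in> {1..n}"
  shows "f i = i"
proof -
  have lo: "i \<le> f i" if "1 \<le> i" "i \<le> n" for i
    using that
  proof (induction i rule: nat_induct_at_least)
    case base then show ?case using assms(1)[of 1] by auto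
  next
    case (Suc i) then show ?case using assms(2)[of i] by auto
  qed
  have hi: "f i + (n - i) \<le> n" if "1 \<le> i" "i \<le> n" for i
    using that(2,1)
  proof (induction i rule: inc_induct)
    case base then show ?case using assms(1)[of n] by auto
  next
    case (step i) then show ?case using assms(2)[of i] by auto
  qed
  show ?thesis using lo[of i] hi[of i] assms(3) by auto
qed

lemma permutes_inc_id:
  assumes "q permutes {1..n}" "\<And>a. 1 \<le> a \<Longrightarrow> a < n \<Longrightarrow> q a < q (Suc a)"
  shows "q = id"
proof
  fix i
  show "q i = id i"
  proof (cases "i \<in> {1..n}")
    case True
    have "q i = i"
      by (rule strict_inc_id[of n q]) (use True assms permutes_in_image[OF assms(1)] in auto)
    then show ?thesis by simp
  next
    case False then show ?thesis using assms(1) by (simp add: permutes_not_in)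
  qed
qed

text \<open>Left multiplication by \<open>sfun a\<close> exchanges two adjacent values, so it can
  change only the comparison between the two positions that hold them, which are
  \<open>inv w a\<close> and \<open>inv w (Suc a)\<close>.\<close>

lemma invs_sfun_up:
  assumes w: "w permutes {1..n}" and a: "1 \<le> a" "a < n" and up: "inv w a < inv w (Suc a)"
  shows "invs n (sfun a \<circ> w) = insert (inv w a, inv w (Suc a)) (invs n w)"
    and "(inv w a, inv w (Suc a)) \<notin> invs n w"
proof -
  have wi: "w (inv w k) = k" for k using w by (simp add: permutes_inverses)
  have iw: "inv w (w k) = k" for k using w by (simp add: permutes_inverses)
  have rng: "inv w a \<in> {1..n}" "inv w (Suc a) \<in> {1..n}"
    using permutes_in_image[OF permutes_inv[OF w]] a by auto
  show "invs n (sfun a \<circ> w) = insert (inv w a, inv w (Suc a)) (invs n w)"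
  proof (intro set_eqI iffI)
    fix z assume "z \<in> invs n (sfun a \<circ> w)"
    then obtain i j where z: "z = (i, j)" "1 \<le> i" "i < j" "j \<le> n" "sfun a (w j) < sfun a (w i)"
      by (auto simp: invs_def)
    have ne: "w i \<noteq> w j" using z iw by (metis less_irrefl)
    show "z \<in> insert (inv w a, inv w (Suc a)) (invs n w)"
    proof (cases "w j < w i")
      case True then show ?thesis using z by (auto simp: invs_def)
    next
      case False
      then have "w i = a \<and> w j = Suc a" using z(5) ne by (auto simp: sfun_def split: if_splits)
      then have "inv w a = i" "inv w (Suc a) = j" using iw[of i] iw[of j] by auto
      then show ?thesis using z by simp
    qed
  next
    fix z assume "z \<in> insert (inv w a, inv w (Suc a)) (invs n w)"
    then consider "z = (inv w a, inv w (Suc a))" | i j where "z = (i,j)" "1 \<le> i" "i < j" "j \<le> n" "w j < w i"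
      by (auto simp: invs_def)
    then show "z \<in> invs n (sfun a \<circ> w)"
    proof cases
      case 1 then show ?thesis using rng up by (auto simp: invs_def wi sfun_def)
    next
      case 2
      have "\<not> (w i = Suc a \<and> w j = a)"
        using 2 up iw by (metis less_asym)
      then have "sfun a (w j) < sfun a (w i)" using 2 by (auto simp: sfun_def)
      then show ?thesis using 2 by (auto simp: invs_def)
    qed
  qed
  show "(inv w a, inv w (Suc a)) \<notin> invs n w" by (auto simp: invs_def wi)
qed

lemma inv_comp_sfun:
  assumes "w permutes {1..n}" shows "inv (sfun a \<circ> w) = inv w \<circ> sfun a"
  using assms by (subst o_inv_distrib) (auto simp: permutes_bij sfun_eq_transpose)

lemma inv_num_up:
  assumes "w permutes {1..n}" "1 \<le> a" "a < n" "inv w a < inv w (Suc a)"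
  shows "inv_num n (sfun a \<circ> w) = Suc (inv_num n w)"
  using invs_sfun_up[OF assms] by (simp add: inv_num_def)

lemma inv_num_down:
  assumes w: "w permutes {1..n}" and a: "1 \<le> a" "a < n" and d: "inv w (Suc a) < inv w a"
  shows "inv_num n w = Suc (inv_num n (sfun a \<circ> w))"
proof -
  have p: "sfun a \<circ> w permutes {1..n}" by (intro permutes_compose w sfun_permutes a)
  have "inv_num n (sfun a \<circ> (sfun a \<circ> w)) = Suc (inv_num n (sfun a \<circ> w))"
    by (rule inv_num_up[OF p a]) (use d in \<open>auto simp: inv_comp_sfun[OF w] sfun_apply\<close>)
  then show ?thesis by simp
qed

lemma inv_neq:
  assumes "w permutes {1..n}" shows "inv w (Suc a) \<noteq> inv w a"
  using inj_eq[OF permutes_inj[OF permutes_inv[OF assms]], of "Suc a" a] by simp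

text \<open>Without a descent \<open>inv w\<close> would be increasing and hence the
  identity.\<close>

lemma exists_descent:
  assumes w: "w permutes {1..n}" and ne: "w \<noteq> id"
  obtains a where "1 \<le> a" "a < n" "inv w (Suc a) < inv w a"
proof -
  have "inv w \<noteq> id" using ne w by (metis inv_id permutes_inv_inv)
  then have "\<exists>a. 1 \<le> a \<and> a < n \<and> \<not> inv w a < inv w (Suc a)"
    using permutes_inc_id[OF permutes_inv[OF w]] by blast
  then show ?thesis using that inv_neq[OF w] by (metis linorder_neqE_nat)
qed

lemma inv_num_id [simp]: "inv_num n id = 0"
proof -
  have "invs n id = {}" by (auto simp: invs_def)
  then show ?thesis by (simp only: inv_num_def card.empty)
qed

lemma inv_num_le_length:
  "set l \<subseteq> {1..<n} \<Longrightarrow> inv_num n (word_perm l) \<le> length l"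
proof (induction l)
  case (Cons a l)
  have p: "word_perm l permutes {1..n}" using Cons by (auto intro: word_perm_permutes)
  have a: "1 \<le> a" "a < n" using Cons by auto
  consider "inv (word_perm l) a < inv (word_perm l) (Suc a)" | "inv (word_perm l) (Suc a) < inv (word_perm l) a"
    using inv_neq[OF p, of a] by linarith
  then show ?case
    using inv_num_up[OF p a] inv_num_down[OF p a] Cons unfolding word_perm_Cons by cases (auto simp: comp_def)
qed simp

lemma exists_reduced:
  "w permutes {1..n} \<Longrightarrow> \<exists>l. set l \<subseteq> {1..<n} \<and> word_perm l = w \<and> length l = inv_num n w"
proof (induction "inv_num n w" arbitrary: w)
  case 0
  have "w = id"
  proof (rule ccontr)
    assume "w \<noteq> id"
    then obtain a where "1 \<le> a" "a < n" "inv w (Suc a) < inv w a" using exists_descent 0 by metis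
    then show False using inv_num_down[of w n a] 0 by simp
  qed
  then show ?case using 0 by (metis word_perm_Nil list.size(3) empty_set empty_subsetI)
next
  case (Suc k)
  have "w \<noteq> id" using Suc by auto
  then obtain a where a: "1 \<le> a" "a < n" "inv w (Suc a) < inv w a" using exists_descent Suc by metis
  have p: "sfun a \<circ> w permutes {1..n}" by (intro permutes_compose Suc sfun_permutes a)
  have "inv_num n w = Suc (inv_num n (sfun a \<circ> w))" by (intro inv_num_down Suc a)
  then obtain l where "set l \<subseteq> {1..<n}" "word_perm l = sfun a \<circ> w" "length l = inv_num n (sfun a \<circ> w)"
    using Suc(1)[OF _ p] Suc by auto
  then show ?case using a \<open>inv_num n w = _\<close> by (intro exI[of _ "a # l"]) auto
qed

text \<open>Reducedness is expressed by the inversion number, so that it is a property of the word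
  alone; \<open>reduced_expr_iff\<close> reconciles this with minimality of the length.\<close>

definition rword :: "nat \<Rightarrow> nat list \<Rightarrow> bool" where
  "rword n l \<longleftrightarrow> set l \<subseteq> {1..<n} \<and> length l = inv_num n (word_perm l)"

lemma reduced_expr_iff:
  assumes "w permutes {1..n}"
  shows "reduced_expr n l w \<longleftrightarrow> rword n l \<and> word_perm l = w"
proof -
  obtain l0 where "set l0 \<subseteq> {1..<n}" "word_perm l0 = w" "length l0 = inv_num n w"
    using exists_reduced[OF assms] by blast
  then show ?thesis
    unfolding reduced_expr_def rword_def using inv_num_le_length by (metis le_antisym)
qed

lemma rword_Nil [simp]: "rword n []"
  by (simp add: rword_def)

lemma rword_ConsD:
  assumes "rword n (a # l)"
  shows "rword n l" "1 \<le> a" "a < n" "inv (word_perm l) a < inv (word_perm l) (Suc a)"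
    "inv (word_perm (a # l)) (Suc a) < inv (word_perm (a # l)) a"
proof -
  have s: "set l \<subseteq> {1..<n}" and a: "1 \<le> a" "a < n" using assms by (auto simp: rword_def)
  show "1 \<le> a" "a < n" by fact+
  have p: "word_perm l permutes {1..n}" using s by (rule word_perm_permutes)
  have le: "inv_num n (word_perm l) \<le> length l" by (rule inv_num_le_length[OF s])
  have eq: "Suc (length l) = inv_num n (sfun a \<circ> word_perm l)" using assms by (simp add: rword_def)
  show up: "inv (word_perm l) a < inv (word_perm l) (Suc a)"
    using inv_num_down[OF p a] inv_neq[OF p, of a] le eq by (metis Suc_n_not_le_n le_SucI linorder_neqE_nat not_less_eq_eq)
  show "rword n l" using inv_num_up[OF p a up] eq s by (simp add: rword_def)
  show "inv (word_perm (a # l)) (Suc a) < inv (word_perm (a # l)) a"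
    using up by (simp add: inv_comp_sfun[OF p] sfun_apply)
qed

lemma rword_ConsI:
  assumes "rword n l" "1 \<le> a" "a < n" "inv (word_perm l) a < inv (word_perm l) (Suc a)"
  shows "rword n (a # l)"
  using assms inv_num_up[of "word_perm l" n a] by (simp add: rword_def word_perm_permutes)

text \<open>The form of the exchange property used below: splitting off a left descent lowers the
  number of inversions by one, and the rest has a word of exactly that length.\<close>

lemma rword_descent:
  assumes w: "w permutes {1..n}" and a: "1 \<le> a" "a < n" "inv w (Suc a) < inv w a"
  obtains l where "rword n (a # l)" "word_perm (a # l) = w"
proof -
  have p: "sfun a \<circ> w permutes {1..n}" by (intro permutes_compose w sfun_permutes a)
  obtain l where l: "set l \<subseteq> {1..<n}" "word_perm l = sfun a \<circ> w" "length l = inv_num n (sfun a \<circ> w)"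
    using exists_reduced[OF p] by blast
  have "rword n (a # l)" using l a inv_num_down[OF w a] by (simp add: rword_def)
  then show ?thesis using that l by simp
qed

lemma sfun_braid: "sfun a \<circ> (sfun (Suc a) \<circ> (sfun a \<circ> w)) = sfun (Suc a) \<circ> (sfun a \<circ> (sfun (Suc a) \<circ> w))"
  by (auto simp: sfun_apply fun_eq_iff)

lemma sfun_far: "Suc a < c \<or> Suc c < a \<Longrightarrow> sfun a \<circ> (sfun c \<circ> w) = sfun c \<circ> (sfun a \<circ> w)"
  by (auto simp: sfun_apply fun_eq_iff)

text \<open>Matsumoto's theorem for the symmetric group.\<close>

lemma matsumoto:
  assumes refl: "\<And>l. rword n l \<Longrightarrow> R l l"
    and sym: "\<And>l l'. R l l' \<Longrightarrow> R l' l"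
    and trans: "\<And>l l' l''. R l l' \<Longrightarrow> R l' l'' \<Longrightarrow> R l l''"
    and cong: "\<And>a l l'. R l l' \<Longrightarrow> rword n (a # l) \<Longrightarrow> rword n (a # l') \<Longrightarrow> R (a # l) (a # l')"
    and far: "\<And>a c l. rword n (a # c # l) \<Longrightarrow> rword n (c # a # l) \<Longrightarrow> Suc a < c \<Longrightarrow> R (a # c # l) (c # a # l)"
    and braid: "\<And>a l. rword n (a # Suc a # a # l) \<Longrightarrow> rword n (Suc a # a # Suc a # l) \<Longrightarrow>
       R (a # Suc a # a # l) (Suc a # a # Suc a # l)"
  shows "rword n l \<Longrightarrow> rword n l' \<Longrightarrow> word_perm l = word_perm l' \<Longrightarrow> R l l'"
proof (induction "length l" arbitrary: l l')
  case 0
  then have "length l' = 0" unfolding rword_def by metis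
  then show ?case using 0 refl by simp
next
  case (Suc k)
  define w where "w = word_perm l"
  have len: "length l' = length l" using Suc by (simp add: rword_def)
  obtain a m where l: "l = a # m" using Suc by (cases l) auto
  obtain c m' where l': "l' = c # m'" using Suc len by (cases l') auto
  have wp: "w permutes {1..n}" using Suc(3) unfolding w_def rword_def by (auto intro: word_perm_permutes)
  have wl': "word_perm l' = w" using Suc w_def by simp
  have da: "rword n m" "1 \<le> a" "a < n" "inv w (Suc a) < inv w a"
    using rword_ConsD[of n a m] Suc(3) by (auto simp: l w_def)
  have dc: "rword n m'" "1 \<le> c" "c < n" "inv w (Suc c) < inv w c"
    using rword_ConsD[of n c m'] Suc(4) wl' by (auto simp: l')
  have lm: "length m = k" "length m' = k" using Suc len l l' by auto
  have wm: "word_perm m = sfun a \<circ> w" by (simp add: w_def l)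
  have wm': "word_perm m' = sfun c \<circ> w" using wl' by (auto simp: l')
  \<comment> \<open>Equal first letters: the tails are reduced words of the same shorter
    permutation, so the induction hypothesis applies to them.\<close>
  have step: "R (a # m) (a # x)"
    if "rword n (a # m)" "word_perm (a # m) = w" "length m = k" "rword n (a # x)" "word_perm (a # x) = w"
    for a x m
  proof (rule cong)
    have "word_perm m = sfun a \<circ> w" "word_perm x = sfun a \<circ> w"
      using that by (metis sfun_comp_sfun_comp word_perm_Cons)+
    then show "R m x" using Suc(1)[of m x] that rword_ConsD(1) by auto
  qed (use that in auto)
  \<comment> \<open>Different first letters are both descents of \<open>w\<close>, so
    \<open>w\<close> has reduced words starting with the longest element of the subgroup generated
    by \<open>a\<close> and \<open>c\<close>, written in either way. \<open>step\<close> joins the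
    given words to these two, and one commutation or braid move joins the two to each other.\<close>
  have main: "R (a # m) (c # m')"
    if ac: "a < c" and *: "rword n (a # m)" "word_perm (a # m) = w" "length m = k"
       "rword n (c # m')" "word_perm (c # m') = w" "length m' = k" for a c m m'
  proof -
    have da: "1 \<le> a" "a < n" "inv w (Suc a) < inv w a" using rword_ConsD[of n a m] * by auto
    have dc: "1 \<le> c" "c < n" "inv w (Suc c) < inv w c" using rword_ConsD[of n c m'] * by auto
    have pa: "sfun a \<circ> w permutes {1..n}" by (intro permutes_compose wp sfun_permutes da)
    have ia: "inv (sfun a \<circ> w) = inv w \<circ> sfun a" by (rule inv_comp_sfun[OF wp])
    show ?thesis
    proof (cases "c = Suc a")
      case False
      then have far': "Suc a < c" using ac by simp
      have "inv (sfun a \<circ> w) (Suc c) < inv (sfun a \<circ> w) c" using dc far' by (auto simp: ia sfun_apply)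
      then obtain y where y: "rword n (c # y)" "word_perm (c # y) = sfun a \<circ> w"
        using rword_descent[OF pa dc(1,2)] by blast
      have yw: "word_perm (a # c # y) = w" using y by simp
      have r1: "rword n (a # c # y)"
        by (rule rword_ConsI[OF y(1)]) (use da y in \<open>auto simp: ia sfun_apply\<close>)
      have eq2: "word_perm (c # a # y) = w" using yw far' unfolding word_perm_Cons by (metis sfun_far)
      have r2: "rword n (c # a # y)" using r1 eq2 yw by (auto simp: rword_def)
      show ?thesis
        using step[OF *(1-3) r1 yw] far[OF r1 r2 far'] step[OF *(4-6) r2 eq2] sym trans by blast
    next
      case True
      note c = True
      have "inv (sfun a \<circ> w) (Suc c) < inv (sfun a \<circ> w) c" using dc da by (auto simp: ia sfun_apply c)
      have pca: "sfun c \<circ> (sfun a \<circ> w) permutes {1..n}" by (intro permutes_compose pa sfun_permutes dc)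
      have ica: "inv (sfun c \<circ> (sfun a \<circ> w)) = inv w \<circ> sfun a \<circ> sfun c"
        using inv_comp_sfun[OF pa] ia by metis
      have "inv (sfun c \<circ> (sfun a \<circ> w)) (Suc a) < inv (sfun c \<circ> (sfun a \<circ> w)) a"
        using dc da unfolding ica by (auto simp: sfun_apply c)
      then obtain y where y: "rword n (a # y)" "word_perm (a # y) = sfun c \<circ> (sfun a \<circ> w)"
        using rword_descent[OF pca da(1,2)] by blast
      have r0: "rword n (c # a # y)"
      proof (rule rword_ConsI[OF y(1) dc(1,2)])
        show "inv (word_perm (a # y)) c < inv (word_perm (a # y)) (Suc c)"
          unfolding y(2) ica using da dc by (auto simp: sfun_apply c)
      qed
      have y2: "word_perm (c # a # y) = sfun a \<circ> w" using y by simp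
      have r1: "rword n (a # c # a # y)"
        by (rule rword_ConsI[OF r0]) (use dc da y2 in \<open>auto simp: ia sfun_apply c\<close>)
      have yw: "word_perm (a # c # a # y) = w" using y2 by simp
      have eq2: "word_perm (c # a # c # y) = w" using yw c unfolding word_perm_Cons by (metis sfun_braid)
      have r2: "rword n (c # a # c # y)" using r1 eq2 yw by (auto simp: rword_def)
      show ?thesis
        using step[OF *(1-3) r1 yw] braid[of a y] r1 r2 c step[OF *(4-6) r2 eq2] sym trans by blast
    qed
  qed
  have A: "rword n (a # m)" "word_perm (a # m) = w" "rword n (c # m')" "word_perm (c # m') = w"
    using Suc wl' w_def l l' by auto
  consider "a = c" | "a < c" | "c < a" by linarith
  then show ?case
  proof cases
    case 1 then show ?thesis using step[of a m m'] A lm l l' by auto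
  next
    case 2 then show ?thesis using main A lm l l' by auto
  next
    case 3 then show ?thesis using main[of c a m' m] sym A lm l l' by auto
  qed
qed

subsection \<open>Words and Young subgroups\<close>

text \<open>Words in the simple reflections that exchange neighbours of the same colour, that is, in
  the generators of the Young subgroup of the colouring.\<close>

definition word_sup :: "nat \<Rightarrow> (nat \<Rightarrow> 'c) \<Rightarrow> nat list \<Rightarrow> bool" where
  "word_sup n col l \<longleftrightarrow> (\<forall>a\<in>set l. 1 \<le> a \<and> a < n \<and> col a = col (Suc a))"

lemma word_sup_simps [simp]:
  "word_sup n col []"
  "word_sup n col (a # l) \<longleftrightarrow> 1 \<le> a \<and> a < n \<and> col a = col (Suc a) \<and> word_sup n col l"
  "word_sup n col (l @ l') \<longleftrightarrow> word_sup n col l \<and> word_sup n col l'"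
  by (auto simp: word_sup_def)

lemma word_sup_set: "word_sup n col l \<Longrightarrow> set l \<subseteq> {1..<n}"
  by (auto simp: word_sup_def)

text \<open>The Young subgroup as the stabiliser of the colouring; this keeps block indices out of
  the argument until the comparison with \<open>young\<close>.\<close>

definition col_perms :: "nat \<Rightarrow> (nat \<Rightarrow> 'c) \<Rightarrow> (nat \<Rightarrow> nat) set" where
  "col_perms n col = {w. w permutes {1..n} \<and> (\<forall>k\<in>{1..n}. col (w k) = col k)}"

lemma col_perms_comp: "w \<in> col_perms n col \<Longrightarrow> w' \<in> col_perms n col \<Longrightarrow> w \<circ> w' \<in> col_perms n col"
  unfolding col_perms_def using permutes_in_image[of w' "{1..n}"] permutes_compose[of w' "{1..n}" w]
  by simp

lemma col_perms_inv:
  assumes "w \<in> col_perms n col" shows "inv w \<in> col_perms n col"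
proof -
  have w: "w permutes {1..n}" using assms by (simp add: col_perms_def)
  have "col (inv w k) = col k" if "k \<in> {1..n}" for k
  proof -
    have "inv w k \<in> {1..n}" using permutes_in_image[OF permutes_inv[OF w]] that by simp
    then have "col (w (inv w k)) = col (inv w k)" using assms by (simp add: col_perms_def)
    then show ?thesis using w by (simp add: permutes_inverses)
  qed
  then show ?thesis using permutes_inv[OF w] by (simp add: col_perms_def)
qed

lemma sfun_col_perms:
  "1 \<le> a \<Longrightarrow> a < n \<Longrightarrow> col a = col (Suc a) \<Longrightarrow> sfun a \<in> col_perms n col"
  by (auto simp: col_perms_def sfun_permutes sfun_apply)

lemma word_perm_col_perms: "word_sup n col l \<Longrightarrow> word_perm l \<in> col_perms n col"
proof (induction l)
  case Nil
  have "id \<in> col_perms n col" by (simp add: col_perms_def permutes_id)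
  then show ?case by (simp only: word_perm_Nil)
next
  case (Cons a l)
  then have "sfun a \<circ> word_perm l \<in> col_perms n col"
    using col_perms_comp[OF sfun_col_perms] by (metis word_sup_simps(2))
  then show ?case by (simp only: word_perm_Cons)
qed

text \<open>Each colour class is an interval of positions, which makes the stabiliser of the
  colouring a standard parabolic subgroup.\<close>

locale col_blocks =
  fixes n :: nat and col :: "nat \<Rightarrow> 'c"
  assumes contig: "\<And>i j k. 1 \<le> i \<Longrightarrow> i \<le> j \<Longrightarrow> j \<le> k \<Longrightarrow> k \<le> n \<Longrightarrow> col i = col k \<Longrightarrow> col j = col i"
begin

lemma block_order:
  assumes "i \<in> {1..n}" "j \<in> {1..n}" "i' \<in> {1..n}" "j' \<in> {1..n}" "i < j" "col i \<noteq> col j"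
    "col i' = col i" "col j' = col j"
  shows "i' < j'"
proof (rule ccontr)
  assume n: "\<not> i' < j'"
  show False
  proof (cases "i' < j")
    case True
    have "col i' = col j'" by (rule contig[of j' i' j]) (use n True assms(2-4,8) in simp_all)
    then show False using assms(6-8) by metis
  next
    case False
    have "col j = col i" by (rule contig[of i j i']) (use False assms(1-5,7) in simp_all)
    then show False using assms(6) by metis
  qed
qed

text \<open>A colour-preserving permutation keeps distinct blocks in order, so each of its descents
  lies inside a block.\<close>

lemma exists_col_descent:
  assumes w: "w \<in> col_perms n col" and ne: "w \<noteq> id"
  obtains a where "1 \<le> a" "a < n" "col a = col (Suc a)" "inv w (Suc a) < inv w a"
proof -
  have p: "w permutes {1..n}" using w by (simp add: col_perms_def)
  have "inv w \<noteq> id" using ne p by (metis inv_id permutes_inv_inv)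
  then obtain a where a: "1 \<le> a" "a < n" "\<not> inv w a < inv w (Suc a)"
    using permutes_inc_id[OF permutes_inv[OF p]] by blast
  have "col a = col (Suc a)"
  proof (rule ccontr)
    assume "col a \<noteq> col (Suc a)"
    moreover have "a \<in> {1..n}" "Suc a \<in> {1..n}" using a by simp_all
    moreover from this have "inv w a \<in> {1..n}" "inv w (Suc a) \<in> {1..n}"
      by (simp_all only: permutes_in_image[OF permutes_inv[OF p]])
    moreover have "\<forall>k\<in>{1..n}. col (inv w k) = col k"
      using col_perms_inv[OF w] by (simp add: col_perms_def)
    ultimately have "inv w a < inv w (Suc a)" using block_order[of a "Suc a"] by (metis lessI)
    then show False using a by simp
  qed
  then show ?thesis using that a inv_neq[OF p] by (metis linorder_neqE_nat)
qed

lemma exists_col_rword: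
  "w \<in> col_perms n col \<Longrightarrow> \<exists>l. word_sup n col l \<and> rword n l \<and> word_perm l = w"
proof (induction "inv_num n w" arbitrary: w)
  case 0
  then have "w permutes {1..n}" by (simp add: col_perms_def)
  then obtain l where "rword n l" "word_perm l = w" "length l = inv_num n w"
    using exists_reduced[of w n] by (auto simp: rword_def)
  then show ?case using 0 by (intro exI[of _ l]) auto
next
  case (Suc k)
  have p: "w permutes {1..n}" using Suc by (simp add: col_perms_def)
  have "w \<noteq> id" using Suc by auto
  then obtain a where a: "1 \<le> a" "a < n" "col a = col (Suc a)" "inv w (Suc a) < inv w a"
    using exists_col_descent Suc by metis
  have y: "sfun a \<circ> w \<in> col_perms n col" by (rule col_perms_comp[OF sfun_col_perms[OF a(1-3)] Suc(3)])
  have n: "inv_num n w = Suc (inv_num n (sfun a \<circ> w))" by (intro inv_num_down p a)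
  then obtain l where l: "word_sup n col l" "rword n l" "word_perm l = sfun a \<circ> w"
    using Suc(1)[OF _ y] Suc by auto
  have "word_perm (a # l) = w" by (simp add: l)
  moreover have "rword n (a # l)" using l a n calculation by (auto simp: rword_def)
  ultimately show ?case using l a by (intro exI[of _ "a # l"]) auto
qed

text \<open>Commutation and braid moves keep the set of letters, so all reduced words of a
  permutation use the same letters, and one of these words is already known to stay inside the
  blocks.\<close>

lemma rword_word_sup:
  assumes "rword n l" "word_perm l \<in> col_perms n col" shows "word_sup n col l"
proof -
  obtain l' where l': "word_sup n col l'" "rword n l'" "word_perm l' = word_perm l"
    using exists_col_rword assms(2) by metis
  have "set l' = set l"
    by (rule matsumoto[where R = "\<lambda>l l'. set l = set l'" and n = n]) (use assms l' in auto)
  then show ?thesis using l'(1) by (simp add: word_sup_def)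
qed

definition block_pairs :: "(nat \<times> nat) set" where
  "block_pairs = {(i, j). 1 \<le> i \<and> i < j \<and> j \<le> n \<and> col i = col j}"

lemma finite_block_pairs [simp]: "finite block_pairs"
  by (rule finite_subset[of _ "{1..n} \<times> {1..n}"]) (auto simp: block_pairs_def)

lemma invs_block_pairs:
  assumes w: "w \<in> col_perms n col" shows "invs n w \<subseteq> block_pairs"
proof -
  have p: "w permutes {1..n}" using w by (simp add: col_perms_def)
  have "col i = col j" if ij: "1 \<le> i" "i < j" "j \<le> n" "w j < w i" for i j
  proof (rule ccontr)
    assume "col i \<noteq> col j"
    moreover have "i \<in> {1..n}" "j \<in> {1..n}" using ij by simp_all
    moreover from this have "w i \<in> {1..n}" "w j \<in> {1..n}" by (simp_all only: permutes_in_image[OF p])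
    moreover have "\<forall>k\<in>{1..n}. col (w k) = col k" using w by (simp add: col_perms_def)
    ultimately have "w i < w j" using block_order[of i j] ij(2) by metis
    then show False using ij by simp
  qed
  then show ?thesis by (auto simp: invs_def block_pairs_def)
qed

text \<open>The inversion set decides how the permutation orders any two positions; with equal sets
  \<open>w \<circ> inv w'\<close> is therefore increasing.\<close>

lemma invs_inject:
  assumes w: "w permutes {1..n}" and w': "w' permutes {1..n}" and eq: "invs n w = invs n w'"
  shows "w = w'"
proof -
  have q: "w \<circ> inv w' permutes {1..n}" by (intro permutes_compose w permutes_inv w')
  have "(w \<circ> inv w') a < (w \<circ> inv w') (Suc a)" if a: "1 \<le> a" "a < n" for a
  proof -
    define i j where "i = inv w' a" and "j = inv w' (Suc a)"
    have r: "i \<in> {1..n}" "j \<in> {1..n}"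
      using permutes_in_image[OF permutes_inv[OF w']] a by (auto simp: i_def j_def)
    have wij: "w' i = a" "w' j = Suc a" using w' by (auto simp: i_def j_def permutes_inverses)
    have ne: "w i \<noteq> w j" using wij permutes_inj[OF w] by (metis injD n_not_Suc_n)
    have "w i < w j"
    proof (cases "i < j")
      case True
      then have "(i, j) \<notin> invs n w'" using wij by (simp add: invs_def)
      then have "(i, j) \<notin> invs n w" using eq by simp
      then show ?thesis using True r ne by (auto simp: invs_def)
    next
      case False
      then have "(j, i) \<in> invs n w'" using wij r ne by (cases "i = j") (auto simp: invs_def)
      then have "(j, i) \<in> invs n w" using eq by simp
      then show ?thesis by (simp add: invs_def)
    qed
    then show ?thesis by (simp add: i_def j_def)
  qed
  then have "w \<circ> inv w' = id" by (rule permutes_inc_id[OF q])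
  then have "w \<circ> (inv w' \<circ> w') = w'" by (metis comp_assoc comp_id id_comp)
  then show ?thesis using w' by (simp add: permutes_inv_o)
qed

text \<open>Transfers the count to the inverse, so that right multiplication can be reduced to the
  results on left multiplication.\<close>

lemma inv_num_inv:
  assumes w: "w permutes {1..n}" shows "inv_num n (inv w) = inv_num n w"
proof -
  have wi: "\<And>k. w (inv w k) = k" "\<And>k. inv w (w k) = k" using w by (simp_all add: permutes_inverses)
  have rng: "\<And>k. 1 \<le> k \<and> k \<le> n \<Longrightarrow> 1 \<le> w k \<and> w k \<le> n"
    using permutes_in_image[OF w] by simp
  have rng': "\<And>k. 1 \<le> k \<and> k \<le> n \<Longrightarrow> 1 \<le> inv w k \<and> inv w k \<le> n"
    using permutes_in_image[OF permutes_inv[OF w]] by simp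
  have le: "1 \<le> i \<Longrightarrow> i < j \<Longrightarrow> j \<le> n \<Longrightarrow> 1 \<le> j \<and> i \<le> n" for i j :: nat by simp
  have "bij_betw (\<lambda>(i, j). (w j, w i)) (invs n w) (invs n (inv w))"
  proof (rule bij_betw_byWitness[where f' = "\<lambda>(i, j). (inv w j, inv w i)"])
    show "(\<lambda>(i, j). (w j, w i)) ` invs n w \<subseteq> invs n (inv w)"
    proof clarify
      fix i j assume "(i, j) \<in> invs n w"
      then have ij: "1 \<le> i" "i < j" "j \<le> n" "w j < w i" by (simp_all add: invs_def)
      then show "(w j, w i) \<in> invs n (inv w)"
        using rng[of i] rng[of j] le[of i j] by (simp add: invs_def wi)
    qed
    show "(\<lambda>(i, j). (inv w j, inv w i)) ` invs n (inv w) \<subseteq> invs n w"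
    proof clarify
      fix i j assume "(i, j) \<in> invs n (inv w)"
      then have ij: "1 \<le> i" "i < j" "j \<le> n" "inv w j < inv w i" by (simp_all add: invs_def)
      then show "(inv w j, inv w i) \<in> invs n w"
        using rng'[of i] rng'[of j] le[of i j] by (simp add: invs_def wi)
    qed
  qed (simp_all add: wi split: prod.splits)
  then show ?thesis unfolding inv_num_def by (metis bij_betw_same_card)
qed

lemma inv_num_right:
  assumes w: "w permutes {1..n}" and a: "1 \<le> a" "a < n" and "w a < w (Suc a)"
  shows "inv_num n (w \<circ> sfun a) = Suc (inv_num n w)"
proof -
  have "inv (w \<circ> sfun a) = sfun a \<circ> inv w"
    using w by (subst o_inv_distrib) (auto simp: permutes_bij sfun_eq_transpose)
  moreover have "inv_num n (sfun a \<circ> inv w) = Suc (inv_num n (inv w))"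
    using assms by (intro inv_num_up permutes_inv) (auto simp: permutes_inv_inv)
  ultimately show ?thesis
    using inv_num_inv[OF w] inv_num_inv[OF permutes_compose[OF sfun_permutes[OF a] w]] by simp
qed

text \<open>Descents between neighbours chain up along a block, so every pair inside a block becomes
  an inversion; no other pair can be one.\<close>

lemma no_ascent_longest:
  assumes w: "w \<in> col_perms n col"
    and desc: "\<And>a. 1 \<le> a \<Longrightarrow> a < n \<Longrightarrow> col a = col (Suc a) \<Longrightarrow> w (Suc a) < w a"
  shows "invs n w = block_pairs"
proof
  show "block_pairs \<subseteq> invs n w"
  proof (safe, goal_cases)
    case (1 i j)
    have "1 \<le> i \<Longrightarrow> i < j \<Longrightarrow> j \<le> n \<Longrightarrow> col i = col j \<Longrightarrow> w j < w i" for j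
    proof (induction j)
      case (Suc j)
      have c: "col j = col i" by (rule contig[of i j "Suc j"]) (use Suc.prems in simp_all)
      then have "w (Suc j) < w j" using Suc by (intro desc) auto
      moreover have "w j < w i \<or> j = i" using Suc c by auto
      ultimately show ?case by auto
    qed simp
    then show ?case using 1 by (auto simp: invs_def block_pairs_def)
  qed
qed (rule invs_block_pairs[OF w])

text \<open>Appending an ascent inside a block keeps the word reduced, and
  \<open>card block_pairs\<close> bounds its length; when no ascent remains, the word represents the
  longest element of the Young subgroup.\<close>

lemma complete_to_longest:
  assumes "rword n l" "word_sup n col l"
  shows "\<exists>l'. word_sup n col (l @ l') \<and> rword n (l @ l') \<and> invs n (word_perm (l @ l')) = block_pairs"
  using assms
proof (induction "card block_pairs - length l" arbitrary: l rule: less_induct)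
  case less
  note cp = word_perm_col_perms[OF less(3)]
  then have p: "word_perm l permutes {1..n}" by (simp add: col_perms_def)
  show ?case
  proof (cases "\<exists>a. 1 \<le> a \<and> a < n \<and> col a = col (Suc a) \<and> word_perm l a < word_perm l (Suc a)")
    case False
    have "word_perm l (Suc a) \<noteq> word_perm l a" for a
      using inj_eq[OF permutes_inj[OF p], of "Suc a" a] by simp
    then have "invs n (word_perm l) = block_pairs"
      using False by (intro no_ascent_longest[OF cp]) (metis linorder_neqE_nat)
    then show ?thesis using less by (intro exI[of _ "[]"]) auto
  next
    case True
    then obtain a where a: "1 \<le> a" "a < n" "col a = col (Suc a)" "word_perm l a < word_perm l (Suc a)"
      by blast
    have wa: "word_perm (l @ [a]) = word_perm l \<circ> sfun a" by (simp add: word_perm_append)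
    have r: "rword n (l @ [a])"
      using less(2) inv_num_right[OF p a(1,2,4)] a unfolding rword_def wa by auto
    have s: "word_sup n col (l @ [a])" using less a by simp
    have "length (l @ [a]) \<le> card block_pairs"
      using r invs_block_pairs[OF word_perm_col_perms[OF s]] unfolding rword_def inv_num_def
      by (metis card_mono finite_block_pairs)
    then obtain l' where "word_sup n col ((l @ [a]) @ l')" "rword n ((l @ [a]) @ l')"
      "invs n (word_perm ((l @ [a]) @ l')) = block_pairs"
      using less(1)[of "l @ [a]", OF _ r s] by (metis diff_less_mono2 length_append_singleton less_eq_Suc_le lessI order_less_le_trans)
    then show ?thesis by (intro exI[of _ "a # l'"]) auto
  qed
qed

end

subsection \<open>The free algebra and its representations\<close>

text \<open>The pointwise simplification rules would rewrite inside the eta-expanded functions that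
  induction proofs produce.\<close>

lemmas fun_apply = plus_fun_apply zero_fun_apply minus_apply

declare fun_apply [simp del]

definition fscale :: "'k::field \<Rightarrow> ('w \<Rightarrow> 'k) \<Rightarrow> 'w \<Rightarrow> 'k" where
  "fscale c f = (\<lambda>w. c * f w)"

interpretation FS: vector_space fscale
  by standard (auto simp: fscale_def fun_eq_iff algebra_simps fun_apply)

lemma fscale_apply: "fscale c f w = c * f w"
  by (simp add: fscale_def)

lemma sum_fun_apply: "sum f S w = (\<Sum>a\<in>S. f a w)"
  by (induction S rule: infinite_finite_induct) (auto simp: fun_apply)

lemma fa_add_eq: "fa_add f g = f + g" by (simp add: fa_add_def fun_eq_iff fun_apply fscale_apply)
lemma fa_diff_eq: "fa_diff f g = f - g" by (simp add: fa_diff_def fun_eq_iff fun_apply fscale_apply)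
lemma fa_smul_eq: "fa_smul c f = fscale c f" by (simp add: fa_smul_def fun_eq_iff fun_apply fscale_apply)
lemma fa_zero_eq: "fa_zero = 0" by (simp add: fa_zero_def fun_eq_iff fun_apply fscale_apply)
lemma fa_sum_eq: "fa_sum S f = sum f S" by (simp add: fa_sum_def fun_eq_iff sum_fun_apply)

lemma fa_mult_assoc:
  fixes f g h :: "'g list \<Rightarrow> 'k::field"
  shows "fa_mult (fa_mult f g) h = fa_mult f (fa_mult g h)"
proof
  fix w :: "'g list"
  let ?n = "length w"
  have "fa_mult (fa_mult f g) h w
      = (\<Sum>(k, j)\<in>Sigma {..?n} (\<lambda>k. {..k}). f (take j w) * g (drop j (take k w)) * h (drop k w))"
    unfolding fa_mult_def
    by (subst sum.Sigma[symmetric]) (auto simp: sum_distrib_right min_def intro!: sum.cong)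
  also have "\<dots> = (\<Sum>(j, i)\<in>Sigma {..?n} (\<lambda>j. {..?n - j}). f (take j w) * g (take i (drop j w)) * h (drop i (drop j w)))"
    by (rule sum.reindex_bij_witness[where i = "\<lambda>(j, i). (i + j, j)" and j = "\<lambda>(k, j). (j, k - j)"])
      (auto simp: take_drop add.commute)
  also have "\<dots> = fa_mult f (fa_mult g h) w"
    unfolding fa_mult_def
    by (subst sum.Sigma[symmetric]) (auto simp: sum_distrib_left mult.assoc intro!: sum.cong)
  finally show "fa_mult (fa_mult f g) h w = fa_mult f (fa_mult g h) w" .
qed

lemma fa_mult_word:
  fixes f :: "'g list \<Rightarrow> 'k::field"
  shows "fa_mult (fa_word u) f w = (if take (length u) w = u then f (drop (length u) w) else 0)"
proof (cases "take (length u) w = u")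
  case True
  then have le: "length u \<le> length w" by (metis length_take min.cobounded1)
  have "fa_mult (fa_word u) f w = (\<Sum>k\<le>length w. if k = length u then f (drop k w) else 0)"
    unfolding fa_mult_def fa_word_def
    by (rule sum.cong) (use True in \<open>auto simp: min_def split: if_splits\<close>)
  then show ?thesis using True le by simp
next
  case False
  have z: "fa_word u (take k w) = (0::'k)" if "k \<le> length w" for k
    using False that by (auto simp: fa_word_def min_def split: if_splits)
  have "fa_mult (fa_word u) f w = 0"
    unfolding fa_mult_def by (intro sum.neutral) (use z in simp)
  then show ?thesis using False by simp
qed

lemma fa_mult_Nil [simp]: "fa_mult (fa_word []) f = f"
  by (rule ext) (simp add: fa_mult_word)

lemma fa_word_mult_word: "fa_mult (fa_word u) (fa_word v) = fa_word (u @ v)"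
proof
  fix w
  show "fa_mult (fa_word u) (fa_word v) w = fa_word (u @ v) w"
    unfolding fa_mult_word[of u "fa_word v"] using append_eq_conv_conj[of u v w]
    by (auto simp: fa_word_def)
qed

lemma fa_mult_Nil_right [simp]: "fa_mult f (fa_word []) = f"
proof
  fix w
  have "fa_mult f (fa_word []) w = (\<Sum>k\<le>length w. if k = length w then f w else 0)"
    unfolding fa_mult_def fa_word_def by (rule sum.cong) auto
  then show "fa_mult f (fa_word []) w = f w" by simp
qed

lemma fa_mult_linear:
  "fa_mult (f + g) h = fa_mult f h + fa_mult g h"
  "fa_mult f (g + h) = fa_mult f g + fa_mult f h"
  "fa_mult (f - g) h = fa_mult f h - fa_mult g h"
  "fa_mult f (g - h) = fa_mult f g - fa_mult f h"
  "fa_mult (fscale c f) h = fscale c (fa_mult f h)"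
  "fa_mult f (fscale c h) = fscale c (fa_mult f h)"
  "fa_mult 0 h = 0" "fa_mult f 0 = 0"
  by (auto simp: fa_mult_def fun_eq_iff fun_apply fscale_apply algebra_simps sum.distrib sum_subtractf
    sum_distrib_left)

lemma fa_elemI: "finite S \<Longrightarrow> (\<And>w. f w \<noteq> 0 \<Longrightarrow> w \<in> S \<and> set w \<subseteq> V) \<Longrightarrow> fa_elem V f"
  unfolding fa_elem_def by (metis (mono_tags, lifting) mem_Collect_eq rev_finite_subset subsetI)

lemma fa_elem_word: "set u \<subseteq> V \<Longrightarrow> fa_elem V (fa_word u)"
  by (rule fa_elemI[of "{u}"]) (auto simp: fa_word_def split: if_splits)

lemma fa_elem_add:
  fixes f g :: "'g list \<Rightarrow> 'k::field"
  shows "fa_elem V f \<Longrightarrow> fa_elem V g \<Longrightarrow> fa_elem V (f + g)"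
  by (rule fa_elemI[of "{w. f w \<noteq> 0} \<union> {w. g w \<noteq> 0}"])
    (unfold fa_elem_def fun_apply, simp, metis (mono_tags) Un_iff add_0 add_0_right diff_0_right mem_Collect_eq)

lemma fa_elem_diff:
  fixes f g :: "'g list \<Rightarrow> 'k::field"
  shows "fa_elem V f \<Longrightarrow> fa_elem V g \<Longrightarrow> fa_elem V (f - g)"
  by (rule fa_elemI[of "{w. f w \<noteq> 0} \<union> {w. g w \<noteq> 0}"])
    (unfold fa_elem_def fun_apply, simp, metis (mono_tags) Un_iff add_0 add_0_right diff_0_right mem_Collect_eq)

lemma fa_elem_scale: "fa_elem V f \<Longrightarrow> fa_elem V (fscale c f)"
  by (rule fa_elemI[of "{w. f w \<noteq> 0}"]) (auto simp: fa_elem_def fscale_apply)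

lemma fa_elem_zero: "fa_elem V 0"
  by (simp add: fa_elem_def fun_apply)

lemma fa_elem_sum:
  fixes f :: "'a \<Rightarrow> 'g list \<Rightarrow> 'k::field"
  shows "(\<And>a. a \<in> S \<Longrightarrow> fa_elem V (f a)) \<Longrightarrow> fa_elem V (sum f S)"
  by (induction S rule: infinite_finite_induct) (auto intro: fa_elem_zero fa_elem_add)

lemma fa_elem_mult:
  assumes f: "fa_elem V f" and g: "fa_elem V g" shows "fa_elem V (fa_mult f g)"
proof (rule fa_elemI[of "(\<lambda>(a, b). a @ b) ` ({w. f w \<noteq> 0} \<times> {w. g w \<noteq> 0})"])
  show "finite ((\<lambda>(a, b). a @ b) ` ({w. f w \<noteq> 0} \<times> {w. g w \<noteq> 0}))"
    using f g by (auto simp: fa_elem_def)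
  fix w assume "fa_mult f g w \<noteq> 0"
  then obtain k where k: "f (take k w) \<noteq> 0" "g (drop k w) \<noteq> 0"
    unfolding fa_mult_def by (metis (no_types, lifting) mult_eq_0_iff sum.neutral)
  then have "w = (\<lambda>(a, b). a @ b) (take k w, drop k w)"
    "(take k w, drop k w) \<in> {w. f w \<noteq> 0} \<times> {w. g w \<noteq> 0}" by auto
  moreover have "set w \<subseteq> V"
    using k f g unfolding fa_elem_def by (metis append_take_drop_id set_append sup.boundedI)
  ultimately show "w \<in> (\<lambda>(a, b). a @ b) ` ({w. f w \<noteq> 0} \<times> {w. g w \<noteq> 0}) \<and> set w \<subseteq> V"
    by blast
qed

lemma fa_elem_pow: "fa_elem V f \<Longrightarrow> fa_elem V (fa_pow f m)"
  by (induction m) (auto simp: fa_pow_def fa_one_def intro: fa_elem_word fa_elem_mult)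

lemma fa_word_decomp: "fa_elem V f \<Longrightarrow> f = (\<Sum>w | f w \<noteq> 0. fscale (f w) (fa_word w))"
  by (rule ext) (auto simp: fa_elem_def sum_fun_apply fscale_apply fa_word_def if_distrib[of "(*) _"] cong: if_cong)

lemma fa_elem_induct [consumes 1, case_names zero word add scale]:
  assumes f: "fa_elem V f"
    and zero: "P 0"
    and word: "\<And>u. set u \<subseteq> V \<Longrightarrow> P (fa_word u)"
    and add: "\<And>f g. fa_elem V f \<Longrightarrow> fa_elem V g \<Longrightarrow> P f \<Longrightarrow> P g \<Longrightarrow> P (f + g)"
    and scale: "\<And>c f. fa_elem V f \<Longrightarrow> P f \<Longrightarrow> P (fscale c f)"
  shows "P f"
proof -
  have "P (\<Sum>w\<in>S. fscale (f w) (fa_word w)) \<and> fa_elem V (\<Sum>w\<in>S. fscale (f w) (fa_word w))"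
    if "finite S" "S \<subseteq> {w. f w \<noteq> 0}" for S
    using that
  proof (induction S)
    case empty then show ?case using zero fa_elem_zero by simp
  next
    case (insert w S)
    then have w: "set w \<subseteq> V" using f by (auto simp: fa_elem_def)
    have "P (fscale (f w) (fa_word w))" by (intro scale word fa_elem_word w)
    then show ?case using insert w by (auto intro!: add fa_elem_add fa_elem_scale fa_elem_word)
  qed
  from this[of "{w. f w \<noteq> 0}"] show ?thesis
    using f fa_word_decomp[OF f] by (auto simp: fa_elem_def)
qed

lemma gen_ideal_closed:
  "0 \<in> gen_ideal V G"
  "f \<in> gen_ideal V G \<Longrightarrow> g \<in> gen_ideal V G \<Longrightarrow> f + g \<in> gen_ideal V G"
  "f \<in> gen_ideal V G \<Longrightarrow> fscale c f \<in> gen_ideal V G"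
  unfolding zero_fun_def plus_fun_def fscale_def
  by (rule gen_ideal.intros; assumption?)+

lemma gen_ideal_induct' [consumes 1, case_names zero gen add scale]:
  assumes f: "f \<in> gen_ideal V G"
    and zero: "P 0"
    and gen: "\<And>g u v. g \<in> G \<Longrightarrow> set u \<subseteq> V \<Longrightarrow> set v \<subseteq> V \<Longrightarrow> P (fa_mult (fa_mult (fa_word u) g) (fa_word v))"
    and add: "\<And>f g. f \<in> gen_ideal V G \<Longrightarrow> g \<in> gen_ideal V G \<Longrightarrow> P f \<Longrightarrow> P g \<Longrightarrow> P (f + g)"
    and scale: "\<And>c f. f \<in> gen_ideal V G \<Longrightarrow> P f \<Longrightarrow> P (fscale c f)"
  shows "P f"
  using f
proof (induction rule: gen_ideal.induct)
  case zero show ?case using assms(2) unfolding zero_fun_def .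
next
  case (gen g u v) then show ?case by (rule assms(3))
next
  case (add f g) then show ?case using assms(4)[of f g] unfolding plus_fun_def by blast
next
  case (smul f c) then show ?case using assms(5)[of f c] unfolding fscale_def by blast
qed

lemma gen_ideal_left:
  "f \<in> gen_ideal V G \<Longrightarrow> set u \<subseteq> V \<Longrightarrow> fa_mult (fa_word u) f \<in> gen_ideal V G"
proof (induction rule: gen_ideal_induct')
  case (gen g u' v)
  have "fa_mult (fa_mult (fa_word (u @ u')) g) (fa_word v) \<in> gen_ideal V G"
    by (rule gen_ideal.gen) (use gen in auto)
  then show ?case by (simp only: fa_word_mult_word[symmetric] fa_mult_assoc)
qed (simp_all add: fa_mult_linear gen_ideal_closed)

lemma gen_ideal_right:
  "f \<in> gen_ideal V G \<Longrightarrow> set v \<subseteq> V \<Longrightarrow> fa_mult f (fa_word v) \<in> gen_ideal V G"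
proof (induction rule: gen_ideal_induct')
  case (gen g u v')
  have "fa_mult (fa_mult (fa_word u) g) (fa_word (v' @ v)) \<in> gen_ideal V G"
    by (rule gen_ideal.gen) (use gen in auto)
  then show ?case by (simp only: fa_word_mult_word[symmetric] fa_mult_assoc)
qed (simp_all add: fa_mult_linear gen_ideal_closed)

lemma subspace_gen_ideal: "FS.subspace (gen_ideal V G)"
  by (rule FS.subspaceI) (simp_all add: gen_ideal_closed)

lemma gen_ideal_mult_elem:
  assumes "f \<in> gen_ideal V G" "fa_elem V Y" shows "fa_mult f Y \<in> gen_ideal V G"
  using assms(2)
proof (induction rule: fa_elem_induct)
  case zero then show ?case using FS.subspace_0[OF subspace_gen_ideal] by (simp add: fa_mult_linear)
next
  case (word u) then show ?case using gen_ideal_right assms(1) by blast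
next
  case (add f g) then show ?case by (simp add: fa_mult_linear FS.subspace_add[OF subspace_gen_ideal])
next
  case (scale c f) then show ?case by (simp add: fa_mult_linear FS.subspace_scale[OF subspace_gen_ideal])
qed

lemma gen_ideal_gen: "g \<in> G \<Longrightarrow> g \<in> gen_ideal V G"
  using gen_ideal.gen[of g G "[]" V "[]"] by simp

text \<open>No relation is imposed on the operators, so that relations can later be required modulo
  a subspace only. There are two instances: left multiplication on the free algebra, for spanning,
  and the operators on superpolynomials, for independence.\<close>

locale gen_rep = vector_space scale
  for scale :: "'k::field \<Rightarrow> 'v::ab_group_add \<Rightarrow> 'v" +
  fixes \<rho> :: "'i gen \<Rightarrow> 'v \<Rightarrow> 'v"
  assumes rho_add: "\<rho> g (v + w) = \<rho> g v + \<rho> g w"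
    and rho_scale: "\<rho> g (scale c v) = scale c (\<rho> g v)"
begin

text \<open>For a coefficient function of infinite support the sum is 0 by convention, hence the
  hypotheses \<open>fa_elem UNIV\<close> in the laws that follow.\<close>

definition ev :: "('i gen list \<Rightarrow> 'k) \<Rightarrow> 'v \<Rightarrow> 'v" where
  "ev f v = (\<Sum>w | f w \<noteq> 0. scale (f w) (foldr \<rho> w v))"

lemma rho_zero: "\<rho> g 0 = 0" using rho_scale[of g 0 0] by simp
lemma rho_diff: "\<rho> g (v - w) = \<rho> g v - \<rho> g w"
  using rho_add[of g "v - w" w] by (simp add: eq_diff_eq)

lemma words_add: "foldr \<rho> w (u + v) = foldr \<rho> w u + foldr \<rho> w v"
  by (induction w) (auto simp: rho_add)
lemma words_scale: "foldr \<rho> w (scale c v) = scale c (foldr \<rho> w v)"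
  by (induction w) (auto simp: rho_scale)
lemma words_zero: "foldr \<rho> w 0 = 0"
  by (induction w) (auto simp: rho_zero)
lemma ev_superset:
  assumes "finite S" "{w. f w \<noteq> 0} \<subseteq> S"
  shows "ev f v = (\<Sum>w\<in>S. scale (f w) (foldr \<rho> w v))"
  unfolding ev_def by (rule sum.mono_neutral_left) (use assms in auto)

lemma ev_word: "ev (fa_word u) v = foldr \<rho> u v"
  by (subst ev_superset[of "{u}"]) (auto simp: fa_word_def split: if_splits)

lemma ev_zero: "ev 0 v = 0"
  by (simp add: ev_def fun_apply)

lemma ev_add: "fa_elem UNIV f \<Longrightarrow> fa_elem UNIV g \<Longrightarrow> ev (f + g) v = ev f v + ev g v"
  by (subst (1 2 3) ev_superset[of "{w. f w \<noteq> 0} \<union> {w. g w \<noteq> 0}"])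
    (auto simp: fa_elem_def fun_apply scale_left_distrib sum.distrib)

lemma ev_scale: "fa_elem UNIV f \<Longrightarrow> ev (fscale c f) v = scale c (ev f v)"
  by (subst (1 2) ev_superset[of "{w. f w \<noteq> 0}"]) (auto simp: fa_elem_def fscale_apply scale_sum_right)

lemma ev_diff: "fa_elem UNIV f \<Longrightarrow> fa_elem UNIV g \<Longrightarrow> ev (f - g) v = ev f v - ev g v"
  by (subst (1 2 3) ev_superset[of "{w. f w \<noteq> 0} \<union> {w. g w \<noteq> 0}"])
    (auto simp: fa_elem_def fun_apply scale_left_diff_distrib sum_subtractf)

lemma ev_sum: "(\<And>a. a \<in> S \<Longrightarrow> fa_elem UNIV (f a)) \<Longrightarrow> ev (sum f S) v = (\<Sum>a\<in>S. ev (f a) v)"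
  by (induction S rule: infinite_finite_induct) (auto simp: ev_zero ev_add fa_elem_sum)

lemma ev_v_add: "ev f (u + v) = ev f u + ev f v"
  by (simp add: ev_def words_add scale_right_distrib sum.distrib)

lemma ev_v_scale: "ev f (scale c v) = scale c (ev f v)"
  by (simp add: ev_def words_scale scale_sum_right mult.commute)

lemma ev_mult:
  assumes f: "fa_elem UNIV f" and g: "fa_elem UNIV g"
  shows "ev (fa_mult f g) v = ev f (ev g v)"
  using f
proof (induction rule: fa_elem_induct)
  case zero then show ?case by (simp add: fa_mult_linear ev_zero)
next
  case (word u)
  show ?case using g
  proof (induction rule: fa_elem_induct)
    case zero then show ?case by (simp add: fa_mult_linear ev_zero ev_word words_zero)
  next
    case (word u') then show ?case by (simp add: fa_word_mult_word ev_word)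
  next
    case (add f g)
    then show ?case by (simp add: fa_mult_linear ev_add ev_v_add fa_elem_mult fa_elem_word)
  next
    case (scale c f)
    then show ?case by (simp add: fa_mult_linear ev_scale ev_v_scale fa_elem_mult fa_elem_word)
  qed
next
  case (add f1 f2)
  then show ?case using g by (simp add: fa_mult_linear ev_add fa_elem_mult)
next
  case (scale c f1)
  then show ?case using g by (simp add: fa_mult_linear ev_scale fa_elem_mult)
qed

lemma ev_one: "ev fa_one v = v"
  by (simp add: fa_one_def ev_word)

lemma ev_pow: "fa_elem UNIV f \<Longrightarrow> ev (fa_pow f m) v = (ev f ^^ m) v"
proof (induction m)
  case 0 then show ?case by (simp add: fa_pow_def ev_one)
next
  case (Suc m)
  have "fa_pow f (Suc m) = fa_mult f (fa_pow f m)" by (simp add: fa_pow_def)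
  then show ?case using Suc by (simp add: ev_mult fa_elem_pow)
qed

text \<open>Stability of \<open>N\<close> under the operators takes care of left factors. A right
  factor of a relation merely changes the vector to which the relation is applied, and relations
  send all vectors into \<open>N\<close>.\<close>

lemma gen_ideal_ev:
  assumes N: "subspace N" and stable: "\<And>g v. g \<in> V \<Longrightarrow> v \<in> N \<Longrightarrow> \<rho> g v \<in> N"
    and G: "\<And>r. r \<in> G \<Longrightarrow> fa_elem UNIV r" "\<And>r v. r \<in> G \<Longrightarrow> ev r v \<in> N"
  shows "f \<in> gen_ideal V G \<Longrightarrow> fa_elem UNIV f \<and> (\<forall>v. ev f v \<in> N)"
proof (induction rule: gen_ideal_induct')
  case zero
  then show ?case using fa_elem_zero subspace_0[OF N] by (simp add: ev_zero)
next
  case (gen g u v)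
  have w: "foldr \<rho> u x \<in> N" if "x \<in> N" for x
    using gen(2) that by (induction u) (auto intro: stable)
  have e: "fa_elem UNIV (fa_word u :: 'i gen list \<Rightarrow> 'k)" for u
    by (simp add: fa_elem_word)
  show ?case
    using G[OF gen(1)] w e by (simp add: fa_elem_mult ev_mult ev_word)
next
  case (add f g)
  then show ?case by (auto simp: ev_add subspace_add[OF N] intro: fa_elem_add)
next
  case (scale c f)
  then show ?case by (auto simp: ev_scale subspace_scale[OF N] intro: fa_elem_scale)
qed

end

text \<open>The left regular representation: evaluation is multiplication (\<open>FL_ev\<close>), so
  membership of relations in an ideal becomes a system of operator identities modulo that
  ideal.\<close>

interpretation FL: gen_rep fscale "\<lambda>g. fa_mult (fa_word [g])"
  by standard (auto simp: fa_mult_linear)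

lemma FL_words: "foldr (\<lambda>g. fa_mult (fa_word [g])) u Y = fa_mult (fa_word u) Y"
proof (induction u)
  case Nil then show ?case by simp
next
  case (Cons a u)
  have "fa_mult (fa_word [a]) (fa_mult (fa_word u) Y) = fa_mult (fa_word (a # u)) Y"
    unfolding fa_mult_assoc[symmetric] fa_word_mult_word by simp
  then show ?case using Cons by simp
qed

lemma FL_ev: "fa_elem UNIV f \<Longrightarrow> FL.ev f Y = fa_mult f Y"
proof (induction rule: fa_elem_induct)
  case zero then show ?case by (simp add: FL.ev_zero fa_mult_linear)
next
  case (word u) then show ?case by (simp add: FL.ev_word FL_words)
next
  case (add f g) then show ?case by (simp add: FL.ev_add fa_mult_linear)
next
  case (scale c f) then show ?case by (simp add: FL.ev_scale fa_mult_linear)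
qed

section \<open>Exchanging neighbours in a word; the defining relations as operator
  identities\<close>

lemma swap_at_length [simp]: "length (swap_at a \<nu>) = length \<nu>"
  by (simp add: swap_at_def)

lemma ent_swap_at:
  assumes "1 \<le> a" "a < length \<nu>" "1 \<le> p" "p \<le> length \<nu>"
  shows "ent (swap_at a \<nu>) p = ent \<nu> (sfun a p)"
  using assms by (auto simp: swap_at_def ent_def sfun_apply nth_list_update)

lemma ent_eqI:
  assumes "length \<mu> = length \<nu>" "\<And>p. 1 \<le> p \<Longrightarrow> p \<le> length \<nu> \<Longrightarrow> ent \<mu> p = ent \<nu> p"
  shows "\<mu> = \<nu>"
proof (rule nth_equalityI)
  fix i assume "i < length \<mu>"
  then show "\<mu> ! i = \<nu> ! i" using assms(1) assms(2)[of "Suc i"] by (simp add: ent_def)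
qed (rule assms(1))

lemma swap_at_swap_at: "1 \<le> a \<Longrightarrow> a < length \<nu> \<Longrightarrow> swap_at a (swap_at a \<nu>) = \<nu>"
  by (rule ent_eqI) (auto simp: ent_swap_at sfun_apply)

lemma swap_at_same: "1 \<le> a \<Longrightarrow> a < length \<nu> \<Longrightarrow> ent \<nu> a = ent \<nu> (Suc a) \<Longrightarrow> swap_at a \<nu> = \<nu>"
  by (rule ent_eqI) (auto simp: ent_swap_at sfun_apply)

context gen_rep
begin

definition Qop :: "('i \<Rightarrow> 'i \<Rightarrow> nat \<Rightarrow> nat \<Rightarrow> 'k) \<Rightarrow> 'i \<Rightarrow> 'i \<Rightarrow> nat \<Rightarrow> nat \<Rightarrow> 'v \<Rightarrow> 'v" where
  "Qop t i j p q v = (\<Sum>(r, s)\<in>Qsupp t i j. scale (t i j r s) ((\<rho> (X p) ^^ r) ((\<rho> (X q) ^^ s) v)))"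

definition braid_op :: "'i set \<Rightarrow> ('i \<Rightarrow> 'i \<Rightarrow> nat \<Rightarrow> nat \<Rightarrow> 'k) \<Rightarrow> 'i list \<Rightarrow> nat \<Rightarrow> 'v \<Rightarrow> 'v" where
  "braid_op Iodd t \<nu> a v =
    (let i = ent \<nu> a; j = ent \<nu> (a + 1) in
     if i = ent \<nu> (a + 2) \<and> i \<notin> Iodd then
       (\<Sum>(r, s)\<in>Qsupp t i j. scale (t i j r s)
         (\<Sum>k<r. (\<rho> (X (a + 2)) ^^ k) ((\<rho> (X a) ^^ (r - 1 - k)) ((\<rho> (X (a + 1)) ^^ s) v))))
     else if i = ent \<nu> (a + 2) \<and> i \<in> Iodd then
       scale (sgn_par Iodd [j])
        ((\<lambda>u. \<rho> (X (a + 2)) u - \<rho> (X a) u)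
          (\<Sum>(r, s)\<in>Qsupp t i j. scale (t i j r s)
            (\<Sum>k<r div 2. (\<rho> (X (a + 2)) ^^ (2 * k)) ((\<rho> (X a) ^^ (2 * (r div 2 - 1 - k)))
              ((\<rho> (X (a + 1)) ^^ s) v)))))
     else 0)"

text \<open>One conjunct for each family of defining relations, tested on the single vector
  \<open>v\<close> and modulo \<open>N\<close>. For spanning \<open>N\<close> is the cyclotomic
  ideal, for independence it is the subspace \<open>rep_ideal\<close>.\<close>

definition klr_ops :: "'i set \<Rightarrow> ('i \<Rightarrow> 'i \<Rightarrow> nat \<Rightarrow> nat \<Rightarrow> 'k) \<Rightarrow> nat \<Rightarrow> 'i list set \<Rightarrow> 'v set \<Rightarrow> 'v \<Rightarrow> bool" where
  "klr_ops Iodd t n IB N v \<longleftrightarrow>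
     (\<forall>\<mu>\<in>IB. \<forall>\<nu>\<in>IB. \<rho> (E \<mu>) (\<rho> (E \<nu>) v) - (if \<mu> = \<nu> then \<rho> (E \<nu>) v else 0) \<in> N) \<and>
     ((\<Sum>\<nu>\<in>IB. \<rho> (E \<nu>) v) - v \<in> N) \<and>
     (\<forall>\<nu>\<in>IB. \<forall>p\<in>{1..n}. \<forall>q\<in>{1..n}. p \<noteq> q \<longrightarrow>
        \<rho> (X p) (\<rho> (X q) (\<rho> (E \<nu>) v))
          - scale (sgn_par Iodd [ent \<nu> p, ent \<nu> q]) (\<rho> (X q) (\<rho> (X p) (\<rho> (E \<nu>) v))) \<in> N) \<and>
     (\<forall>\<nu>\<in>IB. \<forall>p\<in>{1..n}. \<rho> (X p) (\<rho> (E \<nu>) v) - \<rho> (E \<nu>) (\<rho> (X p) v) \<in> N) \<and>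
     (\<forall>\<nu>\<in>IB. \<forall>a\<in>{1..<n}. \<rho> (T a) (\<rho> (E \<nu>) v) - \<rho> (E (swap_at a \<nu>)) (\<rho> (T a) v) \<in> N) \<and>
     (\<forall>\<nu>\<in>IB. \<forall>a\<in>{1..<n}. \<forall>p\<in>{1..n}. p \<noteq> a \<and> p \<noteq> a + 1 \<longrightarrow>
        \<rho> (T a) (\<rho> (X p) (\<rho> (E \<nu>) v))
          - scale (sgn_par Iodd [ent \<nu> p, ent \<nu> a, ent \<nu> (a + 1)]) (\<rho> (X p) (\<rho> (T a) (\<rho> (E \<nu>) v))) \<in> N) \<and>
     (\<forall>\<nu>\<in>IB. \<forall>a\<in>{1..<n}.
        \<rho> (T a) (\<rho> (X (a + 1)) (\<rho> (E \<nu>) v))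
          - scale (sgn_par Iodd [ent \<nu> a, ent \<nu> (a + 1)]) (\<rho> (X a) (\<rho> (T a) (\<rho> (E \<nu>) v)))
          - (if ent \<nu> a = ent \<nu> (a + 1) then \<rho> (E \<nu>) v else 0) \<in> N) \<and>
     (\<forall>\<nu>\<in>IB. \<forall>a\<in>{1..<n}.
        \<rho> (X (a + 1)) (\<rho> (T a) (\<rho> (E \<nu>) v))
          - scale (sgn_par Iodd [ent \<nu> a, ent \<nu> (a + 1)]) (\<rho> (T a) (\<rho> (X a) (\<rho> (E \<nu>) v)))
          - (if ent \<nu> a = ent \<nu> (a + 1) then \<rho> (E \<nu>) v else 0) \<in> N) \<and>
     (\<forall>\<nu>\<in>IB. \<forall>a\<in>{1..<n}.
        \<rho> (T a) (\<rho> (T a) (\<rho> (E \<nu>) v)) - Qop t (ent \<nu> a) (ent \<nu> (a + 1)) a (a + 1) (\<rho> (E \<nu>) v) \<in> N) \<and>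
     (\<forall>\<nu>\<in>IB. \<forall>a\<in>{1..<n}. \<forall>c\<in>{1..<n}. c + 1 < a \<or> a + 1 < c \<longrightarrow>
        \<rho> (T a) (\<rho> (T c) (\<rho> (E \<nu>) v))
          - scale (sgn_par Iodd [ent \<nu> a, ent \<nu> (a + 1), ent \<nu> c, ent \<nu> (c + 1)])
              (\<rho> (T c) (\<rho> (T a) (\<rho> (E \<nu>) v))) \<in> N) \<and>
     (\<forall>\<nu>\<in>IB. \<forall>a. 1 \<le> a \<and> a + 1 < n \<longrightarrow>
        \<rho> (T (a + 1)) (\<rho> (T a) (\<rho> (T (a + 1)) (\<rho> (E \<nu>) v)))
          - \<rho> (T a) (\<rho> (T (a + 1)) (\<rho> (T a) (\<rho> (E \<nu>) v)))
          - braid_op Iodd t \<nu> a (\<rho> (E \<nu>) v) \<in> N)"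

lemma rho_elem [simp]:
  "fa_elem UNIV (gE \<nu> :: ('i, 'k) fa)" "fa_elem UNIV (gX p :: ('i, 'k) fa)" "fa_elem UNIV (gT a :: ('i, 'k) fa)"
  "fa_elem UNIV (fa_one :: ('i, 'k) fa)"
  by (simp_all add: gE_def gX_def gT_def fa_one_def fa_elem_word)

lemma ev_gens: "ev (gE \<nu>) v = \<rho> (E \<nu>) v" "ev (gX p) v = \<rho> (X p) v" "ev (gT a) v = \<rho> (T a) v"
  by (simp_all add: gE_def gX_def gT_def ev_word)

lemma ev_gens_fun: "ev (gE \<nu>) = \<rho> (E \<nu>)" "ev (gX p) = \<rho> (X p)" "ev (gT a) = \<rho> (T a)"
  by (simp_all add: fun_eq_iff ev_gens)

lemmas fa_elem_ops = fa_elem_mult fa_elem_add fa_elem_diff fa_elem_scale fa_elem_zero fa_elem_pow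
lemmas fa_eqs = fa_add_eq fa_diff_eq fa_smul_eq fa_zero_eq fa_sum_eq

lemma elem_prod [simp]:
  "fa_elem UNIV (fa_prod ([] :: ('i, 'k) fa list))"
  "fa_elem UNIV (f :: ('i, 'k) fa) \<Longrightarrow> fa_elem UNIV (fa_prod fs) \<Longrightarrow> fa_elem UNIV (fa_prod (f # fs))"
  by (simp_all add: fa_prod_def fa_elem_mult)

lemma ev_prod_simps:
  "ev (fa_prod []) v = v"
  "fa_elem UNIV f \<Longrightarrow> fa_elem UNIV (fa_prod fs) \<Longrightarrow> ev (fa_prod (f # fs)) v = ev f (ev (fa_prod fs) v)"
  by (simp_all add: fa_prod_def ev_mult ev_one)

lemma Qx_elem [simp]: "fa_elem UNIV (Qx t i j p q :: ('i, 'k) fa)"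
  unfolding Qx_def fa_eqs by (rule fa_elem_sum) (auto intro!: fa_elem_ops split: prod.splits)

lemma ev_Qx: "ev (Qx t i j p q) v = Qop t i j p q v"
proof -
  have "ev (Qx t i j p q) v = (\<Sum>a\<in>Qsupp t i j. ev (case a of (r, s) \<Rightarrow>
      fscale (t i j r s) (fa_mult (fa_pow (gX p) r) (fa_pow (gX q) s))) v)"
    unfolding Qx_def fa_eqs by (rule ev_sum) (auto intro!: fa_elem_ops split: prod.splits)
  then show ?thesis
    by (simp add: Qop_def case_prod_beta ev_scale ev_mult fa_elem_ops ev_pow ev_gens_fun)
qed

lemma braid_rhs_elem [simp]: "fa_elem UNIV (braid_rhs Iodd t \<nu> a :: ('i, 'k) fa)"
  unfolding braid_rhs_def fa_eqs Let_def
  by (auto intro!: fa_elem_ops fa_elem_sum simp: case_prod_beta fa_elem_pow)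

lemma ev_braid: "ev (braid_rhs Iodd t \<nu> a) v = braid_op Iodd t \<nu> a v"
  unfolding braid_rhs_def braid_op_def fa_eqs Let_def
  by (simp add: case_prod_beta ev_scale ev_mult ev_sum ev_diff ev_zero fa_elem_ops fa_elem_sum
      ev_prod_simps ev_pow ev_gens_fun)

lemma ev_ifs:
  "ev (if P then f else 0) v = (if P then ev f v else 0)"
  "fa_elem UNIV (f :: ('i, 'k) fa) \<Longrightarrow> fa_elem UNIV (if P then f else 0)"
  by (simp_all add: ev_zero fa_elem_zero)

lemmas ev_simps = ev_mult ev_diff ev_scale ev_sum ev_ifs ev_prod_simps ev_gens ev_one ev_Qx ev_braid
  fa_elem_ops fa_elem_sum

lemma ball_Collect1: "(\<forall>r\<in>{f a |a. P a}. R r) \<longleftrightarrow> (\<forall>a. P a \<longrightarrow> R (f a))" by blast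
lemma ball_Collect2: "(\<forall>r\<in>{f a b |a b. P a b}. R r) \<longleftrightarrow> (\<forall>a b. P a b \<longrightarrow> R (f a b))" by blast
lemma ball_Collect3: "(\<forall>r\<in>{f a b c |a b c. P a b c}. R r) \<longleftrightarrow> (\<forall>a b c. P a b c \<longrightarrow> R (f a b c))" by blast

text \<open>The bridge is crossed in both directions: from the ideal to operator identities for
  spanning, and from operator identities to the ideal for independence. Finiteness of the supports
  of the relations comes along with it.\<close>

lemma KLR_rels_ev:
  "(\<forall>r\<in>KLR_rels I Iodd alpha t n \<beta>. fa_elem UNIV r \<and> ev r v \<in> N) \<longleftrightarrow>
     klr_ops Iodd t n (Ibeta I alpha n \<beta>) N v"
  unfolding KLR_rels_def Let_def ball_Un fa_eqs ball_Collect1 ball_Collect2 ball_Collect3 klr_ops_def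
    conj_assoc
  by (intro arg_cong2[where f = "(\<and>)"]) (simp_all add: ev_simps Ball_def, blast+)

lemma cyc_rels_ev:
  assumes "n \<noteq> 0"
  shows "(\<forall>r\<in>cyc_rels I alpha h Lam n \<beta>. fa_elem UNIV r \<and> ev r v \<in> N) \<longleftrightarrow>
    (\<Sum>\<nu>\<in>Ibeta I alpha n \<beta>. (\<rho> (X 1) ^^ nat (h (ent \<nu> 1) Lam)) (\<rho> (E \<nu>) v)) \<in> N"
  using assms by (simp add: cyc_rels_def fa_eqs ev_simps ev_pow ev_gens_fun)

end

lemma sgn_par_sq: "sgn_par Iodd is * sgn_par Iodd is = (1 :: 'k::field)"
  by (simp add: sgn_par_def)

lemma sgn_par_nz: "sgn_par Iodd is \<noteq> (0 :: 'k::field)"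
  by (simp add: sgn_par_def)

subsection \<open>Spanning\<close>

text \<open>\<open>W\<close> holds the vectors on which the relations are valid modulo
  \<open>J\<close>. In the application these are the finite combinations of words in the generators,
  since the ideal absorbs right multiplication by those.\<close>

locale klr_mod = gen_rep scale \<rho>
  for scale :: "'k::field \<Rightarrow> 'v::ab_group_add \<Rightarrow> 'v" and \<rho> :: "'i gen \<Rightarrow> 'v \<Rightarrow> 'v" +
  fixes Iodd :: "'i set" and t :: "'i \<Rightarrow> 'i \<Rightarrow> nat \<Rightarrow> nat \<Rightarrow> 'k" and n :: nat and IB :: "'i list set"
    and W J :: "'v set"
  assumes subW: "subspace W" and subJ: "subspace J"
    and stabW: "\<And>v. v \<in> W \<Longrightarrow> \<nu> \<in> IB \<Longrightarrow> \<rho> (E \<nu>) v \<in> W"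
      "\<And>v. v \<in> W \<Longrightarrow> p \<in> {1..n} \<Longrightarrow> \<rho> (X p) v \<in> W"
      "\<And>v. v \<in> W \<Longrightarrow> a \<in> {1..<n} \<Longrightarrow> \<rho> (T a) v \<in> W"
    and stabJ: "\<And>v. v \<in> J \<Longrightarrow> \<nu> \<in> IB \<Longrightarrow> \<rho> (E \<nu>) v \<in> J"
      "\<And>v. v \<in> J \<Longrightarrow> p \<in> {1..n} \<Longrightarrow> \<rho> (X p) v \<in> J"
      "\<And>v. v \<in> J \<Longrightarrow> a \<in> {1..<n} \<Longrightarrow> \<rho> (T a) v \<in> J"
    and rel: "\<And>v. v \<in> W \<Longrightarrow> klr_ops Iodd t n IB J v"
    and IB_len: "\<And>\<nu>. \<nu> \<in> IB \<Longrightarrow> length \<nu> = n"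
    and IB_swap: "\<And>\<nu> a. \<nu> \<in> IB \<Longrightarrow> a \<in> {1..<n} \<Longrightarrow> swap_at a \<nu> \<in> IB"
    and Qsupp_diag: "\<And>\<nu> a. \<nu> \<in> IB \<Longrightarrow> a \<in> {1..n} \<Longrightarrow> Qsupp t (ent \<nu> a) (ent \<nu> a) = {}"
begin

definition eqv :: "'v \<Rightarrow> 'v \<Rightarrow> bool" (infix "\<approx>" 50) where "a \<approx> b \<longleftrightarrow> a - b \<in> J"

lemma eqv_refl [simp]: "a \<approx> a" by (simp add: eqv_def subspace_0[OF subJ])
lemma eqv_sym: "a \<approx> b \<Longrightarrow> b \<approx> a"
  unfolding eqv_def using subspace_neg[OF subJ, of "a - b"] by simp
lemma eqv_trans [trans]: "a \<approx> b \<Longrightarrow> b \<approx> c \<Longrightarrow> a \<approx> c"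
  unfolding eqv_def using subspace_add[OF subJ, of "a - b" "b - c"] by simp
lemma eqv_add: "a \<approx> b \<Longrightarrow> c \<approx> d \<Longrightarrow> a + c \<approx> b + d"
  unfolding eqv_def using subspace_add[OF subJ, of "a - b" "c - d"] by (simp add: algebra_simps)
lemma eqv_scale: "a \<approx> b \<Longrightarrow> scale c a \<approx> scale c b"
  unfolding eqv_def using subspace_scale[OF subJ, of "a - b" c] by (simp add: scale_right_diff_distrib)
lemma eqv_x: "a \<approx> b \<Longrightarrow> p \<in> {1..n} \<Longrightarrow> \<rho> (X p) a \<approx> \<rho> (X p) b"
  unfolding eqv_def using stabJ(2) rho_diff by metis
lemma eqv_t: "a \<approx> b \<Longrightarrow> p \<in> {1..<n} \<Longrightarrow> \<rho> (T p) a \<approx> \<rho> (T p) b"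
  unfolding eqv_def using stabJ(3) rho_diff by metis
lemma eqv_e: "a \<approx> b \<Longrightarrow> \<nu> \<in> IB \<Longrightarrow> \<rho> (E \<nu>) a \<approx> \<rho> (E \<nu>) b"
  unfolding eqv_def using stabJ(1) rho_diff by metis

lemma eqv_solve:
  assumes "m \<approx> scale s y + scale c w"
  shows "scale c w \<approx> m + scale (- s) y" "scale s y \<approx> m + scale (- c) w"
  using subspace_neg[OF subJ assms[unfolded eqv_def]] by (simp_all add: eqv_def algebra_simps)

definition sp :: "'v set \<Rightarrow> 'v set" where "sp S = span (J \<union> S)"

lemma sub_sp [simp]: "subspace (sp S)" by (simp add: sp_def)
lemma sp_J: "a \<in> J \<Longrightarrow> a \<in> sp S" by (simp add: sp_def span_base)
lemma sp_base: "a \<in> S \<Longrightarrow> a \<in> sp S" by (simp add: sp_def span_base)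
lemma sp_add: "a \<in> sp S \<Longrightarrow> b \<in> sp S \<Longrightarrow> a + b \<in> sp S" by (simp add: sp_def span_add)
lemma sp_scale: "a \<in> sp S \<Longrightarrow> scale c a \<in> sp S" by (simp add: sp_def span_scale)
lemma sp_sum: "(\<And>x. x \<in> A \<Longrightarrow> f x \<in> sp S) \<Longrightarrow> sum f A \<in> sp S" unfolding sp_def by (rule span_sum)
lemma sp_eqv: assumes "a \<approx> b" "b \<in> sp S" shows "a \<in> sp S"
proof -
  have "(a - b) + b \<in> sp S" using assms by (intro sp_add) (auto simp: eqv_def sp_J)
  then show ?thesis by simp
qed
lemma sp_scaleD: assumes "scale c a \<in> sp S" "c \<noteq> 0" shows "a \<in> sp S"
  using sp_scale[OF assms(1), of "inverse c"] assms(2) by simp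
lemma sp_min: "S \<subseteq> U \<Longrightarrow> J \<subseteq> U \<Longrightarrow> subspace U \<Longrightarrow> sp S \<subseteq> U"
  unfolding sp_def by (rule span_minimal) auto
lemma sp_subsetI: "(\<And>s. s \<in> S \<Longrightarrow> s \<in> sp S') \<Longrightarrow> a \<in> sp S \<Longrightarrow> a \<in> sp S'"
  using sp_min[of S "sp S'"] sp_J by auto
lemma sp_mono: "S \<subseteq> S' \<Longrightarrow> a \<in> sp S \<Longrightarrow> a \<in> sp S'"
  by (rule sp_subsetI) (auto intro: sp_base)

lemma sp_map:
  assumes a: "a \<in> sp S"
    and add: "\<And>u v. F (u + v) = F u + F v" and sc: "\<And>c v. F (scale c v) = scale c (F v)"
    and J: "\<And>j. j \<in> J \<Longrightarrow> F j \<in> U" and S: "\<And>s. s \<in> S \<Longrightarrow> F s \<in> U" and U: "subspace U"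
  shows "F a \<in> U"
proof -
  have z: "F 0 = 0" using sc[of 0 0] by simp
  have "subspace {x. F x \<in> U}"
    by (rule subspaceI) (auto simp: z add sc subspace_0[OF U] subspace_add[OF U] subspace_scale[OF U])
  then have "sp S \<subseteq> {x. F x \<in> U}" using J S by (intro sp_min) auto
  then show ?thesis using a by auto
qed

lemma sp_map_x:
  "a \<in> sp S \<Longrightarrow> p \<in> {1..n} \<Longrightarrow> (\<And>s. s \<in> S \<Longrightarrow> \<rho> (X p) s \<in> sp S') \<Longrightarrow> \<rho> (X p) a \<in> sp S'"
  by (rule sp_map[of a S]) (simp_all add: rho_add rho_scale stabJ sp_J)

lemma sp_map_t:
  "a \<in> sp S \<Longrightarrow> p \<in> {1..<n} \<Longrightarrow> (\<And>s. s \<in> S \<Longrightarrow> \<rho> (T p) s \<in> sp S') \<Longrightarrow> \<rho> (T p) a \<in> sp S'"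
  by (rule sp_map[of a S]) (simp_all add: rho_add rho_scale stabJ sp_J)

lemma sp_map_e:
  "a \<in> sp S \<Longrightarrow> \<nu> \<in> IB \<Longrightarrow> (\<And>s. s \<in> S \<Longrightarrow> \<rho> (E \<nu>) s \<in> sp S') \<Longrightarrow> \<rho> (E \<nu>) a \<in> sp S'"
  by (rule sp_map[of a S]) (simp_all add: rho_add rho_scale stabJ sp_J)

text \<open>Weight vectors modulo \<open>J\<close>: the idempotent fixes them only up to an element
  of \<open>J\<close>, so the computations use \<open>\<approx>\<close> instead of equality.\<close>

definition wt :: "'i list \<Rightarrow> 'v \<Rightarrow> bool" where
  "wt \<nu> v \<longleftrightarrow> v \<in> W \<and> \<nu> \<in> IB \<and> \<rho> (E \<nu>) v \<approx> v"

lemma wtD: "wt \<nu> v \<Longrightarrow> v \<in> W" "wt \<nu> v \<Longrightarrow> \<nu> \<in> IB" "wt \<nu> v \<Longrightarrow> \<rho> (E \<nu>) v \<approx> v"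
  by (auto simp: wt_def)

lemma relD:
  assumes "v \<in> W" "\<nu> \<in> IB"
  shows "\<mu> \<in> IB \<Longrightarrow> \<rho> (E \<mu>) (\<rho> (E \<nu>) v) \<approx> (if \<mu> = \<nu> then \<rho> (E \<nu>) v else 0)"
    and "p \<in> {1..n} \<Longrightarrow> q \<in> {1..n} \<Longrightarrow> p \<noteq> q \<Longrightarrow> \<rho> (X p) (\<rho> (X q) (\<rho> (E \<nu>) v)) \<approx>
       scale (sgn_par Iodd [ent \<nu> p, ent \<nu> q]) (\<rho> (X q) (\<rho> (X p) (\<rho> (E \<nu>) v)))"
    and "p \<in> {1..n} \<Longrightarrow> \<rho> (X p) (\<rho> (E \<nu>) v) \<approx> \<rho> (E \<nu>) (\<rho> (X p) v)"
    and "a \<in> {1..<n} \<Longrightarrow> \<rho> (T a) (\<rho> (E \<nu>) v) \<approx> \<rho> (E (swap_at a \<nu>)) (\<rho> (T a) v)"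
    and "a \<in> {1..<n} \<Longrightarrow> p \<in> {1..n} \<Longrightarrow> p \<noteq> a \<Longrightarrow> p \<noteq> a + 1 \<Longrightarrow> \<rho> (T a) (\<rho> (X p) (\<rho> (E \<nu>) v)) \<approx>
       scale (sgn_par Iodd [ent \<nu> p, ent \<nu> a, ent \<nu> (a + 1)]) (\<rho> (X p) (\<rho> (T a) (\<rho> (E \<nu>) v)))"
    and "a \<in> {1..<n} \<Longrightarrow> \<rho> (T a) (\<rho> (X (a + 1)) (\<rho> (E \<nu>) v))
       - scale (sgn_par Iodd [ent \<nu> a, ent \<nu> (a + 1)]) (\<rho> (X a) (\<rho> (T a) (\<rho> (E \<nu>) v)))
       \<approx> (if ent \<nu> a = ent \<nu> (a + 1) then \<rho> (E \<nu>) v else 0)"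
    and "a \<in> {1..<n} \<Longrightarrow> \<rho> (X (a + 1)) (\<rho> (T a) (\<rho> (E \<nu>) v))
       - scale (sgn_par Iodd [ent \<nu> a, ent \<nu> (a + 1)]) (\<rho> (T a) (\<rho> (X a) (\<rho> (E \<nu>) v)))
       \<approx> (if ent \<nu> a = ent \<nu> (a + 1) then \<rho> (E \<nu>) v else 0)"
    and "a \<in> {1..<n} \<Longrightarrow> \<rho> (T a) (\<rho> (T a) (\<rho> (E \<nu>) v)) \<approx> Qop t (ent \<nu> a) (ent \<nu> (a + 1)) a (a + 1) (\<rho> (E \<nu>) v)"
    and "a \<in> {1..<n} \<Longrightarrow> c \<in> {1..<n} \<Longrightarrow> c + 1 < a \<or> a + 1 < c \<Longrightarrow> \<rho> (T a) (\<rho> (T c) (\<rho> (E \<nu>) v)) \<approx>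
       scale (sgn_par Iodd [ent \<nu> a, ent \<nu> (a + 1), ent \<nu> c, ent \<nu> (c + 1)]) (\<rho> (T c) (\<rho> (T a) (\<rho> (E \<nu>) v)))"
    and "1 \<le> a \<Longrightarrow> a + 1 < n \<Longrightarrow> \<rho> (T (a + 1)) (\<rho> (T a) (\<rho> (T (a + 1)) (\<rho> (E \<nu>) v)))
       - \<rho> (T a) (\<rho> (T (a + 1)) (\<rho> (T a) (\<rho> (E \<nu>) v))) \<approx> braid_op Iodd t \<nu> a (\<rho> (E \<nu>) v)"
proof -
  note R = rel[OF assms(1), unfolded klr_ops_def, folded eqv_def]
  note r1 = R[THEN conjunct1]
  note r2 = R[THEN conjunct2, THEN conjunct1]
  note r3 = R[THEN conjunct2, THEN conjunct2, THEN conjunct1]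
  note r4 = R[THEN conjunct2, THEN conjunct2, THEN conjunct2, THEN conjunct1]
  note r5 = R[THEN conjunct2, THEN conjunct2, THEN conjunct2, THEN conjunct2, THEN conjunct1]
  note r6 = R[THEN conjunct2, THEN conjunct2, THEN conjunct2, THEN conjunct2, THEN conjunct2, THEN conjunct1]
  note r7 = R[THEN conjunct2, THEN conjunct2, THEN conjunct2, THEN conjunct2, THEN conjunct2, THEN conjunct2, THEN conjunct1]
  note r8 = R[THEN conjunct2, THEN conjunct2, THEN conjunct2, THEN conjunct2, THEN conjunct2, THEN conjunct2, THEN conjunct2, THEN conjunct1]
  note r9 = R[THEN conjunct2, THEN conjunct2, THEN conjunct2, THEN conjunct2, THEN conjunct2, THEN conjunct2, THEN conjunct2, THEN conjunct2, THEN conjunct1]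
  note r10 = R[THEN conjunct2, THEN conjunct2, THEN conjunct2, THEN conjunct2, THEN conjunct2, THEN conjunct2, THEN conjunct2, THEN conjunct2, THEN conjunct2, THEN conjunct1]
  note r11 = R[THEN conjunct2, THEN conjunct2, THEN conjunct2, THEN conjunct2, THEN conjunct2, THEN conjunct2, THEN conjunct2, THEN conjunct2, THEN conjunct2, THEN conjunct2]
  show "\<mu> \<in> IB \<Longrightarrow> \<rho> (E \<mu>) (\<rho> (E \<nu>) v) \<approx> (if \<mu> = \<nu> then \<rho> (E \<nu>) v else 0)"
    using r1 assms(2) by blast
  show "p \<in> {1..n} \<Longrightarrow> q \<in> {1..n} \<Longrightarrow> p \<noteq> q \<Longrightarrow> \<rho> (X p) (\<rho> (X q) (\<rho> (E \<nu>) v)) \<approx>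
       scale (sgn_par Iodd [ent \<nu> p, ent \<nu> q]) (\<rho> (X q) (\<rho> (X p) (\<rho> (E \<nu>) v)))"
    using r3 assms(2) by blast
  show "p \<in> {1..n} \<Longrightarrow> \<rho> (X p) (\<rho> (E \<nu>) v) \<approx> \<rho> (E \<nu>) (\<rho> (X p) v)"
    using r4 assms(2) by blast
  show "a \<in> {1..<n} \<Longrightarrow> \<rho> (T a) (\<rho> (E \<nu>) v) \<approx> \<rho> (E (swap_at a \<nu>)) (\<rho> (T a) v)"
    using r5 assms(2) by blast
  show "a \<in> {1..<n} \<Longrightarrow> p \<in> {1..n} \<Longrightarrow> p \<noteq> a \<Longrightarrow> p \<noteq> a + 1 \<Longrightarrow> \<rho> (T a) (\<rho> (X p) (\<rho> (E \<nu>) v)) \<approx>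
       scale (sgn_par Iodd [ent \<nu> p, ent \<nu> a, ent \<nu> (a + 1)]) (\<rho> (X p) (\<rho> (T a) (\<rho> (E \<nu>) v)))"
    using r6 assms(2) by blast
  show "a \<in> {1..<n} \<Longrightarrow> \<rho> (T a) (\<rho> (X (a + 1)) (\<rho> (E \<nu>) v))
       - scale (sgn_par Iodd [ent \<nu> a, ent \<nu> (a + 1)]) (\<rho> (X a) (\<rho> (T a) (\<rho> (E \<nu>) v)))
       \<approx> (if ent \<nu> a = ent \<nu> (a + 1) then \<rho> (E \<nu>) v else 0)"
    using r7 assms(2) by blast
  show "a \<in> {1..<n} \<Longrightarrow> \<rho> (X (a + 1)) (\<rho> (T a) (\<rho> (E \<nu>) v))
       - scale (sgn_par Iodd [ent \<nu> a, ent \<nu> (a + 1)]) (\<rho> (T a) (\<rho> (X a) (\<rho> (E \<nu>) v)))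
       \<approx> (if ent \<nu> a = ent \<nu> (a + 1) then \<rho> (E \<nu>) v else 0)"
    using r8 assms(2) by blast
  show "a \<in> {1..<n} \<Longrightarrow> \<rho> (T a) (\<rho> (T a) (\<rho> (E \<nu>) v)) \<approx> Qop t (ent \<nu> a) (ent \<nu> (a + 1)) a (a + 1) (\<rho> (E \<nu>) v)"
    using r9 assms(2) by blast
  show "a \<in> {1..<n} \<Longrightarrow> c \<in> {1..<n} \<Longrightarrow> c + 1 < a \<or> a + 1 < c \<Longrightarrow> \<rho> (T a) (\<rho> (T c) (\<rho> (E \<nu>) v)) \<approx>
       scale (sgn_par Iodd [ent \<nu> a, ent \<nu> (a + 1), ent \<nu> c, ent \<nu> (c + 1)]) (\<rho> (T c) (\<rho> (T a) (\<rho> (E \<nu>) v)))"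
    using r10 assms(2) by blast
  show "1 \<le> a \<Longrightarrow> a + 1 < n \<Longrightarrow> \<rho> (T (a + 1)) (\<rho> (T a) (\<rho> (T (a + 1)) (\<rho> (E \<nu>) v)))
       - \<rho> (T a) (\<rho> (T (a + 1)) (\<rho> (T a) (\<rho> (E \<nu>) v))) \<approx> braid_op Iodd t \<nu> a (\<rho> (E \<nu>) v)"
    using r11 assms(2) by blast
qed

lemma wt_e: "wt \<nu> v \<Longrightarrow> \<mu> \<in> IB \<Longrightarrow> \<mu> \<noteq> \<nu> \<Longrightarrow> \<rho> (E \<mu>) v \<approx> 0"
  using relD(1)[of v \<nu> \<mu>] eqv_e[of "\<rho> (E \<nu>) v" v \<mu>] by (auto simp: wt_def intro: eqv_trans eqv_sym)

lemma wt_x: assumes "wt \<nu> v" "p \<in> {1..n}" shows "wt \<nu> (\<rho> (X p) v)"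
proof -
  note A = wtD[OF assms(1)]
  have "\<rho> (E \<nu>) (\<rho> (X p) v) \<approx> \<rho> (X p) v"
    using relD(3)[OF A(1,2) assms(2)] eqv_x[OF A(3) assms(2)] eqv_sym eqv_trans by blast
  then show ?thesis using A stabW(2) assms(2) by (simp add: wt_def)
qed

lemma wt_t: assumes "wt \<nu> v" "a \<in> {1..<n}" shows "wt (swap_at a \<nu>) (\<rho> (T a) v)"
proof -
  note A = wtD[OF assms(1)]
  have "\<rho> (E (swap_at a \<nu>)) (\<rho> (T a) v) \<approx> \<rho> (T a) v"
    using relD(4)[OF A(1,2) assms(2)] eqv_t[OF A(3) assms(2)] eqv_sym eqv_trans by blast
  then show ?thesis using A stabW(3) assms(2) IB_swap by (simp add: wt_def)
qed

lemma xx: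
  assumes "wt \<nu> v" and p: "p \<in> {1..n}" "q \<in> {1..n}" "p \<noteq> q"
  shows "\<rho> (X p) (\<rho> (X q) v) \<approx> scale (sgn_par Iodd [ent \<nu> p, ent \<nu> q]) (\<rho> (X q) (\<rho> (X p) v))"
proof -
  note A = wtD[OF assms(1)]
  have "\<rho> (X p) (\<rho> (X q) v) \<approx> \<rho> (X p) (\<rho> (X q) (\<rho> (E \<nu>) v))"
    by (intro eqv_x eqv_sym[OF A(3)] p)
  also note relD(2)[OF A(1,2) p]
  also have "scale (sgn_par Iodd [ent \<nu> p, ent \<nu> q]) (\<rho> (X q) (\<rho> (X p) (\<rho> (E \<nu>) v))) \<approx>
      scale (sgn_par Iodd [ent \<nu> p, ent \<nu> q]) (\<rho> (X q) (\<rho> (X p) v))"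
    by (intro eqv_scale eqv_x A(3) p)
  finally show ?thesis .
qed

text \<open>With \<open>tx_const\<close> this brings the three relations between \<tau> and x to one
  form: \<tau>_a turns x_p into the variable at \<open>sfun a p\<close>, with a sign, and leaves a
  constant. For \<open>p = a\<close> the relation must be solved for \<tau>_a x_a; this works
  because the sign squares to 1, and it causes the minus sign in \<open>tx_const\<close>.\<close>

definition tx_sgn :: "'i list \<Rightarrow> nat \<Rightarrow> nat \<Rightarrow> 'k" where
  "tx_sgn \<nu> a p = (if p = a \<or> p = Suc a then sgn_par Iodd [ent \<nu> a, ent \<nu> (a + 1)]
     else sgn_par Iodd [ent \<nu> p, ent \<nu> a, ent \<nu> (a + 1)])"

definition tx_const :: "'i list \<Rightarrow> nat \<Rightarrow> nat \<Rightarrow> 'k" where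
  "tx_const \<nu> a p = (if ent \<nu> a \<noteq> ent \<nu> (a + 1) then 0 else if p = Suc a then 1
     else if p = a then - sgn_par Iodd [ent \<nu> a, ent \<nu> (a + 1)] else 0)"

lemma tx_sgn_nz: "tx_sgn \<nu> a p \<noteq> 0"
  by (simp add: tx_sgn_def sgn_par_nz)

lemma tx_const_nz: "ent \<nu> a = ent \<nu> (a + 1) \<Longrightarrow> tx_const \<nu> a a \<noteq> 0"
  by (simp add: tx_const_def sgn_par_nz)

lemma tx:
  assumes "wt \<nu> v" and a: "a \<in> {1..<n}" and p: "p \<in> {1..n}"
  shows "\<rho> (T a) (\<rho> (X p) v) \<approx> scale (tx_sgn \<nu> a p) (\<rho> (X (sfun a p)) (\<rho> (T a) v)) + scale (tx_const \<nu> a p) v"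
proof -
  note A = wtD[OF assms(1)]
  have a': "a \<in> {1..n}" "a + 1 \<in> {1..n}" using a by auto
  let ?s = "sgn_par Iodd [ent \<nu> a, ent \<nu> (a + 1)] :: 'k"
  define d where "d = (if ent \<nu> a = ent \<nu> (a + 1) then v else 0)"
  have d: "(if ent \<nu> a = ent \<nu> (a + 1) then \<rho> (E \<nu>) v else 0) \<approx> d" using A(3) by (simp add: d_def)
  consider "p = a" | "p = a + 1" | "p \<noteq> a" "p \<noteq> a + 1" by blast
  then show ?thesis
  proof cases
    case 3
    have eqs: "tx_sgn \<nu> a p = sgn_par Iodd [ent \<nu> p, ent \<nu> a, ent \<nu> (a + 1)]" "tx_const \<nu> a p = 0"
      "sfun a p = p" using 3 by (simp_all add: tx_sgn_def tx_const_def sfun_apply)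
    have "\<rho> (T a) (\<rho> (X p) v) \<approx> \<rho> (T a) (\<rho> (X p) (\<rho> (E \<nu>) v))"
      by (intro eqv_t eqv_x eqv_sym[OF A(3)] a p)
    also note relD(5)[OF A(1,2) a p 3]
    also have "scale (sgn_par Iodd [ent \<nu> p, ent \<nu> a, ent \<nu> (a + 1)]) (\<rho> (X p) (\<rho> (T a) (\<rho> (E \<nu>) v))) \<approx>
        scale (sgn_par Iodd [ent \<nu> p, ent \<nu> a, ent \<nu> (a + 1)]) (\<rho> (X p) (\<rho> (T a) v))"
      by (intro eqv_scale eqv_t eqv_x A(3) a p)
    finally show ?thesis by (simp add: eqs)
  next
    case 2
    have eqs: "tx_sgn \<nu> a p = ?s" "scale (tx_const \<nu> a p) v = d" "sfun a p = a"
      using 2 by (simp_all add: tx_sgn_def tx_const_def sfun_apply d_def)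
    have "\<rho> (T a) (\<rho> (X p) v) \<approx> \<rho> (T a) (\<rho> (X p) (\<rho> (E \<nu>) v))"
      by (intro eqv_t eqv_x eqv_sym[OF A(3)] a p)
    also have "\<rho> (T a) (\<rho> (X p) (\<rho> (E \<nu>) v)) = scale ?s (\<rho> (X a) (\<rho> (T a) (\<rho> (E \<nu>) v))) +
      (\<rho> (T a) (\<rho> (X p) (\<rho> (E \<nu>) v)) - scale ?s (\<rho> (X a) (\<rho> (T a) (\<rho> (E \<nu>) v))))" by simp
    also have "\<dots> \<approx> scale ?s (\<rho> (X a) (\<rho> (T a) v)) + d"
      using relD(6)[OF A(1,2) a] 2
      by (intro eqv_add eqv_scale eqv_x eqv_t A(3) a a') (auto intro: eqv_trans[OF _ d])
    finally show ?thesis by (simp add: eqs)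
  next
    case 1
    have eqs: "tx_sgn \<nu> a p = ?s" "scale (tx_const \<nu> a p) v = scale (- ?s) d" "sfun a p = a + 1"
      using 1 by (simp_all add: tx_sgn_def tx_const_def sfun_apply d_def)
    have "\<rho> (T a) (\<rho> (X p) v) \<approx> \<rho> (T a) (\<rho> (X p) (\<rho> (E \<nu>) v))"
      by (intro eqv_t eqv_x eqv_sym[OF A(3)] a p)
    also have "\<rho> (T a) (\<rho> (X p) (\<rho> (E \<nu>) v)) = scale ?s (\<rho> (X (a + 1)) (\<rho> (T a) (\<rho> (E \<nu>) v))) +
      scale (- ?s) (\<rho> (X (a + 1)) (\<rho> (T a) (\<rho> (E \<nu>) v)) - scale ?s (\<rho> (T a) (\<rho> (X p) (\<rho> (E \<nu>) v))))"
      by (simp add: scale_right_diff_distrib sgn_par_sq)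
    also have "\<dots> \<approx> scale ?s (\<rho> (X (a + 1)) (\<rho> (T a) v)) + scale (- ?s) d"
      using relD(7)[OF A(1,2) a] 1
      by (intro eqv_add eqv_scale eqv_x eqv_t A(3) a a') (auto intro: eqv_trans[OF _ d])
    finally show ?thesis by (simp add: eqs)
  qed
qed

abbreviation xw :: "nat list \<Rightarrow> 'v \<Rightarrow> 'v" where "xw u v \<equiv> foldr (\<lambda>p. \<rho> (X p)) u v"
abbreviation tw :: "nat list \<Rightarrow> 'v \<Rightarrow> 'v" where "tw l v \<equiv> foldr (\<lambda>a. \<rho> (T a)) l v"

lemma xw_linear: "xw u (v + w) = xw u v + xw u w" "xw u (scale c v) = scale c (xw u v)"
  by (induction u) (auto simp: rho_add rho_scale)

lemma xw_J: "set u \<subseteq> {1..n} \<Longrightarrow> v \<in> J \<Longrightarrow> xw u v \<in> J"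
  by (induction u) (auto intro: stabJ)

lemma eqv_xw: "a \<approx> b \<Longrightarrow> set u \<subseteq> {1..n} \<Longrightarrow> xw u a \<approx> xw u b"
  by (induction u) (auto intro: eqv_x)

lemma wt_xw: "wt \<nu> v \<Longrightarrow> set u \<subseteq> {1..n} \<Longrightarrow> wt \<nu> (xw u v)"
  by (induction u) (auto intro: wt_x)

lemma wt_tw: "wt \<nu> v \<Longrightarrow> set l \<subseteq> {1..<n} \<Longrightarrow> wt (foldr swap_at l \<nu>) (tw l v)"
  by (induction l) (auto intro: wt_t)

lemma sp_map_xw:
  "a \<in> sp S \<Longrightarrow> set u \<subseteq> {1..n} \<Longrightarrow> (\<And>s. s \<in> S \<Longrightarrow> xw u s \<in> sp S') \<Longrightarrow> xw u a \<in> sp S'"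
  by (rule sp_map[of a S]) (auto simp: xw_linear intro: xw_J sp_J)

lemma xw_replicate: "xw (replicate m p) v = (\<rho> (X p) ^^ m) v"
  by (induction m) auto

text \<open>Variables commute up to a nonzero scalar on weight vectors, so the letters of the target
  word can be pulled to the front one after the other.\<close>

lemma xw_perm:
  assumes "wt \<nu> v"
  shows "mset u = mset u' \<Longrightarrow> set u \<subseteq> {1..n} \<Longrightarrow> \<exists>s. s \<noteq> 0 \<and> xw u v \<approx> scale s (xw u' v)"
proof (induction u' arbitrary: u)
  case Nil then show ?case by (intro exI[of _ 1]) simp
next
  case (Cons p u')
  have front: "\<exists>s. s \<noteq> 0 \<and> xw (u1 @ p # u2) v \<approx> scale s (\<rho> (X p) (xw (u1 @ u2) v))"
    if "set (u1 @ p # u2) \<subseteq> {1..n}" for u1 u2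
    using that
  proof (induction u1)
    case Nil then show ?case by (intro exI[of _ 1]) simp
  next
    case (Cons q u1)
    then obtain s where s: "s \<noteq> 0" "xw (u1 @ p # u2) v \<approx> scale s (\<rho> (X p) (xw (u1 @ u2) v))" by auto
    have q: "q \<in> {1..n}" and p: "p \<in> {1..n}" using Cons by auto
    have a: "wt \<nu> (xw (u1 @ u2) v)" by (rule wt_xw[OF assms]) (use Cons in auto)
    have e1: "xw ((q # u1) @ p # u2) v \<approx> scale s (\<rho> (X q) (\<rho> (X p) (xw (u1 @ u2) v)))"
      using eqv_x[OF s(2) q] by (simp add: rho_scale)
    show ?case
    proof (cases "p = q")
      case True then show ?thesis using e1 s by (intro exI[of _ s]) simp
    next
      case False
      then have "scale s (\<rho> (X q) (\<rho> (X p) (xw (u1 @ u2) v))) \<approx>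
         scale s (scale (sgn_par Iodd [ent \<nu> q, ent \<nu> p]) (\<rho> (X p) (\<rho> (X q) (xw (u1 @ u2) v))))"
        using xx[OF a q p] by (intro eqv_scale) auto
      then show ?thesis using eqv_trans[OF e1] s
        by (intro exI[of _ "s * sgn_par Iodd [ent \<nu> q, ent \<nu> p]"]) (auto simp: sgn_par_nz)
    qed
  qed
  have "p \<in> set u" using Cons(2) by (metis list.set_intros(1) set_mset_mset)
  then obtain u1 u2 where u: "u = u1 @ p # u2" by (meson split_list)
  have "mset (u1 @ u2) = mset u'" using Cons(2) u by simp
  then obtain s where s: "s \<noteq> 0" "xw (u1 @ u2) v \<approx> scale s (xw u' v)"
    using Cons(1)[of "u1 @ u2"] Cons(3) u by auto
  obtain s' where s': "s' \<noteq> 0" "xw u v \<approx> scale s' (\<rho> (X p) (xw (u1 @ u2) v))"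
    using front[of u1 u2] Cons(3) u by auto
  have "scale s' (\<rho> (X p) (xw (u1 @ u2) v)) \<approx> scale s' (\<rho> (X p) (scale s (xw u' v)))"
    by (intro eqv_scale eqv_x s) (use Cons(3) u in auto)
  then show ?case using eqv_trans[OF s'(2)] s s' by (intro exI[of _ "s' * s"]) (auto simp: rho_scale)
qed

definition xspan :: "'v \<Rightarrow> 'v set" where "xspan v = {xw u v | u. set u \<subseteq> {1..n}}"

lemma xspanI: "set u \<subseteq> {1..n} \<Longrightarrow> xw u v \<in> xspan v"
  by (auto simp: xspan_def)

lemma xspan_self: "v \<in> xspan v"
  using xspanI[of "[]" v] by simp

lemma xspan_x: "w \<in> xspan v \<Longrightarrow> p \<in> {1..n} \<Longrightarrow> \<rho> (X p) w \<in> xspan v"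
proof -
  assume "w \<in> xspan v" and p: "p \<in> {1..n}"
  then obtain u where "w = xw u v" "set u \<subseteq> {1..n}" by (auto simp: xspan_def)
  then show ?thesis using xspanI[of "p # u" v] p by simp
qed

text \<open>Each passage of \<tau>_a across a variable costs only a term without \<tau>_a.\<close>

lemma t_xw:
  assumes "wt \<nu> v" "a \<in> {1..<n}"
  shows "set u \<subseteq> {1..n} \<Longrightarrow> \<rho> (T a) (xw u v) \<in> sp (xspan (\<rho> (T a) v) \<union> xspan v)"
proof (induction u)
  case Nil then show ?case using xspan_self by (simp add: sp_base)
next
  case (Cons p u)
  let ?S = "xspan (\<rho> (T a) v) \<union> xspan v"
  have p: "p \<in> {1..n}" and u: "set u \<subseteq> {1..n}" using Cons by auto
  have sp: "sfun a p \<in> {1..n}" using p assms(2) by (auto simp: sfun_apply)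
  have "\<rho> (X (sfun a p)) (\<rho> (T a) (xw u v)) \<in> sp ?S"
  proof (rule sp_map_x[OF Cons(1)[OF u] sp])
    fix s assume "s \<in> ?S"
    then have "\<rho> (X (sfun a p)) s \<in> ?S" using xspan_x[OF _ sp] by blast
    then show "\<rho> (X (sfun a p)) s \<in> sp ?S" by (rule sp_base)
  qed
  moreover have "xw u v \<in> sp ?S" by (intro sp_base UnI2 xspanI u)
  ultimately show ?case
    unfolding foldr_Cons comp_apply by (intro sp_eqv[OF tx[OF wt_xw[OF assms(1) u] assms(2) p]] sp_add sp_scale)
qed

text \<open>For different colours \<open>tx_const\<close> vanishes, so \<tau>_a passes monomials
  without error terms.\<close>

lemma t_xw_neq:
  assumes "wt \<nu> v" "a \<in> {1..<n}" "ent \<nu> a \<noteq> ent \<nu> (a + 1)"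
  shows "set u \<subseteq> {1..n} \<Longrightarrow> \<exists>s. s \<noteq> 0 \<and> \<rho> (T a) (xw u v) \<approx> scale s (xw (map (sfun a) u) (\<rho> (T a) v))"
proof (induction u)
  case Nil then show ?case by (intro exI[of _ 1]) simp
next
  case (Cons p u)
  have p: "p \<in> {1..n}" and u: "set u \<subseteq> {1..n}" using Cons by auto
  have sp: "sfun a p \<in> {1..n}" using p assms(2) by (auto simp: sfun_apply)
  obtain s where s: "s \<noteq> 0" "\<rho> (T a) (xw u v) \<approx> scale s (xw (map (sfun a) u) (\<rho> (T a) v))"
    using Cons u by blast
  have "\<rho> (T a) (xw (p # u) v) \<approx> scale (tx_sgn \<nu> a p) (\<rho> (X (sfun a p)) (\<rho> (T a) (xw u v)))"
    using tx[OF wt_xw[OF assms(1) u] assms(2) p] assms(3) by (simp add: tx_const_def)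
  also have "\<dots> \<approx> scale (tx_sgn \<nu> a p) (\<rho> (X (sfun a p)) (scale s (xw (map (sfun a) u) (\<rho> (T a) v))))"
    by (intro eqv_scale eqv_x s sp)
  finally show ?case using s
    by (intro exI[of _ "tx_sgn \<nu> a p * s"]) (auto simp: tx_sgn_nz rho_scale)
qed

text \<open>The monomials allowed below the power \<open>K\<close> of the last variable
  \<open>m\<close>: later variables do not occur, earlier ones are unrestricted.\<close>

definition xlow :: "nat \<Rightarrow> nat \<Rightarrow> 'v \<Rightarrow> 'v set" where
  "xlow m K v = {xw u v | u. set u \<subseteq> {1..m} \<and> count_list u m < K}"

lemma xlowI: "set u \<subseteq> {1..m} \<Longrightarrow> count_list u m < K \<Longrightarrow> xw u v \<in> xlow m K v"
  by (auto simp: xlow_def)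

lemma xlow_x:
  assumes "w \<in> xlow m K v" "1 \<le> p" "p \<le> m"
  shows "\<rho> (X p) w \<in> xlow m (if p = m then Suc K else K) v"
proof -
  obtain u where "w = xw u v" "set u \<subseteq> {1..m}" "count_list u m < K" using assms(1) by (auto simp: xlow_def)
  then show ?thesis using xlowI[of "p # u" m "if p = m then Suc K else K" v] assms(2,3) by auto
qed

lemma xlow_mono: "K \<le> K' \<Longrightarrow> xlow m K v \<subseteq> xlow m K' v"
  by (auto simp: xlow_def)

text \<open>The terms without \<tau>_a form a divided difference: one factor x_a is consumed, and
  the others may have become x_(a+1). So the degree in x_(a+1) stays strictly below the original
  degree in x_a.\<close>

lemma t_xw_eq:
  assumes "wt \<nu> v" "a \<in> {1..<n}"
  shows "set u \<subseteq> {1..a} \<Longrightarrow> \<rho> (T a) (xw u v) \<in> sp (xspan (\<rho> (T a) v) \<union> xlow (Suc a) (count_list u a) v)"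
proof (induction u)
  case Nil then show ?case using xspan_self by (simp add: sp_base)
next
  case (Cons p u)
  let ?S = "\<lambda>K. xspan (\<rho> (T a) v) \<union> xlow (Suc a) K v"
  have p: "p \<in> {1..n}" "p \<in> {1..a}" and u: "set u \<subseteq> {1..n}" "set u \<subseteq> {1..a}" using Cons assms(2) by auto
  have sp: "sfun a p \<in> {1..n}" using p assms(2) by (auto simp: sfun_apply)
  have "\<rho> (X (sfun a p)) (\<rho> (T a) (xw u v)) \<in> sp (?S (count_list (p # u) a))"
  proof (rule sp_map_x[OF Cons(1)[OF u(2)] sp])
    fix s assume s: "s \<in> ?S (count_list u a)"
    show "\<rho> (X (sfun a p)) s \<in> sp (?S (count_list (p # u) a))"
    proof (cases "s \<in> xspan (\<rho> (T a) v)")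
      case True then show ?thesis by (intro sp_base UnI1 xspan_x sp)
    next
      case False
      then have s: "s \<in> xlow (Suc a) (count_list u a) v" using s by simp
      have "1 \<le> sfun a p" "sfun a p \<le> Suc a" "count_list (p # u) a = (if p = a then Suc (count_list u a) else count_list u a)"
        using p by (auto simp: sfun_apply)
      with xlow_x[OF s this(1,2)] have "\<rho> (X (sfun a p)) s \<in> xlow (Suc a) (count_list (p # u) a) v"
        using p by (auto simp: sfun_apply split: if_splits)
      then show ?thesis by (intro sp_base UnI2)
    qed
  qed
  moreover have "scale (tx_const \<nu> a p) (xw u v) \<in> sp (?S (count_list (p # u) a))"
  proof (cases "p = a")
    case True
    have "Suc a \<notin> set u" using u(2) by auto
    then have "xw u v \<in> xlow (Suc a) (count_list (p # u) a) v"
      using u True by (intro xlowI) (auto simp: count_list_0_iff)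
    then show ?thesis by (intro sp_scale sp_base UnI2)
  next
    case False
    then have "tx_const \<nu> a p = 0" using p by (simp add: tx_const_def)
    then show ?thesis by (simp add: subspace_0)
  qed
  ultimately show ?case
    unfolding foldr_Cons comp_apply by (intro sp_eqv[OF tx[OF wt_xw[OF assms(1) u(1)] assms(2) p(1)]] sp_add) (rule sp_scale)
qed

text \<open>The converse estimate: the divided difference of x_a^(N+1) contains x_(a+1)^N with an
  invertible coefficient, so this power can be expressed by \<tau>_a x_a^(N+1), lower terms, and
  terms in which \<tau>_a remains.\<close>

lemma t_xpow:
  assumes "wt \<nu> v" "a \<in> {1..<n}" "ent \<nu> a = ent \<nu> (a + 1)"
  shows "(\<rho> (X (Suc a)) ^^ N) v \<in>
    sp ({\<rho> (T a) ((\<rho> (X a) ^^ Suc N) v)} \<union> xspan (\<rho> (T a) v) \<union> xlow (Suc a) N v)"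
proof (induction N)
  let ?c = "tx_const \<nu> a a"
  have c: "?c \<noteq> 0" using assms(3) by (rule tx_const_nz)
  have a: "a \<in> {1..n}" "Suc a \<in> {1..n}" using assms(2) by auto
  have rep: "set (replicate m a) \<subseteq> {1..n}" for m using a(1) by auto
  \<comment> \<open>The relation \<open>tx\<close> at \<open>p = a\<close>, solved for its constant
    term.\<close>
  have key: "(\<rho> (X a) ^^ N) v \<in> sp ({\<rho> (T a) ((\<rho> (X a) ^^ Suc N) v)} \<union>
      {\<rho> (X (Suc a)) (\<rho> (T a) ((\<rho> (X a) ^^ N) v))})" (is "_ \<in> sp ?S") for N
  proof (rule sp_scaleD[OF _ c])
    let ?w = "(\<rho> (X a) ^^ N) v"
    have wt: "wt \<nu> ?w" using wt_xw[OF assms(1) rep, of N] unfolding xw_replicate .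
    have "scale ?c ?w \<approx> \<rho> (T a) (\<rho> (X a) ?w) + scale (- tx_sgn \<nu> a a) (\<rho> (X (Suc a)) (\<rho> (T a) ?w))"
      using tx[OF wt assms(2) a(1)] by (intro eqv_solve(1)) (simp add: sfun_apply)
    moreover have "\<rho> (T a) (\<rho> (X a) ?w) + scale (- tx_sgn \<nu> a a) (\<rho> (X (Suc a)) (\<rho> (T a) ?w)) \<in> sp ?S"
      by (intro sp_add sp_scale sp_base) simp_all
    ultimately show "scale ?c ?w \<in> sp ?S" by (rule sp_eqv)
  qed
  {
    case 0
    have "\<rho> (X (Suc a)) (\<rho> (T a) v) \<in> xspan (\<rho> (T a) v)" by (intro xspan_x xspan_self a)
    then have "s \<in> sp ({\<rho> (T a) ((\<rho> (X a) ^^ Suc 0) v)} \<union> xspan (\<rho> (T a) v) \<union> xlow (Suc a) 0 v)"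
      if "s \<in> {\<rho> (T a) ((\<rho> (X a) ^^ Suc 0) v)} \<union> {\<rho> (X (Suc a)) (\<rho> (T a) ((\<rho> (X a) ^^ 0) v))}" for s
      using that by (intro sp_base) auto
    from sp_subsetI[OF this key[of 0]] show ?case by simp
  next
    case (Suc N)
    let ?S = "{\<rho> (T a) ((\<rho> (X a) ^^ Suc (Suc N)) v)} \<union> xspan (\<rho> (T a) v) \<union> xlow (Suc a) (Suc N) v"
    have "\<rho> (X (Suc a)) ((\<rho> (X (Suc a)) ^^ N) v) \<in> sp ?S"
    proof (rule sp_map_x[OF Suc a(2)])
      fix s assume "s \<in> {\<rho> (T a) ((\<rho> (X a) ^^ Suc N) v)} \<union> xspan (\<rho> (T a) v) \<union> xlow (Suc a) N v"
      then consider "s = \<rho> (T a) ((\<rho> (X a) ^^ Suc N) v)" | "s \<in> xspan (\<rho> (T a) v)" | "s \<in> xlow (Suc a) N v" by auto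
      then show "\<rho> (X (Suc a)) s \<in> sp ?S"
      proof cases
        case 1
        let ?w = "(\<rho> (X a) ^^ Suc N) v"
        have wt: "wt \<nu> ?w" using wt_xw[OF assms(1) rep, of "Suc N"] unfolding xw_replicate .
        \<comment> \<open>The same relation, now solved for the term x_(a+1) \<tau>_a. It raises the
          power under \<tau>_a by one and leaves x_a^(N+1), which has degree 0 in x_(a+1).\<close>
        have *: "scale (tx_sgn \<nu> a a) (\<rho> (X (Suc a)) s) \<approx> \<rho> (T a) (\<rho> (X a) ?w) + scale (- ?c) ?w"
          using tx[OF wt assms(2) a(1)] unfolding 1 by (intro eqv_solve(2)) (simp add: sfun_apply)
        have "?w \<in> xlow (Suc a) (Suc N) v"
        proof -
          have "xw (replicate (Suc N) a) v \<in> xlow (Suc a) (Suc N) v"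
            by (rule xlowI) (use a in \<open>auto simp: count_list_0_iff\<close>)
          then show ?thesis by (simp only: xw_replicate)
        qed
        then have "?w \<in> sp ?S" by (intro sp_base UnI2)
        moreover have "\<rho> (T a) (\<rho> (X a) ?w) \<in> sp ?S" by (intro sp_base UnI1) simp
        ultimately have "\<rho> (T a) (\<rho> (X a) ?w) + scale (- ?c) ?w \<in> sp ?S" by (intro sp_add sp_scale)
        with * have "scale (tx_sgn \<nu> a a) (\<rho> (X (Suc a)) s) \<in> sp ?S" by (rule sp_eqv)
        then show ?thesis by (rule sp_scaleD) (rule tx_sgn_nz)
      next
        case 2
        then have "\<rho> (X (Suc a)) s \<in> xspan (\<rho> (T a) v)" by (rule xspan_x[OF _ a(2)])
        then show ?thesis by (intro sp_base) simp
      next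
        case 3
        then have "\<rho> (X (Suc a)) s \<in> xlow (Suc a) (Suc N) v" using xlow_x[OF 3, of "Suc a"] a by simp
        then show ?thesis by (intro sp_base) simp
      qed
    qed
    then show ?case by simp
  }
qed

end

lemma count_list_replicate: "count_list (replicate m x) y = (if x = y then m else 0)"
  by (induction m) auto

context klr_mod
begin

lemma eqv_sum: "(\<And>x. x \<in> S \<Longrightarrow> f x \<approx> g x) \<Longrightarrow> sum f S \<approx> sum g S"
  by (induction S rule: infinite_finite_induct) (simp_all add: eqv_add)

lemma eqv_0: "a \<approx> 0 \<longleftrightarrow> a \<in> J"
  by (simp add: eqv_def)

lemma xw_sum: "xw u (sum f S) = (\<Sum>a\<in>S. xw u (f a))"
  by (induction S rule: infinite_finite_induct) (simp_all add: xw_linear, use xw_linear(2)[of u 0 0] in simp_all)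

lemma xw_Qop:
  "xw u (Qop t i j p q v) =
    (\<Sum>(r, s)\<in>Qsupp t i j. scale (t i j r s) (xw (u @ replicate r p @ replicate s q) v))"
  unfolding Qop_def xw_sum by (rule sum.cong) (auto simp: xw_linear xw_replicate)

lemma eqv_Qop:
  assumes "v \<approx> w" "p \<in> {1..n}" "q \<in> {1..n}" shows "Qop t i j p q v \<approx> Qop t i j p q w"
proof -
  have "set (replicate r p @ replicate s q) \<subseteq> {1..n}" for r s using assms by auto
  then have "xw (replicate r p @ replicate s q) v \<approx> xw (replicate r p @ replicate s q) w" for r s
    by (rule eqv_xw[OF assms(1)])
  then have "(\<Sum>(r, s)\<in>Qsupp t i j. scale (t i j r s) (xw ([] @ replicate r p @ replicate s q) v)) \<approx>
     (\<Sum>(r, s)\<in>Qsupp t i j. scale (t i j r s) (xw ([] @ replicate r p @ replicate s q) w))"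
    by (intro eqv_sum) (simp add: eqv_scale split: prod.splits)
  then show ?thesis using xw_Qop[of "[]"] by simp
qed

lemma Qop_diag: "\<nu> \<in> IB \<Longrightarrow> a \<in> {1..n} \<Longrightarrow> Qop t (ent \<nu> a) (ent \<nu> a) p q v = 0"
  by (simp add: Qop_def Qsupp_diag)

lemma Qop_xspan:
  assumes "p \<in> {1..n}" "q \<in> {1..n}" shows "Qop t i j p q v \<in> sp (xspan v)"
proof -
  have "set (replicate r p @ replicate s q) \<subseteq> {1..n}" for r s using assms by auto
  then have "(\<Sum>(r, s)\<in>Qsupp t i j. scale (t i j r s) (xw ([] @ replicate r p @ replicate s q) v)) \<in> sp (xspan v)"
    by (intro sp_sum) (clarify, intro sp_scale sp_base xspanI, simp)
  then show ?thesis using xw_Qop[of "[]"] by simp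
qed

lemma tt:
  assumes "wt \<nu> v" and a: "a \<in> {1..<n}"
  shows "\<rho> (T a) (\<rho> (T a) v) \<approx> Qop t (ent \<nu> a) (ent \<nu> (a + 1)) a (a + 1) v"
proof -
  note A = wtD[OF assms(1)]
  have "\<rho> (T a) (\<rho> (T a) v) \<approx> \<rho> (T a) (\<rho> (T a) (\<rho> (E \<nu>) v))"
    by (intro eqv_t a) (rule eqv_sym[OF A(3)])
  also note relD(8)[OF A(1,2) a]
  also have "Qop t (ent \<nu> a) (ent \<nu> (a + 1)) a (a + 1) (\<rho> (E \<nu>) v) \<approx> Qop t (ent \<nu> a) (ent \<nu> (a + 1)) a (a + 1) v"
    by (rule eqv_Qop[OF A(3)]) (use a in auto)
  finally show ?thesis .
qed

lemma tt_xspan: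
  assumes "wt \<nu> v" and a: "a \<in> {1..<n}" shows "\<rho> (T a) (\<rho> (T a) v) \<in> sp (xspan v)"
  by (rule sp_eqv[OF tt[OF assms]], rule Qop_xspan) (use a in auto)

lemma tt_far:
  assumes "wt \<nu> v" and a: "a \<in> {1..<n}" and c: "c \<in> {1..<n}" and far: "c + 1 < a \<or> a + 1 < c"
  obtains s where "s \<noteq> 0" "\<rho> (T a) (\<rho> (T c) v) \<approx> scale s (\<rho> (T c) (\<rho> (T a) v))"
proof
  note A = wtD[OF assms(1)]
  let ?s = "sgn_par Iodd [ent \<nu> a, ent \<nu> (a + 1), ent \<nu> c, ent \<nu> (c + 1)] :: 'k"
  show "?s \<noteq> 0" by (rule sgn_par_nz)
  have "\<rho> (T a) (\<rho> (T c) v) \<approx> \<rho> (T a) (\<rho> (T c) (\<rho> (E \<nu>) v))"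
    by (intro eqv_t a c) (rule eqv_sym[OF A(3)])
  also note relD(9)[OF A(1,2) a c far]
  also have "scale ?s (\<rho> (T c) (\<rho> (T a) (\<rho> (E \<nu>) v))) \<approx> scale ?s (\<rho> (T c) (\<rho> (T a) v))"
    by (intro eqv_scale eqv_t a c A(3))
  finally show "\<rho> (T a) (\<rho> (T c) v) \<approx> scale ?s (\<rho> (T c) (\<rho> (T a) v))" .
qed

lemma xpow_sp: "w \<in> sp (xspan v) \<Longrightarrow> p \<in> {1..n} \<Longrightarrow> (\<rho> (X p) ^^ k) w \<in> sp (xspan v)"
proof (induction k)
  case (Suc k)
  have "\<rho> (X p) ((\<rho> (X p) ^^ k) w) \<in> sp (xspan v)"
  proof (rule sp_map_x[OF Suc.IH])
    show "\<rho> (X p) s \<in> sp (xspan v)" if "s \<in> xspan v" for s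
      by (rule sp_base, rule xspan_x[OF that Suc.prems(2)])
  qed (use Suc.prems in simp_all)
  then show ?case by simp
qed simp

lemma sp_xspan_x: "w \<in> sp (xspan v) \<Longrightarrow> p \<in> {1..n} \<Longrightarrow> \<rho> (X p) w \<in> sp (xspan v)"
  using xpow_sp[of w v p "Suc 0"] by simp

lemma sp_diff: "a \<in> sp S \<Longrightarrow> b \<in> sp S \<Longrightarrow> a - b \<in> sp S"
  by (simp add: subspace_diff)

lemma sp_zero [simp]: "0 \<in> sp S"
  by (simp add: subspace_0)

lemma braid_xspan:
  assumes a: "1 \<le> a" "a + 1 < n" and w: "w \<in> sp (xspan v)"
  shows "braid_op Iodd t \<nu> a w \<in> sp (xspan v)"
proof -
  have p: "a \<in> {1..n}" "a + 1 \<in> {1..n}" "a + 2 \<in> {1..n}" using a by auto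
  have s1: "(\<Sum>(r, s)\<in>S. scale (c r s) (\<Sum>k<f r. (\<rho> (X (a + 2)) ^^ g r k) ((\<rho> (X a) ^^ h r k)
          ((\<rho> (X (a + 1)) ^^ s) w)))) \<in> sp (xspan v)" for S c f g h
    by (rule sp_sum) (clarify, intro sp_scale sp_sum xpow_sp p w)
  show ?thesis unfolding braid_op_def Let_def
    by (simp only: split: if_split) (intro impI conjI sp_scale sp_diff sp_xspan_x p s1 sp_zero)
qed

lemma braid_same:
  "\<nu> \<in> IB \<Longrightarrow> a \<in> {1..<n} \<Longrightarrow> ent \<nu> a = ent \<nu> (a + 1) \<Longrightarrow> braid_op Iodd t \<nu> a v = 0"
  unfolding braid_op_def Let_def using Qsupp_diag[of \<nu> "a + 1"] by (auto simp: rho_zero)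

lemma ttt:
  assumes "wt \<nu> v" and a: "1 \<le> a" "a + 1 < n"
  shows "\<rho> (T (a + 1)) (\<rho> (T a) (\<rho> (T (a + 1)) v)) - \<rho> (T a) (\<rho> (T (a + 1)) (\<rho> (T a) v))
     \<approx> braid_op Iodd t \<nu> a (\<rho> (E \<nu>) v)"
proof -
  note A = wtD[OF assms(1)]
  have a': "a \<in> {1..<n}" "a + 1 \<in> {1..<n}" using a by auto
  have "\<rho> (T (a + 1)) (\<rho> (T a) (\<rho> (T (a + 1)) v)) + scale (-1) (\<rho> (T a) (\<rho> (T (a + 1)) (\<rho> (T a) v)))
    \<approx> \<rho> (T (a + 1)) (\<rho> (T a) (\<rho> (T (a + 1)) (\<rho> (E \<nu>) v))) + scale (-1) (\<rho> (T a) (\<rho> (T (a + 1)) (\<rho> (T a) (\<rho> (E \<nu>) v))))"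
    by (intro eqv_add eqv_scale eqv_t a') (rule eqv_sym[OF A(3)])+
  then show ?thesis using relD(10)[OF A(1,2) a] eqv_trans by simp
qed

lemma ttt_xspan:
  assumes "wt \<nu> v" "1 \<le> a" "a + 1 < n"
  shows "\<rho> (T (a + 1)) (\<rho> (T a) (\<rho> (T (a + 1)) v)) - \<rho> (T a) (\<rho> (T (a + 1)) (\<rho> (T a) v)) \<in> sp (xspan v)"
  by (rule sp_eqv[OF ttt[OF assms]], rule braid_xspan[OF assms(2,3)], rule sp_eqv[OF wtD(3)[OF assms(1)]],
      rule sp_base, rule xspan_self)

text \<open>Multiplying \<open>x\<^sub>j\<^sup>N e(s\<^sub>j \<nu>) = lower terms\<close> by \<open>\<tau>\<^sub>j\<close> on both sides raises the exponent by the degree of the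
  leading term of \<open>\<tau>\<^sub>j\<^sup>2\<close>.\<close>

definition xrel :: "nat \<Rightarrow> 'i list \<Rightarrow> nat \<Rightarrow> bool" where
  "xrel j \<nu> N \<longleftrightarrow> (\<forall>Y. wt \<nu> Y \<longrightarrow> (\<rho> (X j) ^^ N) Y \<in> sp (xlow j N Y))"

lemma xrel_step:
  assumes j: "j \<in> {1..<n}" and \<nu>: "\<nu> \<in> IB" and ne: "ent \<nu> j \<noteq> ent \<nu> (Suc j)"
    and IH: "xrel j (swap_at j \<nu>) N"
    and fin: "finite (Qsupp t (ent \<nu> j) (ent \<nu> (Suc j)))"
    and lead: "t (ent \<nu> j) (ent \<nu> (Suc j)) 0 M \<noteq> 0"
    and low: "\<And>r s. t (ent \<nu> j) (ent \<nu> (Suc j)) r s \<noteq> 0 \<Longrightarrow> s < M \<or> (s = M \<and> r = 0)"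
  shows "xrel (Suc j) \<nu> (N + M)"
  unfolding xrel_def
proof (intro allI impI)
  fix Y assume Y: "wt \<nu> Y"
  let ?i = "ent \<nu> j" and ?k = "ent \<nu> (Suc j)"
  define Y' where "Y' = \<rho> (T j) Y"
  define Z where "Z = \<rho> (T j) Y'"
  have wt': "wt (swap_at j \<nu>) Y'" unfolding Y'_def by (rule wt_t[OF Y j])
  have len: "length \<nu> = n" by (rule IB_len[OF \<nu>])
  have ne': "ent (swap_at j \<nu>) j \<noteq> ent (swap_at j \<nu>) (j + 1)"
    using ne j len by (simp add: ent_swap_at sfun_apply)
  have j1: "Suc j \<in> {1..n}" "j \<in> {1..n}" using j by auto
  have pass: "\<exists>s. s \<noteq> 0 \<and> \<rho> (T j) (xw u Y') \<approx> scale s (xw (map (sfun j) u) Z)" if "set u \<subseteq> {1..j}" for u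
  proof -
    have "set u \<subseteq> {1..n}" using that j by auto
    from t_xw_neq[OF wt' j ne' this] show ?thesis by (simp only: Z_def)
  qed
  have cnt: "count_list (map (sfun j) u) (Suc j) = count_list u j" if "set u \<subseteq> {1..j}" for u
    using that by (induction u) (auto simp: sfun_apply)
  have sub: "set (map (sfun j) u) \<subseteq> {1..Suc j}" if "set u \<subseteq> {1..j}" for u
    using that j by (auto simp: sfun_apply)
  have "(\<rho> (X j) ^^ N) Y' \<in> sp (xlow j N Y')" using IH wt' by (simp add: xrel_def)
  then have "\<rho> (T j) ((\<rho> (X j) ^^ N) Y') \<in> sp (xlow (Suc j) N Z)"
  proof (rule sp_map_t[OF _ j])
    fix s assume "s \<in> xlow j N Y'"
    then obtain u where u: "s = xw u Y'" "set u \<subseteq> {1..j}" "count_list u j < N" by (auto simp: xlow_def)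
    obtain c where "\<rho> (T j) s \<approx> scale c (xw (map (sfun j) u) Z)" using pass[OF u(2)] u(1) by blast
    then show "\<rho> (T j) s \<in> sp (xlow (Suc j) N Z)"
    proof (rule sp_eqv)
      show "scale c (xw (map (sfun j) u) Z) \<in> sp (xlow (Suc j) N Z)"
        by (intro sp_scale sp_base xlowI sub u(2)) (use u cnt in simp)
    qed
  qed
  moreover have "\<exists>c. c \<noteq> 0 \<and> \<rho> (T j) ((\<rho> (X j) ^^ N) Y') \<approx> scale c ((\<rho> (X (Suc j)) ^^ N) Z)"
  proof -
    have "set (replicate N j) \<subseteq> {1..j}" using j by auto
    from pass[OF this] show ?thesis by (simp add: xw_replicate sfun_apply)
  qed
  \<comment> \<open>As the colours differ, \<tau>_j has carried the whole relation over to position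
    \<open>Suc j\<close>; but it now concerns \<open>Z\<close>, which is \<tau>_j^2 applied to
    \<open>Y\<close>.\<close>
  ultimately have key: "(\<rho> (X (Suc j)) ^^ N) Z \<in> sp (xlow (Suc j) N Z)"
    using sp_eqv eqv_sym sp_scaleD by metis
  have Z: "Z \<approx> Qop t ?i ?k j (Suc j) Y" using tt[OF Y j] unfolding Z_def Y'_def Suc_eq_plus1 .
  let ?S = "sp (xlow (Suc j) (N + M) Y)"
  have w: "set (u @ replicate r j @ replicate s (Suc j)) \<subseteq> {1..Suc j}" if "set u \<subseteq> {1..Suc j}" for u r s
    using that j by auto
  have lowS: "z \<in> ?S" if "z \<in> sp (xlow (Suc j) N Z)" for z
  proof (rule sp_subsetI[OF _ that])
    fix z assume "z \<in> xlow (Suc j) N Z"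
    then obtain u where u: "z = xw u Z" "set u \<subseteq> {1..Suc j}" "count_list u (Suc j) < N" by (auto simp: xlow_def)
    have un: "set u \<subseteq> {1..n}" using u(2) j by auto
    have "z \<approx> xw u (Qop t ?i ?k j (Suc j) Y)" using eqv_xw[OF Z un] u(1) by simp
    then show "z \<in> ?S"
    proof (rule sp_eqv)
      show "xw u (Qop t ?i ?k j (Suc j) Y) \<in> ?S"
        unfolding xw_Qop
      proof (rule sp_sum, clarify)
        fix r s assume "(r, s) \<in> Qsupp t ?i ?k"
        then have "s \<le> M" using low[of r s] by (auto simp: Qsupp_def)
        then show "scale (t ?i ?k r s) (xw (u @ replicate r j @ replicate s (Suc j)) Y) \<in> ?S"
          using u by (intro sp_scale sp_base xlowI w) (auto simp: count_list_replicate)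
      qed
    qed
  qed
  have rep: "set (replicate N (Suc j)) \<subseteq> {1..Suc j}" "set (replicate N (Suc j)) \<subseteq> {1..n}" using j by auto
  have "(\<rho> (X (Suc j)) ^^ N) Z \<approx> xw (replicate N (Suc j)) (Qop t ?i ?k j (Suc j) Y)"
    using eqv_xw[OF Z rep(2)] by (simp add: xw_replicate)
  then have "xw (replicate N (Suc j)) (Qop t ?i ?k j (Suc j) Y) \<in> ?S"
    using lowS[OF key] sp_eqv eqv_sym by blast
  \<comment> \<open>After \<tau>_j^2 is replaced by Q, the only term of degree \<open>M\<close> in
    x_(j+1) is the pure power with nonzero coefficient; it supplies the new leading
    monomial.\<close>
  moreover have "xw (replicate N (Suc j)) (Qop t ?i ?k j (Suc j) Y) =
     scale (t ?i ?k 0 M) ((\<rho> (X (Suc j)) ^^ (N + M)) Y) +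
     (\<Sum>(r, s)\<in>Qsupp t ?i ?k - {(0, M)}. scale (t ?i ?k r s) (xw (replicate N (Suc j) @ replicate r j @ replicate s (Suc j)) Y))"
  proof -
    have "(0, M) \<in> Qsupp t ?i ?k" using lead by (simp add: Qsupp_def)
    then show ?thesis unfolding xw_Qop
      by (subst sum.remove[OF fin]) (auto simp: replicate_add[symmetric] xw_replicate simp del: foldr_append)
  qed
  moreover have "(\<Sum>(r, s)\<in>Qsupp t ?i ?k - {(0, M)}. scale (t ?i ?k r s)
      (xw (replicate N (Suc j) @ replicate r j @ replicate s (Suc j)) Y)) \<in> ?S"
  proof (rule sp_sum)
    fix x assume x: "x \<in> Qsupp t ?i ?k - {(0, M)}"
    obtain r s where rs: "x = (r, s)" by fastforce
    then have "s < M" using x low[of r s] by (auto simp: Qsupp_def)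
    then have "scale (t ?i ?k r s) (xw (replicate N (Suc j) @ replicate r j @ replicate s (Suc j)) Y) \<in> ?S"
      by (intro sp_scale sp_base xlowI w rep) (auto simp: count_list_replicate)
    then show "(case x of (r, s) \<Rightarrow> scale (t ?i ?k r s)
      (xw (replicate N (Suc j) @ replicate r j @ replicate s (Suc j)) Y)) \<in> ?S" by (simp add: rs)
  qed
  ultimately have "scale (t ?i ?k 0 M) ((\<rho> (X (Suc j)) ^^ (N + M)) Y) \<in> ?S"
    using sp_diff by (metis (no_types, lifting) add_diff_cancel_right')
  then show "(\<rho> (X (Suc j)) ^^ (N + M)) Y \<in> ?S" using lead by (rule sp_scaleD)
qed

end

section \<open>Reduction to the Young subgroup and to bounded exponents\<close>

locale klr_span = klr_mod scale \<rho> Iodd t n IB W J + col_blocks n "ent \<nu>0"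
  for scale :: "'k::field \<Rightarrow> 'v::ab_group_add \<Rightarrow> 'v" and \<rho> :: "'i gen \<Rightarrow> 'v \<Rightarrow> 'v"
    and Iodd t n IB W J and \<nu>0 :: "'i list" +
  fixes Y0 :: 'v and Lam :: "'i \<Rightarrow> nat" and mm :: "'i \<Rightarrow> 'i \<Rightarrow> nat" and N :: "nat \<Rightarrow> nat"
    and red :: "(nat \<Rightarrow> nat) \<Rightarrow> nat list"
  assumes wt0: "wt \<nu>0 Y0" and finIB: "finite IB"
    and cyc: "\<And>v. n \<noteq> 0 \<Longrightarrow> v \<in> W \<Longrightarrow> (\<Sum>\<nu>\<in>IB. (\<rho> (X 1) ^^ Lam (ent \<nu> 1)) (\<rho> (E \<nu>) v)) \<in> J"
    and Qfin: "\<And>i k. i \<in> set \<nu>0 \<Longrightarrow> k \<in> set \<nu>0 \<Longrightarrow> finite (Qsupp t k i)"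
    and Qlead: "\<And>i k. i \<in> set \<nu>0 \<Longrightarrow> k \<in> set \<nu>0 \<Longrightarrow> i \<noteq> k \<Longrightarrow> t k i 0 (mm i k) \<noteq> 0"
    and Qlow: "\<And>i k r s. i \<in> set \<nu>0 \<Longrightarrow> k \<in> set \<nu>0 \<Longrightarrow> i \<noteq> k \<Longrightarrow> t k i r s \<noteq> 0 \<Longrightarrow>
       s < mm i k \<or> (s = mm i k \<and> r = 0)"
    and N_first: "\<And>f. f \<in> {1..n} \<Longrightarrow> f = 1 \<or> ent \<nu>0 (f - 1) \<noteq> ent \<nu>0 f \<Longrightarrow>
       N f = Lam (ent \<nu>0 f) + (\<Sum>q\<in>{1..<f}. mm (ent \<nu>0 f) (ent \<nu>0 q))"
    and N_next: "\<And>a. a \<in> {1..<n} \<Longrightarrow> ent \<nu>0 a = ent \<nu>0 (Suc a) \<Longrightarrow> N (Suc a) = N a - 1"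
    and red: "\<And>w. w permutes {1..n} \<Longrightarrow> rword n (red w) \<and> word_perm (red w) = w"
begin

abbreviation "col \<equiv> ent \<nu>0"

lemma len0: "length \<nu>0 = n" using wtD(2)[OF wt0] by (rule IB_len)

lemma col_in: "k \<in> {1..n} \<Longrightarrow> col k \<in> set \<nu>0"
  using len0 by (auto simp: ent_def intro!: nth_mem)

text \<open>The block word with its entry at \<open>f\<close> carried to the left as far as position
  \<open>j\<close>. At \<open>j = 1\<close> the colour of \<open>f\<close> stands first, where the
  cyclotomic relation can be used, and \<open>mv f f\<close> is the block word.\<close>

definition mv :: "nat \<Rightarrow> nat \<Rightarrow> 'i list" where "mv f j = foldr swap_at [j..<f] \<nu>0"

lemma mv_props:
  assumes "j \<le> f" "1 \<le> j" "f \<le> n"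
  shows "mv f j \<in> IB \<and> ent (mv f j) j = col f \<and> (\<forall>p. 1 \<le> p \<and> p < j \<longrightarrow> ent (mv f j) p = col p)"
  using assms
proof (induction j rule: inc_induct)
  case base then show ?case using wtD(2)[OF wt0] by (simp add: mv_def)
next
  case (step j)
  have eq: "mv f j = swap_at j (mv f (Suc j))" using step by (simp add: mv_def upt_conv_Cons)
  have IH: "mv f (Suc j) \<in> IB" "ent (mv f (Suc j)) (Suc j) = col f"
    "\<And>p. 1 \<le> p \<Longrightarrow> p < Suc j \<Longrightarrow> ent (mv f (Suc j)) p = col p"
    using step by auto
  have len: "length (mv f (Suc j)) = n" using IB_len IH by blast
  have "mv f j \<in> IB" unfolding eq by (rule IB_swap) (use IH step in auto)
  moreover have "ent (mv f j) j = col f" unfolding eq using step len IH by (simp add: ent_swap_at sfun_apply)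
  moreover have "ent (mv f j) p = col p" if "1 \<le> p" "p < j" for p
    unfolding eq using step len IH(3)[of p] that by (simp add: ent_swap_at sfun_apply)
  ultimately show ?case by blast
qed

text \<open>The cyclotomic relation is a sum over all words; on a weight vector every other
  idempotent acts by 0 modulo \<open>J\<close>, which isolates one summand.\<close>

lemma xrel_cyc:
  assumes "\<mu> \<in> IB" "n \<noteq> 0" shows "xrel 1 \<mu> (Lam (ent \<mu> 1))"
  unfolding xrel_def
proof (intro allI impI)
  fix Y assume Y: "wt \<mu> Y"
  have one: "set (replicate r 1) \<subseteq> {1..n}" for r using assms(2) by auto
  have "(\<Sum>\<nu>\<in>IB. (\<rho> (X 1) ^^ Lam (ent \<nu> 1)) (\<rho> (E \<nu>) Y)) \<approx>
     (\<Sum>\<nu>\<in>IB. if \<nu> = \<mu> then (\<rho> (X 1) ^^ Lam (ent \<nu> 1)) Y else 0)"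
  proof (rule eqv_sum)
    fix \<nu> assume \<nu>: "\<nu> \<in> IB"
    have "\<rho> (E \<nu>) Y \<approx> (if \<nu> = \<mu> then Y else 0)"
      using wt_e[OF Y \<nu>] wtD(3)[OF Y] by auto
    from eqv_xw[OF this one] have "(\<rho> (X 1) ^^ Lam (ent \<nu> 1)) (\<rho> (E \<nu>) Y) \<approx>
        (\<rho> (X 1) ^^ Lam (ent \<nu> 1)) (if \<nu> = \<mu> then Y else 0)" unfolding xw_replicate .
    moreover have "(\<rho> (X 1) ^^ m) 0 = 0" for m by (induction m) (simp_all add: rho_zero)
    ultimately show "(\<rho> (X 1) ^^ Lam (ent \<nu> 1)) (\<rho> (E \<nu>) Y) \<approx>
      (if \<nu> = \<mu> then (\<rho> (X 1) ^^ Lam (ent \<nu> 1)) Y else 0)" by (cases "\<nu> = \<mu>") simp_all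
  qed
  also have "(\<Sum>\<nu>\<in>IB. if \<nu> = \<mu> then (\<rho> (X 1) ^^ Lam (ent \<nu> 1)) Y else 0) = (\<rho> (X 1) ^^ Lam (ent \<mu> 1)) Y"
    using assms(1) finIB by simp
  finally have "(\<rho> (X 1) ^^ Lam (ent \<mu> 1)) Y \<approx> (\<Sum>\<nu>\<in>IB. (\<rho> (X 1) ^^ Lam (ent \<nu> 1)) (\<rho> (E \<nu>) Y))"
    by (rule eqv_sym)
  then show "(\<rho> (X 1) ^^ Lam (ent \<mu> 1)) Y \<in> sp (xlow 1 (Lam (ent \<mu> 1)) Y)"
    by (rule sp_eqv) (intro sp_J cyc assms(2) wtD(1)[OF Y])
qed

text \<open>From the cyclotomic relation at position 1, \<open>xrel_step\<close> moves the entry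
  \<open>f\<close> back to its place across all earlier entries. As \<open>f\<close> opens its
  block, these have other colours, and each adds its degree \<open>mm\<close>; the total is
  \<open>N f\<close>.\<close>

lemma xrel_first:
  assumes f: "f \<in> {1..n}" "f = 1 \<or> col (f - 1) \<noteq> col f"
  shows "xrel f \<nu>0 (N f)"
proof -
  have ne: "col j \<noteq> col f" if "1 \<le> j" "j < f" for j
  proof
    assume e: "col j = col f"
    have "col (f - 1) = col j" by (rule contig[of j "f - 1" f]) (use that f e in auto)
    then show False using f that e by auto
  qed
  have "xrel j (mv f j) (Lam (col f) + (\<Sum>q\<in>{1..<j}. mm (col f) (col q)))" if "1 \<le> j" "j \<le> f" for j
    using that
  proof (induction j rule: nat_induct_at_least)
    case base
    have "mv f 1 \<in> IB" "ent (mv f 1) 1 = col f" using mv_props[of 1 f] f by auto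
    then show ?case using xrel_cyc[of "mv f 1"] f by simp
  next
    case (Suc j)
    have P: "mv f (Suc j) \<in> IB" "ent (mv f (Suc j)) (Suc j) = col f" "ent (mv f (Suc j)) j = col j"
      using mv_props[of "Suc j" f] f Suc by auto
    have eq: "mv f j = swap_at j (mv f (Suc j))" using Suc by (simp add: mv_def upt_conv_Cons)
    have j: "j \<in> {1..<n}" "j \<in> {1..n}" using Suc f by auto
    have c: "col f \<in> set \<nu>0" "col j \<in> set \<nu>0" "col f \<noteq> col j" using col_in f j ne[of j] Suc by auto
    have "xrel (Suc j) (mv f (Suc j)) (Lam (col f) + (\<Sum>q\<in>{1..<j}. mm (col f) (col q)) + mm (col f) (col j))"
    proof (rule xrel_step[OF j(1) P(1)])
      show "xrel j (swap_at j (mv f (Suc j))) (Lam (col f) + (\<Sum>q\<in>{1..<j}. mm (col f) (col q)))"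
        using Suc eq by simp
    qed (use P c Qfin[OF c(1,2)] Qlead[OF c] Qlow[OF c] in auto)
    moreover have "{1..<Suc j} = insert j {1..<j}" using Suc by auto
    ultimately show ?case by (simp add: ac_simps)
  qed
  from this[of f] show ?thesis using f N_first[OF f] by (simp add: mv_def)
qed

lemma int_swap: "word_sup n col l \<Longrightarrow> foldr swap_at l \<nu>0 = \<nu>0"
  by (induction l) (auto simp: len0 intro: swap_at_same)

lemma wt_int: "wt \<nu>0 Y \<Longrightarrow> word_sup n col l \<Longrightarrow> wt \<nu>0 (tw l Y)"
  using wt_tw[of \<nu>0 Y l] int_swap[of l] word_sup_set[of n col l] by simp

definition longer :: "'v \<Rightarrow> 'v set" where
  "longer Y = {xw u (tw l Y) | u l. set u \<subseteq> {1..n} \<and> word_sup n col l \<and> l \<noteq> []}"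

lemma longerI: "set u \<subseteq> {1..n} \<Longrightarrow> word_sup n col l \<Longrightarrow> l \<noteq> [] \<Longrightarrow> xw u (tw l Y) \<in> longer Y"
  by (auto simp: longer_def)

lemma xspan_longer: "word_sup n col l \<Longrightarrow> l \<noteq> [] \<Longrightarrow> xspan (tw l Y) \<subseteq> longer Y"
  by (auto simp: xspan_def intro: longerI)

text \<open>In the odd case the terms with a longer \<open>\<tau>\<close>-word cannot be avoided.\<close>

definition grel :: "nat \<Rightarrow> bool" where
  "grel k \<longleftrightarrow> (\<forall>Y. wt \<nu>0 Y \<longrightarrow> (\<rho> (X k) ^^ N k) Y \<in> sp (xlow k (N k) Y \<union> longer Y))"

text \<open>\<tau>_a applied to the relation for x_a yields x_(a+1) to the power
  \<open>N a - 1\<close> from the leading term. The lower terms lose a degree too, and everything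
  that still contains \<tau>_a is absorbed by \<open>longer\<close>.\<close>

lemma grel_next:
  assumes a: "a \<in> {1..<n}" and c: "col a = col (Suc a)" and IH: "grel a"
  shows "grel (Suc a)"
  unfolding grel_def
proof (intro allI impI)
  fix Y assume Y: "wt \<nu>0 Y"
  have IHY: "(\<rho> (X a) ^^ N a) Y \<in> sp (xlow a (N a) Y \<union> longer Y)" using IH Y by (simp add: grel_def)
  show "(\<rho> (X (Suc a)) ^^ N (Suc a)) Y \<in> sp (xlow (Suc a) (N (Suc a)) Y \<union> longer Y)"
  proof (cases "N a")
    \<comment> \<open>With exponent 0 the relation says that \<open>Y\<close> itself is a
      combination of longer words. Truncated subtraction keeps the next exponent at 0, so the same
      statement is reused.\<close>
    case 0
    then have "Y \<in> sp (xlow a 0 Y \<union> longer Y)" "N (Suc a) = 0" using IHY N_next[OF a c] by auto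
    moreover have "xlow a 0 Y = {}" by (simp add: xlow_def)
    ultimately show ?thesis by (auto elim: sp_mono[rotated])
  next
    case (Suc M)
    have M: "N (Suc a) = M" using N_next[OF a c] Suc by simp
    let ?S = "xlow (Suc a) M Y \<union> longer Y"
    have ws: "word_sup n col [a]" using a c by simp
    have ta: "xspan (\<rho> (T a) Y) \<subseteq> ?S" using xspan_longer[OF ws, of Y] by auto
    have top: "\<rho> (T a) ((\<rho> (X a) ^^ Suc M) Y) \<in> sp ?S"
    proof (rule sp_map_t[OF IHY[unfolded Suc] a])
      fix s assume "s \<in> xlow a (Suc M) Y \<union> longer Y"
      then show "\<rho> (T a) s \<in> sp ?S"
      proof
        assume "s \<in> xlow a (Suc M) Y"
        then obtain u where u: "s = xw u Y" "set u \<subseteq> {1..a}" "count_list u a < Suc M" by (auto simp: xlow_def)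
        have "\<rho> (T a) s \<in> sp (xspan (\<rho> (T a) Y) \<union> xlow (Suc a) (count_list u a) Y)"
          unfolding u(1) by (rule t_xw_eq[OF Y a u(2)])
        moreover have "xlow (Suc a) (count_list u a) Y \<subseteq> xlow (Suc a) M Y" by (rule xlow_mono) (use u in simp)
        ultimately show ?thesis using ta by (elim sp_mono[rotated]) blast
      next
        assume "s \<in> longer Y"
        then obtain u l where u: "s = xw u (tw l Y)" "set u \<subseteq> {1..n}" "word_sup n col l" "l \<noteq> []"
          by (auto simp: longer_def)
        have "\<rho> (T a) s \<in> sp (xspan (\<rho> (T a) (tw l Y)) \<union> xspan (tw l Y))"
          unfolding u(1) by (rule t_xw[OF wt_int[OF Y u(3)] a u(2)])
        moreover have "xspan (\<rho> (T a) (tw l Y)) \<subseteq> longer Y"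
          using xspan_longer[of "a # l" Y] u(3) a c by simp
        moreover have "xspan (tw l Y) \<subseteq> longer Y" by (rule xspan_longer[OF u(3,4)])
        ultimately show ?thesis by (elim sp_mono[rotated]) blast
      qed
    qed
    have c': "col a = col (a + 1)" using c unfolding Suc_eq_plus1 .
    have "(\<rho> (X (Suc a)) ^^ M) Y \<in> sp ({\<rho> (T a) ((\<rho> (X a) ^^ Suc M) Y)} \<union> xspan (\<rho> (T a) Y) \<union> xlow (Suc a) M Y)"
      by (rule t_xpow[OF Y a c'])
    then have "(\<rho> (X (Suc a)) ^^ M) Y \<in> sp ?S"
    proof (rule sp_subsetI[rotated])
      fix s assume "s \<in> {\<rho> (T a) ((\<rho> (X a) ^^ Suc M) Y)} \<union> xspan (\<rho> (T a) Y) \<union> xlow (Suc a) M Y"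
      then consider "s = \<rho> (T a) ((\<rho> (X a) ^^ Suc M) Y)" | "s \<in> ?S" using ta by blast
      then show "s \<in> sp ?S" using top by cases (simp_all only: sp_base)
    qed
    then show ?thesis by (simp only: M)
  qed
qed

lemma grel_all: "1 \<le> k \<Longrightarrow> k \<le> n \<Longrightarrow> grel k"
proof (induction k rule: nat_induct_at_least)
  case base
  then have "xrel 1 \<nu>0 (N 1)" by (intro xrel_first) auto
  then show ?case unfolding grel_def xrel_def by (blast intro: sp_mono[rotated])
next
  case (Suc k)
  show ?case
  proof (cases "col k = col (Suc k)")
    case True then show ?thesis using Suc by (intro grel_next) auto
  next
    case False
    then have "xrel (Suc k) \<nu>0 (N (Suc k))" using Suc by (intro xrel_first) auto
    then show ?thesis unfolding grel_def xrel_def by (blast intro: sp_mono[rotated])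
  qed
qed

text \<open>A filtration by the number of \<tau> factors, over arbitrary letters: intermediate words
  may leave the Young subgroup before the final idempotent is applied.\<close>

definition short :: "nat \<Rightarrow> 'v set" where
  "short L = {xw u (tw l Y0) | u l. set u \<subseteq> {1..n} \<and> set l \<subseteq> {1..<n} \<and> length l < L}"

lemma short_mono: "L \<le> L' \<Longrightarrow> short L \<subseteq> short L'"
  unfolding short_def by (auto intro: less_le_trans)

lemma xspan_short: "set l \<subseteq> {1..<n} \<Longrightarrow> length l < L \<Longrightarrow> xspan (tw l Y0) \<subseteq> short L"
  by (auto simp: short_def xspan_def)

lemma short_t: assumes "a \<in> {1..<n}" "z \<in> sp (short L)" shows "\<rho> (T a) z \<in> sp (short (Suc L))"
proof (rule sp_map_t[OF assms(2,1)])
  fix s assume "s \<in> short L"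
  then obtain u l where u: "s = xw u (tw l Y0)" "set u \<subseteq> {1..n}" "set l \<subseteq> {1..<n}" "length l < L"
    by (auto simp: short_def)
  have "\<rho> (T a) s \<in> sp (xspan (\<rho> (T a) (tw l Y0)) \<union> xspan (tw l Y0))"
    unfolding u(1) by (rule t_xw[OF wt_tw[OF wt0 u(3)] assms(1) u(2)])
  moreover have "xspan (\<rho> (T a) (tw l Y0)) \<subseteq> short (Suc L)" using xspan_short[of "a # l" "Suc L"] u assms(1) by simp
  moreover have "xspan (tw l Y0) \<subseteq> short (Suc L)" by (rule xspan_short) (use u in auto)
  ultimately show "\<rho> (T a) s \<in> sp (short (Suc L))" by (elim sp_mono[rotated]) blast
qed

text \<open>Braid moves hold up to a polynomial and commutations up to a sign, so reduced words of
  one permutation agree up to a nonzero scalar and terms with fewer \<tau> factors.\<close>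

definition same_mod :: "nat list \<Rightarrow> nat list \<Rightarrow> bool" where
  "same_mod l l' \<longleftrightarrow> set l \<subseteq> {1..<n} \<and> set l' \<subseteq> {1..<n} \<and> length l = length l' \<and>
     (\<exists>s d. s \<noteq> 0 \<and> d \<in> sp (short (length l)) \<and> tw l Y0 = scale s (tw l' Y0) + d)"

lemma same_mod_eqv:
  assumes "set l \<subseteq> {1..<n}" "set l' \<subseteq> {1..<n}" "length l = length l'" "s \<noteq> 0" "tw l Y0 \<approx> scale s (tw l' Y0)"
  shows "same_mod l l'"
  unfolding same_mod_def
proof (intro conjI exI)
  show "tw l Y0 - scale s (tw l' Y0) \<in> sp (short (length l))" using assms(5) by (intro sp_J) (simp add: eqv_def)
  show "tw l Y0 = scale s (tw l' Y0) + (tw l Y0 - scale s (tw l' Y0))" by simp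
qed (use assms in auto)

lemma rword_same_mod:
  assumes "rword n l" "rword n l'" "word_perm l = word_perm l'" shows "same_mod l l'"
proof (rule matsumoto[of n same_mod, OF _ _ _ _ _ _ assms])
  show "same_mod l l" if "rword n l" for l
    by (rule same_mod_eqv[of _ _ 1]) (use that in \<open>simp_all add: rword_def\<close>)
next
  fix l l' assume "same_mod l l'"
  then obtain s d where sd: "set l \<subseteq> {1..<n}" "set l' \<subseteq> {1..<n}" "length l = length l'" "s \<noteq> 0"
    "d \<in> sp (short (length l))" "tw l Y0 = scale s (tw l' Y0) + d" by (auto simp: same_mod_def)
  have "tw l' Y0 = scale (inverse s) (tw l Y0) + scale (- inverse s) d"
    using sd(4) by (simp add: sd(6) scale_right_distrib)
  then show "same_mod l' l" unfolding same_mod_def using sd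
    by (intro conjI exI[of _ "inverse s"] exI[of _ "scale (- inverse s) d"]) (simp_all add: sp_scale del: scale_minus_left)
next
  fix l l' l'' assume "same_mod l l'" "same_mod l' l''"
  then obtain s d s' d' where sd: "set l \<subseteq> {1..<n}" "set l' \<subseteq> {1..<n}" "length l = length l'" "s \<noteq> 0"
    "d \<in> sp (short (length l))" "tw l Y0 = scale s (tw l' Y0) + d"
    "set l'' \<subseteq> {1..<n}" "length l' = length l''" "s' \<noteq> 0"
    "d' \<in> sp (short (length l'))" "tw l' Y0 = scale s' (tw l'' Y0) + d'" by (auto simp: same_mod_def)
  have "tw l Y0 = scale (s * s') (tw l'' Y0) + (scale s d' + d)"
    by (simp add: sd(6,11) scale_right_distrib add.assoc)
  moreover have "scale s d' + d \<in> sp (short (length l))" using sd by (intro sp_add sp_scale) simp_all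
  ultimately show "same_mod l l''" unfolding same_mod_def using sd
    by (intro conjI exI[of _ "s * s'"] exI[of _ "scale s d' + d"]) simp_all
next
  fix a l l' assume R: "same_mod l l'" and r: "rword n (a # l)" "rword n (a # l')"
  then obtain s d where sd: "set l \<subseteq> {1..<n}" "set l' \<subseteq> {1..<n}" "length l = length l'" "s \<noteq> 0"
    "d \<in> sp (short (length l))" "tw l Y0 = scale s (tw l' Y0) + d" by (auto simp: same_mod_def)
  have a: "a \<in> {1..<n}" using r by (simp add: rword_def)
  have "tw (a # l) Y0 = scale s (tw (a # l') Y0) + \<rho> (T a) d" by (simp add: sd(6) rho_add rho_scale)
  then show "same_mod (a # l) (a # l')" unfolding same_mod_def using sd a short_t[OF a sd(5)]
    by (intro conjI exI[of _ s] exI[of _ "\<rho> (T a) d"]) simp_all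
next
  fix a c l assume r: "rword n (a # c # l)" "rword n (c # a # l)" and far: "Suc a < c"
  have s: "set l \<subseteq> {1..<n}" "a \<in> {1..<n}" "c \<in> {1..<n}" using r by (auto simp: rword_def)
  have "a + 1 < c" using far by simp
  then obtain k where "k \<noteq> 0" "\<rho> (T a) (\<rho> (T c) (tw l Y0)) \<approx> scale k (\<rho> (T c) (\<rho> (T a) (tw l Y0)))"
    using tt_far[OF wt_tw[OF wt0 s(1)] s(2,3)] by blast
  then show "same_mod (a # c # l) (c # a # l)"
    by (intro same_mod_eqv[of _ _ k]) (use s in simp_all)
next
  fix a l assume r: "rword n (a # Suc a # a # l)" "rword n (Suc a # a # Suc a # l)"
  have s: "set l \<subseteq> {1..<n}" "1 \<le> a" "a + 1 < n" using r by (auto simp: rword_def)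
  define d where "d = \<rho> (T (a + 1)) (\<rho> (T a) (\<rho> (T (a + 1)) (tw l Y0))) - \<rho> (T a) (\<rho> (T (a + 1)) (\<rho> (T a) (tw l Y0)))"
  have "d \<in> sp (xspan (tw l Y0))" unfolding d_def by (rule ttt_xspan[OF wt_tw[OF wt0 s(1)] s(2,3)])
  moreover have "xspan (tw l Y0) \<subseteq> short (length (a # Suc a # a # l))" by (rule xspan_short) (use s in auto)
  ultimately have d: "scale (-1) d \<in> sp (short (length (a # Suc a # a # l)))" by (intro sp_scale) (elim sp_mono[rotated])
  have "tw (a # Suc a # a # l) Y0 = scale 1 (tw (Suc a # a # Suc a # l) Y0) + scale (-1) d"
    by (simp add: d_def Suc_eq_plus1 del: add_Suc_right)
  then show "same_mod (a # Suc a # a # l) (Suc a # a # Suc a # l)" unfolding same_mod_def using s d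
    by (intro conjI exI[of _ 1] exI[of _ "scale (-1) d"]) simp_all
qed

lemma nonreduced_descent:
  assumes "rword n m" "a \<in> {1..<n}" "\<not> rword n (a # m)"
  obtains m' where "rword n (a # m')" "word_perm (a # m') = word_perm m"
proof -
  have p: "word_perm m permutes {1..n}" using assms(1) by (auto simp: rword_def intro: word_perm_permutes)
  have "\<not> inv (word_perm m) a < inv (word_perm m) (Suc a)" using rword_ConsI[OF assms(1)] assms(2,3) by auto
  then have "inv (word_perm m) (Suc a) < inv (word_perm m) a" using inv_neq[OF p, of a] by linarith
  then show ?thesis using rword_descent[OF p] assms(2) that by auto
qed

text \<open>Where reducedness first fails, Matsumoto's theorem allows a rewriting in which some
  \<tau>_a meets itself; \<tau>_a^2 acts by a polynomial, which removes two factors.\<close>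

lemma nonreduced_short:
  "set l \<subseteq> {1..<n} \<Longrightarrow> \<not> rword n l \<Longrightarrow> tw l Y0 \<in> sp (short (length l))"
proof (induction l)
  case Nil then show ?case by simp
next
  case (Cons a m)
  have a: "a \<in> {1..<n}" and m: "set m \<subseteq> {1..<n}" using Cons by auto
  show ?case
  proof (cases "rword n m")
    case False
    then show ?thesis using short_t[OF a Cons.IH[OF m]] by simp
  next
    case True
    then obtain m' where m': "rword n (a # m')" "word_perm (a # m') = word_perm m"
      using nonreduced_descent[OF True a Cons(3)] by blast
    then have "same_mod m (a # m')" using rword_same_mod True by simp
    then obtain s d where sd: "length m = Suc (length m')" "d \<in> sp (short (length m))"
      "tw m Y0 = scale s (tw (a # m') Y0) + d" unfolding same_mod_def by (metis length_Cons)
    have s': "set m' \<subseteq> {1..<n}" using m' by (auto simp: rword_def)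
    have e: "tw (a # m) Y0 = scale s (\<rho> (T a) (\<rho> (T a) (tw m' Y0))) + \<rho> (T a) d"
      by (simp add: sd(3) rho_add rho_scale)
    have "\<rho> (T a) (\<rho> (T a) (tw m' Y0)) \<in> sp (xspan (tw m' Y0))" by (rule tt_xspan[OF wt_tw[OF wt0 s'] a])
    moreover have "xspan (tw m' Y0) \<subseteq> short (length (a # m))" by (rule xspan_short[OF s']) (simp add: sd(1))
    ultimately have "\<rho> (T a) (\<rho> (T a) (tw m' Y0)) \<in> sp (short (length (a # m)))" by (elim sp_mono[rotated])
    moreover have "\<rho> (T a) d \<in> sp (short (length (a # m)))" using short_t[OF a sd(2)] by simp
    ultimately show ?thesis unfolding e by (intro sp_add sp_scale)
  qed
qed

definition std :: "'v set" where
  "std = {xw u (tw (red w) Y0) | u w. set u \<subseteq> {1..n} \<and> w permutes {1..n}}"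

lemma std_x: "z \<in> sp std \<Longrightarrow> set u \<subseteq> {1..n} \<Longrightarrow> xw u z \<in> sp std"
proof (erule sp_map_xw)
  fix s assume u: "set u \<subseteq> {1..n}" and "s \<in> std"
  then obtain u' w where "s = xw u' (tw (red w) Y0)" "set u' \<subseteq> {1..n}" "w permutes {1..n}" by (auto simp: std_def)
  then have "xw u s = xw (u @ u') (tw (red w) Y0)" "set (u @ u') \<subseteq> {1..n}" using u by auto
  then show "xw u s \<in> sp std" using \<open>w permutes {1..n}\<close> by (intro sp_base) (simp only: std_def, blast)
qed

lemma short_std: "z \<in> sp (short L) \<Longrightarrow> z \<in> sp std"
proof (induction L arbitrary: z)
  case 0
  then show ?case by (elim sp_mono[rotated]) (simp add: short_def)
next
  case (Suc L)
  show ?case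
  proof (rule sp_subsetI[OF _ Suc(2)])
    fix s assume "s \<in> short (Suc L)"
    then obtain u l where u: "s = xw u (tw l Y0)" "set u \<subseteq> {1..n}" "set l \<subseteq> {1..<n}" "length l \<le> L"
      by (auto simp: short_def)
    have "z \<in> sp std" if "z \<in> sp (short (length l))" for z
      using that short_mono[OF u(4)] Suc(1) by (blast intro: sp_mono)
    note IH = this
    have "tw l Y0 \<in> sp std"
    proof (cases "rword n l")
      case False then show ?thesis using IH nonreduced_short[OF u(3)] by blast
    next
      case True
      have p: "word_perm l permutes {1..n}" by (rule word_perm_permutes[OF u(3)])
      then have "same_mod l (red (word_perm l))" using rword_same_mod[OF True] red[OF p] by simp
      then obtain c d where cd: "d \<in> sp (short (length l))" "tw l Y0 = scale c (tw (red (word_perm l)) Y0) + d"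
        unfolding same_mod_def by metis
      have "xw [] (tw (red (word_perm l)) Y0) \<in> std"
        unfolding std_def using p by (intro CollectI exI[of _ "[]"] exI[of _ "word_perm l"]) simp
      then have "tw (red (word_perm l)) Y0 \<in> sp std" by (intro sp_base) simp
      then show ?thesis unfolding cd(2) using IH[OF cd(1)] by (intro sp_add sp_scale)
    qed
    then show "s \<in> sp std" unfolding u(1) using u(2) by (rule std_x)
  qed
qed

lemma act_col:
  "set l \<subseteq> {1..<n} \<Longrightarrow> k \<in> {1..n} \<Longrightarrow> ent (foldr swap_at l \<nu>0) (word_perm l k) = col k"
proof (induction l)
  case (Cons a l)
  have l: "set l \<subseteq> {1..<n}" and a: "1 \<le> a" "a < n" using Cons by auto
  have len: "length (foldr swap_at l \<nu>0) = n" using wtD(2)[OF wt_tw[OF wt0 l]] by (rule IB_len)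
  have "word_perm l k \<in> {1..n}" using permutes_in_image[OF word_perm_permutes[OF l]] Cons(3) by simp
  then have "sfun a (word_perm l k) \<in> {1..n}" using sfun_le_iff[OF a] by simp
  then show ?case using Cons.IH[OF l Cons(3)] a len by (simp add: ent_swap_at)
qed simp

definition corner :: "'v set" where
  "corner = {xw u (tw (red w) Y0) | u w. set u \<subseteq> {1..n} \<and> w \<in> col_perms n col}"

text \<open>The weight of the vector built from \<tau>_w is the block word permuted by w, so the
  idempotent annihilates it unless w preserves the colours.\<close>

lemma std_corner: assumes "z \<in> sp std" shows "\<rho> (E \<nu>0) z \<in> sp corner"
proof (rule sp_map_e[OF assms wtD(2)[OF wt0]])
  fix s assume "s \<in> std"
  then obtain u w where u: "s = xw u (tw (red w) Y0)" "set u \<subseteq> {1..n}" "w permutes {1..n}" by (auto simp: std_def)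
  have r: "set (red w) \<subseteq> {1..<n}" "word_perm (red w) = w" using red[OF u(3)] by (auto simp: rword_def)
  let ?\<mu> = "foldr swap_at (red w) \<nu>0"
  have wt: "wt ?\<mu> s" unfolding u(1) by (intro wt_xw wt_tw wt0 r u)
  show "\<rho> (E \<nu>0) s \<in> sp corner"
  proof (cases "?\<mu> = \<nu>0")
    case False
    then have "\<rho> (E \<nu>0) s \<approx> 0" using wt_e[OF wt wtD(2)[OF wt0]] by auto
    then show ?thesis by (rule sp_eqv) (rule sp_zero)
  next
    case True
    have "w \<in> col_perms n col"
      using act_col[OF r(1)] True u(3) r(2) by (simp add: col_perms_def)
    then have "s \<in> corner" unfolding u(1) corner_def using u(2) by blast
    then have "s \<in> sp corner" by (rule sp_base)
    then show ?thesis using wtD(3)[OF wt] True by (intro sp_eqv[of "\<rho> (E \<nu>0) s" s]) simp_all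
  qed
qed

text \<open>Inside the Young subgroup the error terms disappear: a braid relation there involves a
  single colour, for which Q is zero. So reduced words agree up to a scalar modulo \<open>J\<close>.
  The first conjunct makes the relation meaningful for all reduced words, as Matsumoto's theorem
  requires.\<close>

definition same_int :: "nat list \<Rightarrow> nat list \<Rightarrow> bool" where
  "same_int l l' \<longleftrightarrow> (word_sup n col l \<longleftrightarrow> word_sup n col l') \<and>
     (word_sup n col l \<longrightarrow> (\<exists>s. s \<noteq> 0 \<and> tw l Y0 \<approx> scale s (tw l' Y0)))"

lemma same_intD:
  assumes "same_int l l'" "word_sup n col l"
  obtains s where "s \<noteq> 0" "tw l Y0 \<approx> scale s (tw l' Y0)"
  using assms by (auto simp: same_int_def)

lemma rword_same_int:
  assumes "rword n l" "rword n l'" "word_perm l = word_perm l'" shows "same_int l l'"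
proof (rule matsumoto[of n same_int, OF _ _ _ _ _ _ assms])
  show "same_int l l" for l unfolding same_int_def by (intro conjI impI exI[of _ 1]) simp_all
next
  fix l l' assume R: "same_int l l'"
  have "\<exists>s. s \<noteq> 0 \<and> tw l' Y0 \<approx> scale s (tw l Y0)" if "word_sup n col l'"
  proof -
    have "word_sup n col l" using R that by (simp add: same_int_def)
    from same_intD[OF R this] obtain s where s: "s \<noteq> 0" "tw l Y0 \<approx> scale s (tw l' Y0)" .
    have "scale (inverse s) (tw l Y0) \<approx> tw l' Y0" using eqv_scale[OF s(2), of "inverse s"] s(1) by simp
    from eqv_sym[OF this] show ?thesis using s(1) by (intro exI[of _ "inverse s"]) simp
  qed
  then show "same_int l' l" using R unfolding same_int_def by simp
next
  fix l l' l'' assume R: "same_int l l'" "same_int l' l''"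
  have "\<exists>s. s \<noteq> 0 \<and> tw l Y0 \<approx> scale s (tw l'' Y0)" if w: "word_sup n col l"
  proof -
    have w': "word_sup n col l'" using R(1) w by (simp add: same_int_def)
    from same_intD[OF R(1) w] obtain s where s: "s \<noteq> 0" "tw l Y0 \<approx> scale s (tw l' Y0)" .
    from same_intD[OF R(2) w'] obtain s' where s': "s' \<noteq> 0" "tw l' Y0 \<approx> scale s' (tw l'' Y0)" .
    from eqv_trans[OF s(2) eqv_scale[OF s'(2)]] show ?thesis using s(1) s'(1)
      by (intro exI[of _ "s * s'"]) simp
  qed
  then show "same_int l l''" using R unfolding same_int_def by simp
next
  fix a l l' assume R: "same_int l l'" and r: "rword n (a # l)" "rword n (a # l')"
  have a: "a \<in> {1..<n}" using r by (simp add: rword_def)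
  have "\<exists>s. s \<noteq> 0 \<and> tw (a # l) Y0 \<approx> scale s (tw (a # l') Y0)" if "word_sup n col (a # l)"
  proof -
    have "word_sup n col l" using that by simp
    from same_intD[OF R this] obtain s where s: "s \<noteq> 0" "tw l Y0 \<approx> scale s (tw l' Y0)" .
    from eqv_t[OF s(2) a] show ?thesis using s(1) by (intro exI[of _ s]) (simp add: rho_scale)
  qed
  then show "same_int (a # l) (a # l')" using R unfolding same_int_def by simp
next
  fix a c l assume r: "rword n (a # c # l)" "rword n (c # a # l)" and far: "Suc a < c"
  have s: "set l \<subseteq> {1..<n}" "a \<in> {1..<n}" "c \<in> {1..<n}" using r by (auto simp: rword_def)
  have "a + 1 < c" using far by simp
  then obtain k where "k \<noteq> 0" "\<rho> (T a) (\<rho> (T c) (tw l Y0)) \<approx> scale k (\<rho> (T c) (\<rho> (T a) (tw l Y0)))"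
    using tt_far[OF wt_tw[OF wt0 s(1)] s(2,3)] by blast
  then show "same_int (a # c # l) (c # a # l)" unfolding same_int_def by (intro conjI impI exI[of _ k]) auto
next
  fix a l assume r: "rword n (a # Suc a # a # l)" "rword n (Suc a # a # Suc a # l)"
  have "tw (a # Suc a # a # l) Y0 \<approx> scale 1 (tw (Suc a # a # Suc a # l) Y0)" if w: "word_sup n col (a # Suc a # a # l)"
  proof -
    have a: "1 \<le> a" "a + 1 < n" and l: "word_sup n col l" and c: "col a = col (a + 1)"
      using w by (simp_all flip: Suc_eq_plus1)
    have aa: "a \<in> {1..<n}" using a by auto
    have "\<rho> (T (a + 1)) (\<rho> (T a) (\<rho> (T (a + 1)) (tw l Y0))) - \<rho> (T a) (\<rho> (T (a + 1)) (\<rho> (T a) (tw l Y0)))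
      \<approx> braid_op Iodd t \<nu>0 a (\<rho> (E \<nu>0) (tw l Y0))" by (rule ttt[OF wt_int[OF wt0 l] a])
    then have "\<rho> (T (a + 1)) (\<rho> (T a) (\<rho> (T (a + 1)) (tw l Y0))) \<approx> \<rho> (T a) (\<rho> (T (a + 1)) (\<rho> (T a) (tw l Y0)))"
      unfolding braid_same[OF wtD(2)[OF wt0] aa c] by (simp add: eqv_def)
    from eqv_sym[OF this] show ?thesis by (simp flip: Suc_eq_plus1)
  qed
  then show "same_int (a # Suc a # a # l) (Suc a # a # Suc a # l)"
    unfolding same_int_def by (intro conjI impI exI[of _ 1]) auto
qed

text \<open>Inside a block \<tau>_a^2 is 0, because Q vanishes for equal colours; the rewriting that
  made nonreduced words shorter now makes them vanish.\<close>

lemma nonreduced_int: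
  "word_sup n col l \<Longrightarrow> \<not> rword n l \<Longrightarrow> tw l Y0 \<in> J"
proof (induction l)
  case Nil then show ?case by simp
next
  case (Cons a m)
  have a: "a \<in> {1..<n}" and m: "word_sup n col m" and c: "col a = col (a + 1)"
    using Cons.prems(1) by (simp_all flip: Suc_eq_plus1)
  show ?case
  proof (cases "rword n m")
    case False
    then show ?thesis using stabJ(3)[OF Cons.IH[OF m] a] by simp
  next
    case True
    then obtain m' where m': "rword n (a # m')" "word_perm (a # m') = word_perm m"
      using nonreduced_descent[OF True a Cons(3)] by blast
    then have "same_int m (a # m')" using rword_same_int True by simp
    then obtain s where s: "word_sup n col m'" "tw m Y0 \<approx> scale s (\<rho> (T a) (tw m' Y0))"
      using m by (auto simp: same_int_def)
    have "\<rho> (T a) (\<rho> (T a) (tw m' Y0)) \<approx> 0"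
      proof -
      have "a + 1 \<in> {1..n}" using a by auto
      then show ?thesis using tt[OF wt_int[OF wt0 s(1)] a] Qop_diag[OF wtD(2)[OF wt0], of "a + 1"] unfolding c by simp
    qed
    then have "scale s (\<rho> (T a) (\<rho> (T a) (tw m' Y0))) \<approx> 0" using eqv_scale by fastforce
    moreover have "\<rho> (T a) (tw m Y0) \<approx> scale s (\<rho> (T a) (\<rho> (T a) (tw m' Y0)))"
      using eqv_t[OF s(2) a] by (simp add: rho_scale)
    ultimately have "\<rho> (T a) (tw m Y0) \<approx> 0" by (rule eqv_trans[rotated])
    then show ?thesis by (simp add: eqv_0)
  qed
qed

text \<open>Exponents are lowered one position at a time, from \<open>n\<close> down to 1. Up to
  longer words the relation for x_k produces only variables up to \<open>k\<close>, so the bounds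
  already reached at later positions survive.\<close>

lemma reduce_exponents:
  assumes Z: "wt \<nu>0 Z"
    and bounded: "\<And>u. set u \<subseteq> {1..n} \<Longrightarrow> \<forall>j\<in>{1..n}. count_list u j < N j \<Longrightarrow> xw u Z \<in> sp S"
    and long: "\<And>s. s \<in> longer Z \<Longrightarrow> s \<in> sp S"
  shows "set u \<subseteq> {1..n} \<Longrightarrow> xw u Z \<in> sp S"
proof -
  have "\<forall>u. set u \<subseteq> {1..n} \<and> (\<forall>j. k < j \<and> j \<le> n \<longrightarrow> count_list u j < N j) \<longrightarrow> xw u Z \<in> sp S" if "k \<le> n" for k
    using that
  proof (induction k)
    case 0 then show ?case using bounded by auto
  next
    case (Suc k)
    let ?k = "Suc k"
    have "xw u Z \<in> sp S" if "set u \<subseteq> {1..n}" "\<And>j. ?k < j \<Longrightarrow> j \<le> n \<Longrightarrow> count_list u j < N j" for u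
      using that
    proof (induction "count_list u ?k" arbitrary: u rule: less_induct)
      case less
      show ?case
      proof (cases "count_list u ?k < N ?k")
        case True
        then have "\<forall>j. k < j \<and> j \<le> n \<longrightarrow> count_list u j < N j" using less(3) by (metis Suc_lessI)
        then show ?thesis using Suc less(2) by simp
      next
        case False
        have kn: "?k \<in> {1..n}" using Suc by auto
        \<comment> \<open>Up to a scalar the word can be rearranged so that \<open>N ?k\<close>
          copies of the letter \<open>?k\<close> stand next to \<open>Z\<close>, where
          \<open>grel\<close> applies.\<close>
        have "N ?k \<le> count (mset u) ?k" using False by (simp add: count_mset)
        then have "replicate_mset (N ?k) ?k \<subseteq># mset u"
          by (simp only: count_le_replicate_mset_subset_eq)
        then obtain M where M: "mset u = M + replicate_mset (N ?k) ?k"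
          by (metis add.commute subset_mset.le_iff_add)
        obtain u' where u': "mset u' = M" using ex_mset by blast
        have mu: "mset u = mset (u' @ replicate (N ?k) ?k)" using M u' by simp
        then have su': "set u' \<subseteq> {1..n}" using less(2) by (metis set_mset_mset set_append le_sup_iff)
        have cnt: "count_list u j = count_list u' j + (if j = ?k then N ?k else 0)" for j
          using arg_cong[OF mu, of "\<lambda>m. count m j"] by (simp add: count_mset count_list_replicate)
        have main: "xw u' ((\<rho> (X ?k) ^^ N ?k) Z) \<in> sp S"
        proof (rule sp_map_xw[OF _ su'])
          show "(\<rho> (X ?k) ^^ N ?k) Z \<in> sp (xlow ?k (N ?k) Z \<union> longer Z)"
            using grel_all[of ?k] kn Z by (simp add: grel_def)
          fix s assume "s \<in> xlow ?k (N ?k) Z \<union> longer Z"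
          then show "xw u' s \<in> sp S"
          proof
            assume "s \<in> xlow ?k (N ?k) Z"
            then obtain v where v: "s = xw v Z" "set v \<subseteq> {1..?k}" "count_list v ?k < N ?k" by (auto simp: xlow_def)
            have "xw (u' @ v) Z \<in> sp S"
            proof (rule less(1))
              show "count_list (u' @ v) ?k < count_list u ?k" using v(3) cnt[of ?k] by simp
              show "set (u' @ v) \<subseteq> {1..n}" using su' v(2) kn by auto
              fix j assume j: "?k < j" "j \<le> n"
              then have "j \<notin> set v" using v(2) by auto
              then show "count_list (u' @ v) j < N j" using less(3)[OF j] cnt[of j] j by (simp add: count_list_0_iff)
            qed
            then show ?thesis by (simp add: v(1))
          next
            assume "s \<in> longer Z"
            then obtain v l where v: "s = xw v (tw l Z)" "set v \<subseteq> {1..n}" "word_sup n col l" "l \<noteq> []"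
              by (auto simp: longer_def)
            have "xw (u' @ v) (tw l Z) \<in> longer Z" by (rule longerI) (use v su' in auto)
            then show ?thesis using long v(1) by simp
          qed
        qed
        obtain c where c: "xw u Z \<approx> scale c (xw (u' @ replicate (N ?k) ?k) Z)"
          using xw_perm[OF Z mu less(2)] by blast
        have "xw (u' @ replicate (N ?k) ?k) Z = xw u' ((\<rho> (X ?k) ^^ N ?k) Z)" by (simp add: xw_replicate)
        with c main show ?thesis by (metis sp_eqv sp_scale)
      qed
    qed
    then show ?case by auto
  qed
  from this[of n] show "set u \<subseteq> {1..n} \<Longrightarrow> xw u Z \<in> sp S" by auto
qed

definition ord_word :: "(nat \<Rightarrow> nat) \<Rightarrow> nat list" where
  "ord_word r = concat (map (\<lambda>k. replicate (r k) k) [1..<Suc n])"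

lemma mset_ord_word:
  assumes "set u \<subseteq> {1..n}" shows "mset u = mset (ord_word (count_list u))"
proof (rule multiset_eqI)
  fix x
  have "count (mset (concat (map (\<lambda>k. replicate (r k) k) ks))) x = (if x \<in> set ks then r x else 0)"
    if "distinct ks" for r and ks :: "nat list"
    using that by (induction ks) (auto simp: count_mset count_list_replicate)
  from this[of "[1..<Suc n]" "count_list u"] have
    "count (mset (ord_word (count_list u))) x = (if x \<in> {1..n} then count_list u x else 0)"
    by (auto simp: ord_word_def)
  moreover have "count_list u x = 0" if "x \<notin> {1..n}" using that assms by (auto simp: count_list_0_iff)
  ultimately show "count (mset u) x = count (mset (ord_word (count_list u))) x"
    by (simp add: count_mset)
qed

definition basis_vecs :: "'v set" where
  "basis_vecs = {xw (ord_word r) (tw (red w) Y0) | r w. w \<in> col_perms n col \<and> (\<forall>k\<in>{1..n}. r k < N k)}"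

text \<open>Lowering exponents creates terms with more \<tau> factors. These vanish or belong to
  permutations with more inversions, whose number is bounded by \<open>block_pairs\<close>; so the
  induction starts at the longest element.\<close>

lemma corner_basis:
  "w \<in> col_perms n col \<Longrightarrow> set u \<subseteq> {1..n} \<Longrightarrow> xw u (tw (red w) Y0) \<in> sp basis_vecs"
proof (induction "card block_pairs - inv_num n w" arbitrary: w u rule: less_induct)
  case less
  have p: "w permutes {1..n}" using less(2) by (simp add: col_perms_def)
  have rw: "rword n (red w)" "word_perm (red w) = w" using red[OF p] by auto
  have ws: "word_sup n col (red w)" using rword_word_sup[OF rw(1)] rw(2) less(2) by simp
  have Z: "wt \<nu>0 (tw (red w) Y0)" by (rule wt_int[OF wt0 ws])
  show ?case
  proof (rule reduce_exponents[OF Z _ _ less(3)])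
    fix u assume u: "set u \<subseteq> {1..n}" "\<forall>j\<in>{1..n}. count_list u j < N j"
    obtain c where c: "xw u (tw (red w) Y0) \<approx> scale c (xw (ord_word (count_list u)) (tw (red w) Y0))"
      using xw_perm[OF Z mset_ord_word[OF u(1)] u(1)] by blast
    have "xw (ord_word (count_list u)) (tw (red w) Y0) \<in> basis_vecs"
      unfolding basis_vecs_def using u less(2) by blast
    then show "xw u (tw (red w) Y0) \<in> sp basis_vecs" by (intro sp_eqv[OF c] sp_scale sp_base)
  next
    fix s assume "s \<in> longer (tw (red w) Y0)"
    then obtain v l where v: "s = xw v (tw l (tw (red w) Y0))" "set v \<subseteq> {1..n}" "word_sup n col l" "l \<noteq> []"
      by (auto simp: longer_def)
    let ?l = "l @ red w"
    have wl: "word_sup n col ?l" using v(3) ws by simp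
    have s: "s = xw v (tw ?l Y0)" by (simp add: v(1))
    show "s \<in> sp basis_vecs"
    proof (cases "rword n ?l")
      case False
      then have "s \<in> J" unfolding s by (intro xw_J v(2) nonreduced_int wl)
      then show ?thesis by (rule sp_J)
    next
      case True
      let ?w = "word_perm ?l"
      have cw: "?w \<in> col_perms n col" by (rule word_perm_col_perms[OF wl])
      then have pw: "?w permutes {1..n}" by (simp add: col_perms_def)
      have "same_int ?l (red ?w)" using rword_same_int[OF True] red[OF pw] by simp
      then obtain c where c: "tw ?l Y0 \<approx> scale c (tw (red ?w) Y0)" using wl unfolding same_int_def by blast
      have "inv_num n ?w = length ?l" using True unfolding rword_def by simp
      moreover have "inv_num n w = length (red w)" using rw unfolding rword_def by simp
      moreover have "inv_num n ?w \<le> card block_pairs"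
        unfolding inv_num_def by (rule card_mono[OF finite_block_pairs invs_block_pairs[OF cw]])
      moreover have "0 < length l" using v(4) by simp
      ultimately have lt: "card block_pairs - inv_num n ?w < card block_pairs - inv_num n w"
        unfolding length_append by linarith
      have "xw v (tw (red ?w) Y0) \<in> sp basis_vecs" by (rule less(1)[OF lt cw v(2)])
      then have "xw v (scale c (tw (red ?w) Y0)) \<in> sp basis_vecs" unfolding xw_linear by (rule sp_scale)
      then show ?thesis unfolding s by (rule sp_eqv[OF eqv_xw[OF c v(2)]])
    qed
  qed
qed

lemma words_reach:
  "set g \<subseteq> {E \<nu> | \<nu>. \<nu> \<in> IB} \<union> {X p | p. 1 \<le> p \<and> p \<le> n} \<union> {T a | a. 1 \<le> a \<and> a < n} \<Longrightarrow>
    \<exists>L. foldr \<rho> g Y0 \<in> sp (short L)"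
proof (induction g)
  case Nil
  have "xspan (tw [] Y0) \<subseteq> short 1" by (rule xspan_short) auto
  then have "Y0 \<in> short 1" using xspan_self by auto
  then show ?case by (auto intro: sp_base)
next
  case (Cons g gs)
  then obtain L where L: "foldr \<rho> gs Y0 \<in> sp (short L)" by auto
  consider \<nu> where "g = E \<nu>" "\<nu> \<in> IB" | p where "g = X p" "p \<in> {1..n}" | a where "g = T a" "a \<in> {1..<n}"
    using Cons(2) by auto
  then show ?case
  proof cases
    case 1
    have "\<rho> (E \<nu>) (foldr \<rho> gs Y0) \<in> sp (short L)"
    proof (rule sp_map_e[OF L 1(2)])
      fix s assume s: "s \<in> short L"
      then obtain u l where u: "s = xw u (tw l Y0)" "set u \<subseteq> {1..n}" "set l \<subseteq> {1..<n}" by (auto simp: short_def)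
      have wt: "wt (foldr swap_at l \<nu>0) s" unfolding u(1) by (intro wt_xw wt_tw wt0 u)
      have "\<rho> (E \<nu>) s \<approx> s \<or> \<rho> (E \<nu>) s \<approx> 0" using wt_e[OF wt 1(2)] wtD(3)[OF wt] by metis
      then show "\<rho> (E \<nu>) s \<in> sp (short L)" using sp_eqv sp_base[OF s] sp_zero by blast
    qed
    then show ?thesis using 1 by auto
  next
    case 2
    have "\<rho> (X p) (foldr \<rho> gs Y0) \<in> sp (short L)"
    proof (rule sp_map_x[OF L 2(2)])
      fix s assume "s \<in> short L"
      then obtain u l where u: "s = xw u (tw l Y0)" "set u \<subseteq> {1..n}" "set l \<subseteq> {1..<n}" "length l < L"
        by (auto simp: short_def)
      then have "\<rho> (X p) s = xw (p # u) (tw l Y0)" "set (p # u) \<subseteq> {1..n}" using 2 by auto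
      then show "\<rho> (X p) s \<in> sp (short L)" using u(3,4) by (intro sp_base) (simp only: short_def, blast)
    qed
    then show ?thesis using 2 by auto
  next
    case 3
    then show ?thesis using short_t[OF 3(2) L] by auto
  qed
qed

theorem corner_spanned:
  assumes "set g \<subseteq> {E \<nu> | \<nu>. \<nu> \<in> IB} \<union> {X p | p. 1 \<le> p \<and> p \<le> n} \<union> {T a | a. 1 \<le> a \<and> a < n}"
  shows "\<rho> (E \<nu>0) (foldr \<rho> g Y0) \<in> sp basis_vecs"
proof -
  obtain L where "foldr \<rho> g Y0 \<in> sp (short L)" using words_reach[OF assms] by blast
  then have "\<rho> (E \<nu>0) (foldr \<rho> g Y0) \<in> sp corner" by (intro std_corner short_std)
  then show ?thesis
  proof (rule sp_subsetI[rotated])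
    fix s assume "s \<in> corner"
    then obtain u w where "s = xw u (tw (red w) Y0)" "set u \<subseteq> {1..n}" "w \<in> col_perms n col"
      by (auto simp: corner_def)
    then show "s \<in> sp basis_vecs" using corner_basis by simp
  qed
qed

end

subsection \<open>Superpolynomials\<close>

definition pscale :: "'k::field \<Rightarrow> ('m \<Rightarrow>\<^sub>0 'k) \<Rightarrow> 'm \<Rightarrow>\<^sub>0 'k" where
  "pscale c = Poly_Mapping.map ((*) c)"

lemma lookup_pscale: "Poly_Mapping.lookup (pscale c f) m = c * Poly_Mapping.lookup f m"
  by (simp add: pscale_def Poly_Mapping.map.rep_eq when_def)

interpretation PS: vector_space pscale
  by standard (auto intro!: poly_mapping_eqI simp: lookup_pscale lookup_add algebra_simps)

definition bas :: "'m \<Rightarrow> 'm \<Rightarrow>\<^sub>0 'k::field" where "bas m = Poly_Mapping.single m 1"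

lemma lookup_bas: "Poly_Mapping.lookup (bas m) m' = (if m = m' then 1 else 0)"
  by (simp add: bas_def lookup_single when_def)

lemma poly_decomp: "f = (\<Sum>m\<in>Poly_Mapping.keys f. pscale (Poly_Mapping.lookup f m) (bas m))"
  by (rule poly_mapping_eqI)
    (auto simp: lookup_sum lookup_pscale lookup_bas if_distrib in_keys_iff cong: if_cong)

definition plin :: "('m \<Rightarrow> 'n \<Rightarrow>\<^sub>0 'k::field) \<Rightarrow> ('m \<Rightarrow>\<^sub>0 'k) \<Rightarrow> 'n \<Rightarrow>\<^sub>0 'k" where
  "plin \<phi> f = (\<Sum>m\<in>Poly_Mapping.keys f. pscale (Poly_Mapping.lookup f m) (\<phi> m))"

lemma plin_superset:
  assumes "finite S" "Poly_Mapping.keys f \<subseteq> S"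
  shows "plin \<phi> f = (\<Sum>m\<in>S. pscale (Poly_Mapping.lookup f m) (\<phi> m))"
  unfolding plin_def by (rule sum.mono_neutral_left) (use assms in \<open>auto simp: in_keys_iff\<close>)

definition lin :: "(('m \<Rightarrow>\<^sub>0 'k::field) \<Rightarrow> ('n \<Rightarrow>\<^sub>0 'k)) \<Rightarrow> bool" where
  "lin F \<longleftrightarrow> (\<forall>u v. F (u + v) = F u + F v) \<and> (\<forall>c v. F (pscale c v) = pscale c (F v))"

lemma lin_add: "lin F \<Longrightarrow> F (u + v) = F u + F v" by (simp add: lin_def)
lemma lin_scale: "lin F \<Longrightarrow> F (pscale c v) = pscale c (F v)" by (simp add: lin_def)
lemma lin_zero: "lin F \<Longrightarrow> F 0 = 0" using lin_scale[of F 0 0] by simp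
lemma lin_neg: "lin F \<Longrightarrow> F (- v) = - F v" using lin_scale[of F "-1" v] by simp
lemma lin_diff: "lin F \<Longrightarrow> F (u - v) = F u - F v" using lin_add[of F u "- v"] lin_neg[of F v] by simp
lemma lin_sum: "lin F \<Longrightarrow> F (sum f S) = (\<Sum>a\<in>S. F (f a))"
  by (induction S rule: infinite_finite_induct) (simp_all add: lin_zero lin_add)
lemmas lin_simps = lin_add lin_scale lin_zero lin_neg lin_diff lin_sum

lemma lin_id: "lin (\<lambda>v. v)" by (simp add: lin_def)
lemma lin_0: "lin (\<lambda>v. 0)" by (simp add: lin_def)
lemma lin_comp: "lin F \<Longrightarrow> lin G \<Longrightarrow> lin (\<lambda>v. F (G v))" by (simp add: lin_def)
lemma lin_plus: "lin F \<Longrightarrow> lin G \<Longrightarrow> lin (\<lambda>v. F v + G v)"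
  by (simp add: lin_def PS.scale_right_distrib algebra_simps)
lemma lin_minus: "lin F \<Longrightarrow> lin G \<Longrightarrow> lin (\<lambda>v. F v - G v)"
  by (simp add: lin_def PS.scale_right_diff_distrib algebra_simps)
lemma lin_pscale: "lin F \<Longrightarrow> lin (\<lambda>v. pscale c (F v))"
  by (simp add: lin_def PS.scale_right_distrib mult.commute)
lemma lin_sums: "(\<And>a. a \<in> S \<Longrightarrow> lin (F a)) \<Longrightarrow> lin (\<lambda>v. \<Sum>a\<in>S. F a v)"
  by (induction S rule: infinite_finite_induct) (simp_all add: lin_0 lin_plus)
lemma lin_pow:
  fixes F :: "('m \<Rightarrow>\<^sub>0 'k::field) \<Rightarrow> ('m \<Rightarrow>\<^sub>0 'k)"
  assumes "lin F" shows "lin (F ^^ m)"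
proof (induction m)
  case 0 show ?case by (simp add: lin_def)
next
  case (Suc m)
  have "lin (\<lambda>v. F ((F ^^ m) v))" by (rule lin_comp[OF assms Suc])
  then show ?case by (simp add: comp_def)
qed

lemma lin_plin:
  fixes \<phi> :: "'m \<Rightarrow> 'n \<Rightarrow>\<^sub>0 'k::field"
  shows "lin (plin \<phi>)"
  unfolding lin_def
proof (intro conjI allI)
  fix u v :: "'m \<Rightarrow>\<^sub>0 'k"
  let ?S = "Poly_Mapping.keys u \<union> Poly_Mapping.keys v"
  have "Poly_Mapping.keys (u + v) \<subseteq> ?S" by (rule keys_add)
  then have "plin \<phi> (u + v) = (\<Sum>m\<in>?S. pscale (Poly_Mapping.lookup (u + v) m) (\<phi> m))"
    by (intro plin_superset) auto
  moreover have "plin \<phi> u = (\<Sum>m\<in>?S. pscale (Poly_Mapping.lookup u m) (\<phi> m))" by (rule plin_superset) auto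
  moreover have "plin \<phi> v = (\<Sum>m\<in>?S. pscale (Poly_Mapping.lookup v m) (\<phi> m))" by (rule plin_superset) auto
  ultimately show "plin \<phi> (u + v) = plin \<phi> u + plin \<phi> v"
    by (simp add: lookup_add PS.scale_left_distrib sum.distrib)
next
  fix c and v :: "'m \<Rightarrow>\<^sub>0 'k"
  have "Poly_Mapping.keys (pscale c v) \<subseteq> Poly_Mapping.keys v" by (auto simp: in_keys_iff lookup_pscale)
  then have "plin \<phi> (pscale c v) = (\<Sum>m\<in>Poly_Mapping.keys v. pscale (Poly_Mapping.lookup (pscale c v) m) (\<phi> m))"
    by (intro plin_superset) auto
  then show "plin \<phi> (pscale c v) = pscale c (plin \<phi> v)"
    by (simp add: plin_def lookup_pscale PS.scale_sum_right)
qed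

lemma plin_bas [simp]: "plin \<phi> (bas m) = \<phi> m"
  by (simp add: plin_def bas_def)

lemma lin_eqI:
  assumes F: "lin F" and G: "lin G" and eq: "\<And>m. F (bas m) = G (bas m)"
  shows "F v = G v"
proof -
  have "F v = (\<Sum>m\<in>Poly_Mapping.keys v. pscale (Poly_Mapping.lookup v m) (F (bas m)))"
    by (subst poly_decomp[of v]) (simp add: lin_simps[OF F])
  also have "\<dots> = G v"
    by (subst (3) poly_decomp[of v]) (simp add: lin_simps[OF G] eq)
  finally show ?thesis .
qed

text \<open>A multiset stands for the monomial with its variables in descending order from left to
  right. All signs are put into the operators, so the vector space does not depend on the
  parities.\<close>

type_synonym 'k spoly = "nat multiset \<Rightarrow>\<^sub>0 'k"

definition desc :: "nat multiset \<Rightarrow> nat list" where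
  "desc M = rev (sorted_list_of_multiset M)"

lemma mset_desc [simp]: "mset (desc M) = M"
  by (simp add: desc_def)

lemma desc_empty [simp]: "desc {#} = []"
  by (simp add: desc_def)

lemma sorted_desc: "sorted (rev (desc M))"
  by (simp add: desc_def)

lemma desc_unique: "sorted (rev u) \<Longrightarrow> desc (mset u) = u"
  by (metis desc_def mset_rev rev_rev_ident sorted_list_of_multiset_mset sorted_sort_id)

lemma desc_add: assumes "\<forall>x\<in>#M. x \<le> l" shows "desc (add_mset l M) = l # desc M"
proof -
  have "sorted (rev (l # desc M))" using assms sorted_desc[of M]
    by (simp add: sorted_append) (metis mset_desc set_mset_mset)
  from desc_unique[OF this] show ?thesis by simp
qed

text \<open>\<open>ty\<close> serves to fix the coefficient field, which the parities alone do not
  mention.\<close>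

locale superpoly =
  fixes par :: "nat \<Rightarrow> bool" and ty :: "'k::field itself"
begin

definition sg :: "nat \<Rightarrow> nat \<Rightarrow> 'k" where "sg k l = (if par k \<and> par l then - 1 else 1)"

text \<open>The sign of bringing a new leftmost factor \<open>k\<close> to its place in descending
  order: if odd, it anticommutes with each larger odd variable that it passes.\<close>

definition sgX :: "nat \<Rightarrow> nat multiset \<Rightarrow> 'k" where
  "sgX k M = (if par k then (- 1) ^ size {#l \<in># M. par l \<and> k < l#} else 1)"

definition Xo :: "nat \<Rightarrow> 'k spoly \<Rightarrow> 'k spoly" where
  "Xo k = plin (\<lambda>M. pscale (sgX k M) (bas (add_mset k M)))"

definition one :: "'k spoly" where "one = bas {#}"

abbreviation Xw :: "nat list \<Rightarrow> 'k spoly \<Rightarrow> 'k spoly" where "Xw u v \<equiv> foldr Xo u v"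

lemma sg_sq [simp]: "sg k l * sg k l = 1" "sg k l * (sg k l * c) = c" by (simp_all add: sg_def)
lemma sg_sym: "sg k l = sg l k" by (auto simp: sg_def)
lemma sg_nz [simp]: "sg k l \<noteq> 0" by (simp add: sg_def)
lemma sgX_sq [simp]: "sgX k M * sgX k M = 1" by (simp add: sgX_def flip: power_add mult_2)
lemma sgX_nz [simp]: "sgX k M \<noteq> 0" by (simp add: sgX_def)

lemma lin_Xo [simp]: "lin (Xo k)" unfolding Xo_def by (rule lin_plin)
lemma lin_Xo_comp [simp]: "lin F \<Longrightarrow> lin (\<lambda>v. Xo k (F v))"
  by (rule lin_comp[OF lin_Xo])
lemmas Xo_simps = lin_simps[OF lin_Xo]

lemma Xo_bas: "Xo k (bas M) = pscale (sgX k M) (bas (add_mset k M))"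
  by (simp add: Xo_def)

lemma sgX_add: "sgX k (add_mset l M) = (if par k \<and> par l \<and> k < l then - 1 else 1) * sgX k M"
  by (simp add: sgX_def)

lemma Xo_comm: "k \<noteq> l \<Longrightarrow> Xo k (Xo l v) = pscale (sg k l) (Xo l (Xo k v))"
proof (rule lin_eqI[where F = "\<lambda>v. Xo k (Xo l v)" and G = "\<lambda>v. pscale (sg k l) (Xo l (Xo k v))"])
  fix M assume "k \<noteq> l"
  then have "sgX l M * sgX k (add_mset l M) = sg k l * (sgX k M * sgX l (add_mset k M))"
    by (auto simp: sgX_add sg_def)
  then show "Xo k (Xo l (bas M)) = pscale (sg k l) (Xo l (Xo k (bas M)))"
    by (simp add: Xo_bas Xo_simps add_mset_commute)
qed (simp_all add: lin_pscale)

lemma Xw_simps: "Xw u (v + w) = Xw u v + Xw u w" "Xw u (pscale c v) = pscale c (Xw u v)" "Xw u 0 = 0"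
  by (induction u) (simp_all add: Xo_simps)

lemma lin_Xw [simp]: "lin (foldr Xo u)"
  by (simp add: lin_def Xw_simps)

lemma Xo_bas_top: assumes "\<forall>l\<in>#M. l \<le> k" shows "Xo k (bas M) = bas (add_mset k M)"
proof -
  have "{#l \<in># M. par l \<and> k < l#} = {#}" using assms by (auto simp: filter_mset_eq_mempty_iff)
  then have "sgX k M = 1" unfolding sgX_def by (simp only: size_empty power_0 if_cancel)
  then show ?thesis by (simp add: Xo_bas)
qed

lemma Xw_sorted: "sorted (rev u) \<Longrightarrow> Xw u one = bas (mset u)"
proof (induction u)
  case Nil then show ?case by (simp add: one_def)
next
  case (Cons k u)
  then have "\<forall>l\<in>#mset u. l \<le> k" "sorted (rev u)" by (auto simp: sorted_append)
  then show ?case using Cons.IH Xo_bas_top[of "mset u" k] by simp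
qed

lemma bas_Xw: "bas M = Xw (desc M) one"
  using Xw_sorted[OF sorted_desc[of M]] by simp

lemma Xw_bas: "\<exists>c. c * c = 1 \<and> Xw u (bas M) = pscale c (bas (mset u + M))"
proof (induction u)
  case Nil then show ?case by (intro exI[of _ 1]) simp
next
  case (Cons k u)
  then obtain c where "c * c = 1" "Xw u (bas M) = pscale c (bas (mset u + M))" by blast
  moreover from this have "(c * sgX k (mset u + M)) * (c * sgX k (mset u + M)) = 1"
    by (metis mult.assoc mult.commute mult_1 sgX_sq)
  ultimately show ?case by (intro exI[of _ "c * sgX k (mset u + M)"]) (simp add: Xo_simps Xo_bas)
qed

lemma lin_eq_wordsI:
  assumes "lin F" "lin G" "\<And>u. F (Xw u one) = G (Xw u one)" shows "F v = G v"
  by (rule lin_eqI[OF assms(1,2)]) (use assms(3) in \<open>simp add: bas_Xw\<close>)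

text \<open>The scheme of proof for relations between divided differences: the difference of both
  sides kills \<open>one\<close> and passes variables up to scalars and relabelling, hence kills
  every monomial.\<close>

lemma skew_zero:
  assumes Z: "lin Z" and one: "Z one = 0" and sk: "\<And>l v. \<exists>c m. Z (Xo l v) = pscale c (Xo m (Z v))"
  shows "Z v = 0"
proof (rule lin_eq_wordsI[OF Z lin_0])
  fix u show "Z (Xw u one) = 0"
  proof (induction u)
    case Nil then show ?case using one by simp
  next
    case (Cons l u)
    obtain c m where "Z (Xo l (Xw u one)) = pscale c (Xo m (Z (Xw u one)))" using sk by blast
    then show ?case using Cons by (simp add: Xo_simps)
  qed
qed

subsection \<open>Divided differences\<close>

text \<open>The constants of the relation between \<tau>_k and x_l inside a block, with the minus
  sign that comes from solving for \<tau>_k x_k; compare \<open>tx_const\<close>.\<close>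

definition cc :: "nat \<Rightarrow> nat \<Rightarrow> 'k" where
  "cc k l = (if l = Suc k then 1 else if l = k then - sg k k else 0)"

text \<open>Reading the twisted Leibniz rule along the descending word of a monomial makes the
  operator well defined; that the rule then holds for every left factor is
  \<open>D_Xo\<close>.\<close>

primrec dw :: "nat \<Rightarrow> nat list \<Rightarrow> 'k spoly" where
  "dw k [] = 0"
| "dw k (l # u) = pscale (sg k l) (Xo (sfun k l) (dw k u)) + pscale (cc k l) (Xw u one)"

definition D :: "nat \<Rightarrow> 'k spoly \<Rightarrow> 'k spoly" where
  "D k = plin (\<lambda>M. dw k (desc M))"

lemma lin_D [simp]: "lin (D k)" unfolding D_def by (rule lin_plin)
lemma lin_D_comp [simp]: "lin F \<Longrightarrow> lin (\<lambda>v. D k (F v))"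
  by (rule lin_comp[OF lin_D])
lemmas D_simps = lin_simps[OF lin_D]

lemma D_one [simp]: "D k one = 0"
  by (simp add: D_def one_def)

lemma D_bas_top:
  assumes "\<forall>x\<in>#M. x \<le> l"
  shows "D k (Xo l (bas M)) = pscale (sg k l) (Xo (sfun k l) (D k (bas M))) + pscale (cc k l) (bas M)"
  using assms by (simp add: Xo_bas_top D_def desc_add bas_Xw[symmetric])

lemma par_sfun: "par k = par (Suc k) \<Longrightarrow> par (sfun k l) = par l"
  by (auto simp: sfun_apply)

lemma sg_sfun: "par k = par (Suc k) \<Longrightarrow> sg (sfun k l) m = sg l m" "par k = par (Suc k) \<Longrightarrow> sg m (sfun k l) = sg m l"
  by (auto simp: sg_def par_sfun)

lemma sg_Suc: "par k = par (Suc k) \<Longrightarrow> sg (Suc k) m = sg k m" "par k = par (Suc k) \<Longrightarrow> sg m (Suc k) = sg m k"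
  by (auto simp: sg_def)

text \<open>If \<open>l\<close> is not the largest variable, the largest variable \<open>j\<close>
  of the monomial is moved in front of it. The defining recursion applies to \<open>j\<close>, and
  the induction hypothesis to the shorter monomial.\<close>

lemma D_Xo_bas:
  assumes k: "par k = par (Suc k)"
  shows "D k (Xo l (bas M)) = pscale (sg k l) (Xo (sfun k l) (D k (bas M))) + pscale (cc k l) (bas M)"
proof (induction "size M" arbitrary: M l rule: less_induct)
  case less
  show ?case
  proof (cases "\<forall>x\<in>#M. x \<le> l")
    case True then show ?thesis by (rule D_bas_top)
  next
    case False
    define j where "j = Max (set_mset M)"
    have ne: "M \<noteq> {#}" using False by auto
    then have jM: "j \<in># M" unfolding j_def by (intro Max_in) auto
    have jmax: "\<forall>x\<in>#M. x \<le> j" unfolding j_def by simp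
    have lj: "l < j" using False jmax by (meson less_le_trans not_le)
    define M' where "M' = M - {#j#}"
    have M: "M = add_mset j M'" using jM by (simp add: M'_def)
    have jM': "\<forall>x\<in>#M'. x \<le> j" using jmax M by auto
    have b: "bas M = Xo j (bas M')" using Xo_bas_top[OF jM'] M by simp
    have IH: "D k (Xo l (bas M')) = pscale (sg k l) (Xo (sfun k l) (D k (bas M'))) + pscale (cc k l) (bas M')"
      by (rule less) (simp add: M)
    have top: "D k (Xo j (Xo l (bas M'))) = pscale (sg k j) (Xo (sfun k j) (D k (Xo l (bas M')))) + pscale (cc k j) (Xo l (bas M'))"
    proof -
      have "\<forall>x\<in>#add_mset l M'. x \<le> j" using jM' lj by auto
      note t = D_bas_top[OF this, of k]
      show ?thesis unfolding Xo_bas[of l] Xo_simps D_simps t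
        by (simp add: PS.scale_right_distrib mult.commute)
    qed
    have sl: "sfun k l \<noteq> sfun k j" using lj by (metis less_irrefl sfun_sfun)
    have c: "Xo (sfun k j) (Xo (sfun k l) v) = pscale (sg l j) (Xo (sfun k l) (Xo (sfun k j) v))" for v
      using Xo_comm[of "sfun k j" "sfun k l" v] sl by (simp add: sg_sfun[OF k] sg_sym[of j])
    have "D k (Xo l (bas M)) = pscale (sg l j) (D k (Xo j (Xo l (bas M'))))"
      unfolding b using lj by (subst Xo_comm) (simp_all add: D_simps)
    also have "\<dots> = pscale (sg k l * sg k j) (Xo (sfun k l) (Xo (sfun k j) (D k (bas M')))) +
       (pscale (sg l j * sg k j * cc k l) (Xo (sfun k j) (bas M')) + pscale (sg l j * cc k j) (Xo l (bas M')))"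
      by (simp add: top IH Xo_simps c PS.scale_right_distrib mult_ac)
    \<comment> \<open>The terms without a divided difference must match. As \<open>cc k\<close>
      vanishes off \<open>k\<close> and \<open>Suc k\<close>, only a few positions of
      \<open>l < j\<close> relative to \<open>k\<close> matter.\<close>
    also have "pscale (sg l j * sg k j * cc k l) (Xo (sfun k j) (bas M')) + pscale (sg l j * cc k j) (Xo l (bas M'))
       = pscale (sg k l * cc k j) (Xo (sfun k l) (bas M')) + pscale (cc k l) (Xo j (bas M'))"
    proof -
      consider "l = k" "j = Suc k" | "l = k" "j \<noteq> Suc k" | "l = Suc k" | "l \<noteq> k" "l \<noteq> Suc k" "j = k"
        | "l \<noteq> k" "l \<noteq> Suc k" "j = Suc k" | "l \<noteq> k" "l \<noteq> Suc k" "j \<noteq> k" "j \<noteq> Suc k" by blast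
      then show ?thesis
      proof cases
        case 4 then show ?thesis using sg_sym[of l k] by (simp add: cc_def sfun_apply)
      next
        case 5 then show ?thesis using sg_sym[of l k] by (simp add: cc_def sfun_apply sg_Suc[OF k])
      qed (use lj in \<open>simp_all add: cc_def sfun_apply sg_Suc[OF k]\<close>)
    qed
    finally show ?thesis
      unfolding b by (simp add: D_bas_top[OF jM'] Xo_simps PS.scale_right_distrib)
  qed
qed

lemma D_Xo:
  assumes "par k = par (Suc k)"
  shows "D k (Xo l v) = pscale (sg k l) (Xo (sfun k l) (D k v)) + pscale (cc k l) v"
  by (rule lin_eqI[where F = "\<lambda>v. D k (Xo l v)" and
        G = "\<lambda>v. pscale (sg k l) (Xo (sfun k l) (D k v)) + pscale (cc k l) v"])
    (simp_all add: lin_plus lin_pscale lin_id D_Xo_bas[OF assms])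

text \<open>The constants produced when a variable passes \<open>D k\<close> twice cancel, so the
  square satisfies the hypotheses of \<open>skew_zero\<close>.\<close>

lemma DD:
  assumes "par k = par (Suc k)" shows "D k (D k v) = 0"
proof (rule skew_zero[where Z = "\<lambda>v. D k (D k v)"])
  fix l v
  have "D k (D k (Xo l v)) = pscale 1 (Xo l (D k (D k v)))"
    by (simp add: D_Xo[OF assms] D_simps PS.scale_right_distrib sg_sfun[OF assms] sg_Suc[OF assms])
      (simp add: cc_def sfun_apply sg_Suc[OF assms] PS.scale_left_distrib[symmetric])
  then show "\<exists>c m. D k (D k (Xo l v)) = pscale c (Xo m (D k (D k v)))" by blast
qed (simp_all add: D_simps)

lemma D_far:
  assumes k: "par k = par (Suc k)" and m: "par m = par (Suc m)" and far: "Suc k < m"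
  shows "D k (D m v) = pscale (sg k m) (D m (D k v))"
proof -
  have "D k (D m v) - pscale (sg k m) (D m (D k v)) = 0"
  proof (rule skew_zero[where Z = "\<lambda>v. D k (D m v) - pscale (sg k m) (D m (D k v))"])
    fix l v
    have cmt: "sfun k (sfun m l) = sfun m (sfun k l)" using far by (auto simp: sfun_apply)
    consider "l \<in> {k, Suc k}" | "l \<in> {m, Suc m}" | "l \<notin> {k, Suc k}" "l \<notin> {m, Suc m}" by blast
    then have "D k (D m (Xo l v)) - pscale (sg k m) (D m (D k (Xo l v))) =
      pscale (sg m l * sg k l) (Xo (sfun m (sfun k l)) (D k (D m v) - pscale (sg k m) (D m (D k v))))"
    proof cases
      case 1
      then have "sfun m l = l" "cc m l = 0" "cc m (sfun k l) = 0" "sg m l = sg k m" "sfun m (sfun k l) = sfun k l"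
        using far
        using sg_sym[of m k] by (auto simp: sfun_apply cc_def sg_Suc[OF k] sg_Suc(2)[OF k])
      then show ?thesis
        by (simp add: D_Xo[OF k] D_Xo[OF m] D_simps Xo_simps PS.scale_right_distrib PS.scale_right_diff_distrib
            sg_sfun[OF k] sg_sfun[OF m] mult_ac)
    next
      case 2
      then have "sfun k l = l" "cc k l = 0" "cc k (sfun m l) = 0" "sg k l = sg k m" "sfun k (sfun m l) = sfun m l"
        using far
        by (auto simp: sfun_apply cc_def sg_Suc[OF m])
      then show ?thesis
        by (simp add: D_Xo[OF k] D_Xo[OF m] D_simps Xo_simps PS.scale_right_distrib PS.scale_right_diff_distrib
            sg_sfun[OF k] sg_sfun[OF m] mult_ac)
    next
      case 3
      then have "sfun k l = l" "sfun m l = l" "cc k l = 0" "cc m l = 0" by (auto simp: sfun_apply cc_def)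
      then show ?thesis
        by (simp add: D_Xo[OF k] D_Xo[OF m] D_simps Xo_simps PS.scale_right_distrib PS.scale_right_diff_distrib mult_ac)
    qed
    then show "\<exists>c m'. D k (D m (Xo l v)) - pscale (sg k m) (D m (D k (Xo l v))) =
      pscale c (Xo m' (D k (D m v) - pscale (sg k m) (D m (D k v))))" by blast
  qed (simp_all add: lin_minus lin_pscale D_simps)
  then show ?thesis by simp
qed

text \<open>For the three variables concerned the Leibniz rule leaves terms with two divided
  differences; those with a repeated index vanish by \<open>DD\<close>, and the others agree on both
  sides.\<close>

lemma D_braid:
  assumes k: "par k = par (Suc k)" and m: "par (Suc k) = par (Suc (Suc k))"
  shows "D k (D (Suc k) (D k v)) = D (Suc k) (D k (D (Suc k) v))"
proof -
  have "D k (D (Suc k) (D k v)) - D (Suc k) (D k (D (Suc k) v)) = 0"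
  proof (rule skew_zero[where Z = "\<lambda>v. D k (D (Suc k) (D k v)) - D (Suc k) (D k (D (Suc k) v))"])
    fix l v
    let ?K = "Suc k"
    define s where "s = sg k l"
    have sK: "sg ?K x = sg k x" for x by (rule sg_Suc(1)[OF k])
    have sk: "sg k ?K = sg k k" "sg k (Suc ?K) = sg k k" using sg_Suc(2)[OF k, of k] sg_Suc(2)[OF m, of k] by auto
    define e where "e = sg k k"
    have a: "D k (Xo k w) = pscale e (Xo ?K (D k w)) - pscale e w" "D k (Xo ?K w) = pscale e (Xo k (D k w)) + w"
      "D k (Xo (Suc ?K) w) = pscale e (Xo (Suc ?K) (D k w))" for w
      using D_Xo[OF k, of _ w] by (simp_all add: sk cc_def sfun_apply e_def)
    have b: "D ?K (Xo ?K w) = pscale e (Xo (Suc ?K) (D ?K w)) - pscale e w" "D ?K (Xo (Suc ?K) w) = pscale e (Xo ?K (D ?K w)) + w"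
      "D ?K (Xo k w) = pscale e (Xo k (D ?K w))" for w
      using D_Xo[OF m, of _ w] by (simp_all add: sk sK cc_def sfun_apply e_def)
    have ee: "e * e = 1" by (simp add: e_def)
    have dd: "D k (D k w) = 0" "D ?K (D ?K w) = 0" for w using DD[OF k] DD[OF m] by auto
    consider "l = k" | "l = ?K" | "l = Suc ?K" | "l \<noteq> k" "l \<noteq> ?K" "l \<noteq> Suc ?K" by blast
    then have "D k (D ?K (D k (Xo l v))) - D ?K (D k (D ?K (Xo l v))) =
      pscale (sg k l) (Xo (sfun k (sfun ?K (sfun k l))) (D k (D ?K (D k v)) - D ?K (D k (D ?K v))))"
    proof cases
      case 1
      then show ?thesis
        by (simp add: a b dd D_simps Xo_simps sfun_apply ee e_def[symmetric] PS.scale_right_diff_distrib)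
    next
      case 2
      then show ?thesis
        by (simp add: a b dd D_simps Xo_simps sfun_apply ee e_def[symmetric] sk PS.scale_right_diff_distrib)
    next
      case 3
      then show ?thesis
        by (simp add: a b dd D_simps Xo_simps sfun_apply ee e_def[symmetric] sk PS.scale_right_diff_distrib)
    next
      case 4
      then have "D k (Xo l w) = pscale (sg k l) (Xo l (D k w))" "D ?K (Xo l w) = pscale (sg k l) (Xo l (D ?K w))"
        "sfun k (sfun ?K (sfun k l)) = l" for w
        by (simp_all add: D_Xo[OF k] D_Xo[OF m] cc_def sfun_apply sK)
      then show ?thesis
        by (simp add: D_simps Xo_simps PS.scale_right_diff_distrib)
    qed
    then show "\<exists>c m'. D k (D ?K (D k (Xo l v))) - D ?K (D k (D ?K (Xo l v))) =
      pscale c (Xo m' (D k (D ?K (D k v)) - D ?K (D k (D ?K v))))" by blast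
  qed (simp_all add: lin_minus D_simps)
  then show ?thesis by simp
qed

end

context superpoly
begin

lemma pow_lin:
  fixes F :: "'k spoly \<Rightarrow> 'k spoly"
  assumes "lin F" shows "(F ^^ r) (pscale c v) = pscale c ((F ^^ r) v)"
  using lin_scale[OF lin_pow[OF assms, of r]] .

lemma Xo_pow_Xw: "(Xo k ^^ r) v = Xw (replicate r k) v"
  by (induction r) simp_all

lemma Xo_pow_comm: "m \<noteq> k \<Longrightarrow> Xo m ((Xo k ^^ r) v) = pscale (sg m k ^ r) ((Xo k ^^ r) (Xo m v))"
proof (induction r)
  case (Suc r)
  then show ?case by (simp add: Xo_comm[of m k] Xo_simps mult.commute)
qed simp

lemma sg_pow_even: "(par k \<Longrightarrow> even r) \<Longrightarrow> sg m k ^ r = 1" "(par k \<Longrightarrow> even r) \<Longrightarrow> sg k m ^ r = 1"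
  by (auto simp: sg_def)

lemma Xo_pow_even: "(par k \<Longrightarrow> even r) \<Longrightarrow> Xo m ((Xo k ^^ r) v) = (Xo k ^^ r) (Xo m v)"
  using Xo_pow_comm[of m k r v] sg_pow_even(1)[of k r m] funpow_swap1[of "Xo k" r v] by (cases "m = k") auto

lemma Xo_pow_even_pow: "(par k \<Longrightarrow> even r) \<Longrightarrow> (Xo m ^^ s) ((Xo k ^^ r) v) = (Xo k ^^ r) ((Xo m ^^ s) v)"
  by (induction s) (simp_all add: Xo_pow_even)

lemma D_pow_far:
  "par a = par (Suc a) \<Longrightarrow> k \<noteq> a \<Longrightarrow> k \<noteq> Suc a \<Longrightarrow> D a ((Xo k ^^ r) v) = pscale (sg a k ^ r) ((Xo k ^^ r) (D a v))"
proof (induction r)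
  case (Suc r)
  then show ?case by (simp add: D_Xo cc_def sfun_apply Xo_simps mult.commute)
qed simp

lemma D_pow_even:
  "par a = par (Suc a) \<Longrightarrow> k \<noteq> a \<Longrightarrow> k \<noteq> Suc a \<Longrightarrow> (par k \<Longrightarrow> even r) \<Longrightarrow> D a ((Xo k ^^ r) v) = (Xo k ^^ r) (D a v)"
  using D_pow_far[of a k r v] sg_pow_even(1)[of k r a] by simp

subsection \<open>Right multiplication, twists, and degree in one variable\<close>

text \<open>The product of the argument with \<open>g\<close> standing on its right. As
  \<open>K\<close> below is a left ideal, the multiples of a generator have this form.\<close>

definition Rg :: "'k spoly \<Rightarrow> 'k spoly \<Rightarrow> 'k spoly" where "Rg g = plin (\<lambda>M. Xw (desc M) g)"

lemma lin_Rg [simp]: "lin (Rg g)" unfolding Rg_def by (rule lin_plin)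
lemma lin_Rg_comp [simp]: "lin F \<Longrightarrow> lin (\<lambda>v. Rg g (F v))" by (rule lin_comp[OF lin_Rg])
lemmas Rg_simps = lin_simps[OF lin_Rg]

lemma Rg_bas: "Rg g (bas M) = Xw (desc M) g" by (simp add: Rg_def)
lemma Rg_one [simp]: "Rg g one = g" by (simp add: one_def Rg_bas)

lemma Rg_Xo: "Rg g (Xo k v) = Xo k (Rg g v)"
proof (rule lin_eqI[where F = "\<lambda>v. Rg g (Xo k v)" and G = "\<lambda>v. Xo k (Rg g v)"])
  fix M
  have top: "Rg g (Xo k (bas M)) = Xo k (Rg g (bas M))" if "\<forall>x\<in>#M. x \<le> k" for k M
    using that by (simp add: Xo_bas_top Rg_bas desc_add)
  show "Rg g (Xo k (bas M)) = Xo k (Rg g (bas M))"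
  proof (induction "size M" arbitrary: M rule: less_induct)
    case less
    show ?case
    proof (cases "\<forall>x\<in>#M. x \<le> k")
      case True then show ?thesis by (rule top)
    next
      case False
      define j where "j = Max (set_mset M)"
      have ne: "M \<noteq> {#}" using False by auto
      then have jM: "j \<in># M" unfolding j_def by (intro Max_in) auto
      have jmax: "\<forall>x\<in>#M. x \<le> j" unfolding j_def by simp
      obtain x where "x \<in># M" "k < x" using False by (auto simp: not_le)
      then have kj: "k < j" using jmax by (auto intro: less_le_trans)
      define M' where "M' = M - {#j#}"
      have M: "M = add_mset j M'" using jM by (simp add: M'_def)
      have jM': "\<forall>x\<in>#M'. x \<le> j" using jmax M by auto
      have b: "bas M = Xo j (bas M')" using Xo_bas_top[OF jM'] M by simp
      have t2: "Rg g (Xo j (Xo k (bas M'))) = Xo j (Rg g (Xo k (bas M')))"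
      proof -
        have "\<forall>x\<in>#add_mset k M'. x \<le> j" using jM' kj by auto
        note t = top[OF this]
        show ?thesis unfolding Xo_bas[of k] Xo_simps Rg_simps t by simp
      qed
      have "Rg g (Xo k (bas M)) = pscale (sg k j) (Rg g (Xo j (Xo k (bas M'))))"
        unfolding b using kj by (subst Xo_comm) (simp_all add: Rg_simps)
      also have "\<dots> = pscale (sg k j) (Xo j (Xo k (Rg g (bas M'))))" using t2 less[of M'] M by simp
      also have "\<dots> = Xo k (Xo j (Rg g (bas M')))" using kj Xo_comm[of k j "Rg g (bas M')"] by simp
      finally show ?thesis unfolding b by (simp add: top[OF jM'])
    qed
  qed
qed simp_all

lemma Rg_Xw: "Rg g (Xw u v) = Xw u (Rg g v)"
  by (induction u) (simp_all add: Rg_Xo)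

lemma Rg_pow: "Rg g ((Xo k ^^ r) v) = (Xo k ^^ r) (Rg g v)"
  unfolding Xo_pow_Xw by (rule Rg_Xw)

text \<open>The Leibniz rule strips off left factors one by one; what remains at the right end is
  \<open>D k g\<close>, which is 0 by hypothesis.\<close>

lemma Rg_D:
  assumes k: "par k = par (Suc k)" and g: "D k g = 0"
  shows "D k (Rg g v) = Rg g (D k v)"
proof (rule lin_eq_wordsI[where F = "\<lambda>v. D k (Rg g v)" and G = "\<lambda>v. Rg g (D k v)"])
  fix u show "D k (Rg g (Xw u one)) = Rg g (D k (Xw u one))"
    by (induction u) (simp_all add: g Rg_simps Rg_Xo D_Xo[OF k])
qed simp_all

text \<open>A rescaling of the variables. It appears when a power of an odd variable is moved from
  the right end of a polynomial to the left, as in \<open>Rg_monomial\<close>.\<close>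

definition Tw :: "(nat \<Rightarrow> 'k) \<Rightarrow> 'k spoly \<Rightarrow> 'k spoly" where
  "Tw \<theta> = plin (\<lambda>M. pscale (\<Prod>k\<in>#M. \<theta> k) (bas M))"

lemma lin_Tw [simp]: "lin (Tw \<theta>)" unfolding Tw_def by (rule lin_plin)
lemma lin_Tw_comp [simp]: "lin F \<Longrightarrow> lin (\<lambda>v. Tw \<theta> (F v))" by (rule lin_comp[OF lin_Tw])
lemmas Tw_simps = lin_simps[OF lin_Tw]

lemma Tw_one [simp]: "Tw \<theta> one = one" by (simp add: Tw_def one_def)

lemma Tw_Xo: "Tw \<theta> (Xo k v) = pscale (\<theta> k) (Xo k (Tw \<theta> v))"
  by (rule lin_eqI[where F = "\<lambda>v. Tw \<theta> (Xo k v)" and G = "\<lambda>v. pscale (\<theta> k) (Xo k (Tw \<theta> v))"])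
    (simp_all add: lin_pscale Xo_bas Xo_simps Tw_simps, simp add: Tw_def mult_ac Xo_bas Xo_simps)

lemma Tw_pow: "Tw \<theta> ((Xo k ^^ r) v) = pscale (\<theta> k ^ r) ((Xo k ^^ r) (Tw \<theta> v))"
  by (induction r) (simp_all add: Tw_Xo Xo_simps mult.commute)

lemma Tw_Tw: assumes "\<And>k. \<theta> k * \<theta> k = 1" shows "Tw \<theta> (Tw \<theta> v) = v"
proof (rule lin_eqI[where F = "\<lambda>v. Tw \<theta> (Tw \<theta> v)" and G = "\<lambda>v. v"])
  fix M
  have "(\<Prod>k\<in>#M. \<theta> k) * (\<Prod>k\<in>#M. \<theta> k) = 1"
    by (induction M) (simp_all add: assms, metis assms mult.assoc mult.commute mult_1)
  then show "Tw \<theta> (Tw \<theta> (bas M)) = bas M" by (simp add: Tw_def Tw_simps lin_scale[OF lin_plin])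
qed (simp_all add: lin_id)

lemma Tw_Xw: assumes "\<And>k. \<theta> k * \<theta> k = 1" shows "\<exists>c. c * c = 1 \<and> Tw \<theta> (Xw u v) = pscale c (Xw u (Tw \<theta> v))"
proof (induction u)
  case Nil then show ?case by (intro exI[of _ 1]) simp
next
  case (Cons k u)
  then obtain c where "c * c = 1" "Tw \<theta> (Xw u v) = pscale c (Xw u (Tw \<theta> v))" by blast
  moreover have "(\<theta> k * c) * (\<theta> k * c) = 1" using \<open>c * c = 1\<close> assms[of k] by (metis mult.assoc mult.commute mult_1)
  ultimately show ?case by (intro exI[of _ "\<theta> k * c"]) (simp add: Tw_Xo Xo_simps)
qed

lemma Tw_D:
  assumes k: "par k = par (Suc k)" and \<theta>: "\<theta> k = \<theta> (Suc k)" "\<theta> k * \<theta> k = 1"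
  shows "Tw \<theta> (D k v) = pscale (\<theta> k) (D k (Tw \<theta> v))"
proof (rule lin_eq_wordsI[where F = "\<lambda>v. Tw \<theta> (D k v)" and G = "\<lambda>v. pscale (\<theta> k) (D k (Tw \<theta> v))"])
  fix u show "Tw \<theta> (D k (Xw u one)) = pscale (\<theta> k) (D k (Tw \<theta> (Xw u one)))"
  proof (induction u)
    case Nil then show ?case by (simp add: Tw_simps)
  next
    case (Cons l u)
    let ?w = "Xw u one"
    have s: "\<theta> (sfun k l) = \<theta> l" using \<theta> by (auto simp: sfun_apply)
    have c: "\<theta> k * \<theta> l * cc k l = cc k l" using \<theta> by (auto simp: cc_def)
    have "Tw \<theta> (D k (Xo l ?w)) = pscale (sg k l * \<theta> l * \<theta> k) (Xo (sfun k l) (D k (Tw \<theta> ?w))) + pscale (cc k l) (Tw \<theta> ?w)"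
      using Cons by (simp add: D_Xo[OF k] Tw_simps Tw_Xo Xo_simps s)
    moreover have "pscale (\<theta> k) (D k (Tw \<theta> (Xo l ?w))) =
        pscale (sg k l * \<theta> l * \<theta> k) (Xo (sfun k l) (D k (Tw \<theta> ?w))) + pscale (\<theta> k * \<theta> l * cc k l) (Tw \<theta> ?w)"
      by (simp add: Tw_Xo D_simps D_Xo[OF k] PS.scale_right_distrib mult_ac)
    ultimately show ?case using c by simp
  qed
qed (simp_all add: lin_pscale)

text \<open>A left inverse of multiplication by x_l, with value 0 on monomials that do not contain
  it. It serves to cancel powers of a variable modulo \<open>K\<close>.\<close>

definition Yo :: "nat \<Rightarrow> 'k spoly \<Rightarrow> 'k spoly" where
  "Yo l = plin (\<lambda>M. if l \<in># M then pscale (sgX l (M - {#l#})) (bas (M - {#l#})) else 0)"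

lemma lin_Yo [simp]: "lin (Yo l)" unfolding Yo_def by (rule lin_plin)
lemma lin_Yo_comp [simp]: "lin F \<Longrightarrow> lin (\<lambda>v. Yo l (F v))" by (rule lin_comp[OF lin_Yo])
lemmas Yo_simps = lin_simps[OF lin_Yo]

lemma Yo_one [simp]: "Yo l one = 0" by (simp add: Yo_def one_def)

lemma Yo_Xo: "Yo l (Xo l v) = v"
  by (rule lin_eqI[where F = "\<lambda>v. Yo l (Xo l v)" and G = "\<lambda>v. v"])
    (simp_all add: lin_id Xo_bas Yo_simps, simp add: Yo_def)

lemma Yo_Xo_neq: assumes "k \<noteq> l" shows "Yo l (Xo k v) = pscale (sg l k) (Xo k (Yo l v))"
proof (rule lin_eqI[where F = "\<lambda>v. Yo l (Xo k v)" and G = "\<lambda>v. pscale (sg l k) (Xo k (Yo l v))"])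
  fix M
  show "Yo l (Xo k (bas M)) = pscale (sg l k) (Xo k (Yo l (bas M)))"
  proof (cases "l \<in># M")
    case False
    then have "Yo l (bas M) = 0" "Yo l (bas (add_mset k M)) = 0" using assms by (simp_all add: Yo_def)
    then show ?thesis by (simp add: Xo_bas Yo_simps Xo_simps)
  next
    case True
    then obtain M' where M: "M = add_mset l M'" by (metis insert_DiffM)
    have 1: "Yo l (bas M) = pscale (sgX l M') (bas M')" by (simp add: Yo_def M)
    have 2: "Yo l (bas (add_mset k M)) = pscale (sgX l (add_mset k M')) (bas (add_mset k M'))"
      by (simp add: Yo_def M add_mset_commute[of k l])
    have "sgX k M * sgX l (add_mset k M') = sg l k * sgX l M' * sgX k M'"
      using assms by (auto simp: M sgX_add sg_def)
    then show ?thesis by (simp add: Xo_bas Yo_simps Xo_simps 1 2 mult_ac)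
  qed
qed (simp_all add: lin_pscale)

text \<open>The homogeneous component of degree \<open>i\<close> in the variable
  \<open>l\<close>.\<close>

definition pr :: "nat \<Rightarrow> nat \<Rightarrow> 'k spoly \<Rightarrow> 'k spoly" where
  "pr l i = plin (\<lambda>M. if count M l = i then bas M else 0)"

lemma lin_pr [simp]: "lin (pr l i)" unfolding pr_def by (rule lin_plin)
lemmas pr_simps = lin_simps[OF lin_pr]

lemma pr_bas: "pr l i (bas M) = (if count M l = i then bas M else 0)" by (simp add: pr_def)

lemma pr_Xw_one: "pr l i (Xw u one) = (if count_list u l = i then Xw u one else 0)"
proof -
  obtain c where "Xw u one = pscale c (bas (mset u))" using Xw_bas[of u "{#}"] by (auto simp: one_def)
  then show ?thesis by (simp add: pr_simps pr_bas count_mset)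
qed

definition free_of :: "nat \<Rightarrow> 'k spoly \<Rightarrow> bool" where
  "free_of l g \<longleftrightarrow> g \<in> PS.span {Xw u one | u. l \<notin> set u}"

lemma span_lin:
  assumes "lin F" "a \<in> PS.span S" "\<And>s. s \<in> S \<Longrightarrow> F s \<in> U" "PS.subspace U"
  shows "F a \<in> U"
proof -
  have "PS.subspace {x. F x \<in> U}"
    by (rule PS.subspaceI) (simp_all add: lin_simps[OF assms(1)] PS.subspace_0[OF assms(4)]
        PS.subspace_add[OF assms(4)] PS.subspace_scale[OF assms(4)])
  then have "PS.span S \<subseteq> {x. F x \<in> U}" using assms(3) by (intro PS.span_minimal) auto
  then show ?thesis using assms(2) by auto
qed

lemma span_lin_eq:
  assumes "lin F" "lin G" "a \<in> PS.span S" "\<And>s. s \<in> S \<Longrightarrow> F s = G s" shows "F a = G a"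
proof -
  have "F a - G a \<in> {0}"
    by (rule span_lin[OF lin_minus[OF assms(1,2)] assms(3)]) (use assms(4) in auto)
  then show ?thesis by simp
qed

lemma pr_Xw_free:
  assumes "free_of l g"
  shows "pr l i (Xw u g) = (if count_list u l = i then Xw u g else 0)"
proof -
  let ?G = "\<lambda>w. if count_list u l = i then Xw u w else 0"
  have G: "lin ?G" by (cases "count_list u l = i") (simp_all add: lin_0)
  show ?thesis
  proof (rule span_lin_eq[where F = "\<lambda>w. pr l i (Xw u w)" and G = ?G, OF _ G assms[unfolded free_of_def]])
    show "lin (\<lambda>w. pr l i (Xw u w))" by (rule lin_comp[OF lin_pr lin_Xw])
    fix s assume "s \<in> {Xw u one | u. l \<notin> set u}"
    then obtain u' where u': "s = Xw u' one" "l \<notin> set u'" by auto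
    then have s: "Xw u s = Xw (u @ u') one" by simp
    show "pr l i (Xw u s) = ?G s" unfolding s pr_Xw_one using u' by (simp add: count_list_0_iff)
  qed
qed

lemma Yo_free: assumes "free_of l g" shows "Yo l g = 0"
proof (rule span_lin_eq[where F = "Yo l" and G = "\<lambda>v. 0", OF _ _ assms[unfolded free_of_def]])
  fix s assume "s \<in> {Xw u one | u. l \<notin> set u}"
  then obtain u where "s = Xw u one" "l \<notin> set u" by auto
  then show "Yo l s = 0" by (induction u arbitrary: s) (simp_all add: Yo_Xo_neq Xo_simps)
qed (simp_all add: lin_0)

lemma Rg_monomial:
  "Rg ((Xo l ^^ r) one) v = (Xo l ^^ r) (Tw (\<lambda>k. if k = l then 1 else sg l k ^ r) v)"
proof (rule lin_eq_wordsI[where F = "Rg ((Xo l ^^ r) one)" and G = "\<lambda>v. (Xo l ^^ r) (Tw (\<lambda>k. if k = l then 1 else sg l k ^ r) v)"])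
  fix u
  show "Rg ((Xo l ^^ r) one) (Xw u one) = (Xo l ^^ r) (Tw (\<lambda>k. if k = l then 1 else sg l k ^ r) (Xw u one))"
  proof (induction u)
    case (Cons k u)
    let ?w = "Tw (\<lambda>k. if k = l then 1 else sg l k ^ r) (Xw u one)"
    have "Xo k ((Xo l ^^ r) ?w) = pscale (if k = l then 1 else sg l k ^ r) ((Xo l ^^ r) (Xo k ?w))"
      using Xo_pow_comm[of k l r ?w] funpow_swap1[of "Xo l" r ?w] by (simp add: sg_sym[of k l])
    then show ?case using Cons by (simp add: Rg_Xo Tw_Xo pow_lin)
  qed simp
qed (simp_all add: lin_comp[OF lin_pow[OF lin_Xo] lin_Tw])

end

section \<open>The polynomials Q as central operators, and their divided differences\<close>

definition hsum :: "('a \<Rightarrow> 'a) \<Rightarrow> ('a \<Rightarrow> 'a) \<Rightarrow> nat \<Rightarrow> 'a \<Rightarrow> 'a::comm_monoid_add" where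
  "hsum F G r v = (\<Sum>k<r. (F ^^ k) ((G ^^ (r - 1 - k)) v))"

lemma twice_pow: "((\<lambda>v. f (f v)) ^^ m) v = (f ^^ (2 * m)) v"
  by (induction m arbitrary: v) (simp_all add: funpow_swap1)

text \<open>The numerical hypotheses are of the same kind as in the spanning argument, together with
  positivity of all \<open>N k\<close>; if that fails, the index set of the basis is empty.
  \<open>t_even\<close> is what makes the operators \<open>qo\<close> commute with every
  variable.\<close>

locale cyc_poly = superpoly par ty + col_blocks n col
  for par :: "nat \<Rightarrow> bool" and ty :: "'k::field itself" and n and col :: "nat \<Rightarrow> 'i" +
  fixes t :: "'i \<Rightarrow> 'i \<Rightarrow> nat \<Rightarrow> nat \<Rightarrow> 'k" and Lam :: "'i \<Rightarrow> nat" and mm :: "'i \<Rightarrow> 'i \<Rightarrow> nat"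
    and N :: "nat \<Rightarrow> nat"
  assumes par_col: "\<And>k l. k \<in> {1..n} \<Longrightarrow> l \<in> {1..n} \<Longrightarrow> col k = col l \<Longrightarrow> par k = par l"
    and t_even: "\<And>k l r s. k \<in> {1..n} \<Longrightarrow> l \<in> {1..n} \<Longrightarrow> t (col k) (col l) r s \<noteq> 0 \<Longrightarrow>
       (par k \<longrightarrow> even r) \<and> (par l \<longrightarrow> even s)"
    and t_sym: "\<And>k l r s. k \<in> {1..n} \<Longrightarrow> l \<in> {1..n} \<Longrightarrow> t (col k) (col l) r s = t (col l) (col k) s r"
    and Qfin: "\<And>k l. k \<in> {1..n} \<Longrightarrow> l \<in> {1..n} \<Longrightarrow> finite (Qsupp t (col k) (col l))"
    and Qlead: "\<And>k l. k \<in> {1..n} \<Longrightarrow> l \<in> {1..n} \<Longrightarrow> col k \<noteq> col l \<Longrightarrow>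
       t (col k) (col l) (mm (col k) (col l)) 0 \<noteq> 0"
    and Qlow: "\<And>k l r s. k \<in> {1..n} \<Longrightarrow> l \<in> {1..n} \<Longrightarrow> col k \<noteq> col l \<Longrightarrow> t (col k) (col l) r s \<noteq> 0 \<Longrightarrow>
       r < mm (col k) (col l) \<or> (r = mm (col k) (col l) \<and> s = 0)"
    and N_first: "\<And>f. f \<in> {1..n} \<Longrightarrow> f = 1 \<or> col (f - 1) \<noteq> col f \<Longrightarrow>
       N f = Lam (col f) + (\<Sum>q\<in>{1..<f}. mm (col f) (col q))"
    and N_next: "\<And>a. a \<in> {1..<n} \<Longrightarrow> col a = col (Suc a) \<Longrightarrow> N (Suc a) = N a - 1"
    and N_pos: "\<And>k. k \<in> {1..n} \<Longrightarrow> 0 < N k"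
begin

text \<open>Outside \<open>{1..n}\<close> the operator is the identity by default, so that the
  commutation laws need no hypotheses on positions.\<close>

definition qo :: "nat \<Rightarrow> nat \<Rightarrow> 'k spoly \<Rightarrow> 'k spoly" where
  "qo k l v = (if k \<in> {1..n} \<and> l \<in> {1..n} then
     (\<Sum>(r, s)\<in>Qsupp t (col k) (col l). pscale (t (col k) (col l) r s) ((Xo k ^^ r) ((Xo l ^^ s) v))) else v)"

lemma lin_XX: "lin (\<lambda>v. (Xo k ^^ r) ((Xo l ^^ s) v))"
  by (rule lin_comp[OF lin_pow[OF lin_Xo] lin_pow[OF lin_Xo]])

lemma lin_qo [simp]: "lin (qo k l)"
proof (cases "k \<in> {1..n} \<and> l \<in> {1..n}")
  case True
  then have "qo k l = (\<lambda>v. \<Sum>x\<in>Qsupp t (col k) (col l). pscale (t (col k) (col l) (fst x) (snd x)) ((Xo k ^^ fst x) ((Xo l ^^ snd x) v)))"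
    by (simp add: qo_def fun_eq_iff case_prod_beta)
  then show ?thesis by (simp only: lin_sums lin_pscale lin_XX)
next
  case False
  then have "qo k l = (\<lambda>v. v)" by (auto simp: qo_def fun_eq_iff)
  then show ?thesis by (simp add: lin_id)
qed

lemma lin_qo_comp [simp]: "lin F \<Longrightarrow> lin (\<lambda>v. qo k l (F v))" by (rule lin_comp[OF lin_qo])
lemmas qo_simps = lin_simps[OF lin_qo]

lemma XX_even:
  assumes "k \<in> {1..n}" "l \<in> {1..n}" "t (col k) (col l) r s \<noteq> 0"
  shows "Xo m ((Xo k ^^ r) ((Xo l ^^ s) v)) = (Xo k ^^ r) ((Xo l ^^ s) (Xo m v))"
  using t_even[OF assms] by (simp add: Xo_pow_even)

lemma qo_Xo: "qo k l (Xo m v) = Xo m (qo k l v)"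
proof (cases "k \<in> {1..n} \<and> l \<in> {1..n}")
  case True
  then show ?thesis unfolding qo_def
    by (auto simp: Xo_simps XX_even Qsupp_def intro!: sum.cong)
qed (auto simp: qo_def)

lemma qo_pow: "qo k l ((Xo m ^^ r) v) = (Xo m ^^ r) (qo k l v)"
  by (induction r) (simp_all add: qo_Xo)

lemma qo_qo: "qo k l (qo k' l' v) = qo k' l' (qo k l v)"
proof (cases "k' \<in> {1..n} \<and> l' \<in> {1..n}")
  case True
  have "qo k l (\<Sum>x\<in>S. pscale (c x) ((Xo k' ^^ f x) ((Xo l' ^^ g x) v))) =
      (\<Sum>x\<in>S. pscale (c x) ((Xo k' ^^ f x) ((Xo l' ^^ g x) (qo k l v))))" for S :: "(nat \<times> nat) set" and c f g
    by (simp add: qo_simps qo_pow)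
  then show ?thesis using True unfolding qo_def[of k' l'] by (simp add: case_prod_beta)
qed (auto simp: qo_def)

lemma qo_sym: "qo k l v = qo l k v"
proof (cases "k \<in> {1..n} \<and> l \<in> {1..n}")
  case True
  have S: "Qsupp t (col l) (col k) = prod.swap ` Qsupp t (col k) (col l)"
    using True by (auto simp: Qsupp_def t_sym[of l k] image_iff)
  have "qo l k v = (\<Sum>(r, s)\<in>Qsupp t (col k) (col l). pscale (t (col l) (col k) s r) ((Xo l ^^ s) ((Xo k ^^ r) v)))"
    using True unfolding qo_def S by (subst sum.reindex) (auto simp: case_prod_beta)
  also have "\<dots> = qo k l v"
    unfolding qo_def using True t_even[of k l] t_sym[of k l]
    by (auto simp: Qsupp_def Xo_pow_even_pow intro!: sum.cong)
  finally show ?thesis by simp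
qed (auto simp: qo_def)

definition internal :: "nat \<Rightarrow> bool" where
  "internal a \<longleftrightarrow> 1 \<le> a \<and> a < n \<and> col a = col (Suc a)"

lemma int_par: "internal a \<Longrightarrow> par a = par (Suc a)"
  unfolding internal_def by (intro par_col) auto

lemma qo_D_far:
  assumes a: "internal a" and "k \<notin> {a, Suc a}" "l \<notin> {a, Suc a}"
  shows "D a (qo k l v) = qo k l (D a v)"
proof (cases "k \<in> {1..n} \<and> l \<in> {1..n}")
  case True
  have "D a ((Xo k ^^ r) ((Xo l ^^ s) v)) = (Xo k ^^ r) ((Xo l ^^ s) (D a v))" if "t (col k) (col l) r s \<noteq> 0" for r s
    using t_even[of k l r s] that True assms D_pow_even[OF int_par[OF a]] by simp
  then show ?thesis using True unfolding qo_def by (auto simp: D_simps Qsupp_def intro!: sum.cong)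
qed (auto simp: qo_def)

text \<open>\<open>delta a\<close> and \<open>hpow a r\<close> factor the divided difference of a
  power. In the odd case the exponent is even, the quotient is taken with respect to the squares,
  and the factor x_(a+1) - x_a remains; this is the shape of the right-hand side of the braid
  relation.\<close>

definition delta :: "nat \<Rightarrow> 'k spoly \<Rightarrow> 'k spoly" where
  "delta a v = (if par a then Xo (Suc a) v - Xo a v else v)"

definition hpow :: "nat \<Rightarrow> nat \<Rightarrow> 'k spoly \<Rightarrow> 'k spoly" where
  "hpow a r v = (if par a then
      (\<Sum>k<r div 2. (Xo (Suc a) ^^ (2 * k)) ((Xo a ^^ (2 * (r div 2 - 1 - k))) v))
    else (\<Sum>k<r. (Xo (Suc a) ^^ k) ((Xo a ^^ (r - 1 - k)) v)))"

lemma lin_delta [simp]: "lin (delta a)"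
  unfolding delta_def by (cases "par a") (simp_all add: lin_id lin_minus)
lemmas delta_simps = lin_simps[OF lin_delta]

lemma lin_hpow [simp]: "lin (hpow a r)"
  unfolding hpow_def by (cases "par a") (simp_all add: lin_sums lin_XX)

text \<open>An abstract form that serves both parities: \<open>F\<close> and \<open>G\<close> are
  the two variables in the even case and their squares in the odd case, and \<open>d\<close> is
  \<open>delta\<close>. \<open>hsum\<close> plays the part of the quotient (F^r - G^r)/(F -
  G).\<close>

lemma D_hsum:
  assumes lF: "lin F" and lG: "lin G" and ld: "lin d"
    and FG: "\<And>v. F (G v) = G (F v)" and dF: "\<And>v. F (d v) = d (F v)" and dG: "\<And>v. G (d v) = d (G v)"
    and DF: "\<And>v. D a (F v) = G (D a v) + d v" and DG: "\<And>v. D a (G v) = F (D a v) - d v"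
  shows "D a ((F ^^ r) v) = (G ^^ r) (D a v) + d (hsum F G r v)"
    "D a ((G ^^ r) v) = (F ^^ r) (D a v) - d (hsum F G r v)"
proof -
  have FGp: "G ((F ^^ k) v) = (F ^^ k) (G v)" for k v by (induction k) (simp_all add: FG[symmetric])
  have h1: "hsum F G (Suc r) v = G (hsum F G r v) + (F ^^ r) v" for r
  proof -
    have "G ((F ^^ k) ((G ^^ (r - 1 - k)) v)) = (F ^^ k) ((G ^^ (r - k)) v)" if "k < r" for k
    proof -
      have "r - k = Suc (r - 1 - k)" using that by simp
      then show ?thesis by (simp add: FGp)
    qed
    then show ?thesis by (simp add: hsum_def lin_simps[OF lG])
  qed
  have h2: "hsum F G (Suc r) v = F (hsum F G r v) + (G ^^ r) v" for r
    unfolding hsum_def by (subst sum.lessThan_Suc_shift) (simp add: lin_simps[OF lF] add.commute diff_Suc_eq_diff_pred)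
  show "D a ((F ^^ r) v) = (G ^^ r) (D a v) + d (hsum F G r v)"
  proof (induction r)
    case (Suc r)
    then show ?case by (simp add: DF h1 lin_simps[OF lG] lin_simps[OF ld] dG add.assoc)
  qed (simp add: hsum_def lin_simps[OF ld])
  show "D a ((G ^^ r) v) = (F ^^ r) (D a v) - d (hsum F G r v)"
  proof (induction r)
    case (Suc r)
    then show ?case by (simp add: DG h2 lin_simps[OF lF] lin_simps[OF ld] dF diff_diff_eq)
  qed (simp add: hsum_def lin_simps[OF ld])
qed

lemma D_pow:
  assumes a: "internal a" and r: "par a \<Longrightarrow> even r"
  shows "D a ((Xo (Suc a) ^^ r) v) = (Xo a ^^ r) (D a v) + delta a (hpow a r v)"
    "D a ((Xo a ^^ r) v) = (Xo (Suc a) ^^ r) (D a v) - delta a (hpow a r v)"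
proof -
  note p = int_par[OF a]
  have D1: "D a (Xo (Suc a) w) = pscale (sg a a) (Xo a (D a w)) + w"
    "D a (Xo a w) = pscale (sg a a) (Xo (Suc a) (D a w)) - pscale (sg a a) w" for w
    by (simp_all add: D_Xo[OF p] cc_def sfun_apply sg_Suc[OF p])
  have "D a ((Xo (Suc a) ^^ r) v) = (Xo a ^^ r) (D a v) + delta a (hpow a r v) \<and>
    D a ((Xo a ^^ r) v) = (Xo (Suc a) ^^ r) (D a v) - delta a (hpow a r v)"
  proof (cases "par a")
    case False
    then have s: "sg a a = 1" by (simp add: sg_def)
    have c: "Xo (Suc a) (Xo a w) = Xo a (Xo (Suc a) w)" for w
      using Xo_comm[of "Suc a" a w] False by (simp add: sg_def)
    have "hpow a r v = hsum (Xo (Suc a)) (Xo a) r v" using False by (simp add: hpow_def hsum_def)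
    then show ?thesis
      using D_hsum[of "Xo (Suc a)" "Xo a" "\<lambda>v. v" a r v] False by (simp add: delta_def D1 s c lin_id)
  next
    case True
    then have s: "sg a a = - 1" by (simp add: sg_def)
    have c: "Xo (Suc a) (Xo a w) = - Xo a (Xo (Suc a) w)" for w
      using Xo_comm[of "Suc a" a w] True p by (simp add: sg_def)
    obtain m where m: "r = 2 * m" using r[OF True] by auto
    let ?F = "\<lambda>v. Xo (Suc a) (Xo (Suc a) v)" and ?G = "\<lambda>v. Xo a (Xo a v)"
    have h: "hpow a (2 * m) v = hsum ?F ?G m v" using True by (simp add: hpow_def hsum_def m twice_pow)
    have "D a ((?F ^^ m) v) = (?G ^^ m) (D a v) + delta a (hsum ?F ?G m v) \<and>
      D a ((?G ^^ m) v) = (?F ^^ m) (D a v) - delta a (hsum ?F ?G m v)"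
      by (intro conjI; rule D_hsum)
        (use True in \<open>simp_all add: delta_def D1 s c Xo_simps lin_minus algebra_simps\<close>)
    then show ?thesis unfolding m h twice_pow .
  qed
  then show "D a ((Xo (Suc a) ^^ r) v) = (Xo a ^^ r) (D a v) + delta a (hpow a r v)"
    "D a ((Xo a ^^ r) v) = (Xo (Suc a) ^^ r) (D a v) - delta a (hpow a r v)" by simp_all
qed

text \<open>The divided difference of Q in its first variable, which is the right-hand side of the
  braid relation up to a sign.\<close>

definition dq :: "nat \<Rightarrow> nat \<Rightarrow> 'k spoly \<Rightarrow> 'k spoly" where
  "dq a l v = delta a (\<Sum>(r, s)\<in>Qsupp t (col a) (col l). pscale (t (col a) (col l) r s) (hpow a r ((Xo l ^^ s) v)))"

lemma qo_D_next:
  assumes a: "internal a" and l: "l \<in> {1..n}" "l \<notin> {a, Suc a}"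
  shows "D a (qo (Suc a) l v) = qo a l (D a v) + dq a l v"
    "D a (qo a l v) = qo (Suc a) l (D a v) - dq a l v"
proof -
  have r: "a \<in> {1..n}" "Suc a \<in> {1..n}" and c: "col (Suc a) = col a" using a by (auto simp: internal_def)
  have e: "(par a \<longrightarrow> even (fst x)) \<and> (par l \<longrightarrow> even (snd x))" if "x \<in> Qsupp t (col a) (col l)" for x
    using that t_even[OF r(1) l(1)] by (auto simp: Qsupp_def)
  have DXl: "D a ((Xo l ^^ snd x) v) = (Xo l ^^ snd x) (D a v)" if "x \<in> Qsupp t (col a) (col l)" for x
    using D_pow_even[OF int_par[OF a], of l "snd x" v] e[OF that] l by simp
  have 1: "D a ((Xo (Suc a) ^^ fst x) ((Xo l ^^ snd x) v)) =
      (Xo a ^^ fst x) ((Xo l ^^ snd x) (D a v)) + delta a (hpow a (fst x) ((Xo l ^^ snd x) v))"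
    "D a ((Xo a ^^ fst x) ((Xo l ^^ snd x) v)) =
      (Xo (Suc a) ^^ fst x) ((Xo l ^^ snd x) (D a v)) - delta a (hpow a (fst x) ((Xo l ^^ snd x) v))"
    if "x \<in> Qsupp t (col a) (col l)" for x
    using e[OF that] by (simp_all add: D_pow[OF a] DXl[OF that])
  show "D a (qo (Suc a) l v) = qo a l (D a v) + dq a l v"
    using r l by (simp add: qo_def dq_def c case_prod_beta D_simps delta_simps 1 PS.scale_right_distrib sum.distrib)
  show "D a (qo a l v) = qo (Suc a) l (D a v) - dq a l v"
    using r l by (simp add: qo_def dq_def c case_prod_beta D_simps delta_simps 1 PS.scale_right_diff_distrib sum_subtractf)
qed

lemma qo_hpow: "qo k l (hpow a r v) = hpow a r (qo k l v)"
  by (simp add: hpow_def qo_simps qo_pow)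

lemma qo_delta: "qo k l (delta a v) = delta a (qo k l v)"
  by (simp add: delta_def qo_simps qo_Xo)

lemma qo_dq: "qo k l (dq a m v) = dq a m (qo k l v)"
  by (simp add: dq_def qo_delta case_prod_beta qo_simps qo_hpow qo_pow)

text \<open>The product of the two factors is symmetric in x_a and x_(a+1): the corrections
  \<open>dq\<close> have opposite signs, and they cancel because \<open>dq\<close> commutes with
  \<open>qo\<close>.\<close>

lemma D_qo_qo:
  assumes a: "internal a" and l: "l \<in> {1..n}" "l \<notin> {a, Suc a}"
  shows "D a (qo a l (qo (Suc a) l v)) = qo a l (qo (Suc a) l (D a v))"
  by (simp add: qo_D_next[OF assms] qo_simps qo_dq qo_qo[of "Suc a" l a l])

interpretation QC: comp_fun_commute "\<lambda>x. qo (fst x) (snd x)"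
  by standard (simp add: fun_eq_iff qo_qo)

text \<open>The factors commute by \<open>qo_qo\<close>, so the fold over a finite set of pairs does
  not depend on an order.\<close>

definition qo_prod :: "(nat \<times> nat) set \<Rightarrow> 'k spoly \<Rightarrow> 'k spoly" where
  "qo_prod S v = Finite_Set.fold (\<lambda>x. qo (fst x) (snd x)) v S"

lemma qo_prod_empty [simp]: "qo_prod {} v = v" by (simp add: qo_prod_def)

lemma qo_prod_insert: "finite S \<Longrightarrow> (k, l) \<notin> S \<Longrightarrow> qo_prod (insert (k, l) S) v = qo k l (qo_prod S v)"
  by (simp add: qo_prod_def QC.fold_insert)

lemma qo_prod_remove: "finite S \<Longrightarrow> (k, l) \<in> S \<Longrightarrow> qo_prod S v = qo k l (qo_prod (S - {(k, l)}) v)"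
  using qo_prod_insert[of "S - {(k, l)}" k l v] by (simp add: insert_absorb)

lemma lin_qo_prod [simp]: "finite S \<Longrightarrow> lin (qo_prod S)"
proof (induction S rule: finite_induct)
  case (insert x S)
  have "qo_prod (insert x S) = (\<lambda>v. qo (fst x) (snd x) (qo_prod S v))"
    using insert qo_prod_insert[of S "fst x" "snd x"] by (simp add: fun_eq_iff)
  then show ?case using insert by simp
next
  case empty
  have "qo_prod {} = (\<lambda>v. v)" by (simp add: fun_eq_iff)
  then show ?case by (simp add: lin_id)
qed

lemma qo_prod_induct_comm:
  assumes "finite S" and Z: "\<And>k l v. (k, l) \<in> S \<Longrightarrow> Z (qo k l v) = qo k l (Z v)"
  shows "Z (qo_prod S v) = qo_prod S (Z v)"
  using assms
proof (induction S rule: finite_induct)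
  case (insert x S)
  then show ?case using qo_prod_insert[of S "fst x" "snd x"] by simp
qed simp

lemma qo_prod_Xo: "finite S \<Longrightarrow> qo_prod S (Xo m v) = Xo m (qo_prod S v)"
  by (rule qo_prod_induct_comm[symmetric]) (simp_all add: qo_Xo)

lemma qo_prod_pow: "finite S \<Longrightarrow> qo_prod S ((Xo m ^^ r) v) = (Xo m ^^ r) (qo_prod S v)"
  by (induction r) (simp_all add: qo_prod_Xo)

lemma qo_prod_qo: "finite S \<Longrightarrow> qo_prod S (qo k l v) = qo k l (qo_prod S v)"
  by (rule qo_prod_induct_comm[symmetric]) (simp_all add: qo_qo)

lemma qo_prod_union: "finite S \<Longrightarrow> finite S' \<Longrightarrow> S \<inter> S' = {} \<Longrightarrow> qo_prod (S \<union> S') v = qo_prod S (qo_prod S' v)"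
proof (induction S rule: finite_induct)
  case (insert x S)
  have "qo_prod (insert x (S \<union> S')) v = qo (fst x) (snd x) (qo_prod (S \<union> S') v)"
    using insert qo_prod_insert[of "S \<union> S'" "fst x" "snd x"] by simp
  moreover have "qo_prod (insert x S) w = qo (fst x) (snd x) (qo_prod S w)" for w
    using insert qo_prod_insert[of S "fst x" "snd x"] by simp
  ultimately show ?case using insert by simp
qed simp

lemma Rg_qo: "Rg g (qo k l v) = qo k l (Rg g v)"
  by (simp add: qo_def Rg_simps case_prod_beta Rg_pow)

lemma Rg_qo_prod: "finite S \<Longrightarrow> Rg g (qo_prod S v) = qo_prod S (Rg g v)"
  by (rule qo_prod_induct_comm) (simp_all add: Rg_qo)

text \<open>\<open>S\<close> splits into orbits under the exchange of \<open>a\<close> and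
  \<open>Suc a\<close>. A fixed pair commutes with \<open>D a\<close> by \<open>qo_D_far\<close>, an
  orbit of two pairs by \<open>D_qo_qo\<close>, and pairs within \<open>{a, Suc a}\<close> are
  excluded.\<close>

lemma D_qo_prod:
  assumes a: "internal a" and S: "finite S" "S \<subseteq> {1..n} \<times> {1..n}"
    and sym: "\<And>k l. (k, l) \<in> S \<Longrightarrow> (sfun a k, sfun a l) \<in> S"
    and ne: "\<And>k l. (k, l) \<in> S \<Longrightarrow> \<not> (k \<in> {a, Suc a} \<and> l \<in> {a, Suc a})"
  shows "D a (qo_prod S v) = qo_prod S (D a v)"
  using S sym ne
proof (induction "card S" arbitrary: S v rule: less_induct)
  case less
  have sa: "sfun a a = Suc a" "sfun a (Suc a) = a" by (simp_all add: sfun_apply)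
  show ?case
  proof (cases "S = {}")
    case False
    then obtain k l where kl: "(k, l) \<in> S" by auto
    \<comment> \<open>The induction hypothesis after the removal of one orbit
      \<open>R\<close>.\<close>
    have sub: "D a (qo_prod (S - R) w) = qo_prod (S - R) (D a w)" if S': "R \<subseteq> S" "R \<noteq> {}"
      and R: "\<And>k l. (sfun a k, sfun a l) \<in> R \<Longrightarrow> (k, l) \<in> R" for R w
    proof (rule less(1))
      have "S - R \<subset> S" using S' by blast
      then show "card (S - R) < card S" using less(2) by (intro psubset_card_mono)
      show "finite (S - R)" using less(2) by simp
      show "S - R \<subseteq> {1..n} \<times> {1..n}" using less(3) by blast
      show "\<And>k l. (k, l) \<in> S - R \<Longrightarrow> (sfun a k, sfun a l) \<in> S - R" using R less(4) by blast
      show "\<And>k l. (k, l) \<in> S - R \<Longrightarrow> \<not> (k \<in> {a, Suc a} \<and> l \<in> {a, Suc a})" using less(5) by blast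
    qed
    have r: "k \<in> {1..n}" "l \<in> {1..n}" using kl less(3) by auto
    consider "k \<notin> {a, Suc a}" "l \<notin> {a, Suc a}" | "k \<in> {a, Suc a}" "l \<notin> {a, Suc a}" | "l \<in> {a, Suc a}" "k \<notin> {a, Suc a}"
      using less(5)[OF kl] by blast
    then show ?thesis
    proof cases
      case 1
      have sk: "sfun a k = k" and sl: "sfun a l = l" using 1 by (simp_all add: sfun_apply)
      have R: "(k', l') \<in> {(k, l)}" if h: "(sfun a k', sfun a l') \<in> {(k, l)}" for k' l'
      proof -
        have "sfun a k' = sfun a k" "sfun a l' = sfun a l" using h sk sl by simp_all
        then have "sfun a (sfun a k') = sfun a (sfun a k)" "sfun a (sfun a l') = sfun a (sfun a l)"
          by (simp_all only:)
        then show ?thesis by simp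
      qed
      have "D a (qo_prod (S - {(k, l)}) w) = qo_prod (S - {(k, l)}) (D a w)" for w
        by (rule sub[OF _ _ R]) (use kl in simp_all)
      then show ?thesis using qo_prod_remove[OF less(2) kl] qo_D_far[OF a 1] by simp
    next
      case 2
      have sl: "sfun a l = l" using 2 by (auto simp: sfun_apply)
      have m: "(a, l) \<in> S" "(Suc a, l) \<in> S" using less(4)[OF kl] kl 2 sl sa by auto
      let ?S = "S - {(a, l), (Suc a, l)}"
      have R: "(sfun a k', sfun a l') \<in> {(a, l), (Suc a, l)} \<Longrightarrow> (k', l') \<in> {(a, l), (Suc a, l)}" for k' l'
        using sl sa by (metis Pair_inject insert_iff empty_iff sfun_sfun)
      have IH: "D a (qo_prod ?S w) = qo_prod ?S (D a w)" for w by (rule sub[OF _ _ R]) (use m in simp_all)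
      have e: "qo_prod S w = qo a l (qo (Suc a) l (qo_prod ?S w))" for w
      proof -
        have "S - {(a, l)} - {(Suc a, l)} = ?S" by blast
        then show ?thesis
          using qo_prod_remove[OF less(2) m(1), of w] qo_prod_remove[of "S - {(a, l)}" "Suc a" l w] m(2) less(2) by simp
      qed
      show ?thesis unfolding e using D_qo_qo[OF a r(2) 2(2)] IH by simp
    next
      case 3
      have sk: "sfun a k = k" using 3 by (auto simp: sfun_apply)
      have m: "(k, a) \<in> S" "(k, Suc a) \<in> S" using less(4)[OF kl] kl 3 sk sa by auto
      let ?S = "S - {(k, a), (k, Suc a)}"
      have R: "(sfun a k', sfun a l') \<in> {(k, a), (k, Suc a)} \<Longrightarrow> (k', l') \<in> {(k, a), (k, Suc a)}" for k' l'
        using sk sa by (metis Pair_inject insert_iff empty_iff sfun_sfun)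
      have IH: "D a (qo_prod ?S w) = qo_prod ?S (D a w)" for w by (rule sub[OF _ _ R]) (use m in simp_all)
      have e: "qo_prod S w = qo a k (qo (Suc a) k (qo_prod ?S w))" for w
      proof -
        have "S - {(k, a)} - {(k, Suc a)} = ?S" by blast
        then show ?thesis
          using qo_prod_remove[OF less(2) m(1), of w] qo_prod_remove[of "S - {(k, a)}" k "Suc a" w] m(2) less(2)
          by (simp add: qo_sym[of a k] qo_sym[of "Suc a" k])
      qed
      show ?thesis unfolding e using D_qo_qo[OF a r(1) 3(2)] IH by simp
    qed
  qed simp
qed

definition first :: "nat \<Rightarrow> bool" where
  "first f \<longleftrightarrow> f \<in> {1..n} \<and> (f = 1 \<or> col (f - 1) \<noteq> col f)"

text \<open>What the cyclotomic relation becomes when the entry \<open>f\<close> is moved to the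
  front: the cyclotomic power together with the Q of all pairs crossed on the way.\<close>

definition Fo :: "nat \<Rightarrow> 'k spoly \<Rightarrow> 'k spoly" where
  "Fo f v = (Xo f ^^ Lam (col f)) (qo_prod (Pair f ` {1..<f}) v)"

lemma lin_Fo [simp]: "lin (Fo f)"
proof -
  have "lin (\<lambda>v. (Xo f ^^ Lam (col f)) (qo_prod (Pair f ` {1..<f}) v))"
    by (rule lin_comp[OF lin_pow[OF lin_Xo] lin_qo_prod]) simp
  then show ?thesis by (simp add: Fo_def[abs_def])
qed
lemmas Fo_simps = lin_simps[OF lin_Fo]

lemma Fo_Xo: "\<exists>c. Fo f (Xo m v) = pscale c (Xo m (Fo f v))"
proof -
  let ?w = "qo_prod (Pair f ` {1..<f}) v"
  have "\<exists>c. (Xo f ^^ r) (Xo m ?w) = pscale c (Xo m ((Xo f ^^ r) ?w))" for r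
  proof (cases "m = f")
    case True then show ?thesis by (intro exI[of _ 1]) (simp add: funpow_swap1)
  next
    case False
    have "sg m f ^ r * sg m f ^ r = 1" by (simp flip: power_mult_distrib)
    then show ?thesis using Xo_pow_comm[OF False, of r ?w] by (intro exI[of _ "sg m f ^ r"]) simp
  qed
  then show ?thesis by (simp add: Fo_def qo_prod_Xo)
qed

text \<open>As the Q are central, \<open>Fo f\<close> passes variables up to scalars, so its whole
  image lies in the left ideal generated by its value at \<open>one\<close>.\<close>

lemma Fo_span: "Fo f v \<in> PS.span {Xw u (Fo f one) | u. True}"
proof -
  have w: "\<exists>c. Fo f (Xw u one) = pscale c (Xw u (Fo f one))" for u
  proof (induction u)
    case Nil then show ?case by (intro exI[of _ 1]) simp
  next
    case (Cons m u)
    then obtain c where "Fo f (Xw u one) = pscale c (Xw u (Fo f one))" by blast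
    moreover obtain c' where "Fo f (Xo m (Xw u one)) = pscale c' (Xo m (Fo f (Xw u one)))" using Fo_Xo by blast
    ultimately show ?case by (intro exI[of _ "c' * c"]) (simp add: Xo_simps)
  qed
  have "Fo f v = (\<Sum>M\<in>Poly_Mapping.keys v. pscale (Poly_Mapping.lookup v M) (Fo f (bas M)))"
    by (subst poly_decomp[of v]) (simp add: Fo_simps)
  also have "\<dots> \<in> PS.span {Xw u (Fo f one) | u. True}"
  proof (intro PS.span_sum PS.span_scale)
    fix M
    obtain c where c: "Fo f (bas M) = pscale c (Xw (desc M) (Fo f one))"
      using w[of "desc M"] unfolding bas_Xw[of M, symmetric] by blast
    show "Fo f (bas M) \<in> PS.span {Xw u (Fo f one) | u. True}"
      unfolding c by (intro PS.span_scale PS.span_base) blast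
  qed
  finally show ?thesis .
qed

lemma Rg_Fo: "Rg g (Fo f v) = Fo f (Rg g v)"
  by (simp add: Fo_def Rg_pow Rg_qo_prod)

end

context cyc_poly
begin

subsection \<open>The generators of the cyclotomic ideal\<close>

definition low_span :: "nat \<Rightarrow> nat \<Rightarrow> 'k spoly set" where
  "low_span f d = PS.span {Xw u one | u. set u \<subseteq> {1..f} \<and> count_list u f < d}"

text \<open>Monic up to a nonzero scalar in the last variable \<open>f\<close>. Leaving the leading
  coefficient open avoids tracking signs.\<close>

definition monic_deg :: "nat \<Rightarrow> nat \<Rightarrow> 'k spoly \<Rightarrow> bool" where
  "monic_deg f d v \<longleftrightarrow> (\<exists>\<gamma>. \<gamma> \<noteq> 0 \<and> v - pscale \<gamma> ((Xo f ^^ d) one) \<in> low_span f d)"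

lemma low_span_sub: "PS.subspace (low_span f d)"
  by (simp add: low_span_def)

lemma low_span_mono: "d \<le> d' \<Longrightarrow> v \<in> low_span f d \<Longrightarrow> v \<in> low_span f d'"
  unfolding low_span_def by (rule subsetD[OF PS.span_mono]) auto

lemma low_span_base: "set u \<subseteq> {1..f} \<Longrightarrow> count_list u f < d \<Longrightarrow> Xw u one \<in> low_span f d"
  unfolding low_span_def by (rule PS.span_base) blast

lemma low_span_Xw:
  assumes "v \<in> low_span f d" "set w \<subseteq> {1..f}"
  shows "Xw w v \<in> low_span f (count_list w f + d)"
proof (rule span_lin[OF lin_Xw assms(1)[unfolded low_span_def] _ low_span_sub])
  fix s assume "s \<in> {Xw u one | u. set u \<subseteq> {1..f} \<and> count_list u f < d}"
  then obtain u where u: "s = Xw u one" "set u \<subseteq> {1..f}" "count_list u f < d" by blast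
  then have "Xw w s = Xw (w @ u) one" by simp
  moreover have "Xw (w @ u) one \<in> low_span f (count_list w f + d)"
    by (rule low_span_base) (use u(2,3) assms(2) in auto)
  ultimately show "Xw w s \<in> low_span f (count_list w f + d)" by simp
qed

lemma low_span_Xo: "v \<in> low_span f d \<Longrightarrow> k \<in> {1..f} \<Longrightarrow> Xo k v \<in> low_span f ((if k = f then 1 else 0) + d)"
  using low_span_Xw[of v f d "[k]"] by (cases "k = f") simp_all

lemma monic_deg_le: assumes "monic_deg f d v" "1 \<le> f" shows "v \<in> low_span f (Suc d)"
proof -
  obtain \<gamma> where g: "v - pscale \<gamma> ((Xo f ^^ d) one) \<in> low_span f d" using assms by (auto simp: monic_deg_def)
  have "v - pscale \<gamma> ((Xo f ^^ d) one) \<in> low_span f (Suc d)" by (rule low_span_mono[OF _ g]) simp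
  moreover have "Xw (replicate d f) one \<in> low_span f (Suc d)"
    using assms(2) by (intro low_span_base) (auto simp: count_list_replicate)
  then have "pscale \<gamma> ((Xo f ^^ d) one) \<in> low_span f (Suc d)"
    unfolding Xo_pow_Xw by (rule PS.subspace_scale[OF low_span_sub])
  ultimately show ?thesis using PS.subspace_add[OF low_span_sub] by fastforce
qed

lemma monic_deg_low: assumes "monic_deg f d v" "w \<in> low_span f d" shows "monic_deg f d (v + w)"
proof -
  obtain \<gamma> where "\<gamma> \<noteq> 0" and g: "v - pscale \<gamma> ((Xo f ^^ d) one) \<in> low_span f d" using assms by (auto simp: monic_deg_def)
  moreover have "v + w - pscale \<gamma> ((Xo f ^^ d) one) = (v - pscale \<gamma> ((Xo f ^^ d) one)) + w" by simp
  ultimately show ?thesis unfolding monic_deg_def using PS.subspace_add[OF low_span_sub g assms(2)] by metis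
qed

lemma monic_deg_scale: assumes "monic_deg f d v" "c \<noteq> 0" shows "monic_deg f d (pscale c v)"
proof -
  obtain \<gamma> where "\<gamma> \<noteq> 0" and g: "v - pscale \<gamma> ((Xo f ^^ d) one) \<in> low_span f d" using assms by (auto simp: monic_deg_def)
  moreover have "pscale c v - pscale (c * \<gamma>) ((Xo f ^^ d) one) = pscale c (v - pscale \<gamma> ((Xo f ^^ d) one))"
    by (simp add: PS.scale_right_diff_distrib)
  ultimately show ?thesis unfolding monic_deg_def
    using PS.subspace_scale[OF low_span_sub g, of c] assms(2) by (intro exI[of _ "c * \<gamma>"]) simp
qed

lemma monic_deg_pow: assumes "monic_deg f d v" "1 \<le> f" shows "monic_deg f (r + d) ((Xo f ^^ r) v)"
proof -
  obtain \<gamma> where g: "\<gamma> \<noteq> 0" "v - pscale \<gamma> ((Xo f ^^ d) one) \<in> low_span f d" using assms by (auto simp: monic_deg_def)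
  have "Xw (replicate r f) (v - pscale \<gamma> ((Xo f ^^ d) one)) \<in> low_span f (count_list (replicate r f) f + d)"
    by (rule low_span_Xw[OF g(2)]) (use assms(2) in auto)
  then have "(Xo f ^^ r) (v - pscale \<gamma> ((Xo f ^^ d) one)) \<in> low_span f (r + d)"
    unfolding Xo_pow_Xw[symmetric] by (simp add: count_list_replicate)
  then have "(Xo f ^^ r) v - pscale \<gamma> ((Xo f ^^ (r + d)) one) \<in> low_span f (r + d)"
    by (simp add: lin_simps[OF lin_pow[OF lin_Xo]] funpow_add)
  then show ?thesis using g(1) by (auto simp: monic_deg_def)
qed

lemma monic_deg_one: "monic_deg f 0 one"
  unfolding monic_deg_def by (intro exI[of _ 1]) (simp add: PS.subspace_0[OF low_span_sub])

text \<open>Among the terms of Q only one has the top degree in the first variable, and it does not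
  involve x_q.\<close>

lemma monic_deg_qo:
  assumes f: "f \<in> {1..n}" and q: "q \<in> {1..<f}" and c: "col f \<noteq> col q" and v: "monic_deg f d v"
  shows "monic_deg f (mm (col f) (col q) + d) (qo f q v)"
proof -
  let ?m = "mm (col f) (col q)" and ?S = "Qsupp t (col f) (col q)"
  define F where "F = (\<lambda>x. pscale (t (col f) (col q) (fst x) (snd x)) ((Xo f ^^ fst x) ((Xo q ^^ snd x) v)))"
  have q': "q \<in> {1..n}" using f q by auto
  have fin: "finite ?S" by (rule Qfin[OF f q'])
  have m: "(?m, 0) \<in> ?S" using Qlead[OF f q' c] by (simp add: Qsupp_def)
  have "qo f q v = sum F ?S" using f q' by (simp add: qo_def F_def case_prod_beta)
  also have "\<dots> = F (?m, 0) + sum F (?S - {(?m, 0)})" by (rule sum.remove[OF fin m])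
  finally have e: "qo f q v = F (?m, 0) + sum F (?S - {(?m, 0)})" .
  have "monic_deg f (?m + d) (F (?m, 0))"
    using monic_deg_scale[OF monic_deg_pow[OF v, of ?m] Qlead[OF f q' c]] f by (simp add: F_def)
  moreover have "sum F (?S - {(?m, 0)}) \<in> low_span f (?m + d)"
  proof (rule PS.subspace_sum[OF low_span_sub])
    fix x assume x: "x \<in> ?S - {(?m, 0)}"
    then have "t (col f) (col q) (fst x) (snd x) \<noteq> 0" "x \<noteq> (?m, 0)" by (auto simp: Qsupp_def)
    then have lt: "fst x < ?m" using Qlow[OF f q' c, of "fst x" "snd x"] by (cases x) auto
    have "Xw (replicate (fst x) f @ replicate (snd x) q) v \<in>
        low_span f (count_list (replicate (fst x) f @ replicate (snd x) q) f + Suc d)"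
      by (rule low_span_Xw[OF monic_deg_le[OF v]]) (use f q in auto)
    then have "(Xo f ^^ fst x) ((Xo q ^^ snd x) v) \<in> low_span f (fst x + Suc d)"
      using q by (simp add: count_list_replicate)
    then show "F x \<in> low_span f (?m + d)"
      unfolding F_def using lt by (intro PS.subspace_scale[OF low_span_sub]) (rule low_span_mono, auto)
  qed
  ultimately show ?thesis unfolding e by (rule monic_deg_low)
qed

lemma monic_deg_qo_prod:
  assumes f: "f \<in> {1..n}" and S: "finite S" "S \<subseteq> {1..<f}" "\<And>q. q \<in> S \<Longrightarrow> col f \<noteq> col q"
  shows "monic_deg f (\<Sum>q\<in>S. mm (col f) (col q)) (qo_prod (Pair f ` S) one)"
  using S
proof (induction S rule: finite_induct)
  case empty then show ?case by (simp add: monic_deg_one)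
next
  case (insert q S)
  have "qo_prod (Pair f ` insert q S) one = qo f q (qo_prod (Pair f ` S) one)"
    using insert qo_prod_insert[of "Pair f ` S" f q one] by auto
  then show ?case using insert monic_deg_qo[OF f, of q] by simp
qed

text \<open>The counterpart of \<open>t_xw_eq\<close> for polynomials: one factor x_l is consumed,
  and the others may turn into x_(l+1).\<close>

lemma D_low:
  assumes l: "1 \<le> l" "par l = par (Suc l)" and u: "set u \<subseteq> {1..l}"
  shows "D l (Xw u one) \<in> low_span (Suc l) (count_list u l)"
  using u
proof (induction u)
  case Nil then show ?case by (simp add: PS.subspace_0[OF low_span_sub])
next
  case (Cons k u)
  let ?w = "Xw u one"
  have IH: "D l ?w \<in> low_span (Suc l) (count_list u l)" using Cons by simp
  have "Suc l \<notin> set u" using Cons(2) by auto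
  then have cu: "count_list u (Suc l) = 0" by (simp add: count_list_0_iff)
  have k: "k \<in> {1..l}" using Cons(2) by simp
  show ?case
  proof (cases "k = l")
    case False
    then have "D l (Xo k ?w) = pscale (sg l k) (Xo k (D l ?w))" using k by (simp add: D_Xo[OF l(2)] cc_def sfun_apply)
    moreover have "Xo k (D l ?w) \<in> low_span (Suc l) (count_list u l)" using low_span_Xo[OF IH, of k] k by simp
    ultimately show ?thesis using False by (simp add: PS.subspace_scale[OF low_span_sub])
  next
    case True
    have "?w \<in> low_span (Suc l) (Suc (count_list u l))"
      by (rule low_span_base) (use Cons(2) cu in auto)
    moreover have "Xo (Suc l) (D l ?w) \<in> low_span (Suc l) (Suc (count_list u l))"
      using low_span_Xo[OF IH, of "Suc l"] by (simp add: add.commute[of 1] flip: Suc_eq_plus1)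
    ultimately show ?thesis using True
      by (simp flip: Suc_eq_plus1 add: D_Xo[OF l(2)] sfun_apply PS.subspace_add[OF low_span_sub] PS.subspace_scale[OF low_span_sub])
  qed
qed

lemma D_low_span:
  assumes l: "1 \<le> l" "par l = par (Suc l)" and v: "v \<in> low_span l (Suc d)"
  shows "D l v \<in> low_span (Suc l) d"
proof (rule span_lin[OF lin_D v[unfolded low_span_def] _ low_span_sub])
  fix s assume "s \<in> {Xw u one | u. set u \<subseteq> {1..l} \<and> count_list u l < Suc d}"
  then obtain u where u: "s = Xw u one" "set u \<subseteq> {1..l}" "count_list u l \<le> d" by auto
  show "D l s \<in> low_span (Suc l) d" unfolding u(1) by (rule low_span_mono[OF u(3) D_low[OF l u(2)]])
qed

lemma monic_deg_D_pow:
  assumes l: "1 \<le> l" "par l = par (Suc l)"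
  shows "monic_deg (Suc l) d (D l ((Xo l ^^ Suc d) one))"
proof (induction d)
  case 0
  have "D l ((Xo l ^^ Suc 0) one) = pscale (- sg l l) one" by (simp add: D_Xo[OF l(2)] cc_def Xo_simps)
  then show ?case using monic_deg_scale[OF monic_deg_one, of "- sg l l" "Suc l"] by simp
next
  case (Suc d)
  let ?w = "(Xo l ^^ Suc d) one"
  have "D l (Xo l ?w) = pscale (sg l l) (Xo (Suc l) (D l ?w)) + pscale (cc l l) ?w"
    by (subst D_Xo[OF l(2)]) (simp add: sfun_apply)
  moreover have "monic_deg (Suc l) (Suc d) (pscale (sg l l) (Xo (Suc l) (D l ?w)))"
    using monic_deg_scale[OF monic_deg_pow[OF Suc, of "Suc 0"], of "sg l l"] by simp
  moreover have "Xw (replicate (Suc d) l) one \<in> low_span (Suc l) (Suc d)"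
    using l(1) by (intro low_span_base) (auto simp: count_list_replicate)
  then have "pscale (cc l l) ?w \<in> low_span (Suc l) (Suc d)"
    unfolding Xo_pow_Xw by (rule PS.subspace_scale[OF low_span_sub])
  ultimately have "monic_deg (Suc l) (Suc d) (D l (Xo l ?w))" using monic_deg_low by metis
  then show ?case by simp
qed

lemma monic_deg_D:
  assumes l: "1 \<le> l" "par l = par (Suc l)" and v: "monic_deg l (Suc d) v"
  shows "monic_deg (Suc l) d (D l v)"
proof -
  let ?p = "(Xo l ^^ Suc d) one"
  obtain \<gamma> where g: "\<gamma> \<noteq> 0" "v - pscale \<gamma> ?p \<in> low_span l (Suc d)" using v by (auto simp: monic_deg_def)
  have "D l v = pscale \<gamma> (D l ?p) + D l (v - pscale \<gamma> ?p)" by (simp only: D_simps) simp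
  then show ?thesis using monic_deg_low[OF monic_deg_scale[OF monic_deg_D_pow[OF l] g(1)] D_low_span[OF l g(2)]] by simp
qed

text \<open>The generator with index \<open>j\<close> is monic in the variable \<open>j\<close> of degree \<open>N j\<close>; within a block it arises
  from its predecessor by a divided difference.\<close>

primrec cyc_gen :: "nat \<Rightarrow> 'k spoly" where
  "cyc_gen 0 = one"
| "cyc_gen (Suc j) = (if internal j then D j (cyc_gen j) else Fo (Suc j) one)"

lemma not_internal_first: "\<not> internal j \<Longrightarrow> Suc j \<le> n \<Longrightarrow> first (Suc j)"
  by (cases "j = 0") (auto simp: internal_def first_def)

lemma cyc_gen_first: assumes "first f" shows "cyc_gen f = Fo f one"
proof (cases f)
  case (Suc j)
  have "\<not> internal j" using assms by (cases "j = 0") (auto simp: internal_def first_def Suc)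
  then show ?thesis by (simp add: Suc)
qed (use assms in \<open>simp add: first_def\<close>)

lemma first_col:
  assumes f: "first f" and q: "q \<in> {1..<f}" shows "col f \<noteq> col q"
proof
  assume c: "col f = col q"
  have "col (f - 1) = col q" by (rule contig[of q "f - 1" f]) (use f q c in \<open>simp_all add: first_def, linarith?\<close>)
  moreover have "f \<noteq> 1" using q by auto
  ultimately show False using f c unfolding first_def by metis
qed

lemma monic_deg_cyc_gen: "1 \<le> j \<Longrightarrow> j \<le> n \<Longrightarrow> monic_deg j (N j) (cyc_gen j)"
proof (induction j)
  case (Suc j)
  show ?case
  proof (cases "internal j")
    case True
    then have j: "1 \<le> j" "j < n" "col j = col (Suc j)" by (auto simp: internal_def)
    have "Suc (N (Suc j)) = N j" using N_next[of j] N_pos[of j] j by simp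
    then show ?thesis using Suc.IH j True monic_deg_D[OF j(1) int_par[OF True], of "N (Suc j)" "cyc_gen j"] by simp
  next
    case False
    let ?f = "Suc j"
    have f: "first ?f" using not_internal_first[OF False] Suc by simp
    then have f': "?f \<in> {1..n}" "?f = 1 \<or> col (?f - 1) \<noteq> col ?f" unfolding first_def by blast+
    have "monic_deg ?f (Lam (col ?f) + (\<Sum>q\<in>{1..<?f}. mm (col ?f) (col q))) (Fo ?f one)"
      unfolding Fo_def using f' first_col[OF f] by (intro monic_deg_pow monic_deg_qo_prod) auto
    then show ?thesis using cyc_gen_first[OF f] N_first[OF f'] by simp
  qed
qed simp

lemma D_word_zero: "par a = par (Suc a) \<Longrightarrow> a \<notin> set u \<Longrightarrow> Suc a \<notin> set u \<Longrightarrow> D a (Xw u one) = 0"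
  by (induction u) (simp_all add: D_Xo cc_def Xo_simps)

lemma cyc_gen_free: assumes "1 \<le> j" "j \<le> n" "j < l" shows "free_of l (cyc_gen j)"
proof -
  have "cyc_gen j \<in> low_span j (Suc (N j))" using monic_deg_le[OF monic_deg_cyc_gen] assms by simp
  moreover have "{Xw u one | u. set u \<subseteq> {1..j} \<and> count_list u j < Suc (N j)} \<subseteq> {Xw u one | u. l \<notin> set u}"
    using assms(3) by fastforce
  ultimately show ?thesis unfolding free_of_def low_span_def using PS.span_mono by blast
qed

text \<open>For \<open>a > j\<close> the variables concerned are absent. If \<open>j\<close> opens a
  block, its factors Q form a product symmetric in x_a and x_(a+1). Otherwise the generator is a
  divided difference of its predecessor, and \<open>DD\<close>, \<open>D_braid\<close> or
  \<open>D_far\<close> reduces the claim to an earlier generator.\<close>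

lemma D_cyc_gen: "internal a \<Longrightarrow> 1 \<le> j \<Longrightarrow> j \<le> n \<Longrightarrow> a \<noteq> j \<Longrightarrow> D a (cyc_gen j) = 0"
proof (induction j arbitrary: a rule: less_induct)
  case (less j)
  note pa = int_par[OF less(2)]
  consider "j < a" | "a < j" using less by linarith
  then show ?case
  proof cases
    case 1
    have "cyc_gen j \<in> low_span j (Suc (N j))" using monic_deg_le[OF monic_deg_cyc_gen] less by simp
    then show ?thesis unfolding low_span_def
    proof (rule span_lin_eq[OF lin_D lin_0])
      fix s assume "s \<in> {Xw u one | u. set u \<subseteq> {1..j} \<and> count_list u j < Suc (N j)}"
      then obtain u where u: "s = Xw u one" "set u \<subseteq> {1..j}" by blast
      show "D a s = 0" unfolding u(1) by (rule D_word_zero[OF pa]) (use u(2) 1 in auto)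
    qed
  next
    case 2
    then obtain i where j: "j = Suc i" by (cases j) auto
    show ?thesis
    proof (cases "internal i")
      case False
      have f: "first j" using not_internal_first[OF False] less j by simp
      \<comment> \<open>\<open>a\<close> is internal and \<open>i\<close> is not, so
        \<open>a\<close> cannot be the position just before \<open>j\<close>.\<close>
      have ai: "Suc a < j" using False less(2) 2 j by (metis less_SucE Suc_less_eq)
      have "D a (qo_prod (Pair j ` {1..<j}) one) = qo_prod (Pair j ` {1..<j}) (D a one)"
      proof (rule D_qo_prod[OF less(2)])
        show "Pair j ` {1..<j} \<subseteq> {1..n} \<times> {1..n}" using less by auto
        have sj: "sfun a j = j" using ai by (simp add: sfun_apply)
        fix k l assume kl: "(k, l) \<in> Pair j ` {1..<j}"
        have "1 \<le> a" using less(2) by (simp add: internal_def)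
        then show "(sfun a k, sfun a l) \<in> Pair j ` {1..<j}" using kl sj ai by (auto simp: sfun_apply)
        show "\<not> (k \<in> {a, Suc a} \<and> l \<in> {a, Suc a})" using kl ai by auto
      qed simp
      then show ?thesis unfolding cyc_gen_first[OF f] Fo_def using D_pow_far[OF pa, of j] ai
        by (simp add: lin_zero[OF lin_qo_prod] lin_zero[OF lin_pow[OF lin_Xo]])
    next
      case True
      then have e: "cyc_gen j = D i (cyc_gen i)" and i: "1 \<le> i" "i < n" by (simp_all add: j internal_def)
      consider "a = i" | "Suc a = i" | "Suc a < i" using 2 j by linarith
      then show ?thesis
      proof cases
        case 1 then show ?thesis using DD[OF int_par[OF True]] by (simp add: e)
      next
        case 2
        \<comment> \<open>After the braid relation the innermost operator is \<open>D i\<close>, and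
          it kills \<open>cyc_gen a\<close> by the induction hypothesis.\<close>
        have "cyc_gen i = D a (cyc_gen a)" using 2 less(2) by auto
        moreover have "D i (cyc_gen a) = 0" using 2 True j less by (intro less(1)) (auto simp: internal_def)
        ultimately show ?thesis using D_braid[of a "cyc_gen a"] pa int_par[OF True] 2 by (simp add: e D_simps)
      next
        case 3
        have "D a (cyc_gen i) = 0" using 3 less j by (intro less(1)) (auto simp: internal_def)
        then show ?thesis using D_far[of a i "cyc_gen i"] pa int_par[OF True] 3 by (simp add: e D_simps)
      qed
    qed
  qed
qed

text \<open>The left ideal generated by the first \<open>l\<close> generators. The parameter allows
  generators to be removed one at a time in \<open>K_small\<close>.\<close>

definition K :: "nat \<Rightarrow> 'k spoly set" where
  "K l = PS.span {Xw u (cyc_gen j) | u j. 1 \<le> j \<and> j \<le> l}"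

lemma K_sub: "PS.subspace (K l)" by (simp add: K_def)

lemma K_mono: "l \<le> l' \<Longrightarrow> K l \<subseteq> K l'"
  unfolding K_def by (rule PS.span_mono) fastforce

lemma K_base: "1 \<le> j \<Longrightarrow> j \<le> l \<Longrightarrow> Xw u (cyc_gen j) \<in> K l"
  unfolding K_def by (rule PS.span_base) blast

lemma K_lin:
  assumes "lin F" "v \<in> K l" "\<And>u j. 1 \<le> j \<Longrightarrow> j \<le> l \<Longrightarrow> F (Xw u (cyc_gen j)) \<in> K l'"
  shows "F v \<in> K l'"
  by (rule span_lin[OF assms(1) assms(2)[unfolded K_def] _ K_sub]) (use assms(3) in blast)

lemma K_Xw: "v \<in> K l \<Longrightarrow> Xw w v \<in> K l"
proof (rule K_lin[OF lin_Xw])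
  fix u j assume "1 \<le> j" "j \<le> l"
  then show "Xw w (Xw u (cyc_gen j)) \<in> K l" using K_base[of j l "w @ u"] by simp
qed

lemma K_Xo: "v \<in> K l \<Longrightarrow> Xo m v \<in> K l" using K_Xw[of v l "[m]"] by simp

lemma K_pow: "v \<in> K l \<Longrightarrow> (Xo m ^^ r) v \<in> K l" unfolding Xo_pow_Xw by (rule K_Xw)

lemma K_qo: assumes "v \<in> K l" shows "qo k m v \<in> K l"
  using assms by (auto simp: qo_def intro!: PS.subspace_sum[OF K_sub] PS.subspace_scale[OF K_sub] K_pow)

text \<open>The Leibniz rule reduces the claim to generators. All but one are killed, and
  \<open>cyc_gen a\<close> becomes \<open>cyc_gen (Suc a)\<close>, which is why the index may have
  to grow.\<close>

lemma K_D:
  assumes a: "internal a" and l: "l \<le> m" "m \<le> n" "a \<le> l \<Longrightarrow> Suc a \<le> m" and v: "v \<in> K l"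
  shows "D a v \<in> K m"
proof (rule K_lin[OF lin_D v])
  fix u j assume j: "1 \<le> j" "j \<le> l"
  have g: "D a (cyc_gen j) \<in> K m"
  proof (cases "a = j")
    case True
    then show ?thesis using K_base[of "Suc a" m "[]"] a j l by simp
  next
    case False
    then show ?thesis using D_cyc_gen[OF a, of j] j l PS.subspace_0[OF K_sub] by simp
  qed
  show "D a (Xw u (cyc_gen j)) \<in> K m"
  proof (induction u)
    case Nil then show ?case using g by simp
  next
    case (Cons k u)
    have "Xw u (cyc_gen j) \<in> K m" using j l by (intro K_base) auto
    then show ?case using Cons
      by (simp add: D_Xo[OF int_par[OF a]] PS.subspace_add[OF K_sub] PS.subspace_scale[OF K_sub] K_Xo)
  qed
qed

lemma Fo_K: assumes f: "first f" and l: "f \<le> l" shows "Fo f v \<in> K l"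
proof -
  have "{Xw u (Fo f one) | u. True} \<subseteq> {Xw u (cyc_gen j) | u j. 1 \<le> j \<and> j \<le> l}"
    using f l unfolding cyc_gen_first[OF f, symmetric] by (auto simp: first_def)
  then show ?thesis using Fo_span[of f v] PS.span_mono unfolding K_def by blast
qed

text \<open>Right multiplication by the later generator commutes with the divided differences producing
  the earlier one, because these annihilate the later generator.\<close>

lemma Rg_cyc_gen: "1 \<le> j \<Longrightarrow> j < l \<Longrightarrow> l \<le> n \<Longrightarrow> Rg (cyc_gen l) (cyc_gen j) \<in> K j"
proof (induction j)
  case (Suc j)
  show ?case
  proof (cases "internal j")
    case True
    then have j: "1 \<le> j" by (simp add: internal_def)
    have "Rg (cyc_gen l) (cyc_gen (Suc j)) = D j (Rg (cyc_gen l) (cyc_gen j))"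
      using True Rg_D[OF int_par[OF True] D_cyc_gen[OF True]] Suc by simp
    moreover have "Rg (cyc_gen l) (cyc_gen j) \<in> K j" using Suc j by simp
    ultimately show ?thesis using K_D[OF True, of j "Suc j"] Suc by simp
  next
    case False
    have f: "first (Suc j)" using not_internal_first[OF False] Suc by simp
    show ?thesis unfolding cyc_gen_first[OF f] Rg_Fo by (rule Fo_K[OF f]) simp
  qed
qed simp

text \<open>Right multiplication commutes with left multiplication, so the claim reduces to
  generators. It is the substitute for commutativity when one divides by the next generator.\<close>

lemma Rg_K: assumes "v \<in> K l" "Suc l \<le> n" shows "Rg (cyc_gen (Suc l)) v \<in> K l"
proof (rule K_lin[OF lin_Rg assms(1)])
  fix u j assume j: "1 \<le> j" "j \<le> l"
  have "Rg (cyc_gen (Suc l)) (cyc_gen j) \<in> K l" using Rg_cyc_gen[of j "Suc l"] j assms(2) K_mono[OF j(2)] by auto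
  then show "Rg (cyc_gen (Suc l)) (Xw u (cyc_gen j)) \<in> K l" by (simp add: Rg_Xw K_Xw)
qed

lemma Tw_qo:
  assumes th: "\<And>k. \<theta> k * \<theta> k = 1" "\<And>k. \<not> par k \<Longrightarrow> \<theta> k = 1"
  shows "Tw \<theta> (qo k l v) = qo k l (Tw \<theta> v)"
proof (cases "k \<in> {1..n} \<and> l \<in> {1..n}")
  case True
  have p: "\<theta> m ^ r = 1" if "par m \<Longrightarrow> even r" for m r
  proof (cases "par m")
    case True
    then obtain s where "r = 2 * s" using \<open>par m \<Longrightarrow> even r\<close> by auto
    then show ?thesis using th(1)[of m] by (simp add: power_mult power2_eq_square)
  qed (simp add: th(2))
  have "Tw \<theta> ((Xo k ^^ r) ((Xo l ^^ s) v)) = (Xo k ^^ r) ((Xo l ^^ s) (Tw \<theta> v))"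
    if "t (col k) (col l) r s \<noteq> 0" for r s
  proof -
    have "\<theta> k ^ r = 1" "\<theta> l ^ s = 1" using t_even[of k l r s] that True by (auto intro: p)
    then show ?thesis by (simp add: Tw_pow pow_lin)
  qed
  then show ?thesis using True unfolding qo_def
    by (auto simp: Tw_simps case_prod_beta Qsupp_def intro!: sum.cong)
qed (auto simp: qo_def)

text \<open>A twist commutes with the Q because their exponents at odd variables are even, and with
  \<open>D a\<close> up to a scalar if x_a and x_(a+1) are rescaled equally.\<close>

lemma Tw_cyc_gen:
  assumes th: "\<And>k. \<theta> k * \<theta> k = 1" "\<And>k. \<not> par k \<Longrightarrow> \<theta> k = 1"
    and "\<And>a. internal a \<Longrightarrow> Suc a \<le> j \<Longrightarrow> \<theta> a = \<theta> (Suc a)"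
  shows "\<exists>c. Tw \<theta> (cyc_gen j) = pscale c (cyc_gen j)"
  using assms(3)
proof (induction j)
  case 0 then show ?case by (intro exI[of _ 1]) simp
next
  case (Suc j)
  show ?case
  proof (cases "internal j")
    case True
    obtain c where "Tw \<theta> (cyc_gen j) = pscale c (cyc_gen j)" using Suc by fastforce
    then show ?thesis using Tw_D[OF int_par[OF True] Suc(2)[OF True] th(1), of "cyc_gen j"] True
      by (intro exI[of _ "\<theta> j * c"]) (simp add: D_simps)
  next
    case False
    have "Tw \<theta> (qo_prod S one) = qo_prod S (Tw \<theta> one)" if "finite S" for S
      by (rule qo_prod_induct_comm[OF that]) (rule Tw_qo[OF th])
    then show ?thesis using False by (intro exI[of _ "\<theta> (Suc j) ^ Lam (col (Suc j))"]) (simp add: Fo_def Tw_pow)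
  qed
qed

lemma Tw_K:
  assumes th: "\<And>k. \<theta> k * \<theta> k = 1" "\<And>k. \<not> par k \<Longrightarrow> \<theta> k = 1"
    and "\<And>a. internal a \<Longrightarrow> Suc a \<le> l \<Longrightarrow> \<theta> a = \<theta> (Suc a)" and v: "v \<in> K l"
  shows "Tw \<theta> v \<in> K l"
proof (rule K_lin[OF lin_Tw v])
  fix u j assume j: "1 \<le> j" "j \<le> l"
  obtain c where "Tw \<theta> (cyc_gen j) = pscale c (cyc_gen j)" using Tw_cyc_gen[of \<theta> j] th assms(3) j by fastforce
  moreover obtain c' where "Tw \<theta> (Xw u (cyc_gen j)) = pscale c' (Xw u (Tw \<theta> (cyc_gen j)))" using Tw_Xw[of \<theta> u "cyc_gen j"] th(1) by auto
  ultimately show "Tw \<theta> (Xw u (cyc_gen j)) \<in> K l" using j by (simp add: Xw_simps K_base PS.subspace_scale[OF K_sub])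
qed

lemma pr_K: assumes "v \<in> K l" "l < m" "l \<le> n" shows "pr m i v \<in> K l"
proof (rule K_lin[OF lin_pr assms(1)])
  fix u j assume j: "1 \<le> j" "j \<le> l"
  then show "pr m i (Xw u (cyc_gen j)) \<in> K l"
    using pr_Xw_free[OF cyc_gen_free, of j m i u] assms K_base[of j l u] by (simp add: PS.subspace_0[OF K_sub])
qed

lemma Yo_K: assumes "v \<in> K l" "l < m" "l \<le> n" shows "Yo m v \<in> K l"
proof (rule K_lin[OF lin_Yo assms(1)])
  fix u j assume j: "1 \<le> j" "j \<le> l"
  show "Yo m (Xw u (cyc_gen j)) \<in> K l"
  proof (induction u)
    case Nil then show ?case using Yo_free[OF cyc_gen_free, of j m] j assms by (simp add: PS.subspace_0[OF K_sub])
  next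
    case (Cons k u)
    then show ?case using K_base[OF j, of u]
      by (cases "k = m") (simp_all add: Yo_Xo Yo_Xo_neq K_Xo PS.subspace_scale[OF K_sub])
  qed
qed

lemma Yo_pow_K: assumes "(Xo m ^^ r) v \<in> K l" "l < m" "l \<le> n" shows "v \<in> K l"
  using assms(1) by (induction r) (use Yo_K[OF _ assms(2,3)] in \<open>fastforce simp: Yo_Xo\<close>)+

lemma lookup_pr: "Poly_Mapping.lookup (pr l i g) M = (if count M l = i then Poly_Mapping.lookup g M else 0)"
proof -
  have "Poly_Mapping.lookup (pr l i g) M =
      (\<Sum>x\<in>Poly_Mapping.keys g. if x = M then if count M l = i then Poly_Mapping.lookup g x else 0 else 0)"
    unfolding pr_def plin_def lookup_sum
    by (rule sum.cong) (simp_all add: lookup_pscale lookup_bas)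
  then show ?thesis by (simp add: in_keys_iff)
qed

lemma pr_pr: "pr l i (pr l i' v) = (if i = i' then pr l i v else 0)"
  by (rule poly_mapping_eqI) (auto simp: lookup_pr)

lemma lin_Rg_left: "lin (\<lambda>g. Rg g v)"
  unfolding Rg_def plin_def by (intro lin_sums lin_pscale lin_Xw)

lemma pr_Rg:
  assumes "count_list u l \<le> i"
  shows "pr l i (Rg (Xw u one) p) = Rg (Xw u one) (pr l (i - count_list u l) p)"
proof (rule lin_eqI[where F = "\<lambda>p. pr l i (Rg (Xw u one) p)" and G = "\<lambda>p. Rg (Xw u one) (pr l (i - count_list u l) p)"])
  show "lin (\<lambda>p. pr l i (Rg (Xw u one) p))" by (rule lin_comp[OF lin_pr lin_Rg])
  show "lin (\<lambda>p. Rg (Xw u one) (pr l (i - count_list u l) p))" by (rule lin_comp[OF lin_Rg lin_pr])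
  fix M
  have c: "count_list (desc M) l = count M l" by (metis count_mset mset_desc)
  have "Rg (Xw u one) (bas M) = Xw (desc M @ u) one" by (simp add: Rg_bas)
  then show "pr l i (Rg (Xw u one) (bas M)) = Rg (Xw u one) (pr l (i - count_list u l) (bas M))"
    using assms by (auto simp only: pr_Xw_one pr_bas) (auto simp: c Rg_simps)
qed

text \<open>In the product of p with a monic generator the highest degree in x_l comes only from the
  top component of p and the leading power: division by a monic polynomial, with the quotient on the
  left.\<close>

lemma top_part:
  assumes l: "1 \<le> l" "l \<le> n"
  obtains \<gamma> where "\<gamma> \<noteq> 0"
    "\<And>d p. (\<And>i. d < i \<Longrightarrow> pr l i p = 0) \<Longrightarrow> pr l (d + N l) (Rg (cyc_gen l) p) = pscale \<gamma> (Rg ((Xo l ^^ N l) one) (pr l d p))"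
proof -
  let ?x = "(Xo l ^^ N l) one"
  obtain \<gamma> where g: "\<gamma> \<noteq> 0" "cyc_gen l - pscale \<gamma> ?x \<in> low_span l (N l)" using monic_deg_cyc_gen[OF l] by (auto simp: monic_deg_def)
  show thesis
  proof (rule that[OF g(1)])
    fix d p assume p: "\<And>i. d < i \<Longrightarrow> pr l i p = 0"
    have low: "pr l (d + N l) (Rg w p) = 0" if "w \<in> low_span l (N l)" for w
    proof (rule span_lin_eq[where F = "\<lambda>w. pr l (d + N l) (Rg w p)" and G = "\<lambda>w. 0", OF _ lin_0 that[unfolded low_span_def]])
      show "lin (\<lambda>w. pr l (d + N l) (Rg w p))" by (rule lin_comp[OF lin_pr lin_Rg_left])
      fix s assume "s \<in> {Xw u one | u. set u \<subseteq> {1..l} \<and> count_list u l < N l}"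
      then obtain u where u: "s = Xw u one" "count_list u l < N l" by blast
      then show "pr l (d + N l) (Rg s p) = 0" using p by (simp add: pr_Rg Rg_simps)
    qed
    have "Rg (cyc_gen l) p = pscale \<gamma> (Rg ?x p) + Rg (cyc_gen l - pscale \<gamma> ?x) p"
      by (simp add: lin_simps[OF lin_Rg_left])
    moreover have "pr l (d + N l) (Rg ?x p) = Rg ?x (pr l d p)"
      unfolding Xo_pow_Xw by (subst pr_Rg) (simp_all add: count_list_replicate)
    ultimately show "pr l (d + N l) (Rg (cyc_gen l) p) = pscale \<gamma> (Rg ?x (pr l d p))"
      using low[OF g(2)] by (simp add: pr_simps)
  qed
qed

text \<open>Moving the power to the left produces a twist. The power is removed by \<open>Yo\<close>
  and the twist undone by repeating it; both operations preserve \<open>K l\<close>.\<close>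

lemma monomial_K:
  assumes L: "Suc l \<le> n" and q: "Rg ((Xo (Suc l) ^^ r) one) q \<in> K l"
  shows "q \<in> K l"
proof -
  define \<theta> where "\<theta> = (\<lambda>k. if k = Suc l then 1 else sg (Suc l) k ^ r)"
  have 1: "\<theta> k * \<theta> k = 1" for k by (simp add: \<theta>_def flip: power_mult_distrib)
  have 2: "\<not> par k \<Longrightarrow> \<theta> k = 1" for k by (simp add: \<theta>_def sg_def)
  have 3: "\<theta> a = \<theta> (Suc a)" if "internal a" "Suc a \<le> l" for a
    using that sg_Suc(2)[OF int_par[OF that(1)]] by (simp add: \<theta>_def)
  have "Tw \<theta> q \<in> K l" using q L unfolding Rg_monomial \<theta>_def[symmetric] by (rule_tac Yo_pow_K) auto
  then have "Tw \<theta> (Tw \<theta> q) \<in> K l" by (intro Tw_K[of \<theta> l "Tw \<theta> q"]) (use 1 2 3 in auto)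
  then show ?thesis by (simp add: Tw_Tw[OF 1])
qed

lemma K_Suc:
  assumes "v \<in> K (Suc l)" shows "\<exists>\<kappa> p. \<kappa> \<in> K l \<and> v = \<kappa> + Rg (cyc_gen (Suc l)) p"
proof -
  let ?g = "cyc_gen (Suc l)" and ?U = "{v. \<exists>\<kappa> p. \<kappa> \<in> K l \<and> v = \<kappa> + Rg (cyc_gen (Suc l)) p}"
  have "PS.subspace ?U"
  proof (rule PS.subspaceI)
    show "0 \<in> ?U" using PS.subspace_0[OF K_sub, of l] by (auto simp: Rg_simps intro!: exI[of _ 0])
  next
    fix x y assume "x \<in> ?U" "y \<in> ?U"
    then obtain \<kappa> p \<kappa>' p' where "\<kappa> \<in> K l" "x = \<kappa> + Rg ?g p" "\<kappa>' \<in> K l" "y = \<kappa>' + Rg ?g p'" by blast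
    then have "\<kappa> + \<kappa>' \<in> K l" "x + y = (\<kappa> + \<kappa>') + Rg ?g (p + p')"
      by (simp_all add: Rg_simps PS.subspace_add[OF K_sub] algebra_simps)
    then show "x + y \<in> ?U" by blast
  next
    fix c x assume "x \<in> ?U"
    then obtain \<kappa> p where "\<kappa> \<in> K l" "x = \<kappa> + Rg ?g p" by blast
    then have "pscale c \<kappa> \<in> K l" "pscale c x = pscale c \<kappa> + Rg ?g (pscale c p)"
      by (simp_all add: Rg_simps PS.subspace_scale[OF K_sub] PS.scale_right_distrib)
    then show "pscale c x \<in> ?U" by blast
  qed
  moreover have "{Xw u (cyc_gen j) | u j. 1 \<le> j \<and> j \<le> Suc l} \<subseteq> ?U"
  proof clarify
    fix u j assume j: "1 \<le> j" "j \<le> Suc l"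
    show "\<exists>\<kappa> p. \<kappa> \<in> K l \<and> Xw u (cyc_gen j) = \<kappa> + Rg ?g p"
    proof (cases "j = Suc l")
      case True
      then show ?thesis using PS.subspace_0[OF K_sub, of l]
        by (intro exI[of _ 0] exI[of _ "Xw u one"]) (simp add: Rg_Xw)
    next
      case False
      then show ?thesis using K_base[of j l u] j
        by (intro exI[of _ "Xw u (cyc_gen j)"] exI[of _ 0]) (simp add: Rg_simps)
    qed
  qed
  ultimately have "K (Suc l) \<subseteq> ?U" unfolding K_def[of "Suc l"] by (intro PS.span_minimal)
  then show ?thesis using assms by blast
qed

text \<open>Induction on a bound for the degree of \<open>p\<close> in the last variable. The sum
  has no component of degree \<open>N (Suc l)\<close> or more, so the top component of
  \<open>p\<close> times the leading power cancels against \<open>\<kappa>\<close>. Hence that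
  component lies in \<open>K l\<close>, and by \<open>Rg_K\<close> its product with the generator
  can be absorbed into \<open>\<kappa>\<close>.\<close>

lemma strip:
  assumes L: "Suc l \<le> n"
  shows "\<kappa> \<in> K l \<Longrightarrow> (\<And>i. N (Suc l) \<le> i \<Longrightarrow> pr (Suc l) i (\<kappa> + Rg (cyc_gen (Suc l)) p) = 0) \<Longrightarrow>
    (\<And>i. d \<le> i \<Longrightarrow> pr (Suc l) i p = 0) \<Longrightarrow> Rg (cyc_gen (Suc l)) p \<in> K l"
proof (induction d arbitrary: \<kappa> p)
  case 0
  have "p = 0"
  proof (rule poly_mapping_eqI)
    fix M show "Poly_Mapping.lookup p M = Poly_Mapping.lookup 0 M"
      using lookup_pr[of "Suc l" "count M (Suc l)" p M] 0(3) by simp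
  qed
  then show ?case by (simp add: Rg_simps PS.subspace_0[OF K_sub])
next
  case (Suc d)
  let ?L = "Suc l" and ?q = "pr (Suc l) d p"
  obtain \<gamma> where g: "\<gamma> \<noteq> 0" "\<And>d p. (\<And>i. d < i \<Longrightarrow> pr ?L i p = 0) \<Longrightarrow>
      pr ?L (d + N ?L) (Rg (cyc_gen ?L) p) = pscale \<gamma> (Rg ((Xo ?L ^^ N ?L) one) (pr ?L d p))"
    using top_part[of ?L] L by auto
  have "pr ?L (d + N ?L) \<kappa> + pscale \<gamma> (Rg ((Xo ?L ^^ N ?L) one) ?q) = 0"
    using Suc(3)[of "d + N ?L"] g(2)[of d p] Suc(4) by (simp add: pr_simps)
  then have "pscale \<gamma> (Rg ((Xo ?L ^^ N ?L) one) ?q) = - pr ?L (d + N ?L) \<kappa>" by (simp add: eq_neg_iff_add_eq_0 add.commute)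
  moreover have "- pr ?L (d + N ?L) \<kappa> \<in> K l"
    using pr_K[OF Suc(2), of ?L "d + N ?L"] L by (simp add: PS.subspace_neg[OF K_sub])
  ultimately have "pscale (inverse \<gamma>) (pscale \<gamma> (Rg ((Xo ?L ^^ N ?L) one) ?q)) \<in> K l"
    by (simp only: PS.subspace_scale[OF K_sub])
  then have "Rg ((Xo ?L ^^ N ?L) one) ?q \<in> K l" using g(1) by simp
  then have "?q \<in> K l" by (rule monomial_K[OF L])
  then have q: "Rg (cyc_gen ?L) ?q \<in> K l" by (rule Rg_K[OF _ L])
  have "Rg (cyc_gen ?L) (p - ?q) \<in> K l"
  proof (rule Suc(1))
    show "\<kappa> + Rg (cyc_gen ?L) ?q \<in> K l" using PS.subspace_add[OF K_sub] Suc(2) q by blast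
    show "pr ?L i ((\<kappa> + Rg (cyc_gen ?L) ?q) + Rg (cyc_gen ?L) (p - ?q)) = 0" if "N ?L \<le> i" for i
      using Suc(3)[OF that] by (simp add: Rg_simps)
    show "pr ?L i (p - ?q) = 0" if "d \<le> i" for i
      using Suc(4)[of i] that by (cases "i = d") (simp_all add: pr_simps pr_pr)
  qed
  then have "Rg (cyc_gen ?L) (p - ?q) + Rg (cyc_gen ?L) ?q \<in> K l" using PS.subspace_add[OF K_sub] q by blast
  then show ?case by (simp add: Rg_simps)
qed

lemma pr_bound: "\<exists>d. \<forall>i\<ge>d. pr l i p = 0"
proof -
  obtain d where d: "\<And>M. M \<in> Poly_Mapping.keys p \<Longrightarrow> count M l < d"
    using finite_nat_set_iff_bounded[of "(\<lambda>M. count M l) ` Poly_Mapping.keys p"] by auto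
  have "pr l i p = 0" if "d \<le> i" for i
  proof (rule poly_mapping_eqI)
    fix M show "Poly_Mapping.lookup (pr l i p) M = Poly_Mapping.lookup 0 M"
      using d[of M] that by (auto simp: lookup_pr) (metis in_keys_iff not_le)
  qed
  then show ?thesis by blast
qed

lemma K_small:
  "l \<le> n \<Longrightarrow> v \<in> K l \<Longrightarrow> (\<And>k i. k \<in> {1..l} \<Longrightarrow> N k \<le> i \<Longrightarrow> pr k i v = 0) \<Longrightarrow> v = 0"
proof (induction l)
  case 0
  have "{Xw u (cyc_gen j) | u j. 1 \<le> j \<and> j \<le> 0} = {}" by auto
  then show ?case using 0 by (simp only: K_def PS.span_empty) simp
next
  case (Suc l)
  obtain \<kappa> p where k: "\<kappa> \<in> K l" "v = \<kappa> + Rg (cyc_gen (Suc l)) p" using K_Suc[OF Suc(3)] by blast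
  obtain d where d: "\<And>i. d \<le> i \<Longrightarrow> pr (Suc l) i p = 0" using pr_bound by blast
  have "Rg (cyc_gen (Suc l)) p \<in> K l"
    by (rule strip[OF Suc(2) k(1) _ d]) (use Suc(4)[of "Suc l"] k(2) in auto)
  then have "v \<in> K l" unfolding k(2) by (rule PS.subspace_add[OF K_sub k(1)])
  then show ?case using Suc(1,2,4) by simp
qed

end

context cyc_poly
begin

subsection \<open>Linear independence of the divided differences\<close>

lemma word_sup_internal: "word_sup n col l \<longleftrightarrow> (\<forall>a\<in>set l. internal a)"
  by (simp add: word_sup_def internal_def)

lemma lin_Dw [simp]: "lin (foldr D l)"
proof (induction l)
  case (Cons a l)
  have "lin (\<lambda>v. D a (foldr D l v))" using Cons by simp
  then show ?case by (simp add: comp_def)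
qed (simp add: lin_def)
lemmas Dw_simps = lin_simps[OF lin_Dw]

text \<open>For divided differences braid moves hold exactly and commutations up to a sign, which is
  recorded as a scalar with square 1.\<close>

lemma Dw_same:
  assumes "rword n l" "rword n l'" "word_perm l = word_perm l'" "word_sup n col l"
  shows "\<exists>c. c * c = 1 \<and> (\<forall>v. foldr D l v = pscale c (foldr D l' v))"
proof -
  define R where "R = (\<lambda>l l'. (word_sup n col l \<longleftrightarrow> word_sup n col l') \<and>
    (word_sup n col l \<longrightarrow> (\<exists>c. c * c = 1 \<and> (\<forall>v. foldr D l v = pscale c (foldr D l' v)))))"
  have "R l l'"
  proof (rule matsumoto[where R = R, OF _ _ _ _ _ _ assms(1-3)])
    show "R l l" for l unfolding R_def by (auto intro: exI[of _ 1])
    show "R l' l" if "R l l'" for l l'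
    proof -
      have "foldr D l' v = pscale c (foldr D l v)" if "c * c = 1" "\<forall>v. foldr D l v = pscale c (foldr D l' v)" for c v
        using that by simp
      then show ?thesis using \<open>R l l'\<close> unfolding R_def by blast
    qed
    show "R l l''" if "R l l'" "R l' l''" for l l' l''
    proof -
      have "\<exists>d. d * d = 1 \<and> (\<forall>v. foldr D l v = pscale d (foldr D l'' v))"
        if "c * c = 1" "\<forall>v. foldr D l v = pscale c (foldr D l' v)" "c' * c' = 1" "\<forall>v. foldr D l' v = pscale c' (foldr D l'' v)" for c c'
      proof -
        have "(c * c') * (c * c') = 1" using that(1,3) by (metis mult.assoc mult.commute mult_1)
        then show ?thesis using that by (intro exI[of _ "c * c'"]) simp
      qed
      then show ?thesis using that unfolding R_def by metis
    qed
    show "R (a # l) (a # l')" if "R l l'" for a l l' using that unfolding R_def by (auto simp: D_simps)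
    show "R (a # c # l) (c # a # l)" if "Suc a < c" for a c l
    proof -
      have "\<exists>d. d * d = 1 \<and> (\<forall>v. D a (D c (foldr D l v)) = pscale d (D c (D a (foldr D l v))))" if "internal a" "internal c"
        using D_far[of a c] int_par[OF that(1)] int_par[OF that(2)] \<open>Suc a < c\<close>
        by (intro exI[of _ "sg a c"]) simp
      then show ?thesis unfolding R_def word_sup_internal by auto
    qed
    show "R (a # Suc a # a # l) (Suc a # a # Suc a # l)" for a l
    proof -
      have "D a (D (Suc a) (D a v)) = D (Suc a) (D a (D (Suc a) v))" if "internal a" "internal (Suc a)" for v
        using D_braid[of a v] int_par[OF that(1)] int_par[OF that(2)] by simp
      then show ?thesis unfolding R_def word_sup_internal by (auto intro: exI[of _ 1])
    qed
  qed
  then show ?thesis using assms(4) by (simp add: R_def)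
qed

lemma Dw_nonreduced: "word_sup n col l \<Longrightarrow> \<not> rword n l \<Longrightarrow> foldr D l v = 0"
proof (induction l)
  case (Cons a l)
  show ?case
  proof (cases "rword n l")
    case False then show ?thesis using Cons by (simp add: D_simps)
  next
    case True
    have a: "1 \<le> a" "a < n" "internal a" and l: "word_sup n col l" using Cons(2) by (simp_all add: internal_def)
    have p: "word_perm l permutes {1..n}" using word_sup_set[OF l] by (rule word_perm_permutes)
    have "inv (word_perm l) (Suc a) < inv (word_perm l) a"
      using rword_ConsI[OF True a(1,2)] Cons(3) inv_neq[OF p, of a] by linarith
    then obtain l' where l': "rword n (a # l')" "word_perm (a # l') = word_perm l" by (rule rword_descent[OF p a(1,2)])
    obtain c where "\<And>v. foldr D l v = pscale c (foldr D (a # l') v)" using Dw_same[OF True l'(1) l'(2)[symmetric] l] by blast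
    then show ?thesis using DD[OF int_par[OF a(3)]] by (simp add: D_simps)
  qed
qed simp

lemma Dw_pow_far:
  "word_sup n col l \<Longrightarrow> \<forall>a\<in>set l. k < a \<Longrightarrow> \<exists>c. c \<noteq> 0 \<and> (\<forall>v. foldr D l ((Xo k ^^ r) v) = pscale c ((Xo k ^^ r) (foldr D l v)))"
proof (induction l)
  case Nil then show ?case by (intro exI[of _ 1]) simp
next
  case (Cons a l)
  then obtain c where c: "c \<noteq> 0" "\<And>v. foldr D l ((Xo k ^^ r) v) = pscale c ((Xo k ^^ r) (foldr D l v))" by auto
  have "internal a" using Cons(2) by (simp add: internal_def)
  then show ?case using c Cons(3) D_pow_far[OF int_par, of a k r]
    by (intro exI[of _ "c * sg a k ^ r"]) (simp add: D_simps)
qed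

text \<open>Each divided difference lowers the degree by one and passes to the next variable; after
  all \<open>e - k\<close> of them a nonzero constant is left.\<close>

lemma monic_deg_chain:
  assumes "1 \<le> k" "k + j \<le> e" "\<And>i. k \<le> i \<Longrightarrow> i < e \<Longrightarrow> internal i"
  shows "monic_deg (k + j) (e - (k + j)) (foldr D (rev [k..<k + j]) ((Xo k ^^ (e - k)) one))"
  using assms(2)
proof (induction j)
  case 0 then show ?case using monic_deg_pow[OF monic_deg_one assms(1), of "e - k"] by simp
next
  case (Suc j)
  have i: "internal (k + j)" using assms(3) Suc by simp
  have "Suc (e - Suc (k + j)) = e - (k + j)" using Suc by simp
  then have "monic_deg (Suc (k + j)) (e - Suc (k + j)) (D (k + j) (foldr D (rev [k..<k + j]) ((Xo k ^^ (e - k)) one)))"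
    using Suc assms(1) by (intro monic_deg_D int_par[OF i]) auto
  then show ?case by simp
qed

text \<open>A staircase monomial is built from the last position backwards: the power
  \<open>e - k\<close> of x_k, where \<open>e\<close> ends the block of \<open>k\<close>, is
  consumed by the chain from \<open>k\<close> to \<open>e\<close>. The count of letters makes the
  final word as long as the longest element.\<close>

lemma top_vector:
  "k + m = Suc n \<Longrightarrow> 1 \<le> k \<Longrightarrow> \<exists>L v \<gamma>. word_sup n col L \<and> (\<forall>a\<in>set L. k \<le> a) \<and>
     length L = card {(i, j). (i, j) \<in> block_pairs \<and> k \<le> i} \<and> \<gamma> \<noteq> 0 \<and> foldr D L v = pscale \<gamma> one"
proof (induction m arbitrary: k)
  case 0
  then have e: "{(i, j). (i, j) \<in> block_pairs \<and> k \<le> i} = {}" by (auto simp: block_pairs_def)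
  show ?case unfolding e by (intro exI[of _ "[]"] exI[of _ one] exI[of _ 1]) simp
next
  case (Suc m)
  obtain L v \<gamma> where L: "word_sup n col L" "\<forall>a\<in>set L. Suc k \<le> a"
    "length L = card {(i, j). (i, j) \<in> block_pairs \<and> Suc k \<le> i}" "\<gamma> \<noteq> 0" "foldr D L v = pscale \<gamma> one"
    using Suc.IH[of "Suc k"] Suc.prems by auto
  define e where "e = Max {j \<in> {k..n}. col j = col k}"
  have kS: "k \<in> {j \<in> {k..n}. col j = col k}" using Suc.prems by auto
  have eS: "e \<in> {j \<in> {k..n}. col j = col k}" unfolding e_def by (rule Max_in) (use kS in auto)
  have eM: "j \<le> e" if "k \<le> j" "j \<le> n" "col j = col k" for j
    unfolding e_def by (rule Max_ge) (use that in auto)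
  have ce: "col j = col k" if "k \<le> j" "j \<le> e" for j
    using contig[of k j e] that eS Suc.prems by auto
  have int: "internal i" if "k \<le> i" "i < e" for i
    using that ce[of i] ce[of "Suc i"] eS Suc.prems by (auto simp: internal_def)
  define w where "w = foldr D (rev [k..<e]) ((Xo k ^^ (e - k)) one)"
  have "monic_deg e 0 w" using monic_deg_chain[of k "e - k" e] int eS Suc.prems by (simp add: w_def)
  then obtain \<gamma>' where g: "\<gamma>' \<noteq> 0" "w - pscale \<gamma>' one \<in> low_span e 0" by (auto simp: monic_deg_def)
  have "low_span e 0 = {0}" unfolding low_span_def by simp
  then have w: "w = pscale \<gamma>' one" using g(2) by simp
  \<comment> \<open>The operators of \<open>L\<close> have indices above \<open>k\<close>, so they
    pass the power of x_k up to a scalar.\<close>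
  obtain c where c: "c \<noteq> 0" "\<And>v. foldr D L ((Xo k ^^ (e - k)) v) = pscale c ((Xo k ^^ (e - k)) (foldr D L v))"
    using Dw_pow_far[OF L(1), of k "e - k"] L(2) unfolding Suc_le_eq by blast
  have "foldr D (rev [k..<e] @ L) ((Xo k ^^ (e - k)) v) = pscale (c * \<gamma> * \<gamma>') one"
    using w by (simp add: c(2) L(5) Dw_simps pow_lin w_def)
  moreover have "word_sup n col (rev [k..<e] @ L)" using L(1) int by (simp add: word_sup_internal)
  moreover have "length (rev [k..<e] @ L) = card {(i, j). (i, j) \<in> block_pairs \<and> k \<le> i}"
  proof -
    have "{(i, j). (i, j) \<in> block_pairs \<and> k \<le> i} =
        Pair k ` {k<..e} \<union> {(i, j). (i, j) \<in> block_pairs \<and> Suc k \<le> i}"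
    proof (rule set_eqI, clarify)
      fix i j
      have "(k, j) \<in> block_pairs \<longleftrightarrow> j \<in> {k<..e}" using eM[of j] ce[of j] eS Suc.prems by (auto simp: block_pairs_def)
      then show "((i, j) \<in> {(i, j). (i, j) \<in> block_pairs \<and> k \<le> i}) =
          ((i, j) \<in> Pair k ` {k<..e} \<union> {(i, j). (i, j) \<in> block_pairs \<and> Suc k \<le> i})"
        by (cases "i = k") auto
    qed
    moreover have "finite {(i, j). (i, j) \<in> block_pairs \<and> Suc k \<le> i}"
      by (rule finite_subset[OF _ finite_block_pairs]) auto
    ultimately have "card {(i, j). (i, j) \<in> block_pairs \<and> k \<le> i} =
        card (Pair k ` {k<..e}) + card {(i, j). (i, j) \<in> block_pairs \<and> Suc k \<le> i}"
      by (simp only:) (rule card_Un_disjoint, auto)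
    moreover have "card (Pair k ` {k<..e}) = e - k" by (subst card_image) (auto simp: inj_on_def)
    ultimately show ?thesis by (simp add: L(3))
  qed
  ultimately show ?case using L(2,4) g(1) c(1)
    by (intro exI[of _ "rev [k..<e] @ L"] exI[of _ "(Xo k ^^ (e - k)) v"] exI[of _ "c * \<gamma> * \<gamma>'"]) auto
qed

lemma one_nz [simp]: "one \<noteq> 0"
proof
  assume "one = 0"
  then have "Poly_Mapping.lookup one {#} = Poly_Mapping.lookup 0 {#}" by simp
  then show False by (simp add: one_def lookup_bas)
qed

lemma Rg_one_right: "Rg one v = v"
  by (rule lin_eqI[where F = "Rg one" and G = "\<lambda>v. v"]) (simp_all add: lin_id Rg_bas bas_Xw[symmetric])

text \<open>A nonreduced word would act by 0, so the word of \<open>top_vector\<close> is reduced,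
  and by its length it represents the longest element.\<close>

lemma longest_vector:
  obtains L v \<gamma> where "word_sup n col L" "rword n L" "invs n (word_perm L) = block_pairs" "\<gamma> \<noteq> 0" "foldr D L v = pscale \<gamma> one"
proof -
  have b: "{(i, j). (i, j) \<in> block_pairs \<and> 1 \<le> i} = block_pairs" by (auto simp: block_pairs_def)
  obtain L v \<gamma> where L: "word_sup n col L" "length L = card block_pairs" "\<gamma> \<noteq> 0" "foldr D L v = pscale \<gamma> one"
    using top_vector[of 1 n] unfolding b by auto
  have r: "rword n L" using Dw_nonreduced[OF L(1), of v] L(3,4) by auto
  have "invs n (word_perm L) = block_pairs"
    using card_subset_eq[OF finite_block_pairs invs_block_pairs[OF word_perm_col_perms[OF L(1)]]] r L(2)
    by (simp add: rword_def inv_num_def)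
  then show thesis using that L r by blast
qed

text \<open>A permutation of least length with nonzero coefficient is completed on the right to the
  longest element. The same completion of any other one gives a nonreduced word, which acts by 0, so
  evaluation at the vector of \<open>longest_vector\<close> isolates a multiple of
  \<open>q w0\<close> in \<open>K n\<close>.\<close>

lemma separation:
  assumes red: "\<And>w. w permutes {1..n} \<Longrightarrow> rword n (red w) \<and> word_perm (red w) = w"
    and K: "\<And>v. (\<Sum>w\<in>col_perms n col. Rg (foldr D (red w) v) (q w)) \<in> K n"
    and small: "\<And>w k i. w \<in> col_perms n col \<Longrightarrow> k \<in> {1..n} \<Longrightarrow> N k \<le> i \<Longrightarrow> pr k i (q w) = 0"
    and w: "w \<in> col_perms n col"
  shows "q w = 0"
proof (rule ccontr)
  assume ne: "q w \<noteq> 0"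
  have fin: "finite (col_perms n col)"
    by (rule finite_subset[OF _ finite_permutations[of "{1..n}"]]) (auto simp: col_perms_def)
  obtain w0 where w0: "w0 \<in> col_perms n col" "q w0 \<noteq> 0"
    and least: "\<And>w. w \<in> col_perms n col \<Longrightarrow> q w \<noteq> 0 \<Longrightarrow> inv_num n w0 \<le> inv_num n w"
    using ex_has_least_nat[of "\<lambda>w. w \<in> col_perms n col \<and> q w \<noteq> 0" w "inv_num n"] w ne by auto
  have rd: "rword n (red w)" "word_perm (red w) = w" "word_sup n col (red w)" if "w \<in> col_perms n col" for w
    using red[of w] rword_word_sup[of "red w"] that by (auto simp: col_perms_def)
  obtain l where l: "word_sup n col (red w0 @ l)" "rword n (red w0 @ l)" "invs n (word_perm (red w0 @ l)) = block_pairs"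
    using complete_to_longest[OF rd(1,3)[OF w0(1)]] by blast
  obtain L v \<gamma> where L: "word_sup n col L" "rword n L" "invs n (word_perm L) = block_pairs" "\<gamma> \<noteq> 0" "foldr D L v = pscale \<gamma> one"
    by (rule longest_vector)
  have pl: "word_perm u permutes {1..n}" if "word_sup n col u" for u
    by (rule word_perm_permutes[OF word_sup_set[OF that]])
  have eqL: "word_perm u = word_perm L" if "word_sup n col u" "invs n (word_perm u) = block_pairs" for u
    using invs_inject[OF pl[OF that(1)] pl[OF L(1)]] that(2) L(3) by simp
  obtain c where c: "c * c = 1" "foldr D (red w0 @ l) v = pscale c (foldr D L v)"
    using Dw_same[OF l(2) L(2) eqL[OF l(1,3)] l(1)] by blast
  have zero: "Rg (foldr D (red w) (foldr D l v)) (q w) = 0" if w: "w \<in> col_perms n col" "w \<noteq> w0" for w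
  proof (cases "q w = 0")
    case True then show ?thesis by (simp add: Rg_simps)
  next
    case False
    let ?u = "red w @ l"
    have su: "word_sup n col ?u" using rd(3)[OF w(1)] l(1) by simp
    have "\<not> rword n ?u"
    proof
      \<comment> \<open>A reduced word at least as long as the longest element represents it;
        cancelling \<open>l\<close> would then give \<open>w = w0\<close>.\<close>
      assume r: "rword n ?u"
      have "card block_pairs = length (red w0 @ l)" using l(2,3) by (simp add: rword_def inv_num_def)
      also have "\<dots> \<le> length ?u" using least[OF w(1) False] rd(1,2)[OF w(1)] rd(1,2)[OF w0(1)] by (simp add: rword_def)
      also have "\<dots> = card (invs n (word_perm ?u))" using r by (simp add: rword_def inv_num_def)
      finally have "invs n (word_perm ?u) = block_pairs"
        by (intro card_seteq invs_block_pairs[OF word_perm_col_perms[OF su]]) simp_all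
      then have "word_perm ?u = word_perm (red w0 @ l)" using eqL[OF su] eqL[OF l(1,3)] by simp
      then have "w \<circ> word_perm l = w0 \<circ> word_perm l" using rd(2) w(1) w0(1) by (simp add: word_perm_append)
      moreover have "surj (word_perm l)" using pl[of l] l(1) by (simp add: permutes_surj)
      ultimately show False using w(2) by (metis fun.map_comp comp_id surj_iff)
    qed
    then have "foldr D ?u v = 0" by (rule Dw_nonreduced[OF su])
    then show ?thesis by (simp add: lin_zero[OF lin_Rg_left])
  qed
  have "(\<Sum>w\<in>col_perms n col. Rg (foldr D (red w) (foldr D l v)) (q w)) = Rg (foldr D (red w0) (foldr D l v)) (q w0)"
    by (subst sum.remove[OF fin w0(1)]) (simp add: zero)
  also have "\<dots> = pscale (c * \<gamma>) (q w0)"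
    using c(2) by (simp add: L(5) lin_scale[OF lin_Rg_left] Rg_one_right)
  finally have "pscale (c * \<gamma>) (q w0) \<in> K n" using K[of "foldr D l v"] by simp
  then have "pscale (inverse (c * \<gamma>)) (pscale (c * \<gamma>) (q w0)) \<in> K n" by (rule PS.subspace_scale[OF K_sub])
  moreover have "inverse (c * \<gamma>) * (c * \<gamma>) = 1" using c(1) L(4) by (intro left_inverse) auto
  ultimately have "q w0 \<in> K n" by (simp only: PS.scale_scale PS.scale_one)
  then have "q w0 = 0" by (rule K_small[OF order.refl]) (rule small[OF w0(1)])
  then show False using w0(2) by simp
qed

end

context cyc_poly
begin

subsection \<open>The polynomial representation\<close>

text \<open>The variables of the word \<open>\<nu>\<close> are relabelled by their positions in the block word, so that the
  words are encoded by the labellings \<open>\<sigma>\<close> that increase on each colour and \<open>x\<^sub>p e(\<nu>)\<close> acts by the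
  variable \<open>\<sigma> p\<close>. The signs \<open>inv_sign\<close> and \<open>swap_sign\<close> correct the (anti)commutation of odd crossings: exchanging
  the order in which two odd pairs of labels cross changes the sign of the product of the
  comparison factors \<open>sign_below\<close>, and \<open>odd_before\<close> compensates for the three exchanges in a braid relation.\<close>

definition inv_pairs :: "(nat \<Rightarrow> nat) \<Rightarrow> (nat \<times> nat) set" where
  "inv_pairs \<sigma> = prod.swap ` invs n (inv \<sigma>)"

abbreviation per :: "(nat \<Rightarrow> nat) \<Rightarrow> bool" where "per \<sigma> \<equiv> \<sigma> permutes {1..n}"

definition states :: "(nat \<Rightarrow> nat) set" where
  "states = {\<sigma>. per \<sigma> \<and> (\<forall>p q. 1 \<le> p \<and> p < q \<and> q \<le> n \<and> col (\<sigma> p) = col (\<sigma> q) \<longrightarrow> \<sigma> p < \<sigma> q)}"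

definition sp2 :: "nat \<times> nat \<Rightarrow> 'k" where "sp2 x = sg (fst x) (snd x)"

text \<open>The two labels that cross at position \<open>a\<close>, as a pair that does not depend
  on which of them comes first.\<close>

definition pp :: "(nat \<Rightarrow> nat) \<Rightarrow> nat \<Rightarrow> nat \<times> nat" where
  "pp \<sigma> a = (max (\<sigma> a) (\<sigma> (Suc a)), min (\<sigma> a) (\<sigma> (Suc a)))"

definition inv_sign :: "(nat \<Rightarrow> nat) \<Rightarrow> 'k" where "inv_sign \<sigma> = prod sp2 (inv_pairs \<sigma>)"

text \<open>The lexicographic order serves as some total order on pairs: of two different crossings
  exactly one then takes account of the other, which produces the sign of their exchange.\<close>

definition sign_below :: "(nat \<Rightarrow> nat) \<Rightarrow> nat \<times> nat \<Rightarrow> 'k" where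
  "sign_below \<sigma> P = (\<Prod>x\<in>inv_pairs \<sigma>. if x < P then sp2 x else 1)"

definition odd_before :: "(nat \<Rightarrow> nat) \<Rightarrow> nat \<Rightarrow> 'k" where
  "odd_before \<sigma> a = (\<Prod>p\<in>{1..<a}. if par (\<sigma> p) then - 1 else 1)"

definition swap_sign :: "(nat \<Rightarrow> nat) \<Rightarrow> nat \<Rightarrow> 'k" where
  "swap_sign \<sigma> a = (if par (\<sigma> a) \<and> par (\<sigma> (Suc a)) then odd_before \<sigma> a * sign_below \<sigma> (pp \<sigma> a) else 1)"

lemma per_comp: "per \<sigma> \<Longrightarrow> a \<in> {1..<n} \<Longrightarrow> per (\<sigma> \<circ> sfun a)"
  by (intro permutes_compose sfun_permutes) auto

lemma per_eq: "per \<sigma> \<Longrightarrow> \<sigma> p = \<sigma> q \<longleftrightarrow> p = q"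
  by (simp add: permutes_inj inj_eq)

lemma per_in: "per \<sigma> \<Longrightarrow> p \<in> {1..n} \<Longrightarrow> \<sigma> p \<in> {1..n}"
  by (simp only: permutes_in_image)

lemma finite_inv_pairs [simp]: "finite (inv_pairs \<sigma>)" by (simp add: inv_pairs_def)

lemma inv_pairs_sub: "per \<sigma> \<Longrightarrow> inv_pairs \<sigma> \<subseteq> {1..n} \<times> {1..n}"
  unfolding inv_pairs_def invs_def by fastforce

lemma inv_pairs_iff: "(k, l) \<in> inv_pairs \<sigma> \<longleftrightarrow> 1 \<le> l \<and> l < k \<and> k \<le> n \<and> inv \<sigma> k < inv \<sigma> l"
  unfolding inv_pairs_def pair_in_swap_image by (simp add: invs_def)

lemma inv_pairs_id: "inv_pairs id = {}" by (auto simp: inv_pairs_def invs_def)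

lemma inv_pairs_up:
  assumes "per \<sigma>" "a \<in> {1..<n}" "\<sigma> a < \<sigma> (Suc a)"
  shows "inv_pairs (\<sigma> \<circ> sfun a) = insert (\<sigma> (Suc a), \<sigma> a) (inv_pairs \<sigma>)" "(\<sigma> (Suc a), \<sigma> a) \<notin> inv_pairs \<sigma>"
proof -
  have i: "inv (inv \<sigma>) = \<sigma>" using permutes_inv_inv[OF assms(1)] .
  have c: "inv (\<sigma> \<circ> sfun a) = sfun a \<circ> inv \<sigma>"
    using assms by (subst o_inv_distrib) (auto simp: permutes_bij sfun_eq_transpose)
  note u = invs_sfun_up[OF permutes_inv[OF assms(1)], of a, unfolded i]
  show "inv_pairs (\<sigma> \<circ> sfun a) = insert (\<sigma> (Suc a), \<sigma> a) (inv_pairs \<sigma>)" "(\<sigma> (Suc a), \<sigma> a) \<notin> inv_pairs \<sigma>"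
    using u assms unfolding inv_pairs_def c by (auto simp: image_iff)
qed

lemma inv_pairs_down:
  assumes "per \<sigma>" "a \<in> {1..<n}" "\<sigma> (Suc a) < \<sigma> a"
  shows "inv_pairs \<sigma> = insert (\<sigma> a, \<sigma> (Suc a)) (inv_pairs (\<sigma> \<circ> sfun a))" "(\<sigma> a, \<sigma> (Suc a)) \<notin> inv_pairs (\<sigma> \<circ> sfun a)"
  using inv_pairs_up[OF per_comp[OF assms(1,2)] assms(2)] assms(3) by (simp_all add: sfun_apply comp_assoc)

text \<open>One pair enters or leaves the inversion set; since the values of \<open>f\<close> square
  to 1, both cases multiply the product by the same factor.\<close>

lemma inv_pairs_prod:
  assumes l: "per \<sigma>" and a: "a \<in> {1..<n}" and f: "\<And>x. f x * f x = (1 :: 'k)"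
  shows "prod f (inv_pairs (\<sigma> \<circ> sfun a)) = f (pp \<sigma> a) * prod f (inv_pairs \<sigma>)"
proof -
  have "\<sigma> a \<noteq> \<sigma> (Suc a)" using per_eq[OF l] by simp
  then consider "\<sigma> a < \<sigma> (Suc a)" | "\<sigma> (Suc a) < \<sigma> a" by linarith
  then show ?thesis
  proof cases
    case 1 then show ?thesis using inv_pairs_up[OF l a 1] by (simp add: pp_def)
  next
    case 2
    have "f (\<sigma> a, \<sigma> (Suc a)) * (f (\<sigma> a, \<sigma> (Suc a)) * prod f (inv_pairs (\<sigma> \<circ> sfun a))) = prod f (inv_pairs (\<sigma> \<circ> sfun a))"
      using f by (simp flip: mult.assoc)
    then show ?thesis using inv_pairs_down[OF l a 2] 2 by (simp add: pp_def)
  qed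
qed

lemma sp2_sq: "sp2 x * sp2 x = 1" by (simp add: sp2_def)

lemma sp2_pp: "sp2 (pp \<sigma> a) = sg (\<sigma> a) (\<sigma> (Suc a))"
  by (auto simp: sp2_def pp_def sg_def max_def min_def)

lemma inv_sign_toggle: "per \<sigma> \<Longrightarrow> a \<in> {1..<n} \<Longrightarrow> inv_sign (\<sigma> \<circ> sfun a) = sg (\<sigma> a) (\<sigma> (Suc a)) * inv_sign \<sigma>"
  unfolding inv_sign_def by (simp add: inv_pairs_prod sp2_sq sp2_pp)

lemma sign_below_toggle: "per \<sigma> \<Longrightarrow> a \<in> {1..<n} \<Longrightarrow>
   sign_below (\<sigma> \<circ> sfun a) P = (if pp \<sigma> a < P then sg (\<sigma> a) (\<sigma> (Suc a)) else 1) * sign_below \<sigma> P"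
  unfolding sign_below_def by (subst inv_pairs_prod) (simp_all add: sp2_sq sp2_pp)

lemma prod_sq: "(\<And>x. x \<in> S \<Longrightarrow> f x * f x = (1 :: 'k)) \<Longrightarrow> prod f S * prod f S = 1"
  by (simp flip: prod.distrib)

lemma inv_sign_sq: "inv_sign \<sigma> * inv_sign \<sigma> = 1" unfolding inv_sign_def by (rule prod_sq) (simp add: sp2_sq)

lemma odd_before_toggle: "a \<le> c \<Longrightarrow> odd_before (\<sigma> \<circ> sfun c) a = odd_before \<sigma> a"
  unfolding odd_before_def by (rule prod.cong) (auto simp: sfun_apply)

lemma odd_before_Suc: "1 \<le> a \<Longrightarrow> odd_before \<sigma> (Suc a) = odd_before \<sigma> a * (if par (\<sigma> a) then - 1 else 1)"
  unfolding odd_before_def by (simp add: prod.op_ivl_Suc)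

lemma odd_before_toggle_far: "1 \<le> c \<Longrightarrow> Suc c < a \<Longrightarrow> odd_before (\<sigma> \<circ> sfun c) a = odd_before \<sigma> a"
proof (induction a)
  case (Suc a)
  show ?case
  proof (cases "a = Suc c")
    case True
    have "odd_before (\<sigma> \<circ> sfun c) (Suc (Suc c)) = odd_before \<sigma> (Suc (Suc c))"
      using Suc(2) odd_before_toggle[of c c \<sigma>] by (simp add: odd_before_Suc sfun_apply mult_ac)
    then show ?thesis unfolding True .
  next
    case False
    then show ?thesis using Suc by (simp add: odd_before_Suc sfun_apply)
  qed
qed simp

lemma odd_before_sq: "odd_before \<sigma> a * odd_before \<sigma> a = 1" unfolding odd_before_def by (rule prod_sq) simp

lemma sign_below_sq: "sign_below \<sigma> P * sign_below \<sigma> P = 1" unfolding sign_below_def by (rule prod_sq) (simp add: sp2_sq)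

lemma swap_sign_sq: "swap_sign \<sigma> a * swap_sign \<sigma> a = 1"
proof -
  have "(odd_before \<sigma> a * sign_below \<sigma> P) * (odd_before \<sigma> a * sign_below \<sigma> P) = (odd_before \<sigma> a * odd_before \<sigma> a) * (sign_below \<sigma> P * sign_below \<sigma> P)" for P
    by (simp only: mult_ac)
  then show ?thesis by (simp add: swap_sign_def odd_before_sq sign_below_sq)
qed

lemma pp_self: "pp (\<sigma> \<circ> sfun a) a = pp \<sigma> a"
  by (simp add: pp_def sfun_apply max.commute min.commute)

lemma swap_sign_self: "per \<sigma> \<Longrightarrow> a \<in> {1..<n} \<Longrightarrow> swap_sign (\<sigma> \<circ> sfun a) a = swap_sign \<sigma> a"
  unfolding swap_sign_def pp_self by (auto simp: sfun_apply odd_before_toggle sign_below_toggle)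

lemma pp_far: "Suc a < c \<or> Suc c < a \<Longrightarrow> pp (\<sigma> \<circ> sfun a) c = pp \<sigma> c"
  by (auto simp: pp_def sfun_apply)

lemma pp_neq:
  assumes "per \<sigma>" "a \<noteq> c" shows "pp \<sigma> a \<noteq> pp \<sigma> c"
proof
  assume "pp \<sigma> a = pp \<sigma> c"
  then have "{\<sigma> a, \<sigma> (Suc a)} = {\<sigma> c, \<sigma> (Suc c)}"
    unfolding pp_def by (simp add: max_def min_def split: if_splits) blast+
  then have "{a, Suc a} = {c, Suc c}" using per_eq[OF assms(1)] by (auto simp: doubleton_eq_iff)
  then show False using assms(2) by (auto simp: doubleton_eq_iff)
qed

text \<open>Only the larger of the two pairs notices whether the other one has crossed already, so
  the order of the crossings matters by a sign exactly when all four labels are odd.\<close>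

lemma swap_sign_far:
  assumes l: "per \<sigma>" and a: "a \<in> {1..<n}" "c \<in> {1..<n}" and far: "Suc a < c \<or> Suc c < a"
  shows "swap_sign \<sigma> a * swap_sign (\<sigma> \<circ> sfun a) c =
    (if par (\<sigma> a) \<and> par (\<sigma> (Suc a)) \<and> par (\<sigma> c) \<and> par (\<sigma> (Suc c)) then - 1 else 1) * (swap_sign \<sigma> c * swap_sign (\<sigma> \<circ> sfun c) a)"
proof -
  have b: "odd_before (\<sigma> \<circ> sfun a) c = odd_before \<sigma> c" "odd_before (\<sigma> \<circ> sfun c) a = odd_before \<sigma> a"
    using far a odd_before_toggle[of c a \<sigma>] odd_before_toggle[of a c \<sigma>] odd_before_toggle_far[of a c \<sigma>] odd_before_toggle_far[of c a \<sigma>] by auto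
  have p: "pp (\<sigma> \<circ> sfun a) c = pp \<sigma> c" "pp (\<sigma> \<circ> sfun c) a = pp \<sigma> a" using pp_far[OF far] pp_far[of c a] far by auto
  have s: "sfun a c = c" "sfun a (Suc c) = Suc c" "sfun c a = a" "sfun c (Suc a) = Suc a"
    using far by (auto simp: sfun_apply)
  have o: "pp \<sigma> c < pp \<sigma> a \<longleftrightarrow> \<not> pp \<sigma> a < pp \<sigma> c" using pp_neq[OF l, of a c] far by auto
  show ?thesis unfolding swap_sign_def p b sign_below_toggle[OF l a(1)] sign_below_toggle[OF l a(2)] comp_apply s o
    by (cases "pp \<sigma> a < pp \<sigma> c") (auto simp: sg_def)
qed

text \<open>Both sides cross the same three pairs of labels in opposite orders. For three odd labels
  the three exchanges leave a sign; \<open>odd_before\<close> enters at \<open>b\<close> twice on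
  one side and once on the other, which compensates it. The proof is a finite check over parities
  and the order of the pairs.\<close>

lemma swap_sign_braid:
  assumes l: "per \<sigma>" and a: "1 \<le> a" "Suc a < n"
  defines "b \<equiv> Suc a"
  shows "swap_sign \<sigma> b * (swap_sign (\<sigma> \<circ> sfun b) a * swap_sign (\<sigma> \<circ> sfun b \<circ> sfun a) b) =
    swap_sign \<sigma> a * (swap_sign (\<sigma> \<circ> sfun a) b * swap_sign (\<sigma> \<circ> sfun a \<circ> sfun b) a)"
proof -
  let ?u = "\<sigma> a" and ?v = "\<sigma> b" and ?w = "\<sigma> (Suc b)"
  define q where "q x y = (max x y, min x y)" for x y :: nat
  have qc: "q x y = q y x" for x y by (simp add: q_def max.commute min.commute)
  have d: "?u \<noteq> ?v" "?u \<noteq> ?w" "?v \<noteq> ?w" using per_eq[OF l] by (simp_all add: b_def)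
  have ab: "a \<in> {1..<n}" "b \<in> {1..<n}" using a by (auto simp: b_def)
  have s: "sfun a a = b" "sfun a b = a" "sfun b b = Suc b" "sfun b (Suc b) = b" "sfun b a = a" "sfun a (Suc b) = Suc b"
    by (simp_all add: sfun_apply b_def)
  have p: "pp \<mu> a = q (\<mu> a) (\<mu> b)" "pp \<mu> b = q (\<mu> b) (\<mu> (Suc b))" for \<mu> by (simp_all add: pp_def q_def b_def)
  have pb: "per (\<sigma> \<circ> sfun a)" "per (\<sigma> \<circ> sfun b)" using per_comp[OF l] ab by auto
  have B: "odd_before (\<sigma> \<circ> sfun b) a = odd_before \<sigma> a" "odd_before (\<sigma> \<circ> sfun b \<circ> sfun a) a = odd_before \<sigma> a" "odd_before (\<sigma> \<circ> sfun a) a = odd_before \<sigma> a"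
     "odd_before (\<sigma> \<circ> sfun a \<circ> sfun b) a = odd_before \<sigma> a"
    using odd_before_toggle[of a b] odd_before_toggle[of a a] by (simp_all add: b_def)
  have Bb: "odd_before \<mu> b = odd_before \<mu> a * (if par (\<mu> a) then - 1 else 1)" for \<mu> using odd_before_Suc[of a \<mu>] a by (simp add: b_def)
  have Sa: "Suc a = b" by (simp add: b_def)
  have ne: "q ?u ?w \<noteq> q ?v ?w" "q ?u ?v \<noteq> q ?v ?w" "q ?u ?v \<noteq> q ?u ?w"
    using d by (auto simp: q_def max_def min_def)
  have o: "q ?v ?w < q ?u ?w \<longleftrightarrow> \<not> q ?u ?w < q ?v ?w" "q ?v ?w < q ?u ?v \<longleftrightarrow> \<not> q ?u ?v < q ?v ?w"
     "q ?u ?w < q ?u ?v \<longleftrightarrow> \<not> q ?u ?v < q ?u ?w" using ne by auto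
  note L = sign_below_toggle[OF l ab(1)] sign_below_toggle[OF l ab(2)] sign_below_toggle[OF pb(1) ab(2)] sign_below_toggle[OF pb(2) ab(1)]
  have c: "q ?w ?u = q ?u ?w" "q ?w ?v = q ?v ?w" "q ?v ?u = q ?u ?v" by (rule qc)+
  show ?thesis
    unfolding swap_sign_def Sa p L comp_apply s Bb B c o
    by (cases "par ?u"; cases "par ?v"; cases "par ?w"; cases "q ?u ?w < q ?v ?w"; cases "q ?u ?v < q ?v ?w"; cases "q ?u ?v < q ?u ?w")
      (simp_all add: sg_def)
qed

lemma states_per: "\<sigma> \<in> states \<Longrightarrow> per \<sigma>" by (simp add: states_def)

lemma states_mono: "\<sigma> \<in> states \<Longrightarrow> 1 \<le> p \<Longrightarrow> p < q \<Longrightarrow> q \<le> n \<Longrightarrow> col (\<sigma> p) = col (\<sigma> q) \<Longrightarrow> \<sigma> p < \<sigma> q"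
  by (simp add: states_def)

text \<open>A label strictly between the two has the same colour, as colours form intervals, so by
  monotonicity it would have to stand between two adjacent positions.\<close>

lemma states_next:
  assumes l: "\<sigma> \<in> states" and a: "a \<in> {1..<n}" and c: "col (\<sigma> a) = col (\<sigma> (Suc a))"
  shows "\<sigma> (Suc a) = Suc (\<sigma> a)" "internal (\<sigma> a)"
proof -
  note p = states_per[OF l]
  have lt: "\<sigma> a < \<sigma> (Suc a)" using states_mono[OF l, of a "Suc a"] a c by auto
  have r: "\<sigma> a \<in> {1..n}" "\<sigma> (Suc a) \<in> {1..n}" using per_in[OF p] a by auto
  show e: "\<sigma> (Suc a) = Suc (\<sigma> a)"
  proof (rule ccontr)
    assume "\<sigma> (Suc a) \<noteq> Suc (\<sigma> a)"
    then have m: "Suc (\<sigma> a) < \<sigma> (Suc a)" using lt by simp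
    define q where "q = inv \<sigma> (Suc (\<sigma> a))"
    have lq: "\<sigma> q = Suc (\<sigma> a)" using p by (simp add: q_def permutes_inverses)
    have "Suc (\<sigma> a) \<in> {1..n}" using m r by auto
    then have qr: "q \<in> {1..n}" using permutes_in_image[OF p, of q] by (simp add: lq)
    have cq: "col (\<sigma> q) = col (\<sigma> a)" unfolding lq by (rule contig[of _ _ "\<sigma> (Suc a)"]) (use r m c in auto)
    have "q \<noteq> a" "q \<noteq> Suc a" using lq m by auto
    then consider "q < a" | "Suc a < q" by linarith
    then show False
    proof cases
      case 1 then show False using states_mono[OF l, of q a] qr a cq lq by simp
    next
      case 2 then show False using states_mono[OF l, of "Suc a" q] qr a cq c lq m by simp
    qed
  qed
  show "internal (\<sigma> a)" using r e c by (auto simp: internal_def)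
qed

lemma states_swap:
  assumes l: "\<sigma> \<in> states" and a: "a \<in> {1..<n}" and c: "col (\<sigma> a) \<noteq> col (\<sigma> (Suc a))"
  shows "\<sigma> \<circ> sfun a \<in> states"
  unfolding states_def
proof (intro CollectI conjI allI impI)
  show "per (\<sigma> \<circ> sfun a)" using per_comp[OF states_per[OF l] a] .
  fix p q assume pq: "1 \<le> p \<and> p < q \<and> q \<le> n \<and> col ((\<sigma> \<circ> sfun a) p) = col ((\<sigma> \<circ> sfun a) q)"
  then have "sfun a p < sfun a q" using c by (auto simp: sfun_apply split: if_splits)
  moreover have "sfun a p \<in> {1..n}" "sfun a q \<in> {1..n}" using pq sfun_le_iff[of a n] a by auto
  ultimately show "(\<sigma> \<circ> sfun a) p < (\<sigma> \<circ> sfun a) q" using states_mono[OF l, of "sfun a p" "sfun a q"] pq by simp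
qed

lemma id_states: "id \<in> states" by (simp add: states_def permutes_id)

text \<open>Consecutive labels at adjacent positions are inverted with the same other labels, so the
  inverted pairs are symmetric under their exchange, as \<open>D_qo_prod\<close> demands.\<close>

lemma inv_pairs_internal:
  assumes l: "\<sigma> \<in> states" and a: "a \<in> {1..<n}" and c: "col (\<sigma> a) = col (\<sigma> (Suc a))" and kl: "(k, m) \<in> inv_pairs \<sigma>"
  shows "(sfun (\<sigma> a) k, sfun (\<sigma> a) m) \<in> inv_pairs \<sigma>" "\<not> (k \<in> {\<sigma> a, Suc (\<sigma> a)} \<and> m \<in> {\<sigma> a, Suc (\<sigma> a)})"
proof -
  note p = states_per[OF l] and nx = states_next[OF l a c]
  let ?k = "\<sigma> a"
  have i: "inv \<sigma> ?k = a" "inv \<sigma> (Suc ?k) = Suc a" using permutes_inverses(2)[OF p, of a] permutes_inverses(2)[OF p, of "Suc a"] nx(1) by simp_all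
  have r: "?k \<in> {1..n}" "Suc ?k \<in> {1..n}" using per_in[OF p, of a] per_in[OF p, of "Suc a"] a nx(1) by auto
  have km: "1 \<le> m" "m < k" "k \<le> n" "inv \<sigma> k < inv \<sigma> m" using kl by (simp_all add: inv_pairs_iff)
  show ne: "\<not> (k \<in> {?k, Suc ?k} \<and> m \<in> {?k, Suc ?k})" using km i by auto
  have j: "inv \<sigma> x = a \<longleftrightarrow> x = ?k" "inv \<sigma> x = Suc a \<longleftrightarrow> x = Suc ?k" for x
    using per_eq[OF permutes_inv[OF p], of x ?k] per_eq[OF permutes_inv[OF p], of x "Suc ?k"] i by simp_all
  have s: "inv \<sigma> (sfun ?k x) = sfun a (inv \<sigma> x)" for x
    using i j[of x] by (auto simp: sfun_apply)
  have "sfun a (inv \<sigma> k) < sfun a (inv \<sigma> m)" using km(4) ne j[of k] j[of m] by (auto simp: sfun_apply)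
  moreover have "sfun ?k m < sfun ?k k" using km(2) ne by (auto simp: sfun_apply)
  moreover have "sfun ?k m \<in> {1..n}" "sfun ?k k \<in> {1..n}" using r km by (auto simp: sfun_apply)
  ultimately show "(sfun ?k k, sfun ?k m) \<in> inv_pairs \<sigma>" by (simp add: inv_pairs_iff s)
qed

lemma D_qo_prod_inv_pairs:
  assumes "\<sigma> \<in> states" "a \<in> {1..<n}" "col (\<sigma> a) = col (\<sigma> (Suc a))"
  shows "D (\<sigma> a) (qo_prod (inv_pairs \<sigma>) v) = qo_prod (inv_pairs \<sigma>) (D (\<sigma> a) v)"
  by (rule D_qo_prod[OF states_next(2)[OF assms] finite_inv_pairs inv_pairs_sub[OF states_per[OF assms(1)]] inv_pairs_internal[OF assms]])

end

section \<open>The action of the generators and the subspace that the cyclotomic ideal maps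
  into\<close>

locale cyc_rep = cyc_poly par ty n col t Lam mm N
  for par :: "nat \<Rightarrow> bool" and ty :: "'k::field itself" and n :: nat and col :: "nat \<Rightarrow> 'i"
    and t :: "'i \<Rightarrow> 'i \<Rightarrow> nat \<Rightarrow> nat \<Rightarrow> 'k" and Lam :: "'i \<Rightarrow> nat" and mm :: "'i \<Rightarrow> 'i \<Rightarrow> nat"
    and N :: "nat \<Rightarrow> nat" +
  fixes Iodd :: "'i set" and IB :: "'i list set"
  assumes par_Iodd: "\<And>k. k \<in> {1..n} \<Longrightarrow> par k \<longleftrightarrow> col k \<in> Iodd"
    and finIB: "finite IB"
    and word_IB: "\<And>\<sigma>. \<sigma> permutes {1..n} \<Longrightarrow> map (\<lambda>p. col (\<sigma> p)) [1..<Suc n] \<in> IB"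
    and IB_length: "\<And>\<nu>. \<nu> \<in> IB \<Longrightarrow> length \<nu> = n"
    and Q_diag: "\<And>k. k \<in> {1..n} \<Longrightarrow> Qsupp t (col k) (col k) = {}"
begin

definition word :: "(nat \<Rightarrow> nat) \<Rightarrow> 'i list" where "word \<sigma> = map (\<lambda>p. col (\<sigma> p)) [1..<Suc n]"

definition label_sign :: "(nat \<Rightarrow> nat) \<Rightarrow> nat \<Rightarrow> 'k" where "label_sign \<sigma> k = (if par k then inv_sign \<sigma> else 1)"

definition Xs :: "(nat \<Rightarrow> nat) \<Rightarrow> nat \<Rightarrow> 'k spoly \<Rightarrow> 'k spoly" where
  "Xs \<sigma> p v = pscale (label_sign \<sigma> (\<sigma> p)) (Xo (\<sigma> p) v)"

definition Ds :: "(nat \<Rightarrow> nat) \<Rightarrow> nat \<Rightarrow> 'k spoly \<Rightarrow> 'k spoly" where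
  "Ds \<sigma> a v = pscale (label_sign \<sigma> (\<sigma> a)) (D (\<sigma> a) v)"

text \<open>The polynomial \<open>Q\<close> is applied when a pair of labels becomes uninverted; the opposite choice would
  not preserve \<open>rep_ideal\<close> below.\<close>

definition Qs :: "(nat \<Rightarrow> nat) \<Rightarrow> nat \<Rightarrow> 'k spoly \<Rightarrow> 'k spoly" where
  "Qs \<sigma> a v = pscale (swap_sign \<sigma> a) (if \<sigma> a < \<sigma> (Suc a) then qo (\<sigma> a) (\<sigma> (Suc a)) v else v)"

definition vs :: "'k \<Rightarrow> ((nat \<Rightarrow> nat) \<Rightarrow> 'k spoly) \<Rightarrow> (nat \<Rightarrow> nat) \<Rightarrow> 'k spoly" where
  "vs c g = (\<lambda>\<sigma>. pscale c (g \<sigma>))"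

text \<open>Vectors are arbitrary functions on labellings; values outside \<open>states\<close> are
  disregarded by \<open>rep_ideal\<close>. At a crossing of equal colours the labelling stays, since
  exchanging the two labels would destroy monotonicity.\<close>

primrec ro :: "'i gen \<Rightarrow> ((nat \<Rightarrow> nat) \<Rightarrow> 'k spoly) \<Rightarrow> (nat \<Rightarrow> nat) \<Rightarrow> 'k spoly" where
  "ro (E \<nu>) = (\<lambda>g \<sigma>. if word \<sigma> = \<nu> then g \<sigma> else 0)"
| "ro (X p) = (\<lambda>g \<sigma>. Xs \<sigma> p (g \<sigma>))"
| "ro (T a) = (\<lambda>g \<sigma>. if col (\<sigma> a) = col (\<sigma> (Suc a)) then Ds \<sigma> a (g \<sigma>) else Qs \<sigma> a (g (\<sigma> \<circ> sfun a)))"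

lemma lin_Xs [simp]: "lin (Xs \<sigma> p)" unfolding Xs_def[abs_def] by (intro lin_pscale lin_Xo)
lemma lin_Ds [simp]: "lin (Ds \<sigma> p)" unfolding Ds_def[abs_def] by (intro lin_pscale lin_D)
lemma lin_Qs [simp]: "lin (Qs \<sigma> p)" unfolding Qs_def[abs_def]
  by (cases "\<sigma> p < \<sigma> (Suc p)") (simp_all add: lin_pscale lin_id)

lemmas XDQ_simps = lin_simps[OF lin_Xs] lin_simps[OF lin_Ds] lin_simps[OF lin_Qs]

lemma vs_apply: "vs c g \<sigma> = pscale c (g \<sigma>)" by (simp add: vs_def)

sublocale R: gen_rep vs ro
proof unfold_locales
  fix g and v w :: "(nat \<Rightarrow> nat) \<Rightarrow> 'k spoly" and c
  show "ro g (v + w) = ro g v + ro g w"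
    by (cases g) (auto simp: fun_eq_iff fun_apply XDQ_simps)
  show "ro g (vs c v) = vs c (ro g v)"
    by (cases g) (auto simp: fun_eq_iff vs_apply XDQ_simps)
qed (auto simp: fun_eq_iff fun_apply vs_apply PS.scale_right_distrib PS.scale_left_distrib)

lemma sum_state: "(sum f S) \<sigma> = (\<Sum>a\<in>S. f a \<sigma> :: 'k spoly)"
  by (induction S rule: infinite_finite_induct) (simp_all add: fun_apply)

text \<open>The Q of the inverted pairs are those that the crossings applies on the way from the
  labelling to the identity. At the identity no pair is inverted, and the condition is membership in
  \<open>K n\<close>.\<close>

definition rep_ideal :: "((nat \<Rightarrow> nat) \<Rightarrow> 'k spoly) set" where
  "rep_ideal = {g. \<forall>\<sigma>\<in>states. qo_prod (inv_pairs \<sigma>) (g \<sigma>) \<in> K n}"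

lemma rep_ideal_sub: "R.subspace rep_ideal"
  by (rule R.subspaceI)
    (simp_all add: rep_ideal_def fun_apply vs_apply lin_simps[OF lin_qo_prod] PS.subspace_0[OF K_sub] PS.subspace_add[OF K_sub]
      PS.subspace_scale[OF K_sub])

lemma rep_ideal_zero: "(\<And>\<sigma>. \<sigma> \<in> states \<Longrightarrow> g \<sigma> = 0) \<Longrightarrow> g \<in> rep_ideal"
  by (simp add: rep_ideal_def lin_simps[OF lin_qo_prod] PS.subspace_0[OF K_sub])

text \<open>For equal colours the product over the inverted pairs commutes with the divided
  difference. For different colours, the Q applied when a pair is uninverted is the factor that this
  pair contributed before; in the other direction a new factor Q appears, which \<open>K n\<close>
  absorbs.\<close>

lemma rep_ideal_stable_T:
  assumes g: "g \<in> rep_ideal" and a: "a \<in> {1..<n}" shows "ro (T a) g \<in> rep_ideal"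
  unfolding rep_ideal_def
proof (intro CollectI ballI)
  fix \<sigma> assume s: "\<sigma> \<in> states"
  let ?k = "\<sigma> a" and ?l = "\<sigma> (Suc a)" and ?m = "\<sigma> \<circ> sfun a"
  note p = states_per[OF s]
  show "qo_prod (inv_pairs \<sigma>) (ro (T a) g \<sigma>) \<in> K n"
  proof (cases "col ?k = col ?l")
    case True
    note i = states_next(2)[OF s a True]
    have "qo_prod (inv_pairs \<sigma>) (g \<sigma>) \<in> K n" "Suc ?k \<le> n" using g s i by (simp_all add: rep_ideal_def internal_def)
    then have "D ?k (qo_prod (inv_pairs \<sigma>) (g \<sigma>)) \<in> K n" by (intro K_D[OF i, of n n]) simp_all
    then show ?thesis using True
      by (simp add: Ds_def lin_simps[OF lin_qo_prod] D_qo_prod_inv_pairs[OF s a True] PS.subspace_scale[OF K_sub])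
  next
    case False
    have m: "qo_prod (inv_pairs ?m) (g ?m) \<in> K n" using g states_swap[OF s a False] by (simp add: rep_ideal_def)
    have "?k \<noteq> ?l" using per_eq[OF p] by simp
    then consider "?k < ?l" | "?l < ?k" by linarith
    then have "qo_prod (inv_pairs \<sigma>) (Qs \<sigma> a (g ?m)) \<in> K n"
    proof cases
      case 1
      have "qo_prod (inv_pairs ?m) (g ?m) = qo ?l ?k (qo_prod (inv_pairs \<sigma>) (g ?m))"
        using inv_pairs_up[OF p a 1] by (simp add: qo_prod_insert)
      then show ?thesis using m 1
        by (simp add: Qs_def lin_simps[OF lin_qo_prod] qo_prod_qo qo_sym[of ?k ?l] PS.subspace_scale[OF K_sub])
    next
      case 2
      have "qo_prod (inv_pairs \<sigma>) (g ?m) = qo ?k ?l (qo_prod (inv_pairs ?m) (g ?m))"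
        using inv_pairs_down[OF p a 2] qo_prod_insert[of "inv_pairs ?m" ?k ?l] by simp
      then show ?thesis using m 2
        by (simp add: Qs_def lin_simps[OF lin_qo_prod] K_qo PS.subspace_scale[OF K_sub])
    qed
    then show ?thesis using False by simp
  qed
qed

lemma rep_ideal_stable: "g \<in> rep_ideal \<Longrightarrow> ro (E \<nu>) g \<in> rep_ideal" "g \<in> rep_ideal \<Longrightarrow> ro (X p) g \<in> rep_ideal"
  by (auto simp: rep_ideal_def Xs_def lin_simps[OF lin_qo_prod] PS.subspace_0[OF K_sub] qo_prod_Xo intro!: PS.subspace_scale[OF K_sub] K_Xo)

lemma ent_word: "p \<in> {1..n} \<Longrightarrow> ent (word \<sigma>) p = col (\<sigma> p)"
proof -
  assume p: "p \<in> {1..n}"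
  have u: "[1..<Suc n] ! (p - 1) = 1 + (p - 1)" by (rule nth_upt) (use p in auto)
  have l: "p - 1 < length [1..<Suc n]" unfolding length_upt using p by auto
  have "1 + (p - 1) = p" using p by auto
  then show ?thesis unfolding ent_def word_def nth_map[OF l] u by (rule arg_cong)
qed

lemma length_word [simp]: "length (word \<sigma>) = n" by (simp add: word_def)

lemma word_swap: "a \<in> {1..<n} \<Longrightarrow> word (\<sigma> \<circ> sfun a) = swap_at a (word \<sigma>)"
  by (rule ent_eqI) (auto simp: ent_swap_at ent_word sfun_le_iff[of a n, simplified])

lemma word_swap_iff: "a \<in> {1..<n} \<Longrightarrow> length \<nu> = n \<Longrightarrow> word \<sigma> = swap_at a \<nu> \<longleftrightarrow> word (\<sigma> \<circ> sfun a) = \<nu>"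
  using swap_at_swap_at[of a \<nu>] swap_at_swap_at[of a "word \<sigma>"] by (simp add: word_swap) metis

lemma sgn_col:
  assumes "k \<in> {1..n}" "l \<in> {1..n}"
  shows "sgn_par Iodd [col k, col l] = sg k l"
    "p \<in> {1..n} \<Longrightarrow> sgn_par Iodd [col p, col k, col l] = (if par p then sg k l else 1)"
    "p \<in> {1..n} \<Longrightarrow> q \<in> {1..n} \<Longrightarrow>
      sgn_par Iodd [col k, col l, col p, col q] = (if par k \<and> par l \<and> par p \<and> par q then - 1 else (1 :: 'k))"
    "sgn_par Iodd [col k] = (if par k then - 1 else (1 :: 'k))"
  using assms by (auto simp: sgn_par_def sg_def par_Iodd)

lemma label_sign_sq: "label_sign \<sigma> k * label_sign \<sigma> k = 1" by (simp add: label_sign_def inv_sign_sq)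

lemma label_sign_swap: "per \<sigma> \<Longrightarrow> a \<in> {1..<n} \<Longrightarrow> label_sign (\<sigma> \<circ> sfun a) k = (if par k then sg (\<sigma> a) (\<sigma> (Suc a)) else 1) * label_sign \<sigma> k"
  by (simp add: label_sign_def inv_sign_toggle)

text \<open>The relations are checked on vectors concentrated on one word, such as those in the
  image of an idempotent; this ties the colours in the signs of a relation to the labelling.\<close>

definition supp :: "'i list \<Rightarrow> ((nat \<Rightarrow> nat) \<Rightarrow> 'k spoly) \<Rightarrow> bool" where
  "supp \<nu> h \<longleftrightarrow> (\<forall>\<sigma>. h \<sigma> \<noteq> 0 \<longrightarrow> word \<sigma> = \<nu>)"

lemma supp_E: "supp \<nu> (ro (E \<nu>) v)" by (simp add: supp_def)

lemma supp_cases: assumes "supp \<nu> h" obtains "h \<sigma> = 0" | "word \<sigma> = \<nu>" using assms by (auto simp: supp_def)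

lemma Xs_comm: assumes "per \<sigma>" "p \<noteq> q" shows "Xs \<sigma> p (Xs \<sigma> q v) = pscale (sg (\<sigma> p) (\<sigma> q)) (Xs \<sigma> q (Xs \<sigma> p v))"
  using Xo_comm[of "\<sigma> p" "\<sigma> q" v] per_eq[OF assms(1)] assms(2) by (simp add: Xs_def Xo_simps mult_ac)

lemma r_XX:
  assumes h: "supp \<nu> h" and p: "p \<in> {1..n}" "q \<in> {1..n}" "p \<noteq> q" and s: "\<sigma> \<in> states"
  shows "ro (X p) (ro (X q) h) \<sigma> = pscale (sgn_par Iodd [ent \<nu> p, ent \<nu> q]) (ro (X q) (ro (X p) h) \<sigma>)"
proof (cases rule: supp_cases[OF h, of \<sigma>])
  case 2
  show ?thesis using p states_per[OF s] per_in[OF states_per[OF s]] unfolding 2[symmetric]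
    by (simp add: ent_word sgn_col Xs_comm[of \<sigma> p q])
qed (simp add: XDQ_simps)

lemma r_TE:
  assumes a: "a \<in> {1..<n}" and \<nu>: "length \<nu> = n"
  shows "ro (T a) (ro (E \<nu>) v) \<sigma> = ro (E (swap_at a \<nu>)) (ro (T a) v) \<sigma>"
proof -
  have "word (\<sigma> \<circ> sfun a) = word \<sigma>" if "col (\<sigma> a) = col (\<sigma> (Suc a))"
    using that a by (auto simp: word_def sfun_apply)
  then show ?thesis using word_swap_iff[OF a \<nu>, of \<sigma>] by (auto simp: XDQ_simps)
qed

lemma Qs_Xo: "Qs \<sigma> a (Xo k v) = Xo k (Qs \<sigma> a v)"
  by (simp add: Qs_def qo_Xo Xo_simps)

text \<open>Exactly one of the two crossings uninverts the pair, so Q is applied once; the sign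
  \<open>swap_sign\<close> is the same for both and squares to 1.\<close>

lemma Qs_Qs: assumes "per \<sigma>" "a \<in> {1..<n}"
  shows "Qs \<sigma> a (Qs (\<sigma> \<circ> sfun a) a v) = qo (\<sigma> a) (\<sigma> (Suc a)) v"
proof -
  have "\<sigma> a \<noteq> \<sigma> (Suc a)" using per_eq[OF assms(1)] by simp
  then show ?thesis using swap_sign_sq[of \<sigma> a] qo_sym[of "\<sigma> a" "\<sigma> (Suc a)"]
    by (auto simp: Qs_def swap_sign_self[OF assms] sfun_apply qo_simps)
qed

lemma X_pow:
  assumes "par (\<sigma> p) \<Longrightarrow> even r" shows "(ro (X p) ^^ r) g \<sigma> = (Xo (\<sigma> p) ^^ r) (g \<sigma>)"
proof -
  have g: "(ro (X p) ^^ r) g \<sigma> = pscale (label_sign \<sigma> (\<sigma> p) ^ r) ((Xo (\<sigma> p) ^^ r) (g \<sigma>))" for r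
    by (induction r) (simp_all add: Xs_def Xo_simps mult.commute)
  have "label_sign \<sigma> (\<sigma> p) ^ r = 1"
  proof (cases "par (\<sigma> p)")
    case True
    then obtain m where "r = 2 * m" using assms by auto
    then show ?thesis using label_sign_sq[of \<sigma> "\<sigma> p"] by (simp add: power_mult power2_eq_square)
  qed (simp add: label_sign_def)
  then show ?thesis using g[of r] by (simp only: PS.scale_one)
qed

lemma ro_X: "ro (X p) g \<sigma> = Xs \<sigma> p (g \<sigma>)" by simp

lemma X_pow_zero: "g \<sigma> = 0 \<Longrightarrow> (ro (X p) ^^ r) g \<sigma> = 0"
  by (induction r) (simp_all add: XDQ_simps)

context
  fixes \<nu> h a \<sigma>
  assumes h: "supp \<nu> h" and a: "a \<in> {1..<n}" and s: "\<sigma> \<in> states"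
begin

lemma a_in: "a \<in> {1..n}" "Suc a \<in> {1..n}" using a by auto

lemma per_s: "per \<sigma>" by (rule states_per[OF s])

lemma lab_in: "p \<in> {1..n} \<Longrightarrow> \<sigma> p \<in> {1..n}" by (rule per_in[OF per_s])

lemma D_same:
  assumes c: "col (\<sigma> a) = col (\<sigma> (Suc a))"
  shows "\<sigma> (Suc a) = Suc (\<sigma> a)" "par (Suc (\<sigma> a)) = par (\<sigma> a)"
    "D (\<sigma> a) (Xo l v) = pscale (sg (\<sigma> a) l) (Xo (sfun (\<sigma> a) l) (D (\<sigma> a) v)) + pscale (cc (\<sigma> a) l) v"
  using states_next[OF s a c] int_par[of "\<sigma> a"] by (simp_all add: D_Xo)

lemma r_TX:
  assumes p: "p \<in> {1..n}" "p \<noteq> a" "p \<noteq> Suc a"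
  shows "ro (T a) (ro (X p) h) \<sigma> =
    pscale (sgn_par Iodd [ent \<nu> p, ent \<nu> a, ent \<nu> (Suc a)]) (ro (X p) (ro (T a) h) \<sigma>)"
proof (cases "col (\<sigma> a) = col (\<sigma> (Suc a))")
  case True
  note D = D_same[OF True]
  have ne: "\<sigma> p \<noteq> \<sigma> a" "\<sigma> p \<noteq> Suc (\<sigma> a)" using per_eq[OF per_s] p D(1) by metis+
  show ?thesis
  proof (cases rule: supp_cases[OF h, of \<sigma>])
    case 2
    have "sgn_par Iodd [col (\<sigma> p), col (\<sigma> a), col (\<sigma> (Suc a))] = sg (\<sigma> a) (\<sigma> p)"
      unfolding sgn_col(2)[OF lab_in[OF a_in(1)] lab_in[OF a_in(2)] lab_in[OF p(1)]] using D by (auto simp: sg_def)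
    then show ?thesis using True ne unfolding 2[symmetric]
      by (simp add: ent_word[OF p(1)] ent_word[OF a_in(1)] ent_word[OF a_in(2)] Xs_def Ds_def D_simps Xo_simps D(3) cc_def sfun_apply mult_ac)
  qed (simp add: XDQ_simps True)
next
  case False
  show ?thesis
  proof (cases rule: supp_cases[OF h, of "\<sigma> \<circ> sfun a"])
    case 2
    have "sgn_par Iodd [col (\<sigma> p), col (\<sigma> (Suc a)), col (\<sigma> a)] = (if par (\<sigma> p) then sg (\<sigma> a) (\<sigma> (Suc a)) else 1)"
      unfolding sgn_col(2)[OF lab_in[OF a_in(2)] lab_in[OF a_in(1)] lab_in[OF p(1)]] using sg_sym[of "\<sigma> a" "\<sigma> (Suc a)"] by simp
    then show ?thesis using False p unfolding 2[symmetric]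
      by (simp add: ent_word[OF p(1)] ent_word[OF a_in(1)] ent_word[OF a_in(2)] Xs_def label_sign_swap[OF per_s a] XDQ_simps Qs_Xo sfun_apply)
  qed (simp add: XDQ_simps False)
qed

lemma supp_neq:
  assumes "col (\<sigma> a) \<noteq> col (\<sigma> (Suc a))"
  shows "(if ent \<nu> a = ent \<nu> (Suc a) then h \<sigma> else 0) = 0"
proof (cases rule: supp_cases[OF h, of \<sigma>])
  case 2
  then show ?thesis using assms ent_word[OF a_in(1), of \<sigma>] ent_word[OF a_in(2), of \<sigma>] by simp
qed simp

lemma r_Tx1:
  "ro (T a) (ro (X (Suc a)) h) \<sigma> - pscale (sgn_par Iodd [ent \<nu> a, ent \<nu> (Suc a)]) (ro (X a) (ro (T a) h) \<sigma>)
     = (if ent \<nu> a = ent \<nu> (Suc a) then h \<sigma> else 0)"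
proof (cases "col (\<sigma> a) = col (\<sigma> (Suc a))")
  case True
  note D = D_same[OF True]
  show ?thesis
  proof (cases rule: supp_cases[OF h, of \<sigma>])
    case 2
    have "sgn_par Iodd [col (\<sigma> a), col (\<sigma> (Suc a))] = sg (\<sigma> a) (\<sigma> a)"
      unfolding sgn_col(1)[OF lab_in[OF a_in(1)] lab_in[OF a_in(2)]] using D by (auto simp: sg_def)
    moreover have "label_sign \<sigma> (Suc (\<sigma> a)) = label_sign \<sigma> (\<sigma> a)" "sg (\<sigma> a) (Suc (\<sigma> a)) = sg (\<sigma> a) (\<sigma> a)" using D(2) by (simp_all add: label_sign_def sg_def)
    ultimately show ?thesis using True label_sign_sq[of \<sigma> "\<sigma> a"] unfolding 2[symmetric]
      by (simp add: ent_word[OF a_in(1)] ent_word[OF a_in(2)] Xs_def Ds_def D_simps Xo_simps D(1,3) cc_def sfun_apply PS.scale_right_distrib PS.scale_right_diff_distrib mult_ac)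
  qed (simp add: XDQ_simps True)
next
  case False
  show ?thesis
  proof (cases rule: supp_cases[OF h, of "\<sigma> \<circ> sfun a"])
    case 2
    have "sgn_par Iodd [col (\<sigma> (Suc a)), col (\<sigma> a)] = sg (\<sigma> a) (\<sigma> (Suc a))"
      unfolding sgn_col(1)[OF lab_in[OF a_in(2)] lab_in[OF a_in(1)]] by (rule sg_sym)
    moreover have "label_sign (\<sigma> \<circ> sfun a) (\<sigma> a) = sg (\<sigma> a) (\<sigma> (Suc a)) * label_sign \<sigma> (\<sigma> a)"
      unfolding label_sign_swap[OF per_s a] by (simp add: sg_def)
    ultimately show ?thesis using False unfolding 2[symmetric]
      by (simp add: ent_word[OF a_in(1)] ent_word[OF a_in(2)] Xs_def XDQ_simps Qs_Xo sfun_apply)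
  next
    case 1
    then show ?thesis unfolding supp_neq[OF False] by (simp add: XDQ_simps False)
  qed
qed

lemma r_Tx2:
  "ro (X (Suc a)) (ro (T a) h) \<sigma> - pscale (sgn_par Iodd [ent \<nu> a, ent \<nu> (Suc a)]) (ro (T a) (ro (X a) h) \<sigma>)
     = (if ent \<nu> a = ent \<nu> (Suc a) then h \<sigma> else 0)"
proof (cases "col (\<sigma> a) = col (\<sigma> (Suc a))")
  case True
  note D = D_same[OF True]
  show ?thesis
  proof (cases rule: supp_cases[OF h, of \<sigma>])
    case 2
    have "sgn_par Iodd [col (\<sigma> a), col (\<sigma> (Suc a))] = sg (\<sigma> a) (\<sigma> a)"
      unfolding sgn_col(1)[OF lab_in[OF a_in(1)] lab_in[OF a_in(2)]] using D by (auto simp: sg_def)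
    moreover have "label_sign \<sigma> (Suc (\<sigma> a)) = label_sign \<sigma> (\<sigma> a)" using D(2) by (simp_all add: label_sign_def)
    ultimately show ?thesis using True label_sign_sq[of \<sigma> "\<sigma> a"] unfolding 2[symmetric]
      by (simp add: ent_word[OF a_in(1)] ent_word[OF a_in(2)] Xs_def Ds_def D_simps Xo_simps D(1,3) cc_def sfun_apply PS.scale_right_distrib PS.scale_right_diff_distrib mult_ac)
  qed (simp add: XDQ_simps True)
next
  case False
  show ?thesis
  proof (cases rule: supp_cases[OF h, of "\<sigma> \<circ> sfun a"])
    case 2
    have "sgn_par Iodd [col (\<sigma> (Suc a)), col (\<sigma> a)] = sg (\<sigma> a) (\<sigma> (Suc a))"
      unfolding sgn_col(1)[OF lab_in[OF a_in(2)] lab_in[OF a_in(1)]] by (rule sg_sym)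
    moreover have "label_sign (\<sigma> \<circ> sfun a) (\<sigma> (Suc a)) = sg (\<sigma> a) (\<sigma> (Suc a)) * label_sign \<sigma> (\<sigma> (Suc a))"
      unfolding label_sign_swap[OF per_s a] by (simp add: sg_def)
    ultimately show ?thesis using False unfolding 2[symmetric]
      by (simp add: ent_word[OF a_in(1)] ent_word[OF a_in(2)] Xs_def XDQ_simps Qs_Xo sfun_apply)
  next
    case 1
    then show ?thesis unfolding supp_neq[OF False] by (simp add: XDQ_simps False)
  qed
qed

lemma r_TT: "ro (T a) (ro (T a) h) \<sigma> = R.Qop t (ent \<nu> a) (ent \<nu> (Suc a)) a (Suc a) h \<sigma>"
proof -
  note r = lab_in[OF a_in(1)] lab_in[OF a_in(2)]
  \<comment> \<open>The exponents at odd labels are even, so the factors \<open>label_sign\<close>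
    square away and the operator form of Q becomes \<open>qo\<close>; for equal colours its support
    is empty.\<close>
  have Q: "R.Qop t (ent \<nu> a) (ent \<nu> (Suc a)) a (Suc a) h \<sigma> = (if col (\<sigma> a) = col (\<sigma> (Suc a)) then 0 else qo (\<sigma> a) (\<sigma> (Suc a)) (h \<sigma>))"
  proof (cases rule: supp_cases[OF h, of \<sigma>])
    case 2
    let ?c = "col (\<sigma> a)" and ?d = "col (\<sigma> (Suc a))"
    have "R.Qop t (ent \<nu> a) (ent \<nu> (Suc a)) a (Suc a) h \<sigma> =
      (\<Sum>x\<in>Qsupp t ?c ?d. pscale (t ?c ?d (fst x) (snd x)) ((ro (X a) ^^ fst x) ((ro (X (Suc a)) ^^ snd x) h) \<sigma>))"
      unfolding R.Qop_def 2[symmetric] ent_word[OF a_in(1)] ent_word[OF a_in(2)]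
      by (simp add: sum_state vs_apply case_prod_beta)
    also have "\<dots> = (\<Sum>x\<in>Qsupp t ?c ?d. pscale (t ?c ?d (fst x) (snd x)) ((Xo (\<sigma> a) ^^ fst x) ((Xo (\<sigma> (Suc a)) ^^ snd x) (h \<sigma>))))"
    proof (rule sum.cong[OF refl])
      fix x assume "x \<in> Qsupp t ?c ?d"
      then have "t ?c ?d (fst x) (snd x) \<noteq> 0" by (auto simp: Qsupp_def)
      then show "pscale (t ?c ?d (fst x) (snd x)) ((ro (X a) ^^ fst x) ((ro (X (Suc a)) ^^ snd x) h) \<sigma>) =
        pscale (t ?c ?d (fst x) (snd x)) ((Xo (\<sigma> a) ^^ fst x) ((Xo (\<sigma> (Suc a)) ^^ snd x) (h \<sigma>)))"
        using t_even[OF r] by (simp add: X_pow del: ro.simps)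
    qed
    also have "\<dots> = (if ?c = ?d then 0 else qo (\<sigma> a) (\<sigma> (Suc a)) (h \<sigma>))"
      using r Q_diag[OF r(2)] by (auto simp: qo_def case_prod_beta)
    finally show ?thesis .
  next
    case 1
    have "(ro (X a) ^^ r) ((ro (X (Suc a)) ^^ s') h) \<sigma> = 0" for r s' using 1 by (intro X_pow_zero)
    then show ?thesis using 1 by (simp add: R.Qop_def sum_state vs_apply case_prod_beta qo_simps)
  qed
  show ?thesis
  proof (cases "col (\<sigma> a) = col (\<sigma> (Suc a))")
    case True
    then show ?thesis using Q DD[of "\<sigma> a"] D_same[OF True] by (simp add: Ds_def D_simps)
  next
    case False
    have e: "\<sigma> \<circ> sfun a \<circ> sfun a = \<sigma>" by (simp add: comp_assoc)
    show ?thesis using Q False Qs_Qs[OF per_s a] by (simp add: sfun_apply e)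
  qed
qed

end

lemma braid_zero: "h \<sigma> = 0 \<Longrightarrow> R.braid_op Iodd t \<nu> a h \<sigma> = 0"
proof -
  assume h: "h \<sigma> = 0"
  have z: "(ro (X p) ^^ r) ((ro (X q) ^^ r') ((ro (X q') ^^ r'') h)) \<sigma> = 0" for p q q' r r' r''
    using h by (intro X_pow_zero)
  show ?thesis
    unfolding R.braid_op_def Let_def
    by (simp add: sum_state vs_apply case_prod_beta z XDQ_simps fun_apply ro_X del: funpow.simps ro.simps)
qed

lemma braid_none:
  assumes "word \<sigma> = \<nu>" "1 \<le> a" "Suc a < n" and p: "per \<sigma>"
    and "col (\<sigma> a) \<noteq> col (\<sigma> (Suc (Suc a))) \<or> col (\<sigma> a) = col (\<sigma> (Suc a))"
  shows "R.braid_op Iodd t \<nu> a h \<sigma> = 0"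
proof -
  have e: "ent \<nu> a = col (\<sigma> a)" "ent \<nu> (Suc a) = col (\<sigma> (Suc a))" "ent \<nu> (Suc (Suc a)) = col (\<sigma> (Suc (Suc a)))"
    using assms(1-3) by (auto simp flip: assms(1) simp: ent_word)
  show ?thesis
    unfolding R.braid_op_def Let_def Suc_eq_plus1[symmetric] add_2_eq_Suc' e
    using assms(5) per_in[OF p, of "Suc a"] Q_diag[of "\<sigma> (Suc a)"] assms(2,3) by (auto simp: fun_apply vs_apply XDQ_simps)
qed

text \<open>In the pattern i j i the outer labels are consecutive, so the divided difference
  \<open>dq\<close> appears. In the odd case the linear factor contributes \<open>inv_sign\<close>,
  and the sign of the middle colour becomes \<open>sg\<close> of an outer and the middle
  label.\<close>

lemma braid_eq:
  assumes w: "word \<sigma> = \<nu>" and a: "1 \<le> a" "Suc a < n" and p: "per \<sigma>"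
    and c: "col (\<sigma> a) = col (\<sigma> (Suc (Suc a)))" "\<sigma> (Suc (Suc a)) = Suc (\<sigma> a)" "internal (\<sigma> a)"
  shows "R.braid_op Iodd t \<nu> a h \<sigma> =
    pscale (if par (\<sigma> a) then sg (\<sigma> a) (\<sigma> (Suc a)) * inv_sign \<sigma> else 1) (dq (\<sigma> a) (\<sigma> (Suc a)) (h \<sigma>))"
proof -
  let ?u = "\<sigma> a" and ?v = "\<sigma> (Suc a)"
  let ?S = "Qsupp t (col ?u) (col ?v)" and ?t = "t (col ?u) (col ?v)"
  have r: "?u \<in> {1..n}" "?v \<in> {1..n}" using per_in[OF p] a by auto
  have e: "ent \<nu> a = col ?u" "ent \<nu> (Suc a) = col ?v" "ent \<nu> (Suc (Suc a)) = col (\<sigma> (Suc (Suc a)))"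
    using w a by (auto simp flip: w simp: ent_word)
  have pw: "par (Suc ?u) = par ?u" using int_par[OF c(3)] by simp
  have ev: "(par ?u \<longrightarrow> even (fst x)) \<and> (par ?v \<longrightarrow> even (snd x))" if "x \<in> ?S" for x
    using t_even[OF r, of "fst x" "snd x"] that by (auto simp: Qsupp_def)
  show ?thesis
  proof (cases "par ?u")
    case False
    then have i: "col ?u \<notin> Iodd" using par_Iodd[OF r(1)] by simp
    have X: "(ro (X (Suc (Suc a))) ^^ k) ((ro (X a) ^^ l) ((ro (X (Suc a)) ^^ snd x) h)) \<sigma> =
        (Xo (Suc ?u) ^^ k) ((Xo ?u ^^ l) ((Xo ?v ^^ snd x) (h \<sigma>)))" if "x \<in> ?S" for k l x
    proof -
      have 1: "(ro (X (Suc (Suc a))) ^^ k) g \<sigma> = (Xo (Suc ?u) ^^ k) (g \<sigma>)" for g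
        using X_pow[of \<sigma> "Suc (Suc a)" k g] False pw unfolding c(2) by blast
      have 2: "(ro (X a) ^^ l) g \<sigma> = (Xo ?u ^^ l) (g \<sigma>)" for g using X_pow[of \<sigma> a l g] False by blast
      have 3: "(ro (X (Suc a)) ^^ snd x) g \<sigma> = (Xo ?v ^^ snd x) (g \<sigma>)" for g using X_pow[of \<sigma> "Suc a" "snd x" g] ev[OF that] by blast
      show ?thesis unfolding 1 2 3 ..
    qed
    have "R.braid_op Iodd t \<nu> a h \<sigma> = (\<Sum>x\<in>?S. pscale (?t (fst x) (snd x))
        (\<Sum>k<fst x. (Xo (Suc ?u) ^^ k) ((Xo ?u ^^ (fst x - 1 - k)) ((Xo ?v ^^ snd x) (h \<sigma>)))))"
      unfolding R.braid_op_def Let_def Suc_eq_plus1[symmetric] add_2_eq_Suc' e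
      using c(1) i by (simp add: sum_state vs_apply case_prod_beta X del: ro.simps)
    then show ?thesis using False by (simp add: dq_def delta_def hpow_def case_prod_beta)
  next
    case True
    then have i: "col ?u \<in> Iodd" using par_Iodd[OF r(1)] by simp
    have X: "(ro (X (Suc (Suc a))) ^^ (2 * k)) ((ro (X a) ^^ (2 * l)) ((ro (X (Suc a)) ^^ snd x) h)) \<sigma> =
        (Xo (Suc ?u) ^^ (2 * k)) ((Xo ?u ^^ (2 * l)) ((Xo ?v ^^ snd x) (h \<sigma>)))" if "x \<in> ?S" for k l x
      using ev[OF that] c(2) by (simp add: X_pow del: ro.simps)
    define s where "s = (\<Sum>x\<in>?S. pscale (?t (fst x) (snd x)) (\<Sum>k<fst x div 2. (Xo (Suc ?u) ^^ (2 * k))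
        ((Xo ?u ^^ (2 * (fst x div 2 - 1 - k))) ((Xo ?v ^^ snd x) (h \<sigma>)))))"
    have "R.braid_op Iodd t \<nu> a h \<sigma> = pscale (sgn_par Iodd [col ?v]) (Xs \<sigma> (Suc (Suc a)) s - Xs \<sigma> a s)"
      unfolding R.braid_op_def Let_def Suc_eq_plus1[symmetric] add_2_eq_Suc' e s_def
      using c(1) i by (simp add: sum_state vs_apply case_prod_beta X fun_apply ro_X del: ro.simps)
    also have "\<dots> = pscale (sg ?u ?v * inv_sign \<sigma>) (Xo (Suc ?u) s - Xo ?u s)"
      using True pw unfolding sgn_col(4)[OF r(2) r(2)]
      by (simp add: Xs_def c(2) label_sign_def sg_def PS.scale_right_diff_distrib)
    also have "Xo (Suc ?u) s - Xo ?u s = dq ?u ?v (h \<sigma>)"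
      using True by (simp add: dq_def delta_def hpow_def case_prod_beta s_def)
    finally show ?thesis using True by simp
  qed
qed

lemma state_far: "Suc a < c \<or> Suc c < a \<Longrightarrow> \<sigma> \<circ> sfun a \<circ> sfun c = \<sigma> \<circ> sfun c \<circ> sfun a"
  by (auto simp: fun_eq_iff sfun_apply)

text \<open>The case of different colours at \<open>a\<close> and equal colours at \<open>c\<close>
  is left out; \<open>r_far\<close> obtains it by exchanging \<open>a\<close> and
  \<open>c\<close>.\<close>

lemma r_far_aux:
  assumes h: "supp \<nu> h" and a: "a \<in> {1..<n}" and c: "c \<in> {1..<n}" and far: "Suc a < c \<or> Suc c < a"
    and s: "\<sigma> \<in> states" and col: "col (\<sigma> a) = col (\<sigma> (Suc a)) \<or> col (\<sigma> c) \<noteq> col (\<sigma> (Suc c))"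
  shows "ro (T a) (ro (T c) h) \<sigma> =
    pscale (sgn_par Iodd [ent \<nu> a, ent \<nu> (Suc a), ent \<nu> c, ent \<nu> (Suc c)]) (ro (T c) (ro (T a) h) \<sigma>)"
proof -
  have sf: "sfun a c = c" "sfun a (Suc c) = Suc c" "sfun c a = a" "sfun c (Suc a) = Suc a"
    "sfun a a = Suc a" "sfun a (Suc a) = a" "sfun c c = Suc c" "sfun c (Suc c) = c"
    using far by (auto simp: sfun_apply)
  have r: "a \<in> {1..n}" "Suc a \<in> {1..n}" "c \<in> {1..n}" "Suc c \<in> {1..n}" using a c by auto
  note p = states_per[OF s] and lr = r[THEN per_in[OF states_per[OF s]]]
  have d: "\<sigma> a \<noteq> \<sigma> c" "\<sigma> (Suc a) \<noteq> \<sigma> c" "\<sigma> a \<noteq> \<sigma> (Suc c)" "\<sigma> (Suc a) \<noteq> \<sigma> (Suc c)"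
    using per_eq[OF p] far by auto
  define \<epsilon> where "\<epsilon> = (if par (\<sigma> a) \<and> par (\<sigma> (Suc a)) \<and> par (\<sigma> c) \<and> par (\<sigma> (Suc c)) then - 1 else (1 :: 'k))"
  have sgn: "sgn_par Iodd [ent \<nu> a, ent \<nu> (Suc a), ent \<nu> c, ent \<nu> (Suc c)] = \<epsilon>"
    if "word \<mu> = \<nu>" "{\<mu> a, \<mu> (Suc a)} = {\<sigma> a, \<sigma> (Suc a)}" "{\<mu> c, \<mu> (Suc c)} = {\<sigma> c, \<sigma> (Suc c)}" for \<mu>
    unfolding that(1)[symmetric] ent_word[OF r(1)] ent_word[OF r(2)] ent_word[OF r(3)] ent_word[OF r(4)]
    using that(2,3) lr par_Iodd unfolding \<epsilon>_def sgn_par_def by (auto simp: doubleton_eq_iff)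
  consider (ss) "col (\<sigma> a) = col (\<sigma> (Suc a))" "col (\<sigma> c) = col (\<sigma> (Suc c))"
    | (sd) "col (\<sigma> a) = col (\<sigma> (Suc a))" "col (\<sigma> c) \<noteq> col (\<sigma> (Suc c))"
    | (dd) "col (\<sigma> a) \<noteq> col (\<sigma> (Suc a))" "col (\<sigma> c) \<noteq> col (\<sigma> (Suc c))" using col by blast
  then show ?thesis
  proof cases
    case ss
    note na = states_next[OF s a ss(1)] and nc = states_next[OF s c ss(2)]
    note pa = int_par[OF na(2)] and pc = int_par[OF nc(2)]
    have "Suc (\<sigma> a) < \<sigma> c \<or> Suc (\<sigma> c) < \<sigma> a" using d na(1) nc(1) by linarith
    then have D: "D (\<sigma> a) (D (\<sigma> c) v) = pscale (sg (\<sigma> a) (\<sigma> c)) (D (\<sigma> c) (D (\<sigma> a) v))" for v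
      using D_far[OF pa pc] D_far[OF pc pa] sg_sym[of "\<sigma> c" "\<sigma> a"] by auto
    show ?thesis
    proof (cases rule: supp_cases[OF h, of \<sigma>])
      case 2
      have "\<epsilon> = sg (\<sigma> a) (\<sigma> c)" using pa pc na(1) nc(1) by (simp add: \<epsilon>_def sg_def)
      then show ?thesis unfolding sgn[OF 2 refl refl] using ss by (simp add: Ds_def D_simps D mult_ac)
    qed (use ss in \<open>simp add: XDQ_simps\<close>)
  next
    case sd
    note na = states_next[OF s a sd(1)]
    let ?\<mu> = "\<sigma> \<circ> sfun c"
    show ?thesis
    proof (cases rule: supp_cases[OF h, of ?\<mu>])
      case 2
      have e: "sgn_par Iodd [ent \<nu> a, ent \<nu> (Suc a), ent \<nu> c, ent \<nu> (Suc c)] = \<epsilon>"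
        by (rule sgn[OF 2]) (auto simp: sf)
      have "\<epsilon> * (if par (\<sigma> a) then sg (\<sigma> c) (\<sigma> (Suc c)) else 1) = 1"
        using int_par[OF na(2)] na(1) by (simp add: \<epsilon>_def sg_def)
      then have label_sign: "label_sign \<sigma> (\<sigma> a) = \<epsilon> * label_sign ?\<mu> (\<sigma> a)" unfolding label_sign_swap[OF p c] by (simp flip: mult.assoc)
      have "D (\<sigma> a) (Qs \<sigma> c v) = Qs \<sigma> c (D (\<sigma> a) v)" for v
        using qo_D_far[OF na(2), of "\<sigma> c" "\<sigma> (Suc c)"] d na(1) by (simp add: Qs_def D_simps)
      then show ?thesis unfolding e using sd by (simp add: Ds_def sf XDQ_simps label_sign mult_ac)
    qed (use sd in \<open>simp add: XDQ_simps sf\<close>)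
  next
    case dd
    let ?\<mu> = "\<sigma> \<circ> sfun a \<circ> sfun c"
    note c2 = state_far[OF far, of \<sigma>]
    show ?thesis
    proof (cases rule: supp_cases[OF h, of ?\<mu>])
      case 2
      have e: "sgn_par Iodd [ent \<nu> a, ent \<nu> (Suc a), ent \<nu> c, ent \<nu> (Suc c)] = \<epsilon>"
        by (rule sgn[OF 2]) (auto simp: sf)
      have "Qs \<sigma> a (Qs (\<sigma> \<circ> sfun a) c v) = pscale \<epsilon> (Qs \<sigma> c (Qs (\<sigma> \<circ> sfun c) a v))" for v
        using swap_sign_far[OF p a c far] unfolding \<epsilon>_def[symmetric]
        by (simp add: Qs_def sf qo_simps qo_qo[of "\<sigma> a" "\<sigma> (Suc a)" "\<sigma> c" "\<sigma> (Suc c)"])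
      then show ?thesis unfolding e using dd c2 by (simp add: sf)
    qed (use dd c2 in \<open>simp add: XDQ_simps sf\<close>)
  qed
qed

lemma r_far:
  assumes h: "supp \<nu> h" and a: "a \<in> {1..<n}" and c: "c \<in> {1..<n}" and far: "Suc a < c \<or> Suc c < a"
    and s: "\<sigma> \<in> states"
  shows "ro (T a) (ro (T c) h) \<sigma> =
    pscale (sgn_par Iodd [ent \<nu> a, ent \<nu> (Suc a), ent \<nu> c, ent \<nu> (Suc c)]) (ro (T c) (ro (T a) h) \<sigma>)"
proof (cases "col (\<sigma> a) = col (\<sigma> (Suc a)) \<or> col (\<sigma> c) \<noteq> col (\<sigma> (Suc c))")
  case True then show ?thesis by (rule r_far_aux[OF h a c far s])
next
  case False
  let ?e = "sgn_par Iodd [ent \<nu> a, ent \<nu> (Suc a), ent \<nu> c, ent \<nu> (Suc c)] :: 'k"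
  have "sgn_par Iodd [ent \<nu> c, ent \<nu> (Suc c), ent \<nu> a, ent \<nu> (Suc a)] = ?e" by (auto simp: sgn_par_def)
  moreover have "?e * ?e = 1" by (simp add: sgn_par_def)
  ultimately show ?thesis using r_far_aux[OF h c a _ s] far False by auto
qed

end

context cyc_rep
begin

lemma state_braid: "\<sigma> \<circ> sfun (Suc a) \<circ> sfun a \<circ> sfun (Suc a) = \<sigma> \<circ> sfun a \<circ> sfun (Suc a) \<circ> sfun a"
  by (auto simp: fun_eq_iff sfun_apply)

text \<open>Five colour patterns. One colour: the braid relation of divided differences. Patterns i
  i j and i j j: a divided difference commutes with a symmetric product of two Q. Pattern i j i: the
  correction term arises. Three colours: both sides apply the same Q, and
  \<open>swap_sign_braid\<close> matches the signs.\<close>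

lemma r_braid:
  assumes h: "supp \<nu> h" and a: "1 \<le> a" "Suc a < n" and s: "\<sigma> \<in> states"
  shows "ro (T (Suc a)) (ro (T a) (ro (T (Suc a)) h)) \<sigma> - ro (T a) (ro (T (Suc a)) (ro (T a) h)) \<sigma>
    = R.braid_op Iodd t \<nu> a h \<sigma>"
proof -
  define b where "b = Suc a"
  let ?u = "\<sigma> a" and ?v = "\<sigma> b" and ?w = "\<sigma> (Suc b)"
  note p = states_per[OF s]
  have ab: "a \<in> {1..<n}" "b \<in> {1..<n}" using a by (auto simp: b_def)
  have Sa: "Suc a = b" by (simp add: b_def)
  have sf: "sfun a a = b" "sfun a b = a" "sfun b b = Suc b" "sfun b (Suc b) = b" "sfun b a = a" "sfun a (Suc b) = Suc b"
    by (simp_all add: sfun_apply b_def)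
  have r: "?u \<in> {1..n}" "?v \<in> {1..n}" "?w \<in> {1..n}" using per_in[OF p] a by (auto simp: b_def)
  have ne: "?u \<noteq> ?v" "?u \<noteq> ?w" "?v \<noteq> ?w" using per_eq[OF p] by (simp_all add: b_def)
  note sb = state_braid[of \<sigma> a, unfolded Sa]
  have none: "R.braid_op Iodd t \<nu> a h \<sigma> = 0" if "col ?u \<noteq> col ?w \<or> col ?u = col ?v"
    using supp_cases[OF h, of \<sigma>] braid_zero braid_none[OF _ a p, of \<nu> h] that by (metis b_def)
  consider (1) "col ?u = col ?v" "col ?v = col ?w" | (2) "col ?u = col ?v" "col ?v \<noteq> col ?w"
    | (3) "col ?u \<noteq> col ?v" "col ?v = col ?w" | (4) "col ?u \<noteq> col ?v" "col ?v \<noteq> col ?w" "col ?u = col ?w"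
    | (5) "col ?u \<noteq> col ?v" "col ?v \<noteq> col ?w" "col ?u \<noteq> col ?w" by blast
  then have "ro (T b) (ro (T a) (ro (T b) h)) \<sigma> - ro (T a) (ro (T b) (ro (T a) h)) \<sigma> = R.braid_op Iodd t \<nu> a h \<sigma>"
  proof cases
    case 1
    have nu: "?v = Suc ?u" "internal ?u" and nv: "internal ?v"
      using states_next[OF s ab(1)] states_next[OF s ab(2)] 1 by (simp_all add: Sa)
    have "D ?u (D ?v (D ?u v)) = D ?v (D ?u (D ?v v))" for v
      using D_braid[of ?u v] int_par[OF nu(2)] int_par[OF nv] unfolding nu(1) by simp
    moreover have "label_sign \<sigma> ?v = label_sign \<sigma> ?u" using int_par[OF nu(2)] nu(1) by (simp add: label_sign_def)
    ultimately show ?thesis using none 1 by (simp add: Sa Ds_def D_simps)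
  next
    case 2
    have nu: "?v = Suc ?u" "internal ?u" using states_next[OF s ab(1)] 2 by (simp_all add: Sa)
    let ?m = "\<sigma> \<circ> sfun b \<circ> sfun a"
    have lt: "?v < ?w \<longleftrightarrow> ?u < ?w" using nu(1) ne by auto
    have "D ?u (qo ?v ?w (qo ?u ?w x)) = qo ?v ?w (qo ?u ?w (D ?u x))" for x
      using D_qo_qo[OF nu(2) r(3), of x] ne nu(1) by (simp add: qo_qo[of "Suc ?u" ?w ?u ?w])
    then have D: "D ?u (Qs \<sigma> b (Qs (\<sigma> \<circ> sfun b) a x)) = Qs \<sigma> b (Qs (\<sigma> \<circ> sfun b) a (D ?u x))" for x
      using lt by (simp add: Qs_def Sa sf D_simps qo_simps)
    have pu: "par ?v = par ?u" using int_par[OF nu(2)] nu(1) by simp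
    have "label_sign ?m ?u = label_sign \<sigma> ?u"
      unfolding label_sign_swap[OF per_comp[OF p ab(2)] ab(1)] label_sign_swap[OF p ab(2)] Sa using pu by (simp add: sf sg_def)
    then show ?thesis using none 2 by (simp add: Sa sf Ds_def D[symmetric] D_simps XDQ_simps)
  next
    case 3
    have nv: "?w = Suc ?v" "internal ?v" using states_next[OF s ab(2)] 3 by simp_all
    let ?m = "\<sigma> \<circ> sfun a \<circ> sfun b"
    have lt: "?u < ?w \<longleftrightarrow> ?u < ?v" using nv(1) ne by auto
    have "D ?v (qo ?u ?v (qo ?u ?w x)) = qo ?u ?v (qo ?u ?w (D ?v x))" for x
      using D_qo_qo[OF nv(2) r(1), of x] ne nv(1) by (simp add: qo_sym[of ?u])
    then have D: "D ?v (Qs \<sigma> a (Qs (\<sigma> \<circ> sfun a) b x)) = Qs \<sigma> a (Qs (\<sigma> \<circ> sfun a) b (D ?v x))" for x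
      using lt by (simp add: Qs_def Sa sf D_simps qo_simps)
    have pv: "par ?w = par ?v" using int_par[OF nv(2)] nv(1) by simp
    have "label_sign ?m ?v = label_sign \<sigma> ?v"
      unfolding label_sign_swap[OF per_comp[OF p ab(1)] ab(2)] label_sign_swap[OF p ab(1)] Sa using pv by (simp add: sf sg_def)
    then show ?thesis using none 3 by (simp add: Sa sf Ds_def D[symmetric] D_simps XDQ_simps)
  next
    case 4
    let ?s1 = "\<sigma> \<circ> sfun b" and ?s2 = "\<sigma> \<circ> sfun a"
    have s1: "?s1 \<in> states" using states_swap[OF s ab(2)] 4 by simp
    have nu: "?w = Suc ?u" "internal ?u" using states_next[OF s1 ab(1)] 4 by (simp_all add: Sa sf)
    have pu: "par ?w = par ?u" using int_par[OF nu(2)] nu(1) by simp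
    define c where "c = (if par ?u then sg ?u ?v * inv_sign \<sigma> else 1)"
    have c: "label_sign ?s1 ?u = c" "label_sign ?s2 ?u = c"
      unfolding label_sign_swap[OF p ab(1)] label_sign_swap[OF p ab(2)] c_def Sa using pu by (auto simp: label_sign_def sg_def)
    have ee: "\<sigma> \<circ> sfun a \<circ> sfun a = \<sigma>" "\<sigma> \<circ> sfun b \<circ> sfun b = \<sigma>" by (simp_all add: comp_assoc)
    have d: "swap_sign \<sigma> a * (c * swap_sign \<sigma> a) = c" "swap_sign \<sigma> b * (c * swap_sign \<sigma> b) = c" using swap_sign_sq by (metis mult.assoc mult.commute mult_1)+
    let ?x = "h \<sigma>"
    \<comment> \<open>One of the two triple products applies Q before the divided difference and the
      other one after it, with the outer variables exchanged; \<open>qo_D_next\<close> computes the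
      difference.\<close>
    have L1: "ro (T b) (ro (T a) (ro (T b) h)) \<sigma> = pscale c (if ?v < ?w then qo ?v ?w (D ?u ?x) else D ?u (qo ?w ?v ?x))"
      using 4 ne swap_sign_self[OF p ab(2)] d by (auto simp: Sa sf ee Ds_def Qs_def c D_simps qo_simps)
    have L2: "ro (T a) (ro (T b) (ro (T a) h)) \<sigma> = pscale c (if ?u < ?v then qo ?u ?v (D ?u ?x) else D ?u (qo ?v ?u ?x))"
      using 4 ne swap_sign_self[OF p ab(1)] d by (auto simp: Sa sf ee Ds_def Qs_def c D_simps qo_simps)
    have lt: "?v < ?w \<longleftrightarrow> \<not> ?u < ?v" using nu(1) ne by auto
    have vn: "?v \<notin> {?u, Suc ?u}" using ne nu(1) by auto
    have "ro (T b) (ro (T a) (ro (T b) h)) \<sigma> - ro (T a) (ro (T b) (ro (T a) h)) \<sigma> = pscale c (dq ?u ?v ?x)"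
      unfolding L1 L2 lt using qo_D_next[OF nu(2) r(2) vn, of ?x] nu(1) qo_sym[of ?v ?w] qo_sym[of ?v ?u]
      by (auto simp flip: PS.scale_right_diff_distrib)
    moreover have "R.braid_op Iodd t \<nu> a h \<sigma> = pscale c (dq ?u ?v ?x)"
    proof (cases rule: supp_cases[OF h, of \<sigma>])
      case 1
      have "dq ?u ?v 0 = 0" by (simp add: dq_def delta_def hpow_def case_prod_beta lin_zero[OF lin_pow[OF lin_Xo]] Xo_simps)
      then show ?thesis using 1 braid_zero[of h \<sigma>] by simp
    next
      case 2
      then show ?thesis using braid_eq[OF 2 a p, of h] 4 nu unfolding c_def Sa by simp
    qed
    ultimately show ?thesis by simp
  next
    case 5
    let ?Q = "\<lambda>k l v. if k < l then qo k l v else v"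
    have Qc: "?Q k l (?Q k' l' v) = ?Q k' l' (?Q k l v)" for k l k' l' v by (auto simp: qo_qo)
    let ?x = "h (\<sigma> \<circ> sfun b \<circ> sfun a \<circ> sfun b)"
    have L1: "ro (T b) (ro (T a) (ro (T b) h)) \<sigma> =
        pscale (swap_sign \<sigma> b * (swap_sign (\<sigma> \<circ> sfun b) a * swap_sign (\<sigma> \<circ> sfun b \<circ> sfun a) b)) (?Q ?v ?w (?Q ?u ?w (?Q ?u ?v ?x)))"
      using 5 by (simp add: Sa sf Qs_def qo_simps)
    have L2: "ro (T a) (ro (T b) (ro (T a) h)) \<sigma> =
        pscale (swap_sign \<sigma> a * (swap_sign (\<sigma> \<circ> sfun a) b * swap_sign (\<sigma> \<circ> sfun a \<circ> sfun b) a)) (?Q ?u ?v (?Q ?u ?w (?Q ?v ?w ?x)))"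
      using 5 by (simp add: Sa sf sb Qs_def qo_simps)
    have "?Q ?v ?w (?Q ?u ?w (?Q ?u ?v ?x)) = ?Q ?u ?v (?Q ?u ?w (?Q ?v ?w ?x))"
      unfolding Qc[of ?v ?w ?u ?w] Qc[of ?v ?w ?u ?v] Qc[of ?u ?w ?u ?v] ..
    then show ?thesis unfolding L1 L2 using swap_sign_braid[OF p a] none 5 unfolding Sa by simp
  qed
  then show ?thesis by (simp only: b_def)
qed

lemma klr_ops_rep_ideal: "R.klr_ops Iodd t n IB rep_ideal v"
proof -
  have E: "supp \<nu> (ro (E \<nu>) v)" for \<nu> by (rule supp_E)
  have z: "f - vs c g \<in> rep_ideal" if "\<And>\<sigma>. \<sigma> \<in> states \<Longrightarrow> f \<sigma> = pscale c (g \<sigma>)" for f g c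
    by (rule rep_ideal_zero) (simp add: fun_apply vs_apply that)
  have z3: "f - vs c g - k \<in> rep_ideal" if "\<And>\<sigma>. \<sigma> \<in> states \<Longrightarrow> f \<sigma> - pscale c (g \<sigma>) = k \<sigma>" for f g k c
    by (rule rep_ideal_zero) (simp add: fun_apply vs_apply that)
  have z1: "f - g \<in> rep_ideal" if "\<And>\<sigma>. \<sigma> \<in> states \<Longrightarrow> f \<sigma> = g \<sigma>" for f g
    by (rule rep_ideal_zero) (simp add: fun_apply that)
  have z2: "f - g - k \<in> rep_ideal" if "\<And>\<sigma>. \<sigma> \<in> states \<Longrightarrow> f \<sigma> - g \<sigma> = k \<sigma>" for f g k
    by (rule rep_ideal_zero) (simp add: fun_apply that)
  have iff0: "(if P then f else 0) \<sigma> = (if P then f \<sigma> else 0)" for P and f :: "(nat \<Rightarrow> nat) \<Rightarrow> 'k spoly" and \<sigma>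
    by (simp add: fun_apply)
  show ?thesis
    unfolding R.klr_ops_def Suc_eq_plus1[symmetric]
  proof (intro conjI ballI allI impI)
    show "ro (E \<mu>) (ro (E \<nu>) v) - (if \<mu> = \<nu> then ro (E \<nu>) v else 0) \<in> rep_ideal" for \<mu> \<nu>
      by (rule z1) (auto simp: fun_apply)
    show "(\<Sum>\<nu>\<in>IB. ro (E \<nu>) v) - v \<in> rep_ideal"
    proof (rule z1)
      fix \<sigma> assume "\<sigma> \<in> states"
      then have "word \<sigma> \<in> IB" using word_IB[OF states_per] by (simp add: word_def)
      then show "(\<Sum>\<nu>\<in>IB. ro (E \<nu>) v) \<sigma> = v \<sigma>" using finIB by (simp add: sum_state)
    qed
    show "ro (X p) (ro (E \<nu>) v) - ro (E \<nu>) (ro (X p) v) \<in> rep_ideal" for p \<nu>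
      by (rule z1) (simp add: XDQ_simps)
  next
    fix \<nu> p q assume "p \<in> {1..n}" "q \<in> {1..n}" "p \<noteq> q"
    then show "ro (X p) (ro (X q) (ro (E \<nu>) v)) - vs (sgn_par Iodd [ent \<nu> p, ent \<nu> q]) (ro (X q) (ro (X p) (ro (E \<nu>) v))) \<in> rep_ideal"
      by (intro z r_XX[OF E])
  next
    fix \<nu> a assume "\<nu> \<in> IB" "a \<in> {1..<n}"
    then show "ro (T a) (ro (E \<nu>) v) - ro (E (swap_at a \<nu>)) (ro (T a) v) \<in> rep_ideal"
      by (intro z1 r_TE IB_length)
  next
    fix \<nu> a p assume "a \<in> {1..<n}" "p \<in> {1..n}" "p \<noteq> a \<and> p \<noteq> Suc a"
    then show "ro (T a) (ro (X p) (ro (E \<nu>) v)) - vs (sgn_par Iodd [ent \<nu> p, ent \<nu> a, ent \<nu> (Suc a)])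
        (ro (X p) (ro (T a) (ro (E \<nu>) v))) \<in> rep_ideal"
      by (intro z r_TX[OF E]) simp_all
  next
    fix \<nu> a assume a: "a \<in> {1..<n}"
    show "ro (T a) (ro (X (Suc a)) (ro (E \<nu>) v)) - vs (sgn_par Iodd [ent \<nu> a, ent \<nu> (Suc a)]) (ro (X a) (ro (T a) (ro (E \<nu>) v)))
       - (if ent \<nu> a = ent \<nu> (Suc a) then ro (E \<nu>) v else 0) \<in> rep_ideal"
      by (rule z3) (subst r_Tx1[OF E a], auto simp only: iff0)
    show "ro (X (Suc a)) (ro (T a) (ro (E \<nu>) v)) - vs (sgn_par Iodd [ent \<nu> a, ent \<nu> (Suc a)]) (ro (T a) (ro (X a) (ro (E \<nu>) v)))
       - (if ent \<nu> a = ent \<nu> (Suc a) then ro (E \<nu>) v else 0) \<in> rep_ideal"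
      by (rule z3) (subst r_Tx2[OF E a], auto simp only: iff0)
    show "ro (T a) (ro (T a) (ro (E \<nu>) v)) - R.Qop t (ent \<nu> a) (ent \<nu> (Suc a)) a (Suc a) (ro (E \<nu>) v) \<in> rep_ideal"
      by (rule z1) (rule r_TT[OF E a])
  next
    fix \<nu> a c assume "a \<in> {1..<n}" "c \<in> {1..<n}" "Suc c < a \<or> Suc a < c"
    then show "ro (T a) (ro (T c) (ro (E \<nu>) v)) - vs (sgn_par Iodd [ent \<nu> a, ent \<nu> (Suc a), ent \<nu> c, ent \<nu> (Suc c)])
        (ro (T c) (ro (T a) (ro (E \<nu>) v))) \<in> rep_ideal"
      by (intro z r_far[OF E]) auto
  next
    fix \<nu> a assume "1 \<le> a \<and> Suc a < n"
    then show "ro (T (Suc a)) (ro (T a) (ro (T (Suc a)) (ro (E \<nu>) v))) - ro (T a) (ro (T (Suc a)) (ro (T a) (ro (E \<nu>) v)))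
       - R.braid_op Iodd t \<nu> a (ro (E \<nu>) v) \<in> rep_ideal"
      by (intro z2 r_braid[OF E]) auto
  qed
qed

text \<open>Otherwise the preceding label has the same colour and stands further to the right,
  against monotonicity.\<close>

lemma states_one: assumes "\<sigma> \<in> states" "n \<noteq> 0" shows "first (\<sigma> 1)"
proof -
  note p = states_per[OF assms(1)]
  have r: "\<sigma> 1 \<in> {1..n}" using per_in[OF p] assms(2) by auto
  have "col (\<sigma> 1 - 1) \<noteq> col (\<sigma> 1)" if ne: "\<sigma> 1 \<noteq> 1"
  proof
    assume c: "col (\<sigma> 1 - 1) = col (\<sigma> 1)"
    define q where "q = inv \<sigma> (\<sigma> 1 - 1)"
    have q: "\<sigma> q = \<sigma> 1 - 1" using p by (simp add: q_def permutes_inverses)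
    have "\<sigma> q \<in> {1..n}" unfolding q using r ne by auto
    then have qr: "q \<in> {1..n}" by (simp only: permutes_in_image[OF p])
    have "q \<noteq> 1" using q r by auto
    then have "\<sigma> 1 < \<sigma> q" using states_mono[OF assms(1), of 1 q] qr c q by auto
    then show False using q by simp
  qed
  then show ?thesis using r by (auto simp: first_def)
qed

text \<open>The label in the first position stands to the left of all others, so it is inverted with
  every smaller one.\<close>

lemma inv_pairs_one: assumes "per \<sigma>" "n \<noteq> 0" shows "Pair (\<sigma> 1) ` {1..<\<sigma> 1} \<subseteq> inv_pairs \<sigma>"
proof clarify
  fix q assume q: "q \<in> {1..<\<sigma> 1}"
  have r: "\<sigma> 1 \<in> {1..n}" using per_in[OF assms(1)] assms(2) by auto
  have i: "inv \<sigma> (\<sigma> 1) = 1" using permutes_inverses(2)[OF assms(1)] .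
  have qr: "inv \<sigma> q \<in> {1..n}" using per_in[OF permutes_inv[OF assms(1)], of q] q r by auto
  have "inv \<sigma> q \<noteq> inv \<sigma> (\<sigma> 1)" using per_eq[OF permutes_inv[OF assms(1)]] q by auto
  then show "(\<sigma> 1, q) \<in> inv_pairs \<sigma>" using q r qr i by (auto simp: inv_pairs_iff)
qed

text \<open>The power of the variable in first position meets the Q of the pairs formed by its label
  and all smaller ones. Together they are \<open>Fo\<close> at that label, which opens a block, so
  the result lies in \<open>K n\<close>.\<close>

lemma cyc_rep_ideal:
  assumes n: "n \<noteq> 0"
  shows "(\<Sum>\<nu>\<in>IB. (ro (X 1) ^^ Lam (ent \<nu> 1)) (ro (E \<nu>) v)) \<in> rep_ideal"
  unfolding rep_ideal_def
proof (intro CollectI ballI)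
  fix \<sigma> assume s: "\<sigma> \<in> states"
  note p = states_per[OF s]
  let ?f = "\<sigma> 1"
  have pw: "\<exists>c. (ro (X 1) ^^ r) g \<sigma> = pscale c ((Xo ?f ^^ r) (g \<sigma>))" for r g
  proof (induction r)
    case 0 show ?case by (intro exI[of _ 1]) simp
  next
    case (Suc r)
    then obtain c where "(ro (X 1) ^^ r) g \<sigma> = pscale c ((Xo ?f ^^ r) (g \<sigma>))" by blast
    moreover have "(ro (X 1) ^^ Suc r) g \<sigma> = Xs \<sigma> 1 ((ro (X 1) ^^ r) g \<sigma>)" by simp
    ultimately show ?case by (intro exI[of _ "label_sign \<sigma> ?f * c"]) (simp only: Xs_def Xo_simps PS.scale_scale funpow.simps comp_apply)
  qed
  have w: "word \<sigma> \<in> IB" using word_IB[OF p] by (simp add: word_def)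
  have e1: "ent (word \<sigma>) 1 = col ?f" using n by (intro ent_word) auto
  have "(\<Sum>\<nu>\<in>IB. (ro (X 1) ^^ Lam (ent \<nu> 1)) (ro (E \<nu>) v)) \<sigma> =
      (\<Sum>\<nu>\<in>IB. if \<nu> = word \<sigma> then (ro (X 1) ^^ Lam (col ?f)) (ro (E (word \<sigma>)) v) \<sigma> else 0)"
    unfolding sum_state by (rule sum.cong[OF refl]) (auto simp: e1 X_pow_zero simp del: ro.simps(2))
  also have "\<dots> = (ro (X 1) ^^ Lam (col ?f)) (ro (E (word \<sigma>)) v) \<sigma>" using w finIB by simp
  finally obtain c where c: "(\<Sum>\<nu>\<in>IB. (ro (X 1) ^^ Lam (ent \<nu> 1)) (ro (E \<nu>) v)) \<sigma> =
      pscale c ((Xo ?f ^^ Lam (col ?f)) (v \<sigma>))"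
    using pw[of "Lam (col ?f)" "ro (E (word \<sigma>)) v"] by auto
  let ?P = "Pair ?f ` {1..<?f}"
  have f: "first ?f" by (rule states_one[OF s n])
  have "inv_pairs \<sigma> = ?P \<union> (inv_pairs \<sigma> - ?P)" using inv_pairs_one[OF p n] by blast
  then have "qo_prod (inv_pairs \<sigma>) x = qo_prod ?P (qo_prod (inv_pairs \<sigma> - ?P) x)" for x
    using qo_prod_union[of ?P "inv_pairs \<sigma> - ?P" x] by simp
  then have "qo_prod (inv_pairs \<sigma>) ((Xo ?f ^^ Lam (col ?f)) (v \<sigma>)) = Fo ?f (qo_prod (inv_pairs \<sigma> - ?P) (v \<sigma>))"
    by (simp add: qo_prod_pow Fo_def)
  moreover have "\<dots> \<in> K n" by (rule Fo_K[OF f]) (use f in \<open>simp add: first_def\<close>)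
  ultimately show "qo_prod (inv_pairs \<sigma>) ((\<Sum>\<nu>\<in>IB. (ro (X 1) ^^ Lam (ent \<nu> 1)) (ro (E \<nu>) v)) \<sigma>) \<in> K n"
    unfolding c by (simp add: lin_scale[OF lin_qo_prod] PS.subspace_scale[OF K_sub])
qed

lemma inv_sign_id: "inv_sign id = 1" by (simp add: inv_sign_def inv_pairs_id)

text \<open>At the identity labelling all signs are 1, so independence can be tested there with the
  bare operators.\<close>

lemma at_id:
  "ro (X p) g id = Xo p (g id)" "internal a \<Longrightarrow> ro (T a) g id = D a (g id)" "ro (E (word id)) g id = g id"
  by (simp_all add: Xs_def Ds_def label_sign_def inv_sign_id internal_def)

lemma T_word_id: "word_sup n col l \<Longrightarrow> foldr ro (map T l) g id = foldr D l (g id)"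
  by (induction l) (simp_all add: at_id internal_def del: ro.simps)

lemma X_word_id: "foldr ro (map X u) g id = Xw u (g id)"
proof (induction u)
  case (Cons a u)
  then show ?case using at_id(1)[of a "foldr ro (map X u) g"] by (simp only: list.map foldr.simps comp_apply)
qed simp

end

subsection \<open>The block word\<close>

lemma lookup_zscale: "Poly_Mapping.lookup (zscale c v) x = c * Poly_Mapping.lookup v x"
  by (simp add: zscale_def Poly_Mapping.map.rep_eq when_def)

lemma zscale_simps:
  "zscale 0 v = 0" "zscale (a + c) v = zscale a v + zscale c v" "zscale (a - c) v = zscale a v - zscale c v" "zscale 1 v = v"
  by (rule poly_mapping_eqI; simp add: lookup_zscale lookup_add lookup_minus algebra_simps)+

lemma sum_list_zscale: "sum_list (replicate m v) = zscale (int m) v"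
  by (induction m) (simp_all add: zscale_simps)

lemma sum_list_count:
  assumes "finite F" "set \<nu> \<subseteq> F"
  shows "sum_list (map alpha \<nu>) = (\<Sum>i\<in>F. zscale (int (count_list \<nu> i)) (alpha i))"
  using assms(2)
proof (induction \<nu>)
  case Nil then show ?case by (simp add: zscale_simps)
next
  case (Cons x \<nu>)
  have "zscale (int (count_list (x # \<nu>) i)) (alpha i) = (if x = i then alpha i else 0) + zscale (int (count_list \<nu> i)) (alpha i)" for i
    by (simp add: zscale_simps)
  then show ?case using Cons assms(1) by (simp only: sum.distrib) (simp add: sum.delta')
qed

lemma sum_take: "m \<le> length xs \<Longrightarrow> sum_list (map g (take m xs)) = (\<Sum>q\<in>{1..<Suc m}. g (ent xs q) :: int)"
  by (induction m) (simp_all add: take_Suc_conv_app_nth ent_def)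

lemma blkc_Suc: "s < length b \<Longrightarrow> blkc b (Suc s) = blkc b s + b ! s"
  by (simp add: blkc_def take_Suc_conv_app_nth)

lemma blkc_mono: assumes "s \<le> u" shows "blkc b s \<le> blkc b u"
proof -
  have "blkc b s \<le> blkc b (Suc s)" for s
    by (cases "s < length b") (simp add: blkc_Suc, simp add: blkc_def)
  then show ?thesis using lift_Suc_mono_le[of "blkc b" s u] assms by blast
qed

lemma blkc_length: "blkc b (length b) = sum_list b" by (simp add: blkc_def)

lemma block_unique:
  assumes "blkc b s < k" "k \<le> blkc b (Suc s)" "blkc b u < k" "k \<le> blkc b (Suc u)" shows "s = u"
proof (rule ccontr)
  assume "s \<noteq> u"
  then have "Suc s \<le> u \<or> Suc u \<le> s" by linarith
  then show False using blkc_mono[of "Suc s" u b] blkc_mono[of "Suc u" s b] assms by linarith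
qed

lemma block_exists: "1 \<le> k \<Longrightarrow> k \<le> blkc b j \<Longrightarrow> \<exists>s<j. blkc b s < k \<and> k \<le> blkc b (Suc s)"
proof (induction j)
  case 0 then show ?case by (simp add: blkc_def)
next
  case (Suc j)
  then show ?case by (cases "k \<le> blkc b j") (auto intro: less_SucI)
qed

text \<open>Stated for prefixes of whole blocks, so that induction on the number of blocks
  applies.\<close>

lemma prefix_props:
  assumes "length b = length nus"
  defines "P \<equiv> \<lambda>j. concat (map (\<lambda>s. replicate (b ! s) (nus ! s)) [0..<j])"
  shows "j \<le> length nus \<Longrightarrow> length (P j) = blkc b j \<and>
    (\<forall>s k. s < j \<and> blkc b s < k \<and> k \<le> blkc b (Suc s) \<longrightarrow> P j ! (k - 1) = nus ! s) \<and>
    sum_list (map alpha (P j)) = (\<Sum>s<j. zscale (int (b ! s)) (alpha (nus ! s))) \<and> set (P j) \<subseteq> set nus"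
proof (induction j)
  case 0 then show ?case by (simp add: P_def blkc_def)
next
  case (Suc j)
  have P: "P (Suc j) = P j @ replicate (b ! j) (nus ! j)" by (simp add: P_def)
  have j: "j < length b" using Suc assms(1) by simp
  have IH: "length (P j) = blkc b j" "\<And>s k. s < j \<Longrightarrow> blkc b s < k \<Longrightarrow> k \<le> blkc b (Suc s) \<Longrightarrow> P j ! (k - 1) = nus ! s"
    "sum_list (map alpha (P j)) = (\<Sum>s<j. zscale (int (b ! s)) (alpha (nus ! s)))" "set (P j) \<subseteq> set nus" using Suc by auto
  have "P (Suc j) ! (k - 1) = nus ! s" if "s < Suc j" "blkc b s < k" "k \<le> blkc b (Suc s)" for s k
  proof (cases "s = j")
    case True
    then show ?thesis using that IH(1) blkc_Suc[OF j] by (auto simp: P nth_append)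
  next
    case False
    then have "blkc b (Suc s) \<le> blkc b j" using that by (intro blkc_mono) auto
    then show ?thesis using that False IH(1,2) by (auto simp: P nth_append)
  qed
  moreover have "nus ! j \<in> set nus" using j assms(1) by simp
  ultimately show ?case using IH blkc_Suc[OF j] by (auto simp: P sum_list_zscale)
qed

section \<open>From the Cartan superdatum to the hypotheses on blocks, bounds and leading
  terms\<close>

locale cyclotomic_corner =
  fixes I Iodd :: "'i set" and A :: "'i \<Rightarrow> 'i \<Rightarrow> int" and d :: "'i \<Rightarrow> nat"
    and alpha :: "'i \<Rightarrow> ('b \<Rightarrow>\<^sub>0 int)" and h :: "'i \<Rightarrow> ('b \<Rightarrow>\<^sub>0 int) \<Rightarrow> int"
    and form :: "('b \<Rightarrow>\<^sub>0 int) \<Rightarrow> ('b \<Rightarrow>\<^sub>0 int) \<Rightarrow> rat"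
    and t :: "'i \<Rightarrow> 'i \<Rightarrow> nat \<Rightarrow> nat \<Rightarrow> 'k::field"
    and Lam :: "'b \<Rightarrow>\<^sub>0 int"
    and b :: "nat list" and nus :: "'i list"
    and red :: "(nat \<Rightarrow> nat) \<Rightarrow> nat list"
  assumes datum: "cartan_superdatum I Iodd A d alpha h form"
    and Q: "Q_data I Iodd A alpha form t"
    and dominant: "\<And>i. i \<in> I \<Longrightarrow> h i Lam \<ge> 0"
    and len: "length b = length nus"
    and dist: "distinct nus"
    and nusI: "set nus \<subseteq> I"
    and red: "\<And>w. w permutes {1..sum_list b} \<Longrightarrow> reduced_expr (sum_list b) (red w) w"
begin

abbreviation n :: nat where "n \<equiv> sum_list b"
abbreviation \<nu>0 :: "'i list" where "\<nu>0 \<equiv> nutilde b nus"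
abbreviation col :: "nat \<Rightarrow> 'i" where "col \<equiv> ent \<nu>0"
definition \<beta> where "\<beta> = (\<Sum>s<length nus. zscale (int (b ! s)) (alpha (nus ! s)))"
abbreviation IB where "IB \<equiv> Ibeta I alpha n \<beta>"
definition inb :: "nat \<Rightarrow> nat \<Rightarrow> bool" where "inb s k \<longleftrightarrow> s < length b \<and> blkc b s < k \<and> k \<le> blkc b (Suc s)"

lemma nu0: "length \<nu>0 = n" "inb s k \<Longrightarrow> col k = nus ! s" "sum_list (map alpha \<nu>0) = \<beta>" "set \<nu>0 \<subseteq> I"
  using prefix_props[OF len, of "length nus" alpha] nusI
  by (auto simp: nutilde_def inb_def ent_def \<beta>_def blkc_length len[symmetric])

lemma inb_ex: assumes "k \<in> {1..n}" obtains s where "inb s k"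
  using block_exists[of k b "length b"] assms by (auto simp: blkc_length inb_def)

lemma inb_range: assumes "inb s k" shows "k \<in> {1..n}"
proof -
  have "blkc b (Suc s) \<le> blkc b (length b)" using assms by (intro blkc_mono) (simp add: inb_def)
  then show ?thesis using assms by (auto simp: inb_def blkc_length)
qed

lemma inb_unique: "inb s k \<Longrightarrow> inb u k \<Longrightarrow> s = u"
  unfolding inb_def using block_unique by blast

lemma col_eq_iff: "inb s k \<Longrightarrow> inb u l \<Longrightarrow> col k = col l \<longleftrightarrow> s = u"
  using nth_eq_iff_index_eq[OF dist, of s u] nu0(2) by (simp add: inb_def len)

lemma col_inb: assumes "inb s k" "l \<in> {1..n}" "col l = col k" shows "inb s l"
  using inb_ex[OF assms(2)] col_eq_iff[OF _ assms(1)] assms(3) by metis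

lemma col_I: "k \<in> {1..n} \<Longrightarrow> col k \<in> I"
proof -
  assume "k \<in> {1..n}"
  then have "k - 1 < length \<nu>0" using nu0(1) by auto
  then show ?thesis using nu0(4) nth_mem unfolding ent_def by blast
qed

sublocale cb: col_blocks n col
proof
  fix i j k assume a: "1 \<le> i" "i \<le> j" "j \<le> k" "k \<le> n" "col i = col k"
  obtain s where s: "inb s i" using a inb_ex[of i] by auto
  have "inb s k" using col_inb[OF s, of k] a by auto
  then have "inb s j" using s a by (auto simp: inb_def)
  then show "col j = col i" using s nu0(2) by simp
qed

text \<open>As the colours of the blocks are pairwise distinct, the nonempty blocks are exactly the
  colour classes.\<close>

lemma young_col_perms: "young b = col_perms n col"
proof (intro subset_antisym subsetI)
  fix w assume w: "w \<in> young b"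
  have "col (w k) = col k" if k: "k \<in> {1..n}" for k
  proof -
    obtain s where s: "inb s k" by (rule inb_ex[OF k])
    then have "w k \<in> w ` {blkc b s + 1..blkc b (s + 1)}" by (auto simp: inb_def simp flip: Suc_eq_plus1)
    also have "\<dots> = {blkc b s + 1..blkc b (s + 1)}" using w s by (simp add: young_def inb_def)
    finally have "inb s (w k)" using s by (auto simp: inb_def simp flip: Suc_eq_plus1)
    then show ?thesis using nu0(2) s by simp
  qed
  then show "w \<in> col_perms n col" using w by (simp add: col_perms_def young_def)
next
  fix w assume w: "w \<in> col_perms n col"
  then have p: "w permutes {1..n}" by (simp add: col_perms_def)
  have "w ` {blkc b s + 1..blkc b (s + 1)} = {blkc b s + 1..blkc b (s + 1)}" if s: "s < length b" for s
  proof (rule endo_inj_surj)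
    show "w ` {blkc b s + 1..blkc b (s + 1)} \<subseteq> {blkc b s + 1..blkc b (s + 1)}"
    proof clarify
      fix k assume "k \<in> {blkc b s + 1..blkc b (s + 1)}"
      then have k: "inb s k" using s by (auto simp: inb_def simp flip: Suc_eq_plus1)
      have "w k \<in> {1..n}" using permutes_in_image[OF p, of k] inb_range[OF k] by simp
      moreover have "col (w k) = col k" using w inb_range[OF k] by (simp add: col_perms_def)
      ultimately have "inb s (w k)" by (intro col_inb[OF k])
      then show "w k \<in> {blkc b s + 1..blkc b (s + 1)}" by (auto simp: inb_def simp flip: Suc_eq_plus1)
    qed
    show "inj_on w {blkc b s + 1..blkc b (s + 1)}" using permutes_inj_on[OF p] .
  qed simp
  then show "w \<in> young b" using p by (simp add: young_def)
qed

definition LamN :: "'i \<Rightarrow> nat" where "LamN i = nat (h i Lam)"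
definition mm :: "'i \<Rightarrow> 'i \<Rightarrow> nat" where "mm i j = nat (- A i j)"
text \<open>A negative bound is truncated to 0; either way there is no admissible exponent.\<close>

definition N :: "nat \<Rightarrow> nat" where "N k = nat (NLamk alpha h Lam b nus (THE s. inb s k) k)"

lemma N_inb: "inb s k \<Longrightarrow> N k = nat (NLamk alpha h Lam b nus s k)"
  unfolding N_def using inb_unique by (metis the_equality)

lemma h_lin: assumes "i \<in> I" shows "h i (x - y) = h i x - h i y" "set l \<subseteq> I \<Longrightarrow> h i (sum_list (map alpha l)) = sum_list (map (A i) l)"
proof -
  have ad: "h i (x + y) = h i x + h i y" for x y using datum assms by (simp add: cartan_superdatum_def)
  show "h i (x - y) = h i x - h i y" using ad[of "x - y" y] by simp
  have z: "h i 0 = 0" using ad[of 0 0] by simp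
  have al: "h i (alpha j) = A i j" if "j \<in> I" for j using datum assms that by (simp add: cartan_superdatum_def)
  show "set l \<subseteq> I \<Longrightarrow> h i (sum_list (map alpha l)) = sum_list (map (A i) l)"
    by (induction l) (simp_all add: z ad al)
qed

text \<open>At the first position of a block the correction \<open>k - blkc b s - 1\<close> is 0.
  All earlier entries have other colours, so their Cartan entries are nonpositive and the truncation
  in \<open>mm\<close> is harmless.\<close>

lemma N_first:
  assumes f: "f \<in> {1..n}" and first: "f = 1 \<or> col (f - 1) \<noteq> col f"
  shows "N f = LamN (col f) + (\<Sum>q\<in>{1..<f}. mm (col f) (col q))"
proof -
  obtain s where s: "inb s f" using inb_ex[OF f] .
  have "\<not> blkc b s < f - 1"
  proof
    assume l: "blkc b s < f - 1"
    then have "inb s (f - 1)" using s by (auto simp: inb_def)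
    then show False using first l col_eq_iff[OF _ s] by auto
  qed
  then have fs: "f = Suc (blkc b s)" using s by (auto simp: inb_def)
  have fI: "col f \<in> I" by (rule col_I[OF f])
  have neg: "A (col f) (col q) \<le> 0" if q: "q \<in> {1..<f}" for q
  proof -
    have qn: "q \<in> {1..n}" using q f by auto
    have "col q \<noteq> col f"
    proof
      assume "col q = col f"
      then have "inb s q" by (rule col_inb[OF s qn])
      then show False using q fs by (auto simp: inb_def)
    qed
    then show ?thesis using datum fI col_I[OF qn] by (auto simp: cartan_superdatum_def)
  qed
  have "NLamk alpha h Lam b nus s f = h (col f) (Lam - sum_list (map alpha (take (blkc b s) \<nu>0)))"
    using nu0(2)[OF s] fs by (simp add: NLamk_def NLam_def)
  also have "\<dots> = h (col f) Lam - (\<Sum>q\<in>{1..<f}. A (col f) (col q))"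
  proof -
    have "set (take (blkc b s) \<nu>0) \<subseteq> I" by (rule order.trans[OF set_take_subset nu0(4)])
    moreover have "blkc b s \<le> length \<nu>0" using f fs nu0(1) by simp
    ultimately show ?thesis
      unfolding h_lin(1)[OF fI] by (subst h_lin(2)[OF fI]) (simp_all only: sum_take fs)
  qed
  also have "\<dots> = int (LamN (col f)) + (\<Sum>q\<in>{1..<f}. int (mm (col f) (col q)))"
    using dominant[OF fI] neg by (simp add: LamN_def mm_def sum_negf)
  finally show ?thesis unfolding N_inb[OF s] by (simp flip: of_nat_sum of_nat_add)
qed

lemma N_next:
  assumes a: "a \<in> {1..<n}" and c: "col a = col (Suc a)" shows "N (Suc a) = N a - 1"
proof -
  obtain s where s: "inb s a" using inb_ex[of a] a by auto
  have s': "inb s (Suc a)" by (rule col_inb[OF s]) (use a c in auto)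
  have "NLamk alpha h Lam b nus s (Suc a) = NLamk alpha h Lam b nus s a - 1"
    using s by (simp add: NLamk_def inb_def of_nat_diff)
  then show ?thesis unfolding N_inb[OF s] N_inb[OF s'] by (simp add: nat_diff_distrib')
qed

lemma t_facts:
  assumes "i \<in> I" "j \<in> I"
  shows "t i j r s = t j i s r" "t i i r s = 0" "t i j r s \<noteq> 0 \<Longrightarrow> (i \<in> Iodd \<longrightarrow> even r) \<and> (j \<in> Iodd \<longrightarrow> even s)"
    "i \<noteq> j \<Longrightarrow> t i j (mm i j) 0 \<noteq> 0"
proof -
  show sym: "t i j r s = t j i s r" using Q assms by (simp add: Q_data_def)
  show "t i i r s = 0" using Q assms by (auto simp: Q_data_def)
  show "t i j r s \<noteq> 0 \<Longrightarrow> (i \<in> Iodd \<longrightarrow> even r) \<and> (j \<in> Iodd \<longrightarrow> even s)"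
    using Q assms sym unfolding Q_data_def by metis
  show "i \<noteq> j \<Longrightarrow> t i j (mm i j) 0 \<noteq> 0" using Q assms by (simp add: Q_data_def mm_def)
qed

text \<open>Homogeneity of Q with the bilinear form expressed by the Cartan matrix, divided by
  2.\<close>

lemma t_degree:
  assumes ij: "i \<in> I" "j \<in> I" and nz: "t i j r s \<noteq> 0"
  shows "int r * int (d i) + int s * int (d j) = int (d i) * (- A i j)"
proof -
  have f: "form (alpha x) (alpha y) = of_nat (d x) * of_int (A x y)" if "x \<in> I" "y \<in> I" for x y
    using datum that by (simp add: cartan_superdatum_def)
  have A2: "A x x = 2" if "x \<in> I" for x using datum that by (simp add: cartan_superdatum_def)
  have "- 2 * form (alpha i) (alpha j) - of_nat r * form (alpha i) (alpha i) - of_nat s * form (alpha j) (alpha j) = 0"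
    using Q ij nz by (simp add: Q_data_def)
  then have "of_nat r * of_nat (d i) + of_nat s * of_nat (d j) = - (of_nat (d i) * (of_int (A i j) :: rat))"
    unfolding f[OF ij] f[OF ij(1,1)] f[OF ij(2,2)] A2[OF ij(1)] A2[OF ij(2)] by (simp add: algebra_simps)
  then have "(of_int (int r * int (d i) + int s * int (d j)) :: rat) = of_int (int (d i) * (- A i j))" by simp
  then show ?thesis by (simp only: of_int_eq_iff)
qed

text \<open>Homogeneity bounds the first exponent by the negative Cartan entry, and since the
  \<open>d\<close> are positive, equality forces the other exponent to vanish.\<close>

lemma t_low:
  assumes ij: "i \<in> I" "j \<in> I" and nz: "t i j r s \<noteq> 0"
  shows "r < mm i j \<or> (r = mm i j \<and> s = 0)"
proof -
  have d: "d i > 0" "d j > 0" using datum ij by (simp_all add: cartan_superdatum_def)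
  have e: "int (d i) * (- A i j - int r) = int s * int (d j)" using t_degree[OF assms] by (simp add: algebra_simps)
  then have "0 \<le> int (d i) * (- A i j - int r)" by simp
  then have le: "int r \<le> - A i j" using d(1) by (simp add: zero_le_mult_iff)
  show ?thesis
  proof (cases "int r = - A i j")
    case True
    then have "int s * int (d j) = 0" using e by simp
    then show ?thesis using d(2) unfolding mm_def True[symmetric] by simp
  next
    case False
    then show ?thesis using le by (simp add: mm_def zless_nat_eq_int_zless)
  qed
qed

lemma finite_Qsupp: assumes ij: "i \<in> I" "j \<in> I" shows "finite (Qsupp t i j)"
proof (rule finite_subset)
  show "Qsupp t i j \<subseteq> {..mm i j} \<times> {..mm j i}"
  proof clarify
    fix r s assume "(r, s) \<in> Qsupp t i j"
    then have "t i j r s \<noteq> 0" "t j i s r \<noteq> 0" using t_facts(1)[OF ij] by (simp_all add: Qsupp_def)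
    then show "r \<in> {..mm i j} \<and> s \<in> {..mm j i}" using t_low[OF ij] t_low[OF ij(2,1)] by fastforce
  qed
qed simp

text \<open>Linear independence of the simple roots: a word of weight \<beta> contains each letter
  as often as the block word does.\<close>

lemma IB_iff: "\<nu> \<in> IB \<longleftrightarrow> mset \<nu> = mset \<nu>0"
proof
  assume m: "mset \<nu> = mset \<nu>0"
  have e: "sum_list (map alpha x) = sum_mset (image_mset alpha (mset x))" for x
    unfolding mset_map[symmetric] sum_mset_sum_list ..
  have "sum_list (map alpha \<nu>) = sum_list (map alpha \<nu>0)" "length \<nu> = length \<nu>0" "set \<nu> = set \<nu>0"
    unfolding e m using mset_eq_length[OF m] mset_eq_setD[OF m] by simp_all
  then show "\<nu> \<in> IB" using nu0 by (simp add: Ibeta_def)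
next
  assume v: "\<nu> \<in> IB"
  let ?F = "set \<nu> \<union> set \<nu>0" and ?c = "\<lambda>i. int (count_list \<nu> i) - int (count_list \<nu>0 i)"
  have F: "finite ?F" "?F \<subseteq> I" using v nu0(4) by (auto simp: Ibeta_def)
  have "(\<Sum>i\<in>?F. zscale (?c i) (alpha i)) = sum_list (map alpha \<nu>) - sum_list (map alpha \<nu>0)"
    using sum_list_count[OF F(1), of \<nu> alpha] sum_list_count[OF F(1), of \<nu>0 alpha] by (simp add: zscale_simps sum_subtractf)
  also have "\<dots> = 0" using v nu0(3) by (simp add: Ibeta_def)
  finally have s0: "(\<Sum>i\<in>?F. zscale (?c i) (alpha i)) = 0" .
  note li = datum[unfolded cartan_superdatum_def, THEN conjunct2, THEN conjunct2, THEN conjunct2, THEN conjunct2,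
      THEN conjunct2, THEN conjunct1]
  have z: "\<forall>i\<in>?F. ?c i = 0"
    by (rule li[THEN spec[of _ ?F], THEN spec[of _ ?c], THEN mp]) (use F s0 in blast)
  show "mset \<nu> = mset \<nu>0"
  proof (rule multiset_eqI)
    fix x show "count (mset \<nu>) x = count (mset \<nu>0) x"
      using z by (cases "x \<in> ?F") (auto simp: count_mset count_list_0_iff[THEN iffD2])
  qed
qed

lemma finite_IB: "finite IB"
proof (rule finite_subset)
  show "IB \<subseteq> {\<nu>. set \<nu> \<subseteq> set \<nu>0 \<and> length \<nu> = n}"
  proof
    fix \<nu> assume "\<nu> \<in> IB"
    then have m: "mset \<nu> = mset \<nu>0" by (simp only: IB_iff)
    show "\<nu> \<in> {\<nu>. set \<nu> \<subseteq> set \<nu>0 \<and> length \<nu> = n}"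
      using mset_eq_length[OF m] mset_eq_setD[OF m] nu0(1) by simp
  qed
  show "finite {\<nu>. set \<nu> \<subseteq> set \<nu>0 \<and> length \<nu> = n}" by (rule finite_lists_length_eq) simp
qed

lemma IB_length: "\<nu> \<in> IB \<Longrightarrow> length \<nu> = n" by (simp add: Ibeta_def)

lemma nu0_IB: "\<nu>0 \<in> IB" by (simp add: IB_iff)

lemma IB_swap: assumes "\<nu> \<in> IB" "a \<in> {1..<n}" shows "swap_at a \<nu> \<in> IB"
proof -
  have "mset (swap_at a \<nu>) = mset \<nu>"
    unfolding swap_at_def using IB_length[OF assms(1)] assms(2) by (intro mset_swap) auto
  then show ?thesis using assms(1) by (simp add: IB_iff)
qed

lemma IB_ent: "\<nu> \<in> IB \<Longrightarrow> p \<in> {1..n} \<Longrightarrow> ent \<nu> p \<in> I"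
proof -
  assume \<nu>: "\<nu> \<in> IB" and "p \<in> {1..n}"
  then have "p - 1 < length \<nu>" using IB_length[OF \<nu>] by auto
  moreover have "set \<nu> \<subseteq> I" using \<nu> by (simp add: Ibeta_def)
  ultimately show ?thesis using nth_mem unfolding ent_def by blast
qed

lemma map_col: "map col [1..<Suc n] = \<nu>0"
  by (rule nth_equalityI) (simp_all add: nu0(1) ent_def del: upt_Suc)

lemma word_IB: assumes w: "w permutes {1..n}" shows "map (\<lambda>p. col (w p)) [1..<Suc n] \<in> IB"
proof -
  have "distinct (map w [1..<Suc n])" using permutes_inj_on[OF w] by (simp add: distinct_map del: upt_Suc)
  moreover have "set (map w [1..<Suc n]) = {1..n}"
    using permutes_image[OF w] by (simp only: set_map set_upt atLeastLessThanSuc_atLeastAtMost)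
  ultimately have "mset (map w [1..<Suc n]) = mset [1..<Suc n]"
    by (subst set_eq_iff_mset_eq_distinct[symmetric]) (simp_all only: distinct_upt set_upt atLeastLessThanSuc_atLeastAtMost)
  then have "mset (map col (map w [1..<Suc n])) = mset (map col [1..<Suc n])" by (simp only: mset_map)
  then show ?thesis unfolding IB_iff map_col by (simp add: comp_def)
qed

lemma red_rword: "w permutes {1..n} \<Longrightarrow> rword n (red w) \<and> word_perm (red w) = w"
  using red reduced_expr_iff by blast

end

section \<open>Basis elements as words, and spanning in the cyclotomic quotient\<close>

lemma fa_prod_words: "fa_prod (map fa_word ls) = (fa_word (concat ls) :: ('i, 'k::field) fa)"
  by (induction ls) (simp_all add: fa_prod_def fa_one_def fa_word_mult_word)

lemma fa_pow_word: "fa_pow (fa_word [g]) m = (fa_word (replicate m g) :: ('i, 'k::field) fa)"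
  by (induction m) (simp_all add: fa_pow_def fa_one_def fa_word_mult_word)

definition exp_word :: "nat list \<Rightarrow> nat list" where
  "exp_word r = concat (map (\<lambda>k. replicate (r ! (k - 1)) k) [1..<Suc (length r)])"

lemma basis_elem_word:
  "basis_elem red \<nu> (w, r) = (fa_word (E \<nu> # map X (exp_word r) @ map T (red w)) :: ('i, 'k::field) fa)"
proof -
  let ?ks = "[1..<Suc (length r)]"
  have t: "tau_w red w = (fa_word (map T (red w)) :: ('i, 'k) fa)"
    using fa_prod_words[of "map (\<lambda>a. [T a]) (red w)"] by (simp add: tau_w_def gT_def[abs_def] comp_def concat_map_singleton)
  have "basis_elem red \<nu> (w, r) = (fa_prod (map fa_word ([[E \<nu>]] @ map (\<lambda>k. replicate (r ! (k - 1)) (X k)) ?ks @ [map T (red w)])) :: ('i, 'k) fa)"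
    unfolding basis_elem_def by (simp add: t gE_def gX_def fa_pow_word comp_def Suc_eq_plus1 del: upt_Suc)
  also have "\<dots> = fa_word (E \<nu> # map X (exp_word r) @ map T (red w))"
    unfolding fa_prod_words exp_word_def map_concat by (simp add: comp_def del: upt_Suc)
  finally show ?thesis .
qed

lemma count_exp_word: "count_list (exp_word r) k = (if k \<in> {1..length r} then r ! (k - 1) else 0)"
proof -
  have "count_list (concat (map (\<lambda>k. replicate (f k) k) ks)) k = (if k \<in> set ks then f k else 0)"
    if "distinct ks" for f and ks :: "nat list"
    using that by (induction ks) (auto simp: count_list_replicate)
  from this[of "[1..<Suc (length r)]" "\<lambda>k. r ! (k - 1)"] show ?thesis
    unfolding exp_word_def by (simp only: distinct_upt set_upt atLeastLessThanSuc_atLeastAtMost simp_thms)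
qed

lemma exp_word_inject: "length r = length s \<Longrightarrow> mset (exp_word r) = mset (exp_word s) \<Longrightarrow> r = s"
proof (rule nth_equalityI)
  fix i assume l: "length r = length s" "mset (exp_word r) = mset (exp_word s)" and i: "i < length r"
  then have "count_list (exp_word r) (Suc i) = count_list (exp_word s) (Suc i)" by (metis count_mset)
  then show "r ! i = s ! i" using i l(1) by (simp add: count_exp_word)
qed

context cyclotomic_corner
begin

abbreviation V where "V \<equiv> KLR_gens I alpha n \<beta>"
abbreviation J :: "('i, 'k) fa set" where "J \<equiv> cyc_ideal I Iodd alpha h t Lam n \<beta>"
abbreviation S where "S \<equiv> basis_idx alpha h Lam b nus"
abbreviation B :: "(nat \<Rightarrow> nat) \<times> nat list \<Rightarrow> ('i, 'k) fa" where "B \<equiv> basis_elem red \<nu>0"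
definition RS :: "nat list set" where "RS = {r. length r = n \<and> (\<forall>k\<in>{1..n}. r ! (k - 1) < N k)}"

text \<open>Replaces the integer bounds, indexed by block and position, by one natural bound per
  position, so that the index set becomes a product.\<close>

lemma S_eq: "S = col_perms n col \<times> RS"
proof -
  have i: "int x < NLamk alpha h Lam b nus s k \<longleftrightarrow> x < N k" if "inb s k" for x s k
    by (simp add: N_inb[OF that] zless_nat_eq_int_zless)
  have e: "(\<forall>s<length b. \<forall>k. blkc b s < k \<and> k \<le> blkc b (s + 1) \<longrightarrow> int (r ! (k - 1)) < NLamk alpha h Lam b nus s k)
      \<longleftrightarrow> (\<forall>k\<in>{1..n}. r ! (k - 1) < N k)" (is "?L \<longleftrightarrow> ?R") for r
  proof
    assume L: ?L
    show ?R
    proof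
      fix k assume k: "k \<in> {1..n}"
      obtain s where s: "inb s k" by (rule inb_ex[OF k])
      then have "int (r ! (k - 1)) < NLamk alpha h Lam b nus s k" using L by (simp add: inb_def flip: Suc_eq_plus1)
      then show "r ! (k - 1) < N k" by (simp only: i[OF s])
    qed
  next
    assume R: ?R
    show ?L
    proof (intro allI impI)
      fix s k assume "s < length b" "blkc b s < k \<and> k \<le> blkc b (s + 1)"
      then have s: "inb s k" by (simp add: inb_def flip: Suc_eq_plus1)
      then show "int (r ! (k - 1)) < NLamk alpha h Lam b nus s k" unfolding i[OF s] using R inb_range[OF s] by blast
    qed
  qed
  show ?thesis unfolding basis_idx_def young_col_perms e RS_def by auto
qed

lemma finite_RS: "finite RS"
proof (rule finite_subset)
  let ?M = "\<Sum>k\<in>{1..n}. N k"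
  show "RS \<subseteq> {r. set r \<subseteq> {..?M} \<and> length r = n}"
  proof
    fix r assume r: "r \<in> RS"
    have "x \<le> ?M" if x: "x \<in> set r" for x
    proof -
      obtain i where i: "i < n" "x = r ! i" using x r by (auto simp: in_set_conv_nth RS_def)
      have "x < N (Suc i)" using r i by (auto simp: RS_def dest!: bspec[of _ _ "Suc i"])
      also have "\<dots> \<le> ?M" by (rule member_le_sum) (use i in auto)
      finally show ?thesis by simp
    qed
    then show "r \<in> {r. set r \<subseteq> {..?M} \<and> length r = n}" using r by (auto simp: RS_def)
  qed
  show "finite {r. set r \<subseteq> {..?M} \<and> length r = n}" by (rule finite_lists_length_eq) simp
qed

lemma finite_col_perms: "finite (col_perms n col)"
  by (rule finite_subset[OF _ finite_permutations[of "{1..n}"]]) (auto simp: col_perms_def)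

lemma finite_S: "finite S" unfolding S_eq by (intro finite_cartesian_product finite_col_perms finite_RS)

lemma gens_V: "\<nu> \<in> IB \<Longrightarrow> E \<nu> \<in> V" "p \<in> {1..n} \<Longrightarrow> X p \<in> V" "a \<in> {1..<n} \<Longrightarrow> T a \<in> V"
  by (auto simp: KLR_gens_def)

text \<open>\<open>KLR_rels_ev\<close> also carries finiteness of the supports; with
  \<open>UNIV\<close> as the subspace all operator identities hold, and this part remains.\<close>

lemma rels_elem:
  fixes r :: "('i, 'k) fa"
  shows "r \<in> KLR_rels I Iodd alpha t n \<beta> \<Longrightarrow> fa_elem UNIV r"
proof -
  have "FL.klr_ops Iodd t n IB UNIV 0" unfolding FL.klr_ops_def by simp
  then show "r \<in> KLR_rels I Iodd alpha t n \<beta> \<Longrightarrow> fa_elem UNIV r" using FL.KLR_rels_ev by blast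
qed

lemma cyc_elem:
  fixes r :: "('i, 'k) fa"
  shows "r \<in> cyc_rels I alpha h Lam n \<beta> \<Longrightarrow> fa_elem UNIV r"
proof (cases "n = 0")
  case False
  then show "r \<in> cyc_rels I alpha h Lam n \<beta> \<Longrightarrow> fa_elem UNIV r" using FL.cyc_rels_ev[OF False, of I alpha h Lam \<beta> 0 UNIV] by blast
qed (simp add: cyc_rels_def)

sublocale km: klr_mod fscale "\<lambda>g. fa_mult (fa_word [g])" Iodd t n IB "{f. fa_elem V f}" J
proof
  show "FS.subspace {f :: ('i, 'k) fa. fa_elem V f}"
    by (rule FS.subspaceI) (simp_all add: fa_elem_zero fa_elem_add fa_elem_scale)
  show "FS.subspace J" unfolding cyc_ideal_def by (rule subspace_gen_ideal)
  have st: "fa_mult (fa_word [g]) v \<in> {f. fa_elem V f}" if "v \<in> {f. fa_elem V f}" "g \<in> V" for g and v :: "('i, 'k) fa"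
    using that by (auto intro!: fa_elem_mult fa_elem_word)
  show "v \<in> {f. fa_elem V f} \<Longrightarrow> \<nu> \<in> IB \<Longrightarrow> fa_mult (fa_word [E \<nu>]) v \<in> {f. fa_elem V f}"
    "v \<in> {f. fa_elem V f} \<Longrightarrow> p \<in> {1..n} \<Longrightarrow> fa_mult (fa_word [X p]) v \<in> {f. fa_elem V f}"
    "v \<in> {f. fa_elem V f} \<Longrightarrow> p \<in> {1..<n} \<Longrightarrow> fa_mult (fa_word [T p]) v \<in> {f. fa_elem V f}" for \<nu> p and v :: "('i, 'k) fa"
    by (rule st; simp add: gens_V)+
  have sj: "fa_mult (fa_word [g]) v \<in> J" if "v \<in> J" "g \<in> V" for g v
    using that unfolding cyc_ideal_def by (intro gen_ideal_left) auto
  show "v \<in> J \<Longrightarrow> \<nu> \<in> IB \<Longrightarrow> fa_mult (fa_word [E \<nu>]) v \<in> J"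
    "v \<in> J \<Longrightarrow> p \<in> {1..n} \<Longrightarrow> fa_mult (fa_word [X p]) v \<in> J"
    "v \<in> J \<Longrightarrow> p \<in> {1..<n} \<Longrightarrow> fa_mult (fa_word [T p]) v \<in> J" for \<nu> p v
    by (rule sj; simp add: gens_V)+
  show "FL.klr_ops Iodd t n IB J v" if "v \<in> {f. fa_elem V f}" for v
  proof (rule FL.KLR_rels_ev[THEN iffD1], intro ballI conjI)
    fix r :: "('i, 'k) fa" assume r: "r \<in> KLR_rels I Iodd alpha t n \<beta>"
    show u: "fa_elem UNIV r" by (rule rels_elem[OF r])
    show "FL.ev r v \<in> J" unfolding FL_ev[OF u] cyc_ideal_def
      using r that by (intro gen_ideal_mult_elem gen_ideal_gen) auto
  qed
  show "\<nu> \<in> IB \<Longrightarrow> length \<nu> = n" for \<nu> by (rule IB_length)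
  show "\<nu> \<in> IB \<Longrightarrow> a \<in> {1..<n} \<Longrightarrow> swap_at a \<nu> \<in> IB" for \<nu> a by (rule IB_swap)
  show "Qsupp t (ent \<nu> a) (ent \<nu> a) = {}" if "\<nu> \<in> IB" "a \<in> {1..n}" for \<nu> a
    using t_facts(2)[OF IB_ent[OF that] IB_ent[OF that]] by (simp add: Qsupp_def)
qed

abbreviation \<rho> :: "'i gen \<Rightarrow> ('i, 'k) fa \<Rightarrow> ('i, 'k) fa" where "\<rho> g \<equiv> fa_mult (fa_word [g])"

lemma one_W: "fa_one \<in> {f. fa_elem V f}" by (simp add: fa_one_def fa_elem_word)

lemma rho_one: "\<rho> (E \<nu>0) fa_one = gE \<nu>0" by (simp add: fa_one_def gE_def)

lemma wt0: "km.wt \<nu>0 (gE \<nu>0)"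
proof -
  have "km.eqv (\<rho> (E \<nu>0) (\<rho> (E \<nu>0) fa_one)) (\<rho> (E \<nu>0) fa_one)"
    using km.relD(1)[OF one_W nu0_IB nu0_IB] by simp
  moreover have "fa_elem V (gE \<nu>0)" using gens_V(1)[OF nu0_IB] by (simp add: gE_def fa_elem_word)
  ultimately show ?thesis unfolding rho_one by (simp add: km.wt_def nu0_IB)
qed

lemma set_nu0: "i \<in> set \<nu>0 \<Longrightarrow> i \<in> I" using nu0(4) by blast

sublocale ks: klr_span fscale "\<lambda>g. fa_mult (fa_word [g])" Iodd t n IB "{f. fa_elem V f}" J \<nu>0 "gE \<nu>0" LamN mm N red
proof
  show "km.wt \<nu>0 (gE \<nu>0)" by (rule wt0)
  show "finite IB" by (rule finite_IB)
  show "(\<Sum>\<nu>\<in>IB. (\<rho> (X 1) ^^ LamN (ent \<nu> 1)) (\<rho> (E \<nu>) v)) \<in> J" if n: "n \<noteq> 0" and v: "v \<in> {f. fa_elem V f}" for v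
    unfolding LamN_def
  proof (rule FL.cyc_rels_ev[OF n, THEN iffD1], intro ballI conjI)
    fix r :: "('i, 'k) fa" assume r: "r \<in> cyc_rels I alpha h Lam n \<beta>"
    show u: "fa_elem UNIV r" by (rule cyc_elem[OF r])
    show "FL.ev r v \<in> J" unfolding FL_ev[OF u] cyc_ideal_def
      using r v by (intro gen_ideal_mult_elem gen_ideal_gen) auto
  qed
  show "finite (Qsupp t k i)" if "i \<in> set \<nu>0" "k \<in> set \<nu>0" for i k
    using that by (intro finite_Qsupp set_nu0)
  show "t k i 0 (mm i k) \<noteq> 0" if "i \<in> set \<nu>0" "k \<in> set \<nu>0" "i \<noteq> k" for i k
    using t_facts(4)[of i k] t_facts(1)[of i k "mm i k" 0] that set_nu0 by auto
  show "s < mm i k \<or> s = mm i k \<and> r = 0" if "i \<in> set \<nu>0" "k \<in> set \<nu>0" "i \<noteq> k" "t k i r s \<noteq> 0" for i k r s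
    using t_low[of i k s r] t_facts(1)[of i k s r] that set_nu0 by auto
  show "f \<in> {1..n} \<Longrightarrow> f = 1 \<or> col (f - 1) \<noteq> col f \<Longrightarrow> N f = LamN (col f) + (\<Sum>q\<in>{1..<f}. mm (col f) (col q))" for f
    by (rule N_first)
  show "a \<in> {1..<n} \<Longrightarrow> col a = col (Suc a) \<Longrightarrow> N (Suc a) = N a - 1" for a by (rule N_next)
  show "w permutes {1..n} \<Longrightarrow> rword n (red w) \<and> word_perm (red w) = w" for w by (rule red_rword)
qed

lemma red_sup: "w \<in> col_perms n col \<Longrightarrow> word_sup n col (red w)"
  using red_rword[of w] cb.rword_word_sup[of "red w"] by (auto simp: col_perms_def)

text \<open>Basis elements have the idempotent on the left, but the spanning argument starts from it
  on the right. Every letter involved preserves the block word, so the idempotent can be moved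
  through.\<close>

lemma E_comm:
  assumes u: "set u \<subseteq> {1..n}" and l: "word_sup n col l"
  shows "km.eqv (\<rho> (E \<nu>0) (km.xw u (km.tw l fa_one))) (km.xw u (km.tw l (gE \<nu>0)))"
proof -
  have W: "km.tw l fa_one \<in> {f. fa_elem V f}" if "word_sup n col l" for l
    using that
  proof (induction l)
    case Nil show ?case using one_W by simp
  next
    case (Cons a l)
    then have "a \<in> {1..<n}" "km.tw l fa_one \<in> {f. fa_elem V f}" by auto
    then show ?case using km.stabW(3)[of "km.tw l fa_one" a] by simp
  qed
  have T: "km.eqv (\<rho> (E \<nu>0) (km.tw l fa_one)) (km.tw l (gE \<nu>0))" using l
  proof (induction l)
    case Nil then show ?case by (simp add: rho_one)
  next
    case (Cons a l)
    then have a: "a \<in> {1..<n}" "col a = col (Suc a)" and l: "word_sup n col l" by auto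
    have s: "swap_at a \<nu>0 = \<nu>0" using a nu0(1) by (intro swap_at_same) auto
    have "km.eqv (\<rho> (T a) (\<rho> (E \<nu>0) (km.tw l fa_one))) (\<rho> (E \<nu>0) (\<rho> (T a) (km.tw l fa_one)))"
      using km.relD(4)[OF W[OF l] nu0_IB a(1)] unfolding s .
    from km.eqv_trans[OF km.eqv_sym[OF this] km.eqv_t[OF Cons.IH[OF l] a(1)]] show ?case by simp
  qed
  show ?thesis using u
  proof (induction u)
    case Nil then show ?case using T by simp
  next
    case (Cons p u)
    then have p: "p \<in> {1..n}" and u: "set u \<subseteq> {1..n}" by auto
    have "km.xw u (km.tw l fa_one) \<in> {f. fa_elem V f}" using u
    proof (induction u)
      case Nil show ?case using W[OF l] by simp
    next
      case (Cons q u)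
      then have "q \<in> {1..n}" "km.xw u (km.tw l fa_one) \<in> {f. fa_elem V f}" by auto
      then show ?case using km.stabW(2)[of "km.xw u (km.tw l fa_one)" q] by simp
    qed
    then have "km.eqv (\<rho> (X p) (\<rho> (E \<nu>0) (km.xw u (km.tw l fa_one)))) (\<rho> (E \<nu>0) (\<rho> (X p) (km.xw u (km.tw l fa_one))))"
      by (rule km.relD(3)[OF _ nu0_IB p])
    from km.eqv_trans[OF km.eqv_sym[OF this] km.eqv_x[OF Cons.IH[OF u] p]] show ?case by simp
  qed
qed

text \<open>The basis element with its idempotent on the right, as a monomial applied to a weight
  vector; \<open>B_Z\<close> identifies it with \<open>B i\<close> modulo the ideal.\<close>

definition Z :: "(nat \<Rightarrow> nat) \<times> nat list \<Rightarrow> ('i, 'k) fa" where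
  "Z i = km.xw (exp_word (snd i)) (km.tw (red (fst i)) (gE \<nu>0))"

lemma exp_word_set: "set (exp_word r) \<subseteq> {1..length r}"
  using count_exp_word[of r] by (auto simp: subset_iff) (metis count_list_0_iff atLeastAtMost_iff less_irrefl)+

lemma B_Z: assumes "i \<in> S" shows "km.eqv (B i) (Z i)" "km.eqv (\<rho> (E \<nu>0) (Z i)) (Z i)"
proof -
  obtain w r where i: "i = (w, r)" "w \<in> col_perms n col" "r \<in> RS" using assms unfolding S_eq by auto
  have u: "set (exp_word r) \<subseteq> {1..n}" using exp_word_set[of r] i(3) by (simp add: RS_def)
  have "B i = foldr \<rho> (E \<nu>0 # map X (exp_word r) @ map T (red w)) fa_one"
    unfolding i(1) basis_elem_word FL_words by (simp add: fa_one_def)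
  also have "\<dots> = \<rho> (E \<nu>0) (km.xw (exp_word r) (km.tw (red w) fa_one))"
    by (simp add: foldr_map comp_def)
  finally show "km.eqv (B i) (Z i)" using E_comm[OF u red_sup[OF i(2)]] by (simp add: Z_def i(1))
  have "km.wt \<nu>0 (Z i)" unfolding Z_def i(1) fst_conv snd_conv
    using u by (intro km.wt_xw ks.wt_int[OF wt0 red_sup[OF i(2)]]) auto
  then show "km.eqv (\<rho> (E \<nu>0) (Z i)) (Z i)" by (rule km.wtD(3))
qed

lemma corner_conj: assumes "i \<in> S" shows "B i - fa_mult (fa_mult (gE \<nu>0) (B i)) (gE \<nu>0) \<in> J"
proof -
  obtain w r where i: "i = (w, r)" by (cases i)
  have "fa_mult (fa_mult (gE \<nu>0) (B i)) (gE \<nu>0) = \<rho> (E \<nu>0) (fa_mult (fa_word (E \<nu>0 # map X (exp_word r) @ map T (red w))) (gE \<nu>0))"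
    unfolding i basis_elem_word fa_mult_assoc by (simp add: gE_def)
  also have "\<dots> = \<rho> (E \<nu>0) (\<rho> (E \<nu>0) (Z i))"
  proof (rule arg_cong[where f = "\<rho> (E \<nu>0)"])
    have "fa_mult (fa_word (E \<nu>0 # map X (exp_word r) @ map T (red w))) (gE \<nu>0) =
        foldr \<rho> (E \<nu>0 # map X (exp_word r) @ map T (red w)) (gE \<nu>0)" by (rule FL_words[symmetric])
    then show "fa_mult (fa_word (E \<nu>0 # map X (exp_word r) @ map T (red w))) (gE \<nu>0) = \<rho> (E \<nu>0) (Z i)"
      by (simp add: Z_def i foldr_map comp_def)
  qed
  finally have e: "fa_mult (fa_mult (gE \<nu>0) (B i)) (gE \<nu>0) = \<rho> (E \<nu>0) (\<rho> (E \<nu>0) (Z i))" .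
  note z = B_Z[OF assms]
  have "km.eqv (\<rho> (E \<nu>0) (\<rho> (E \<nu>0) (Z i))) (Z i)" by (rule km.eqv_trans[OF km.eqv_e[OF z(2) nu0_IB] z(2)])
  from km.eqv_trans[OF z(1) km.eqv_sym[OF this]] show ?thesis unfolding e km.eqv_def .
qed

definition spn :: "('i, 'k) fa set" where "spn = {y. \<exists>c. y - (\<Sum>i\<in>S. fscale (c i) (B i)) \<in> J}"

lemma spn_sub: "FS.subspace spn"
proof (rule FS.subspaceI)
  show "0 \<in> spn" using FS.subspace_0[OF km.subJ] by (auto simp: spn_def intro!: exI[of _ "\<lambda>_. 0"])
next
  fix x y assume "x \<in> spn" "y \<in> spn"
  then obtain c c' where c: "x - (\<Sum>i\<in>S. fscale (c i) (B i)) \<in> J" "y - (\<Sum>i\<in>S. fscale (c' i) (B i)) \<in> J" by (auto simp: spn_def)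
  have "x + y - (\<Sum>i\<in>S. fscale (c i + c' i) (B i)) = (x - (\<Sum>i\<in>S. fscale (c i) (B i))) + (y - (\<Sum>i\<in>S. fscale (c' i) (B i)))"
    by (simp add: FS.scale_left_distrib sum.distrib)
  also have "\<dots> \<in> J" by (rule FS.subspace_add[OF km.subJ c])
  finally show "x + y \<in> spn" unfolding spn_def by (intro CollectI exI[of _ "\<lambda>i. c i + c' i"])
next
  fix k x assume "x \<in> spn"
  then obtain c where c: "x - (\<Sum>i\<in>S. fscale (c i) (B i)) \<in> J" by (auto simp: spn_def)
  have "fscale k x - (\<Sum>i\<in>S. fscale (k * c i) (B i)) = fscale k (x - (\<Sum>i\<in>S. fscale (c i) (B i)))"
    by (simp add: FS.scale_right_diff_distrib FS.scale_sum_right)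
  also have "\<dots> \<in> J" by (rule FS.subspace_scale[OF km.subJ c])
  finally show "fscale k x \<in> spn" unfolding spn_def by (intro CollectI exI[of _ "\<lambda>i. k * c i"])
qed

lemma spn_J: "x \<in> J \<Longrightarrow> x \<in> spn"
  unfolding spn_def by (intro CollectI exI[of _ "\<lambda>_. 0"]) simp

lemma spn_Z: assumes "i \<in> S" shows "Z i \<in> spn"
proof -
  have "(\<Sum>j\<in>S. fscale (if j = i then 1 else 0) (B j)) = (\<Sum>j\<in>S. if j = i then B i else 0)"
    by (rule sum.cong) auto
  also have "\<dots> = B i" using assms finite_S by simp
  finally have "Z i - (\<Sum>j\<in>S. fscale (if j = i then 1 else 0) (B j)) \<in> J"
    using km.eqv_sym[OF B_Z(1)[OF assms]] by (simp add: km.eqv_def)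
  then show ?thesis unfolding spn_def by (intro CollectI exI[of _ "\<lambda>j. if j = i then 1 else 0"])
qed

lemma basis_vecs_spn: "ks.basis_vecs \<subseteq> spn"
proof
  fix x assume "x \<in> ks.basis_vecs"
  then obtain r w where x: "x = km.xw (ks.ord_word r) (km.tw (red w) (gE \<nu>0))" and w: "w \<in> col_perms n col"
    and r: "\<forall>k\<in>{1..n}. r k < N k" by (auto simp: ks.basis_vecs_def)
  let ?r = "map r [1..<Suc n]"
  have nth: "?r ! (k - 1) = r k" if k: "k \<in> {1..n}" for k
  proof -
    have "k - 1 < length [1..<Suc n]" "[1..<Suc n] ! (k - 1) = 1 + (k - 1)" "1 + (k - 1) = k"
      using k by (auto intro!: nth_upt simp del: upt_Suc)
    then show ?thesis by (simp only: nth_map)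
  qed
  have lr: "length ?r = n" by (simp del: upt_Suc)
  have "(w, ?r) \<in> S" unfolding S_eq RS_def using w lr r nth by (simp del: upt_Suc)
  moreover have "exp_word ?r = ks.ord_word r"
    unfolding exp_word_def ks.ord_word_def lr by (intro arg_cong[where f = concat] map_cong refl) (simp add: nth del: upt_Suc)
  then have "Z (w, ?r) = x" by (simp only: Z_def x fst_conv snd_conv)
  ultimately show "x \<in> spn" using spn_Z by blast
qed

lemma spanning: assumes "fa_elem V f" shows "fa_mult (fa_mult (gE \<nu>0) f) (gE \<nu>0) \<in> spn"
  using assms
proof (induction rule: fa_elem_induct)
  case zero then show ?case using FS.subspace_0[OF spn_sub] by (simp add: fa_mult_linear)
next
  case (word u)
  have "foldr \<rho> u (gE \<nu>0) = fa_mult (fa_word u) (gE \<nu>0)" by (rule FL_words)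
  then have "fa_mult (fa_mult (gE \<nu>0) (fa_word u)) (gE \<nu>0) = \<rho> (E \<nu>0) (foldr \<rho> u (gE \<nu>0))"
    by (simp only: fa_mult_assoc) (simp add: gE_def)
  also have "\<dots> \<in> km.sp ks.basis_vecs" by (rule ks.corner_spanned) (use word in \<open>simp add: KLR_gens_def\<close>)
  also have "\<dots> \<subseteq> spn" unfolding km.sp_def
    by (rule FS.span_minimal[OF _ spn_sub]) (use basis_vecs_spn spn_J in blast)
  finally show ?case .
next
  case (add f g) then show ?case using FS.subspace_add[OF spn_sub] by (simp add: fa_mult_linear)
next
  case (scale c f) then show ?case using FS.subspace_scale[OF spn_sub] by (simp add: fa_mult_linear)
qed

end

section \<open>Independence and the final theorem\<close>

context cyclotomic_corner
begin

lemma B_elem: "fa_elem UNIV (B i)"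
  by (cases i) (simp add: basis_elem_word fa_elem_word)

text \<open>The ideal acts into \<open>rep_ideal\<close>. Read at the identity labelling, a linear
  relation between basis elements becomes one between divided differences with polynomial
  coefficients, to which \<open>separation\<close> applies.\<close>

lemma independent:
  assumes f: "(\<Sum>i\<in>S. fscale (c i) (B i)) \<in> J"
  shows "\<forall>i\<in>S. c i = 0"
proof (cases "\<forall>k\<in>{1..n}. 0 < N k")
  case False
  \<comment> \<open>With a zero bound no exponent list is admissible, so the index set is
    empty.\<close>
  then obtain k where "k \<in> {1..n}" "N k = 0" by auto
  then have "RS = {}" unfolding RS_def by fastforce
  then show ?thesis by (simp add: S_eq)
next
  case True
  interpret C: cyc_rep "\<lambda>k. col k \<in> Iodd" "TYPE('k)" n col t LamN mm N Iodd IB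
  proof
    show "t (col k) (col l) r s \<noteq> 0 \<Longrightarrow> (col k \<in> Iodd \<longrightarrow> even r) \<and> (col l \<in> Iodd \<longrightarrow> even s)"
      if "k \<in> {1..n}" "l \<in> {1..n}" for k l r s
      using t_facts(3)[OF col_I[OF that(1)] col_I[OF that(2)]] .
    show "t (col k) (col l) r s = t (col l) (col k) s r" if "k \<in> {1..n}" "l \<in> {1..n}" for k l r s
      using t_facts(1)[OF col_I[OF that(1)] col_I[OF that(2)]] .
    show "finite (Qsupp t (col k) (col l))" if "k \<in> {1..n}" "l \<in> {1..n}" for k l
      using finite_Qsupp[OF col_I[OF that(1)] col_I[OF that(2)]] .
    show "t (col k) (col l) (mm (col k) (col l)) 0 \<noteq> 0" if "k \<in> {1..n}" "l \<in> {1..n}" "col k \<noteq> col l" for k l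
      using t_facts(4)[OF col_I[OF that(1)] col_I[OF that(2)] that(3)] .
    show "r < mm (col k) (col l) \<or> r = mm (col k) (col l) \<and> s = 0"
      if "k \<in> {1..n}" "l \<in> {1..n}" "t (col k) (col l) r s \<noteq> 0" for k l r s
      using t_low[OF col_I[OF that(1)] col_I[OF that(2)] that(3)] .
    show "N f = LamN (col f) + (\<Sum>q\<in>{1..<f}. mm (col f) (col q))"
      if "f \<in> {1..n}" "f = 1 \<or> col (f - 1) \<noteq> col f" for f using N_first[OF that] .
    show "N (Suc a) = N a - 1" if "a \<in> {1..<n}" "col a = col (Suc a)" for a using N_next[OF that] .
    show "0 < N k" if "k \<in> {1..n}" for k using True that by blast
    show "finite IB" by (rule finite_IB)
    show "map (\<lambda>p. col (w p)) [1..<Suc n] \<in> IB" if "w permutes {1..n}" for w using word_IB[OF that] .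
    show "length \<nu> = n" if "\<nu> \<in> IB" for \<nu> using IB_length[OF that] .
    show "Qsupp t (col k) (col k) = {}" if "k \<in> {1..n}" for k
      using t_facts(2)[OF col_I[OF that] col_I[OF that]] by (simp add: Qsupp_def)
  qed simp_all
  have rep_ideal: "fa_elem UNIV g \<and> (\<forall>v. C.R.ev g v \<in> C.rep_ideal)" if g: "g \<in> J" for g
  proof (rule C.R.gen_ideal_ev[OF C.rep_ideal_sub _ _ _ g[unfolded cyc_ideal_def]])
    fix x v assume "x \<in> V" "v \<in> C.rep_ideal"
    then show "C.ro x v \<in> C.rep_ideal"
      unfolding KLR_gens_def using C.rep_ideal_stable_T[of v] C.rep_ideal_stable[of v] by fastforce
  next
    fix r :: "('i, 'k) fa" assume "r \<in> KLR_rels I Iodd alpha t n \<beta> \<union> cyc_rels I alpha h Lam n \<beta>"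
    then consider "r \<in> KLR_rels I Iodd alpha t n \<beta>" | "r \<in> cyc_rels I alpha h Lam n \<beta>" by blast
    then have "fa_elem UNIV r \<and> (\<forall>v. C.R.ev r v \<in> C.rep_ideal)"
    proof cases
      case 1 then show ?thesis using C.R.KLR_rels_ev[THEN iffD2, OF C.klr_ops_rep_ideal] by blast
    next
      case 2
      then have n: "n \<noteq> 0" by (metis cyc_rels_def empty_iff)
      have "C.R.ev r v \<in> C.rep_ideal" for v
        using C.R.cyc_rels_ev[OF n, of I alpha h Lam \<beta> v C.rep_ideal] C.cyc_rep_ideal[OF n, of v] 2 unfolding LamN_def by blast
      then show ?thesis using cyc_elem[OF 2] by blast
    qed
    then show "fa_elem UNIV r" "C.R.ev r v \<in> C.rep_ideal" for v by blast+
  qed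
  have wid: "C.word id = \<nu>0" unfolding C.word_def id_apply by (rule map_col)
  have evB: "C.R.ev (B (w, r)) g id = foldr C.Xo (exp_word r) (foldr C.D (red w) (g id))"
    if w: "w \<in> col_perms n col" for w r g
  proof -
    have "C.R.ev (B (w, r)) g id = C.ro (E (C.word id)) (foldr C.ro (map X (exp_word r)) (foldr C.ro (map T (red w)) g)) id"
      unfolding basis_elem_word C.R.ev_word wid by simp
    also have "\<dots> = foldr C.Xo (exp_word r) (foldr C.D (red w) (g id))"
      by (simp only: C.at_id(3) C.X_word_id C.T_word_id[OF red_sup[OF w]])
    finally show ?thesis .
  qed
  \<comment> \<open>The coefficients belonging to one permutation are collected into a polynomial.
    The divided differences act first, so it stands to the left of their result, as
    \<open>Rg\<close> expresses.\<close>
  define q where "q w = (\<Sum>r\<in>RS. pscale (c (w, r)) (foldr C.Xo (exp_word r) C.one))" for w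
  have K: "(\<Sum>w\<in>col_perms n col. C.Rg (foldr C.D (red w) v) (q w)) \<in> C.K n" for v
  proof -
    \<comment> \<open>The constant function is a convenient vector whose value at the identity
      labelling is \<open>v\<close>.\<close>
    have "C.R.ev (\<Sum>i\<in>S. fscale (c i) (B i)) (\<lambda>_. v) = (\<Sum>i\<in>S. C.vs (c i) (C.R.ev (B i) (\<lambda>_. v)))"
      by (subst C.R.ev_sum) (auto intro!: fa_elem_scale B_elem sum.cong C.R.ev_scale)
    then have "C.R.ev (\<Sum>i\<in>S. fscale (c i) (B i)) (\<lambda>_. v) id = (\<Sum>i\<in>S. pscale (c i) (C.R.ev (B i) (\<lambda>_. v) id))"
      by (simp only: C.sum_state C.vs_apply)
    also have "\<dots> = (\<Sum>w\<in>col_perms n col. \<Sum>r\<in>RS. pscale (c (w, r)) (C.R.ev (B (w, r)) (\<lambda>_. v) id))"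
      unfolding S_eq sum.cartesian_product by (rule sum.cong) auto
    also have "\<dots> = (\<Sum>w\<in>col_perms n col. C.Rg (foldr C.D (red w) v) (q w))"
      by (rule sum.cong[OF refl]) (simp add: evB q_def C.Rg_simps C.Rg_Xw)
    finally have e: "C.R.ev (\<Sum>i\<in>S. fscale (c i) (B i)) (\<lambda>_. v) id = (\<Sum>w\<in>col_perms n col. C.Rg (foldr C.D (red w) v) (q w))" .
    have "C.qo_prod (C.inv_pairs id) (C.R.ev (\<Sum>i\<in>S. fscale (c i) (B i)) (\<lambda>_. v) id) \<in> C.K n"
      using rep_ideal[OF f] C.id_states unfolding C.rep_ideal_def by blast
    then show ?thesis unfolding C.inv_pairs_id C.qo_prod_empty e .
  qed
  have small: "C.pr k i (q w) = 0" if "k \<in> {1..n}" "N k \<le> i" for w k i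
  proof -
    have "C.pr k i (foldr C.Xo (exp_word r) C.one) = 0" if r: "r \<in> RS" for r
    proof -
      have "count_list (exp_word r) k < N k" using r \<open>k \<in> {1..n}\<close> by (simp add: count_exp_word RS_def)
      then show ?thesis using \<open>N k \<le> i\<close> by (simp add: C.pr_Xw_one)
    qed
    then show ?thesis by (simp add: q_def C.pr_simps)
  qed
  have q0: "q w = 0" if "w \<in> col_perms n col" for w
    by (rule C.separation[OF red_rword K small that])
  show ?thesis
  proof
    fix i assume "i \<in> S"
    then obtain w r where i: "i = (w, r)" "w \<in> col_perms n col" "r \<in> RS" by (auto simp: S_eq)
    let ?M = "mset (exp_word r)"
    have X: "\<exists>e. e * e = 1 \<and> foldr C.Xo (exp_word r') C.one = pscale e (bas (mset (exp_word r')))" for r'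
      using C.Xw_bas[of "exp_word r'" "{#}"] by (simp add: C.one_def)
    have z: "Poly_Mapping.lookup (foldr C.Xo (exp_word r') C.one) ?M = 0" if r': "r' \<in> RS - {r}" for r'
    proof -
      have "mset (exp_word r') \<noteq> ?M" using exp_word_inject[of r' r] r' i(3) by (auto simp: RS_def)
      then show ?thesis using X[of r'] by (auto simp: lookup_pscale lookup_bas)
    qed
    \<comment> \<open>Different exponent lists give different monomials, so this coefficient of
      \<open>q w\<close> is \<open>c (w, r)\<close> up to a sign.\<close>
    have "0 = Poly_Mapping.lookup (q w) ?M" using q0[OF i(2)] by simp
    also have "\<dots> = c (w, r) * Poly_Mapping.lookup (foldr C.Xo (exp_word r) C.one) ?M"
      unfolding q_def lookup_sum lookup_pscale
      by (subst sum.remove[OF finite_RS i(3)]) (simp add: z)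
    finally have "c (w, r) * Poly_Mapping.lookup (foldr C.Xo (exp_word r) C.one) ?M = 0" by simp
    moreover have "Poly_Mapping.lookup (foldr C.Xo (exp_word r) C.one) ?M \<noteq> 0"
      using X[of r] by (auto simp: lookup_pscale lookup_bas)
    ultimately show "c i = 0" by (simp add: i(1))
  qed
qed

end

theorem theorem1p5:
  fixes I Iodd :: "'i set" and A :: "'i \<Rightarrow> 'i \<Rightarrow> int" and d :: "'i \<Rightarrow> nat"
    and alpha :: "'i \<Rightarrow> ('b \<Rightarrow>\<^sub>0 int)" and h :: "'i \<Rightarrow> ('b \<Rightarrow>\<^sub>0 int) \<Rightarrow> int"
    and form :: "('b \<Rightarrow>\<^sub>0 int) \<Rightarrow> ('b \<Rightarrow>\<^sub>0 int) \<Rightarrow> rat"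
    and t :: "'i \<Rightarrow> 'i \<Rightarrow> nat \<Rightarrow> nat \<Rightarrow> 'k::field"
    and Lam :: "'b \<Rightarrow>\<^sub>0 int"
    and b :: "nat list" and nus :: "'i list"
    and red :: "(nat \<Rightarrow> nat) \<Rightarrow> nat list"
  assumes char: "(2::'k) \<noteq> 0"
    and datum: "cartan_superdatum I Iodd A d alpha h form"
    and Q: "Q_data I Iodd A alpha form t"
    and dominant: "\<forall>i\<in>I. h i Lam \<ge> 0"
    and len: "length b = length nus"
    and dist: "distinct nus"
    and nusI: "set nus \<subseteq> I"
    and red: "\<forall>w. w permutes {1..sum_list b} \<longrightarrow> reduced_expr (sum_list b) (red w) w"
  shows "is_basis_corner
           (KLR_gens I alpha (sum_list b) (\<Sum>s<length nus. zscale (int (b ! s)) (alpha (nus ! s))))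
           (cyc_ideal I Iodd alpha h t Lam (sum_list b) (\<Sum>s<length nus. zscale (int (b ! s)) (alpha (nus ! s))))
           (gE (nutilde b nus))
           (basis_idx alpha h Lam b nus)
           (basis_elem red (nutilde b nus))"
proof -
  interpret cyclotomic_corner I Iodd A d alpha h form t Lam b nus red
    by unfold_locales (use assms in auto)
  have diff: "(\<lambda>w. f w - g w) = f - g" for f g :: "('i, 'k) fa" by (simp add: fun_eq_iff fun_apply)
  have comb: "(\<lambda>w. \<Sum>i\<in>S. c i * B i w) = (\<Sum>i\<in>S. fscale (c i) (B i))" for c
    by (simp add: fun_eq_iff sum_fun_apply fscale_apply)
  have "\<exists>c. (\<lambda>w. fa_mult (fa_mult (gE \<nu>0) f) (gE \<nu>0) w - (\<Sum>i\<in>S. c i * B i w)) \<in> J" if f: "fa_elem V f" for f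
  proof -
    obtain c where "fa_mult (fa_mult (gE \<nu>0) f) (gE \<nu>0) - (\<Sum>i\<in>S. fscale (c i) (B i)) \<in> J"
      using spanning[OF f] by (auto simp: spn_def)
    then show ?thesis unfolding comb[symmetric] diff[symmetric] by blast
  qed
  then show ?thesis
    unfolding is_basis_corner_def \<beta>_def[symmetric] comb diff using corner_conj independent by blast
qed

end
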